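(* The Toeplitz determinant $\Delta_n(x,\alpha)$ admits the following asymptotics as $x\to\infty$ for fixed $d_1,d_2\in\mathbb{C}$, $n\in\mathbb{N}\cup\{0\}$, $\alpha\in\mathbb{C}$. (1) If $d_1\pm\mathrm{i}d_2\neq0$ (both signs), $n$ is even, and $x>0$, then $$\Delta_n(x,\alpha)\sim\left(\frac{d_1^2+d_2^2}{2\pi}\right)^{\frac n2}\left(G\left(\frac n2+1\right)\right)^2\left(\frac x4\right)^{-\frac{n^2}{4}},\quad\text{as }x\to\infty,\ x>0.$$ (2) If $d_1\pm\mathrm{i}d_2\neq0$ (both signs), $n$ is odd, and $x>0$, then $$\Delta_n(x,\alpha)\sim(-1)^{\frac{n-1}{2}}\left(\frac{d_1^2+d_2^2}{2\pi}\right)^{\frac n2}G\left(\frac{n+1}{2}\right)G\left(\frac{n+3}{2}\right)\sin\left(x-\phi+\frac{\pi}{4}(n-\alpha)\right)\left(\frac x4\right)^{-\frac{n^2+1}{4}},\quad\text{as }x\to\infty,\ x>0.$$ (3) If $d_1\pm\mathrm{i}d_2\neq0$ (both signs) and $-\pi<\arg(x)<0$, then $$\Delta_n(x,\alpha)\sim(d_1-\mathrm{i}d_2)^n\left(\frac{1}{2\pi}\right)^{\frac n2}e^{-\frac{\mathrm{i}\pi n^2}{4}}G(n+1)e^{-\frac{\mathrm{i}\pi n\alpha}{4}}e^{\mathrm{i}nx}x^{-\frac{n^2}{2}},\quad x\to\infty.$$ (4) If $d_1\pm\mathrm{i}d_2\neq0$ (both signs) and $0<\arg(x)<\pi$, then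 $$\Delta_n(x,\alpha)\sim(d_1+\mathrm{i}d_2)^n\left(\frac{1}{2\pi}\right)^{\frac n2}e^{\frac{\mathrm{i}\pi n^2}{4}}G(n+1)e^{\frac{\mathrm{i}\pi n\alpha}{4}}e^{-\mathrm{i}nx}x^{-\frac{n^2}{2}},\quad x\to\infty.$$ (5) If $d_1+\mathrm{i}d_2=0$ and $-\pi<\arg(x)<\pi$, then $$\Delta_n(x,\alpha)\sim(d_1-\mathrm{i}d_2)^n\left(\frac{1}{2\pi}\right)^{\frac n2}e^{-\frac{\mathrm{i}\pi n^2}{4}}G(n+1)e^{-\frac{\mathrm{i}\pi n\alpha}{4}}e^{\mathrm{i}nx}x^{-\frac{n^2}{2}},\quad x\to\infty.$$ (6) If $d_1-\mathrm{i}d_2=0$ and $-\pi<\arg(x)<\pi$, then $$\Delta_n(x,\alpha)\sim(d_1+\mathrm{i}d_2)^n\left(\frac{1}{2\pi}\right)^{\frac n2}e^{\frac{\mathrm{i}\pi n^2}{4}}G(n+1)e^{\frac{\mathrm{i}\pi n\alpha}{4}}e^{-\mathrm{i}nx}x^{-\frac{n^2}{2}},\quad x\to\infty.$$ Here $G$ is the Barnes $G$-function and $\phi=\frac{1}{2\mathrm{i}}\ln(d_1+\mathrm{i}d_2)-\frac{1}{2\mathrm{i}}\ln(d_1-\mathrm{i}d_2)$.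
   Context: $J_\nu(x)$ and $Y_\nu(x)$ are the Bessel functions of the first and second kind, and $\mathcal{C}_\nu(x)=d_1J_\nu(x)+d_2Y_\nu(x)$ with $d_1,d_2\in\mathbb{C}$. For $n\in\mathbb{N}=\{1,2,\dots\}$, $\Delta_n(x,\alpha)=\det\left(\left\{\mathcal{C}_{\frac{\alpha}{2}-j+k}(x)\right\}_{j,k=0}^{n-1}\right)$, and $\Delta_0(x,\alpha)=1$. The power $(d_1^2+d_2^2)^{\frac n2}$ means $e^{\frac n2\ln(d_1+\mathrm{i}d_2)+\frac n2\ln(d_1-\mathrm{i}d_2)}$, with the same logarithms as in $\phi$; the asymptotic expressions do not depend on the choice of branch of the logarithm. The symbol $\sim$ denotes asymptotic equivalence in the indicated limit.
   Formalization: In (2), ∼ means an error o(amplitude), plus ratio → 1 along x with |sin(...)| ≥ ε for each ε > 0, since real zeros of the sine make the literal ratio limit false; in (3)–(6), x → ∞ uniformly in each closed subsector of the stated open sector. *)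

theory Defs
  imports "HOL-Analysis.Analysis" "Jordan_Normal_Form.Determinant"
begin

text \<open>
  Bessel functions of complex order. The power is the principal one, so these are the principal
  branches, holomorphic in \<open>x\<close> off the non-positive real axis. The entire function \<open>rGamma = 1/\<Gamma>\<close>
  takes care of the terms in which \<open>\<nu> + k + 1\<close> is a pole of \<open>\<Gamma>\<close>.
\<close>

definition Bessel_J :: "complex \<Rightarrow> complex \<Rightarrow> complex" where
  "Bessel_J \<nu> x =
     (x / 2) powr \<nu> *
     (\<Sum>k. (-1) ^ k * rGamma (\<nu> + of_nat k + 1) / fact k * (x / 2) ^ (2 * k))"

definition Bessel_Y_nonint :: "complex \<Rightarrow> complex \<Rightarrow> complex" where
  "Bessel_Y_nonint \<nu> x =
     (Bessel_J \<nu> x * cos (\<nu> * of_real pi) - Bessel_J (- \<nu>) x) / sin (\<nu> * of_real pi)"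

definition Bessel_Y :: "complex \<Rightarrow> complex \<Rightarrow> complex" where
  "Bessel_Y \<nu> x =
     (if \<nu> \<in> \<int> then Lim (at \<nu>) (\<lambda>\<mu>. Bessel_Y_nonint \<mu> x) else Bessel_Y_nonint \<nu> x)"

definition cylinder :: "complex \<Rightarrow> complex \<Rightarrow> complex \<Rightarrow> complex \<Rightarrow> complex" where
  "cylinder d1 d2 \<nu> x = d1 * Bessel_J \<nu> x + d2 * Bessel_Y \<nu> x"

text \<open>The determinant of the empty matrix is \<open>1\<close>, so this covers \<open>n = 0\<close>.\<close>

definition Bessel_Toeplitz_det ::
    "complex \<Rightarrow> complex \<Rightarrow> nat \<Rightarrow> complex \<Rightarrow> complex \<Rightarrow> complex" where
  "Bessel_Toeplitz_det d1 d2 n x \<alpha> =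
     Determinant.det (mat n n (\<lambda>(j, k). cylinder d1 d2 (\<alpha> / 2 - of_nat j + of_nat k) x))"

text \<open>
  The Barnes function through its Weierstrass product, usually stated for \<open>G (1 + w)\<close>:
  \<open>(2 \<pi>)\<close> to the power \<open>w/2\<close>, times \<open>exp (- (w + w\<^sup>2 (1 + \<gamma>)) / 2)\<close>, times the product
  over \<open>k \<ge> 1\<close> of \<open>(1 + w/k)\<^sup>k exp (w\<^sup>2 / (2 k) - w)\<close>.
\<close>

definition Barnes_G :: "complex \<Rightarrow> complex" where
  "Barnes_G z =
     (let w = z - 1 in
        of_real (2 * pi) powr (w / 2) *
        exp (- (w + w\<^sup>2 * (1 + of_real euler_mascheroni)) / 2) *
        (\<Prod>k. (1 + w / of_nat (Suc k)) ^ Suc k * exp (w\<^sup>2 / (2 * of_nat (Suc k)) - w)))"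

text \<open>
  \<open>x \<rightarrow> \<infinity>\<close> uniformly in the closed sector \<open>a \<le> arg x \<le> b\<close>. As usual for asymptotics in the complex
  plane, a limit in an open sector is a limit in each of its closed subsectors.
\<close>

definition at_infinity_sector :: "real \<Rightarrow> real \<Rightarrow> complex filter" where
  "at_infinity_sector a b = inf at_infinity (principal {x. a \<le> Arg x \<and> Arg x \<le> b})"

definition asymp_equiv_open_sector ::
    "(complex \<Rightarrow> complex) \<Rightarrow> real \<Rightarrow> real \<Rightarrow> (complex \<Rightarrow> complex) \<Rightarrow> bool" where
  "asymp_equiv_open_sector f \<theta>1 \<theta>2 g \<longleftrightarrow>
     (\<forall>a b. \<theta>1 < a \<and> a \<le> b \<and> b < \<theta>2 \<longrightarrow> f \<sim>[at_infinity_sector a b] g)"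

text \<open>
  Equivalence to \<open>A x * s x\<close> with an oscillating factor \<open>s\<close>. If \<open>s\<close> has zeros arbitrarily far out, as
  \<open>sin\<close> of a real argument does, the quotient of the two sides need not be defined, let alone tend
  to \<open>1\<close>, near them. The usual meaning is an error that is small relative to the amplitude \<open>A\<close>; it
  entails that the quotient tends to \<open>1\<close> as long as \<open>s\<close> stays bounded away from \<open>0\<close>, and this is
  plain asymptotic equivalence if \<open>s\<close> is bounded away from \<open>0\<close> altogether.
\<close>

definition asymp_equiv_oscillating ::
    "(real \<Rightarrow> complex) \<Rightarrow> (real \<Rightarrow> complex) \<Rightarrow> (real \<Rightarrow> complex) \<Rightarrow> bool" where
  "asymp_equiv_oscillating f A s \<longleftrightarrow>
     (\<lambda>x. f x - A x * s x) \<in> o[at_top](A) \<and>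
     (\<forall>\<epsilon>>0. f \<sim>[inf at_top (principal {x. \<epsilon> \<le> norm (s x)})] (\<lambda>x. A x * s x))"

end

theory Submission
  imports Defs "HOL-Complex_Analysis.Complex_Analysis" "HOL-Real_Asymp.Real_Asymp" "Jordan_Normal_Form.Char_Poly"
begin

text \<open>
  The idea is to expand the determinant in the two Hankel functions. The cylinder function is
  \<open>A * Hankel1 + B * Hankel2\<close> with \<open>A = (d1 - \<i> d2) / 2\<close> and \<open>B = (d1 + \<i> d2) / 2\<close>, so that
  \<open>x\<^bsup>n/2\<^esup>\<close> times the determinant is \<open>\<Sum>p\<le>n. A\<^sup>p B\<^bsup>n-p\<^esup> T n p x\<close>, where \<open>T n p\<close> (below \<open>mixed_coeff n p\<close>)
  collects the contributions with \<open>p\<close> factors \<open>Hankel1\<close>. The heart of the matter is the asymptotics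
  of every single \<open>T n p\<close>: in all closed subsectors of the slit plane it is a nonzero constant
  times \<open>exp (\<i> (2p - n) x) * x\<^bsup>-(p(p-1) + (n-p)(n-p-1))/2\<^esup>\<close> (\<open>normalized_limit\<close>). The six cases
  of the theorem only compare these \<open>n + 1\<close> terms. Below the real axis the exponential makes
  \<open>p = n\<close> win, above it \<open>p = 0\<close>. If \<open>B\<close> or \<open>A\<close> vanishes, only \<open>p = n\<close> or \<open>p = 0\<close> is present. On the
  positive axis the exponentials are bounded and the power of \<open>x\<close> decides: for even \<open>n\<close> the single
  term \<open>p = n/2\<close> dominates, for odd \<open>n\<close> the two neighbours of \<open>n/2\<close> have the same power of \<open>x\<close>, and
  their opposite phases add up to the sine.

  Why the \<open>T n p\<close> behave in this way: for each \<open>\<mu>\<close>, the Toeplitz determinants with entries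
  \<open>\<surd>x * (Hankel2 + \<mu> * Hankel1)\<close> satisfy a Toda equation (\<open>toda_equation\<close>), because differentiation
  only moves the last row or the last column, and Dodgson condensation relates the minors that
  arise. The coefficients of the powers of \<open>\<mu>\<close> in this equation express the convolution of
  \<open>T (n+2)\<close> and \<open>T n\<close> by \<open>T (n+1)\<close> and its derivatives. For each \<open>p\<close> the equation can be rescaled
  such that only one coefficient of the factor \<open>T n\<close> survives as \<open>x \<rightarrow> \<infinity>\<close>, and then dividing by it
  yields the limit of \<open>T (n+2) p\<close> (\<open>normalized_toda\<close>, \<open>convolution_limit\<close>). Derivatives do no harm, because
  a limit in all sectors can be differentiated by Cauchy's estimate (\<open>sector_tendsto_deriv\<close>). So the
  asymptotics for all \<open>n\<close> follow from those for \<open>n = 1\<close>, that is, of the Hankel functions themselves.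

  The leading asymptotics of the Hankel functions (\<open>Hankel1_asymptotics\<close>, \<open>Hankel2_asymptotics\<close>)
  come from the differential equation \<open>u'' = (\<kappa>/x\<^sup>2 - 1) u\<close> for \<open>\<surd>x\<close> times a Bessel function. Along
  horizontal lines to the right the quantities \<open>(u' \<plusminus> \<i> u) exp (\<mp>\<i> x)\<close> converge, with a relative
  error \<open>O(1/x)\<close> and with limits that do not depend on the line (\<open>connection\<close>, \<open>connection_bound\<close>).
  For \<open>Bessel_J\<close> these limits can be read off on the imaginary axis, where they amount to the
  limit of \<open>\<surd>y exp (-y) I\<^sub>\<nu>(y)\<close> for the modified Bessel function \<open>I\<^sub>\<nu>\<close>. This limit is \<open>1/\<surd>(2\<pi>)\<close>, by
  an Abelian argument for the Laplace transform of \<open>w\<^sup>\<nu> I\<^sub>\<nu>(w)\<close>, which is elementary (\<open>scaled_I_limit\<close>).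
  Integer orders, where the Neumann function is defined by a limit in the order, are reached
  because the error bounds are continuous in the order (\<open>Hankel_bound\<close>).

  Finally, the constants contain products of factorials, which are the values of the Barnes
  function at positive integers (\<open>Barnes_G_nat\<close>).
\<close>

section \<open>Determinants and Dodgson condensation\<close>

text \<open>
  The entries are given as a function and not as a matrix, so that a minor is the same determinant
  with reindexed entries.
\<close>

definition dt :: "nat \<Rightarrow> (nat \<Rightarrow> nat \<Rightarrow> 'a::comm_ring_1) \<Rightarrow> 'a" where
  "dt n a = Determinant.det (mat n n (\<lambda>(i, j). a i j))"

lemma dt_cong: "(\<And>i j. i < n \<Longrightarrow> j < n \<Longrightarrow> a i j = b i j) \<Longrightarrow> dt n a = dt n b"
  unfolding dt_def by (intro arg_cong[of _ _ Determinant.det] eq_matI) auto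

lemma dt_permutes: "dt n a = (\<Sum>p | p permutes {0..<n}. signof p * (\<Prod>i = 0..<n. a i (p i)))"
  unfolding dt_def by (subst det_def'[of _ n]) (auto intro!: sum.cong prod.cong simp: permutes_in_image)

lemma dt_0 [simp]: "dt 0 a = 1"
  by (simp add: dt_permutes)

lemma dt_1: "dt (Suc 0) a = a 0 0"
  by (simp add: dt_def det_single)

lemma dt_transpose: "dt n (\<lambda>i j. a j i) = dt n a"
proof -
  have "(mat n n (\<lambda>(i, j). a j i)) = transpose_mat (mat n n (\<lambda>(i, j). a i j))"
    by (intro eq_matI) auto
  then show ?thesis
    unfolding dt_def by (simp only:) (subst det_transpose[of _ n], auto)
qed

lemma dt_identical_rows:
  assumes "i < n" "k < n" "i \<noteq> k" "\<And>j. j < n \<Longrightarrow> a i j = a k j"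
  shows "dt n a = 0"
  unfolding dt_def using assms by (intro det_identical_rows[of _ n i k]) (auto intro!: eq_vecI)

lemma dt_hom: "comm_ring_hom h \<Longrightarrow> h (dt n a) = dt n (\<lambda>i j. h (a i j))"
proof -
  assume "comm_ring_hom h"
  then interpret comm_ring_hom h .
  have "map_mat h (mat n n (\<lambda>(i, j). a i j)) = mat n n (\<lambda>(i, j). h (a i j))"
    by (intro eq_matI) auto
  then show ?thesis
    unfolding dt_def by (simp flip: hom_det)
qed

text \<open>
  Of the rows \<open>0, \<dots>, n + 1\<close> this leaves out the last but one. Condensation is stated for the last
  two rows and columns, because the derivative of a Toeplitz determinant is a minor of this kind.
\<close>

definition skip :: "nat \<Rightarrow> nat \<Rightarrow> nat" where
  "skip n i = (if i < n then i else Suc i)"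

text \<open>
  Multiplying the matrix \<open>A\<close> by the identity matrix whose last two columns are replaced by those of
  the adjugate gives a block triangular matrix with determinant \<open>dt n a * (det A)\<^sup>2\<close>. The second
  factor has the determinant of a \<open>2 \<times> 2\<close> matrix of cofactors. It remains to cancel \<open>det A\<close>, which
  has to be nonzero for this.
\<close>

lemma dodgson_aux:
  fixes a :: "nat \<Rightarrow> nat \<Rightarrow> 'a::idom"
  assumes "dt (n + 2) a \<noteq> 0"
  shows "dt (n + 2) a * dt n a = dt (n + 1) a * dt (n + 1) (\<lambda>i j. a (skip n i) (skip n j)) -
           dt (n + 1) (\<lambda>i j. a (skip n i) j) * dt (n + 1) (\<lambda>i j. a i (skip n j))"
proof -
  define A where "A = mat (n + 2) (n + 2) (\<lambda>(i, j). a i j)"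
  have A: "A \<in> carrier_mat (n + 2) (n + 2)" by (simp add: A_def)
  define d where "d = dt (n + 2) a"
  have d: "Determinant.det A = d" by (simp add: d_def A_def dt_def)
  define M where "M = mat 2 2 (\<lambda>(i, j). cofactor A (n + j) (n + i))"
  define X where "X = four_block_mat (1\<^sub>m n) (mat n 2 (\<lambda>(i, j). cofactor A (n + j) i)) (0\<^sub>m 2 n) M"
  have X: "X \<in> carrier_mat (n + 2) (n + 2)" by (auto simp: X_def M_def)
  have AX: "A * X = four_block_mat (mat n n (\<lambda>(i, j). a i j)) (0\<^sub>m n 2) (mat 2 n (\<lambda>(i, j). a (n + i) j)) (d \<cdot>\<^sub>m 1\<^sub>m 2)"
  proof (rule eq_matI)
    fix i j assume "i < dim_row (four_block_mat (mat n n (\<lambda>(i, j). a i j)) (0\<^sub>m n 2) (mat 2 n (\<lambda>(i, j). a (n + i) j)) (d \<cdot>\<^sub>m 1\<^sub>m 2))"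
      "j < dim_col (four_block_mat (mat n n (\<lambda>(i, j). a i j)) (0\<^sub>m n 2) (mat 2 n (\<lambda>(i, j). a (n + i) j)) (d \<cdot>\<^sub>m 1\<^sub>m 2))"
    then have ij: "i < n + 2" "j < n + 2" by auto
    show "(A * X) $$ (i, j) = four_block_mat (mat n n (\<lambda>(i, j). a i j)) (0\<^sub>m n 2) (mat 2 n (\<lambda>(i, j). a (n + i) j)) (d \<cdot>\<^sub>m 1\<^sub>m 2) $$ (i, j)"
    proof (cases "j < n")
      case True
      have "(A * X) $$ (i, j) = (\<Sum>k\<in>{0..<n+2}. A $$ (i, k) * X $$ (k, j))"
        using ij A X by (auto simp: scalar_prod_def)
      also have "\<dots> = (\<Sum>k\<in>{0..<n+2}. if k = j then A $$ (i, j) else 0)"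
        by (intro sum.cong) (use True ij in \<open>auto simp: X_def M_def\<close>)
      also have "\<dots> = a i j" using ij by (simp add: A_def)
      finally show ?thesis using True ij by auto
    next
      case False
      have "X $$ (k, j) = adj_mat A $$ (k, j)" if "k < n + 2" for k
        using that False ij A by (auto simp: X_def M_def adj_mat_def)
      then have "(A * X) $$ (i, j) = (A * adj_mat A) $$ (i, j)"
        using ij A X adj_mat(1)[OF A] by (auto simp: scalar_prod_def intro!: sum.cong)
      also have "\<dots> = (d \<cdot>\<^sub>m 1\<^sub>m (n + 2)) $$ (i, j)"
        using adj_mat(2)[OF A] d by simp
      finally show ?thesis using False ij by auto
    qed
  qed (use A X in auto)
  have detX: "Determinant.det X = Determinant.det M"
    unfolding X_def by (subst det_four_block_mat_lower_left_zero[of _ n _ 2]) (auto simp: M_def)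
  have "d * Determinant.det M = Determinant.det (A * X)"
    using det_mult[OF A X] d detX by simp
  also have "\<dots> = dt n a * d ^ 2"
    unfolding AX by (subst det_four_block_mat_upper_right_zero[of _ n _ 2]) (auto simp: dt_def)
  finally have *: "Determinant.det M = d * dt n a"
    using assms by (simp add: d_def power2_eq_square)
  have cof: "cofactor A (n + i) (n + j) = (-1) ^ (i + j) *
       dt (n + 1) (\<lambda>i' j'. a (if i = 0 then skip n i' else i') (if j = 0 then skip n j' else j'))"
    if "i < 2" "j < 2" for i j
  proof -
    have "mat_delete A (n + i) (n + j) = mat (n + 1) (n + 1)
       (\<lambda>(i', j'). a (if i = 0 then skip n i' else i') (if j = 0 then skip n j' else j'))"
      using that by (intro eq_matI) (auto simp: mat_delete_def A_def skip_def less_2_cases_iff)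
    moreover have "(-1 :: 'a) ^ (n + i + (n + j)) = (-1) ^ (i + j)"
      by (simp add: power_add flip: power_mult_distrib)
    ultimately show ?thesis
      by (simp add: cofactor_def dt_def)
  qed
  have "Determinant.det M = M $$ (0,0) * M $$ (1,1) - M $$ (0,1) * M $$ (1,0)"
  proof -
    have M: "M \<in> carrier_mat 2 2" by (simp add: M_def)
    have "{..<2::nat} = {0, 1}" by auto
    moreover have "mat_delete M 0 0 \<in> carrier_mat 1 1" "mat_delete M 1 0 \<in> carrier_mat 1 1"
      using M by (auto simp: mat_delete_def)
    ultimately show ?thesis
      using M by (simp add: laplace_expansion_column[OF M, of 0] cofactor_def det_single)
        (simp add: mat_delete_def)
  qed
  also have "\<dots> = dt (n + 1) (\<lambda>i j. a (skip n i) (skip n j)) * dt (n + 1) a -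
           dt (n + 1) (\<lambda>i j. a i (skip n j)) * dt (n + 1) (\<lambda>i j. a (skip n i) j)"
    using cof[of 0 0] cof[of 1 1] cof[of 0 1] cof[of 1 0] by (simp add: M_def)
  finally show ?thesis
    unfolding * d_def by (simp add: mult_ac)
qed

text \<open>
  An indeterminate added on the diagonal turns the determinant into the characteristic polynomial
  of \<open>- a\<close>, which is monic and hence nonzero. The identity for polynomials is then evaluated at \<open>0\<close>.
\<close>

theorem dodgson_condensation:
  fixes a :: "nat \<Rightarrow> nat \<Rightarrow> 'a::idom"
  shows "dt (n + 2) a * dt n a = dt (n + 1) a * dt (n + 1) (\<lambda>i j. a (skip n i) (skip n j)) -
           dt (n + 1) (\<lambda>i j. a (skip n i) j) * dt (n + 1) (\<lambda>i j. a i (skip n j))"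
proof -
  define b :: "nat \<Rightarrow> nat \<Rightarrow> 'a poly" where "b = (\<lambda>i j. [:a i j, if i = j then 1 else 0:])"
  have ev: "poly (dt m (\<lambda>i j. b (f i) (g j))) 0 = dt m (\<lambda>i j. a (f i) (g j))" for m f g
    by (subst dt_hom[where h = "\<lambda>p. poly p 0"]) (auto simp: b_def, unfold_locales, auto)
  have "dt (n + 2) b = char_poly (mat (n + 2) (n + 2) (\<lambda>(i, j). - a i j))"
    unfolding dt_def char_poly_def char_poly_matrix_def
    by (intro arg_cong[of _ _ Determinant.det] eq_matI) (auto simp: b_def)
  then have nz: "dt (n + 2) b \<noteq> 0"
    using degree_monic_char_poly[of "mat (n + 2) (n + 2) (\<lambda>(i, j). - a i j)" "n + 2"] by auto
  have "poly (dt (n + 2) b * dt n b) 0 = poly (dt (n + 1) b * dt (n + 1) (\<lambda>i j. b (skip n i) (skip n j)) -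
           dt (n + 1) (\<lambda>i j. b (skip n i) j) * dt (n + 1) (\<lambda>i j. b i (skip n j))) 0"
    by (subst dodgson_aux[OF nz]) simp
  then show ?thesis
    using ev[of _ "\<lambda>i. i" "\<lambda>i. i"] ev[of _ "skip n" "\<lambda>i. i"] ev[of _ "\<lambda>i. i" "skip n"] ev[of _ "skip n" "skip n"]
    by simp
qed

lemma dt_row:
  assumes "k < n"
  shows "dt n (\<lambda>i j. if i = k then b j else a i j) =
    (\<Sum>p | p permutes {0..<n}. signof p * (b (p k) * (\<Prod>i\<in>{0..<n}-{k}. a i (p i))))"
  unfolding dt_permutes
proof (intro sum.cong refl arg_cong2[of _ _ _ _ "(*)"])
  fix p
  have "(\<Prod>i = 0..<n. if i = k then b (p i) else a i (p i)) = (if k = k then b (p k) else a k (p k)) * (\<Prod>i\<in>{0..<n}-{k}. if i = k then b (p i) else a i (p i))"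
    using assms by (subst prod.remove[of _ k]) auto
  also have "(\<Prod>i\<in>{0..<n}-{k}. if i = k then b (p i) else a i (p i)) = (\<Prod>i\<in>{0..<n}-{k}. a i (p i))"
    by (intro prod.cong) auto
  finally show "(\<Prod>i = 0..<n. if i = k then b (p i) else a i (p i)) = b (p k) * (\<Prod>i\<in>{0..<n}-{k}. a i (p i))"
    by simp
qed

lemma dt_has_field_derivative:
  fixes a :: "'a::real_normed_field \<Rightarrow> nat \<Rightarrow> nat \<Rightarrow> 'a"
  assumes "\<And>i j. i < n \<Longrightarrow> j < n \<Longrightarrow> ((\<lambda>x. a x i j) has_field_derivative a' i j) (at x)"
  shows "((\<lambda>x. dt n (a x)) has_field_derivative
    (\<Sum>k<n. dt n (\<lambda>i j. if i = k then a' k j else a x i j))) (at x)"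
proof -
  have "((\<lambda>x. dt n (a x)) has_field_derivative
     (\<Sum>p | p permutes {0..<n}. signof p * (\<Sum>k\<in>{0..<n}. a' k (p k) * (\<Prod>i\<in>{0..<n}-{k}. a x i (p i))))) (at x)"
    unfolding dt_permutes using assms
    by (intro DERIV_sum DERIV_cmult has_field_derivative_prod) (auto simp: permutes_in_image)
  also have "(\<Sum>p | p permutes {0..<n}. signof p * (\<Sum>k\<in>{0..<n}. a' k (p k) * (\<Prod>i\<in>{0..<n}-{k}. a x i (p i)))) =
     (\<Sum>k\<in>{0..<n}. (\<Sum>p | p permutes {0..<n}. signof p * (a' k (p k) * (\<Prod>i\<in>{0..<n}-{k}. a x i (p i)))))"
    by (simp add: sum_distrib_left) (rule sum.swap)
  also have "\<dots> = (\<Sum>k<n. dt n (\<lambda>i j. if i = k then a' k j else a x i j))"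
    by (simp add: dt_row lessThan_atLeast0)
  finally show ?thesis .
qed

text \<open>
  In the expansion over permutations \<open>p\<close>, the weights of the rows contribute \<open>\<Sum>k. \<alpha> k + \<beta> (p k)\<close>,
  which does not depend on \<open>p\<close>. This is why weights of the form \<open>\<alpha> i + \<beta> j\<close> only lead to a multiple
  of the determinant.
\<close>

lemma dt_weights:
  fixes a :: "nat \<Rightarrow> nat \<Rightarrow> 'a::real_normed_field"
  shows "(\<Sum>k<n. dt n (\<lambda>i j. if i = k then (\<alpha> k + \<beta> j) * a k j + e * b k j else a i j)) =
     ((\<Sum>k<n. \<alpha> k) + (\<Sum>k<n. \<beta> k)) * dt n a + e * (\<Sum>k<n. dt n (\<lambda>i j. if i = k then b k j else a i j))"
proof -
  have "(\<Sum>k<n. dt n (\<lambda>i j. if i = k then (\<alpha> k + \<beta> j) * a k j + e * b k j else a i j)) =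
    (\<Sum>k<n. \<Sum>p | p permutes {0..<n}. signof p * (((\<alpha> k + \<beta> (p k)) * a k (p k) + e * b k (p k)) * (\<Prod>i\<in>{0..<n}-{k}. a i (p i))))"
    by (simp add: dt_row)
  also have "\<dots> = (\<Sum>k<n. \<Sum>p | p permutes {0..<n}. (\<alpha> k + \<beta> (p k)) * (signof p * (\<Prod>i\<in>{0..<n}. a i (p i)))) +
     e * (\<Sum>k<n. \<Sum>p | p permutes {0..<n}. signof p * (b k (p k) * (\<Prod>i\<in>{0..<n}-{k}. a i (p i))))"
    unfolding sum_distrib_left sum.distrib[symmetric]
  proof (intro sum.cong refl)
    fix k p assume "k \<in> {..<n}"
    then have "(\<Prod>i\<in>{0..<n}. a i (p i)) = a k (p k) * (\<Prod>i\<in>{0..<n}-{k}. a i (p i))"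
      by (subst prod.remove[of _ k]) auto
    then show "signof p * (((\<alpha> k + \<beta> (p k)) * a k (p k) + e * b k (p k)) * (\<Prod>i\<in>{0..<n}-{k}. a i (p i))) =
      (\<alpha> k + \<beta> (p k)) * (signof p * (\<Prod>i = 0..<n. a i (p i))) + e * (signof p * (b k (p k) * (\<Prod>i\<in>{0..<n}-{k}. a i (p i))))"
      by (simp add: algebra_simps)
  qed
  also have "(\<Sum>k<n. \<Sum>p | p permutes {0..<n}. (\<alpha> k + \<beta> (p k)) * (signof p * (\<Prod>i\<in>{0..<n}. a i (p i)))) =
    (\<Sum>p | p permutes {0..<n}. (\<Sum>k<n. \<alpha> k + \<beta> (p k)) * (signof p * (\<Prod>i\<in>{0..<n}. a i (p i))))"
    by (subst sum.swap) (simp add: sum_distrib_right)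
  also have "\<dots> = (\<Sum>p | p permutes {0..<n}. ((\<Sum>k<n. \<alpha> k) + (\<Sum>k<n. \<beta> k)) * (signof p * (\<Prod>i\<in>{0..<n}. a i (p i))))"
  proof (intro sum.cong refl arg_cong2[of _ _ _ _ "(*)"])
    fix p assume "p \<in> {p. p permutes {0..<n}}"
    then have "(\<Sum>k\<in>{0..<n}. \<beta> (p k)) = (\<Sum>k\<in>{0..<n}. \<beta> k)"
      by (metis comp_apply mem_Collect_eq sum.cong sum.permute)
    then show "(\<Sum>k<n. \<alpha> k + \<beta> (p k)) = (\<Sum>k<n. \<alpha> k) + (\<Sum>k<n. \<beta> k)"
      by (simp add: sum.distrib lessThan_atLeast0)
  qed
  also have "\<dots> = ((\<Sum>k<n. \<alpha> k) + (\<Sum>k<n. \<beta> k)) * dt n a"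
    by (simp add: dt_permutes sum_distrib_left)
  also have "(\<Sum>k<n. \<Sum>p | p permutes {0..<n}. signof p * (b k (p k) * (\<Prod>i\<in>{0..<n}-{k}. a i (p i)))) =
      (\<Sum>k<n. dt n (\<lambda>i j. if i = k then b k j else a i j))"
    by (simp add: dt_row)
  finally show ?thesis .
qed

text \<open>
  The derivative of a Bessel function is a multiple of it plus a neighbour of adjacent order. The
  multiples only give a scalar factor, so that the derivative of the determinant reduces to a sum in
  which one row at a time is replaced by neighbours.
\<close>

lemma dt_row_derivative:
  fixes a :: "'a::real_normed_field \<Rightarrow> nat \<Rightarrow> nat \<Rightarrow> 'a"
  assumes "\<And>i j. i < n \<Longrightarrow> j < n \<Longrightarrow>
    ((\<lambda>x. a x i j) has_field_derivative (\<alpha> i + \<beta> j) * a x i j + e * b i j) (at x)"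
  shows "((\<lambda>x. dt n (a x)) has_field_derivative
    ((\<Sum>k<n. \<alpha> k) + (\<Sum>k<n. \<beta> k)) * dt n (a x) + e * (\<Sum>k<n. dt n (\<lambda>i j. if i = k then b k j else a x i j))) (at x)"
  using dt_has_field_derivative[of n a "\<lambda>i j. (\<alpha> i + \<beta> j) * a x i j + e * b i j" x, OF assms]
    dt_weights[of n \<alpha> \<beta> "a x" e b] by simp

lemma dt_col_derivative:
  fixes a :: "'a::real_normed_field \<Rightarrow> nat \<Rightarrow> nat \<Rightarrow> 'a"
  assumes "\<And>i j. i < n \<Longrightarrow> j < n \<Longrightarrow>
    ((\<lambda>x. a x i j) has_field_derivative (\<alpha> i + \<beta> j) * a x i j + e * b i j) (at x)"
  shows "((\<lambda>x. dt n (a x)) has_field_derivative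
    ((\<Sum>k<n. \<alpha> k) + (\<Sum>k<n. \<beta> k)) * dt n (a x) + e * (\<Sum>k<n. dt n (\<lambda>i j. if j = k then b i k else a x i j))) (at x)"
proof -
  have "((\<lambda>x. dt n (\<lambda>i j. a x j i)) has_field_derivative
    ((\<Sum>k<n. \<beta> k) + (\<Sum>k<n. \<alpha> k)) * dt n (\<lambda>i j. a x j i) + e * (\<Sum>k<n. dt n (\<lambda>i j. if i = k then b j k else a x j i))) (at x)"
    by (rule dt_row_derivative[where b = "\<lambda>i j. b j i"]) (use assms in \<open>simp add: add_ac\<close>)
  moreover have "dt n (\<lambda>i j. if i = k then b j k else a x j i) = dt n (\<lambda>i j. if j = k then b i k else a x i j)" for k
    by (rule dt_transpose[of n "\<lambda>i j. if j = k then b i k else a x i j"])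
  moreover have "dt n (\<lambda>i j. a x j i) = dt n (a x)" for x by (rule dt_transpose)
  ultimately show ?thesis
    by (simp add: dt_transpose[where a = "a _"] add_ac)
qed

lemma sum_skip:
  fixes f :: "nat \<Rightarrow> 'a::comm_ring_1"
  shows "(\<Sum>k<Suc n. f (skip n k)) = (\<Sum>k<n. f k) + f (Suc n)"
  by (simp add: skip_def)

section \<open>The Toda equation\<close>

text \<open>
  Here \<open>g s\<close> stands for \<open>\<surd>x\<close> times a cylinder function of order \<open>c + 1/2 + s\<close>. In a Toeplitz
  determinant, a row in which all orders are lowered by one equals the next row, so that only the
  last row contributes to the derivative. The same holds for columns in which all orders are raised.
  Hence the first derivative of \<open>\<tau> (n + 1)\<close> is, up to sign and a multiple of \<open>\<tau> (n + 1)\<close>, equal to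
  each of the two minors that lack a row or a column, and the second derivative involves the minor
  that lacks both. Condensation connects these minors with \<open>\<tau> n\<close> and \<open>\<tau> (n + 2)\<close>.
\<close>

lemma toda_equation:
  fixes g :: "int \<Rightarrow> complex \<Rightarrow> complex" and c :: complex
  assumes S: "open S" "0 \<notin> S" "x \<in> S"
    and down: "\<And>s x. x \<in> S \<Longrightarrow> (g s has_field_derivative - ((c + of_int s) / x) * g s x + g (s - 1) x) (at x)"
    and up: "\<And>s x. x \<in> S \<Longrightarrow> (g s has_field_derivative ((c + 1 + of_int s) / x) * g s x - g (s + 1) x) (at x)"
  defines "\<tau> \<equiv> (\<lambda>n x. dt n (\<lambda>i j. g (int j - int i) x))"
  shows "\<tau> (n + 2) x * \<tau> n x = (deriv (\<tau> (n + 1)) x)\<^sup>2 - \<tau> (n + 1) x * (deriv ^^ 2) (\<tau> (n + 1)) x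
     - \<tau> (n + 1) x * deriv (\<tau> (n + 1)) x / x"
proof -
  define D where "D = \<tau> (n + 1)"
  define Dr where "Dr = (\<lambda>x. dt (n + 1) (\<lambda>i j. g (int j - int (skip n i)) x))"
  define Dc where "Dc = (\<lambda>x. dt (n + 1) (\<lambda>i j. g (int (skip n j) - int i) x))"
  define Drc where "Drc = (\<lambda>x. dt (n + 1) (\<lambda>i j. g (int (skip n j) - int (skip n i)) x))"
  define m where "m = (of_nat (n + 1) :: complex)"
  \<comment> \<open>A row with all orders lowered by one equals the next row, so only the last row contributes.\<close>
  have shift_row: "(\<Sum>k<n+1. dt (n + 1) (\<lambda>i j. if i = k then g (int (r j) - int k - 1) x else g (int (r j) - int i) x))
      = dt (n + 1) (\<lambda>i j. g (int (r j) - int (skip n i)) x)" for r x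
  proof -
    have "dt (n + 1) (\<lambda>i j. if i = k then g (int (r j) - int k - 1) x else g (int (r j) - int i) x) = 0" if "k < n" for k
      by (rule dt_identical_rows[of k _ "Suc k"]) (use that in \<open>auto simp: algebra_simps\<close>)
    moreover have "dt (n + 1) (\<lambda>i j. if i = n then g (int (r j) - int n - 1) x else g (int (r j) - int i) x) =
       dt (n + 1) (\<lambda>i j. g (int (r j) - int (skip n i)) x)"
      by (intro dt_cong) (auto simp: skip_def algebra_simps)
    ultimately show ?thesis by simp
  qed
  have shift_col: "(\<Sum>k<n+1. dt (n + 1) (\<lambda>i j. if j = k then g (int k + 1 - int (r i)) x else g (int j - int (r i)) x))
      = dt (n + 1) (\<lambda>i j. g (int (skip n j) - int (r i)) x)" for r x
  proof -
    have "dt (n + 1) (\<lambda>i j. if j = k then g (int k + 1 - int (r i)) x else g (int j - int (r i)) x) = 0" if "k < n" for k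
      by (subst dt_transpose[symmetric], rule dt_identical_rows[of k _ "Suc k"]) (use that in \<open>auto simp: algebra_simps\<close>)
    moreover have "dt (n + 1) (\<lambda>i j. if j = n then g (int n + 1 - int (r i)) x else g (int j - int (r i)) x) =
       dt (n + 1) (\<lambda>i j. g (int (skip n j) - int (r i)) x)"
      by (intro dt_cong) (auto simp: skip_def algebra_simps)
    ultimately show ?thesis by simp
  qed
  have D_row: "(D has_field_derivative - (m * c / x) * D x + Dr x) (at x)" if "x \<in> S" for x
  proof -
    have "x \<noteq> 0" using that S by auto
    have "((\<lambda>x. dt (n + 1) (\<lambda>i j. g (int j - int i) x)) has_field_derivative
      ((\<Sum>k<n+1. - (c - of_nat k) / x) + (\<Sum>k<n+1. - of_nat k / x)) * dt (n + 1) (\<lambda>i j. g (int j - int i) x) +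
      1 * (\<Sum>k<n+1. dt (n + 1) (\<lambda>i j. if i = k then g (int j - int k - 1) x else g (int j - int i) x))) (at x)"
      by (rule dt_row_derivative) (use that \<open>x \<noteq> 0\<close> in \<open>auto intro!: DERIV_cong[OF down] simp: field_simps\<close>)
    also have "(\<Sum>k<n+1. - (c - of_nat k) / x) + (\<Sum>k<n+1. - of_nat k / x) = (\<Sum>k<n+1. - c / x)"
      unfolding sum.distrib[symmetric] by (intro sum.cong) (auto simp: field_simps \<open>x \<noteq> 0\<close>)
    finally show ?thesis
      unfolding shift_row[of "\<lambda>j. j" x] D_def \<tau>_def Dr_def m_def by simp
  qed
  have D_col: "(D has_field_derivative (m * (c + 1) / x) * D x - Dc x) (at x)" if "x \<in> S" for x
  proof -
    have "x \<noteq> 0" using that S by auto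
    have "((\<lambda>x. dt (n + 1) (\<lambda>i j. g (int j - int i) x)) has_field_derivative
      ((\<Sum>k<n+1. (c + 1 - of_nat k) / x) + (\<Sum>k<n+1. of_nat k / x)) * dt (n + 1) (\<lambda>i j. g (int j - int i) x) +
      (-1) * (\<Sum>k<n+1. dt (n + 1) (\<lambda>i j. if j = k then g (int k + 1 - int i) x else g (int j - int i) x))) (at x)"
      by (rule dt_col_derivative) (use that \<open>x \<noteq> 0\<close> in \<open>auto intro!: DERIV_cong[OF up] simp: field_simps\<close>)
    also have "(\<Sum>k<n+1. (c + 1 - of_nat k) / x) + (\<Sum>k<n+1. of_nat k / x) = (\<Sum>k<n+1. (c + 1) / x)"
      unfolding sum.distrib[symmetric] by (intro sum.cong) (auto simp: field_simps \<open>x \<noteq> 0\<close>)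
    finally show ?thesis
      unfolding shift_col[of "\<lambda>j. j" x] D_def \<tau>_def Dc_def m_def by simp
  qed
  have Dr_col: "(Dr has_field_derivative ((m * (c + 1) - 1) / x) * Dr x - Drc x) (at x)" if "x \<in> S" for x
  proof -
    have "x \<noteq> 0" using that S by auto
    have "((\<lambda>x. dt (n + 1) (\<lambda>i j. g (int j - int (skip n i)) x)) has_field_derivative
      ((\<Sum>k<n+1. (c + 1 - of_nat (skip n k)) / x) + (\<Sum>k<n+1. of_nat k / x)) * dt (n + 1) (\<lambda>i j. g (int j - int (skip n i)) x) +
      (-1) * (\<Sum>k<n+1. dt (n + 1) (\<lambda>i j. if j = k then g (int k + 1 - int (skip n i)) x else g (int j - int (skip n i)) x))) (at x)"
      by (rule dt_col_derivative) (use that \<open>x \<noteq> 0\<close> in \<open>auto intro!: DERIV_cong[OF up] simp: field_simps\<close>)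
    also have "(\<Sum>k<n+1. (c + 1 - of_nat (skip n k)) / x) + (\<Sum>k<n+1. of_nat k / x) = (m * (c + 1) - 1) / x"
    proof -
      have e1: "(\<Sum>k<n+1. (c + 1 - of_nat (skip n k)) / x) = (\<Sum>k<n. (c + 1 - of_nat k) / x) + (c - of_nat n) / x"
        unfolding Suc_eq_plus1[symmetric] by (subst sum_skip) simp
      have e2: "(\<Sum>k<n+1. complex_of_nat k / x) = (\<Sum>k<n. of_nat k / x) + of_nat n / x" by simp
      have e3: "(\<Sum>k<n. (c + 1 - of_nat k) / x) + (\<Sum>k<n. of_nat k / x) = (\<Sum>k<n. (c + 1) / x)"
        unfolding sum.distrib[symmetric] by (intro sum.cong) (auto simp: field_simps \<open>x \<noteq> 0\<close>)
      have "(\<Sum>k<n+1. (c + 1 - of_nat (skip n k)) / x) + (\<Sum>k<n+1. of_nat k / x) =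
          (\<Sum>k<n. (c + 1) / x) + (c - of_nat n) / x + of_nat n / x"
        unfolding e1 e2 e3[symmetric] by (simp only: add_ac)
      also have "\<dots> = (m * (c + 1) - 1) / x" using \<open>x \<noteq> 0\<close> by (simp add: m_def field_simps)
      finally show ?thesis .
    qed
    finally show ?thesis
      unfolding shift_col[of "skip n" x] Drc_def Dr_def by simp
  qed
  have "x \<noteq> 0" using S by auto
  \<comment> \<open>The second derivative is obtained from the row form of the first one, whose minor is then
    differentiated by columns; this produces the minor that lacks both a row and a column.\<close>
  have dD: "deriv D y = - (m * c / y) * D y + Dr y" if "y \<in> S" for y
    using D_row[OF that] by (rule DERIV_imp_deriv)
  have "((\<lambda>y. - (m * c / y) * D y + Dr y) has_field_derivative
     (m * c / x\<^sup>2) * D x - (m * c / x) * deriv D x + (((m * (c + 1) - 1) / x) * Dr x - Drc x)) (at x)"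
  proof (rule DERIV_cong)
    have "((\<lambda>y. - (m * c / y)) has_field_derivative m * c / x\<^sup>2) (at x)"
      using \<open>x \<noteq> 0\<close> by (auto intro!: derivative_eq_intros simp: power2_eq_square)
    moreover have "(D has_field_derivative deriv D x) (at x)"
      using D_row[OF \<open>x \<in> S\<close>] dD[OF \<open>x \<in> S\<close>] by simp
    ultimately show "((\<lambda>y. - (m * c / y) * D y + Dr y) has_field_derivative
        m * c / x\<^sup>2 * D x + deriv D x * - (m * c / x) + (((m * (c + 1) - 1) / x) * Dr x - Drc x)) (at x)"
      using Dr_col[OF \<open>x \<in> S\<close>] by (intro DERIV_add DERIV_mult)
  qed (simp add: mult_ac)
  then have "(deriv D has_field_derivative
     (m * c / x\<^sup>2) * D x - (m * c / x) * deriv D x + (((m * (c + 1) - 1) / x) * Dr x - Drc x)) (at x)"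
    by (rule has_field_derivative_transform_within_open[OF _ \<open>open S\<close> \<open>x \<in> S\<close>]) (simp add: dD)
  then have d2: "(deriv ^^ 2) D x = (m * c / x\<^sup>2) * D x - (m * c / x) * deriv D x + (((m * (c + 1) - 1) / x) * Dr x - Drc x)"
    by (simp add: numeral_2_eq_2 DERIV_imp_deriv)
  have Dr: "Dr x = deriv D x + (m * c / x) * D x"
    using dD[OF \<open>x \<in> S\<close>] by simp
  have Dc: "Dc x = (m * (c + 1) / x) * D x - deriv D x"
    using DERIV_imp_deriv[OF D_col[OF \<open>x \<in> S\<close>]] by simp
  have "\<tau> (n + 2) x * \<tau> n x = D x * Drc x - Dr x * Dc x"
    using dodgson_condensation[of n "\<lambda>i j. g (int j - int i) x"]
    unfolding \<tau>_def D_def Drc_def Dr_def Dc_def by simp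
  also have "Drc x = (m * c / x\<^sup>2) * D x - (m * c / x) * deriv D x + ((m * (c + 1) - 1) / x) * Dr x - (deriv ^^ 2) D x"
    using d2 by simp
  also have "D x * \<dots> - Dr x * Dc x = (deriv D x)\<^sup>2 - D x * (deriv ^^ 2) D x - D x * deriv D x / x"
    unfolding Dr Dc using \<open>x \<noteq> 0\<close> by (simp add: field_simps power2_eq_square)
  finally show ?thesis unfolding D_def .
qed

section \<open>Limits in sectors\<close>

definition sector_tendsto :: "(complex \<Rightarrow> complex) \<Rightarrow> complex \<Rightarrow> bool" where
  "sector_tendsto f L \<longleftrightarrow> (\<forall>a b. - pi < a \<and> a \<le> b \<and> b < pi \<longrightarrow> (f \<longlongrightarrow> L) (at_infinity_sector a b))"

lemma eventually_at_infinity_sector: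
  "eventually P (at_infinity_sector a b) \<longleftrightarrow> (\<exists>R. \<forall>x. R \<le> norm x \<and> a \<le> Arg x \<and> Arg x \<le> b \<longrightarrow> P x)"
  by (auto simp: at_infinity_sector_def eventually_inf_principal eventually_at_infinity)

lemma sector_slit: "Arg x < pi \<Longrightarrow> x \<noteq> 0 \<Longrightarrow> x \<in> - \<real>\<^sub>\<le>\<^sub>0"
  by (metis Arg_eq_pi complex_nonpos_Reals_iff ComplI complex_eq_iff less_irrefl order_le_less zero_complex.sel)

lemma eventually_slit: "b < pi \<Longrightarrow> eventually (\<lambda>x. x \<in> - \<real>\<^sub>\<le>\<^sub>0) (at_infinity_sector a b)"
  unfolding eventually_at_infinity_sector
  by (rule exI[of _ 1]) (metis norm_zero not_one_le_zero order_le_less_trans sector_slit)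

lemma at_infinity_sector_le: "at_infinity_sector a b \<le> at_infinity"
  by (simp add: at_infinity_sector_def)

lemma sector_tendsto_cong:
  assumes "\<And>x. x \<in> - \<real>\<^sub>\<le>\<^sub>0 \<Longrightarrow> f x = g x"
  shows "sector_tendsto f L \<longleftrightarrow> sector_tendsto g L"
  unfolding sector_tendsto_def
proof (intro all_cong1 imp_cong refl)
  fix a b :: real assume "- pi < a \<and> a \<le> b \<and> b < pi"
  then show "(f \<longlongrightarrow> L) (at_infinity_sector a b) = (g \<longlongrightarrow> L) (at_infinity_sector a b)"
    by (intro filterlim_cong refl eventually_mono[OF eventually_slit[of b a]] assms) auto
qed

lemma sector_tendsto_const [simp]: "sector_tendsto (\<lambda>_. c) c"
  by (simp add: sector_tendsto_def)

lemma sector_tendsto_add: "sector_tendsto f a \<Longrightarrow> sector_tendsto g b \<Longrightarrow> sector_tendsto (\<lambda>x. f x + g x) (a + b)"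
  unfolding sector_tendsto_def by (auto intro!: tendsto_add)

lemma sector_tendsto_diff: "sector_tendsto f a \<Longrightarrow> sector_tendsto g b \<Longrightarrow> sector_tendsto (\<lambda>x. f x - g x) (a - b)"
  unfolding sector_tendsto_def by (auto intro!: tendsto_diff)

lemma sector_tendsto_mult: "sector_tendsto f a \<Longrightarrow> sector_tendsto g b \<Longrightarrow> sector_tendsto (\<lambda>x. f x * g x) (a * b)"
  unfolding sector_tendsto_def by (auto intro!: tendsto_mult)

lemma sector_tendsto_divide: "sector_tendsto f a \<Longrightarrow> sector_tendsto g b \<Longrightarrow> b \<noteq> 0 \<Longrightarrow> sector_tendsto (\<lambda>x. f x / g x) (a / b)"
  unfolding sector_tendsto_def by (auto intro!: tendsto_divide)

lemma sector_tendsto_sum: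
  "(\<And>i. i \<in> I \<Longrightarrow> sector_tendsto (f i) (c i)) \<Longrightarrow> sector_tendsto (\<lambda>x. \<Sum>i\<in>I. f i x) (\<Sum>i\<in>I. c i)"
  unfolding sector_tendsto_def by (auto intro!: tendsto_sum)

lemma sector_tendsto_inverse: "sector_tendsto inverse 0"
  unfolding sector_tendsto_def
  using tendsto_mono[OF at_infinity_sector_le tendsto_inverse_0] by blast

lemma sector_tendsto_powi_neg:
  assumes "k > 0"
  shows "sector_tendsto (\<lambda>x. x powi (- k)) 0"
proof -
  obtain n where n: "k = int (Suc n)" using assms
    by (metis gr0_conv_Suc zero_less_imp_eq_int)
  have "sector_tendsto (\<lambda>x. inverse x ^ Suc m) 0" for m
  proof (induction m)
    case 0 then show ?case using sector_tendsto_inverse by simp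
  next
    case (Suc m)
    then show ?case using sector_tendsto_mult[OF sector_tendsto_inverse Suc.IH] by simp
  qed
  moreover have "(\<lambda>x::complex. x powi (- k)) = (\<lambda>x. inverse x ^ Suc n)"
    unfolding n by (simp only: power_int_minus power_int_of_nat power_inverse)
  ultimately show ?thesis by simp
qed

lemma Arg_mult_add:
  assumes "x \<noteq> 0" "z \<noteq> 0" "- pi < Arg x + Arg z" "Arg x + Arg z \<le> pi"
  shows "Arg (x * z) = Arg x + Arg z"
proof -
  have "x * z = of_real (norm (x * z)) * exp (\<i> * of_real (Arg x + Arg z))"
    using Arg_eq[OF assms(1)] Arg_eq[OF assms(2)]
    by (simp add: norm_mult exp_add distrib_left mult_ac)
  then show ?thesis
    using assms by (intro Arg_unique[of "norm (x * z)"]) (auto simp: mult_ac)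
qed

text \<open>
  Cauchy's estimate on the disc around \<open>x\<close> of radius \<open>r * norm x\<close>. If \<open>r\<close> is small, these discs lie
  in a slightly larger closed sector, far away from \<open>0\<close>, where \<open>f\<close> is close to \<open>L\<close>.
\<close>

lemma sector_tendsto_deriv:
  assumes hol: "f holomorphic_on - \<real>\<^sub>\<le>\<^sub>0" and lim: "sector_tendsto f L"
  shows "sector_tendsto (\<lambda>x. x * deriv f x) 0"
  unfolding sector_tendsto_def
proof (intro allI impI)
  fix a b :: real assume ab: "- pi < a \<and> a \<le> b \<and> b < pi"
  define \<eta> where "\<eta> = min (a + pi) (pi - b) / 2"
  have e1: "2 * \<eta> \<le> a + pi" and e2: "2 * \<eta> \<le> pi - b" by (auto simp: \<eta>_def)
  have e3: "\<eta> > 0" using ab by (simp add: \<eta>_def)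
  have \<eta>: "\<eta> > 0" "- pi < a - \<eta>" "b + \<eta> < pi" using e1 e2 e3 by simp_all
  have "continuous (at 1) Arg" by (rule continuous_at_Arg) auto
  then obtain \<epsilon> where \<epsilon>: "\<epsilon> > 0" "\<And>z. dist z 1 < \<epsilon> \<Longrightarrow> dist (Arg z) (Arg 1) < \<eta>"
    unfolding continuous_at_eps_delta using \<eta>(1) by (auto simp: dist_norm)
  define r where "r = min (\<epsilon> / 2) (1 / 2)"
  have r: "r > 0" "r < \<epsilon>" "r < 1" "r \<le> 1/2" using \<epsilon>(1) by (auto simp: r_def)
  have near: "y \<noteq> 0 \<and> norm x / 2 \<le> norm y \<and> a - \<eta> \<le> Arg y \<and> Arg y \<le> b + \<eta>"
    if x: "x \<noteq> 0" "a \<le> Arg x" "Arg x \<le> b" and y: "dist x y \<le> r * norm x" for x y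
  proof -
    define z where "z = y / x"
    have yz: "y = x * z" using x by (simp add: z_def)
    have "norm x * dist 1 z = dist x y"
      using x by (simp add: yz dist_norm flip: norm_mult) (simp add: algebra_simps)
    then have "norm x * dist 1 z \<le> norm x * r" using y by (simp add: mult.commute)
    then have d: "dist z 1 \<le> r" using x by (simp add: dist_commute)
    then have z: "\<bar>Arg z\<bar> < \<eta>" using \<epsilon>(2)[of z] r by (simp add: dist_real_def)
    have "1 - norm z \<le> r" using d norm_triangle_ineq2[of 1 z] by (simp add: dist_norm norm_minus_commute)
    then have nz: "norm z \<ge> 1 / 2" using r(4) by linarith
    then have z0: "z \<noteq> 0" by auto
    have "Arg y = Arg x + Arg z" unfolding yz
      by (rule Arg_mult_add) (use x z z0 \<eta> in auto)
    moreover have "norm x / 2 \<le> norm y"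
      using mult_left_mono[OF nz, of "norm x"] by (simp add: yz norm_mult)
    ultimately show ?thesis using x z z0 yz by auto
  qed
  show "((\<lambda>x. x * deriv f x) \<longlongrightarrow> 0) (at_infinity_sector a b)"
  proof (rule tendstoI)
    fix e :: real assume "e > 0"
    have "(f \<longlongrightarrow> L) (at_infinity_sector (a - \<eta>) (b + \<eta>))"
      using lim \<eta> ab unfolding sector_tendsto_def by auto
    then have "eventually (\<lambda>x. dist (f x) L < e * r / 2) (at_infinity_sector (a - \<eta>) (b + \<eta>))"
      using \<open>e > 0\<close> r(1) by (intro tendstoD) auto
    then obtain R where R: "\<And>x. R \<le> norm x \<Longrightarrow> a - \<eta> \<le> Arg x \<Longrightarrow> Arg x \<le> b + \<eta> \<Longrightarrow> dist (f x) L < e * r / 2"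
      unfolding eventually_at_infinity_sector by blast
    show "\<forall>\<^sub>F x in at_infinity_sector a b. dist (x * deriv f x) 0 < e"
      unfolding eventually_at_infinity_sector
    proof (intro exI[of _ "max 1 (2 * R)"] allI impI, elim conjE)
      fix x assume x: "max 1 (2 * R) \<le> norm x" "a \<le> Arg x" "Arg x \<le> b"
      then have x0: "x \<noteq> 0" by auto
      have sub: "cball x (r * norm x) \<subseteq> - \<real>\<^sub>\<le>\<^sub>0"
      proof
        fix y assume "y \<in> cball x (r * norm x)"
        then have "y \<noteq> 0 \<and> norm x / 2 \<le> norm y \<and> a - \<eta> \<le> Arg y \<and> Arg y \<le> b + \<eta>"
          by (intro near[OF x0 x(2,3)]) simp
        then show "y \<in> - \<real>\<^sub>\<le>\<^sub>0" using \<eta>(3) by (intro sector_slit) auto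
      qed
      have hol': "(\<lambda>y. f y - L) holomorphic_on cball x (r * norm x)"
        by (intro holomorphic_intros holomorphic_on_subset[OF hol sub])
      have "norm ((deriv ^^ 1) (\<lambda>y. f y - L) x) \<le> fact 1 * (e * r / 2) / (r * norm x) ^ 1"
      proof (rule Cauchy_inequality)
        show "(\<lambda>y. f y - L) holomorphic_on ball x (r * norm x)"
          by (rule holomorphic_on_subset[OF hol']) auto
        show "continuous_on (cball x (r * norm x)) (\<lambda>y. f y - L)"
          by (rule holomorphic_on_imp_continuous_on[OF hol'])
        show "0 < r * norm x" using r x0 by simp
        fix y assume "norm (x - y) = r * norm x"
        then have "y \<noteq> 0 \<and> norm x / 2 \<le> norm y \<and> a - \<eta> \<le> Arg y \<and> Arg y \<le> b + \<eta>"
          by (intro near x0 x) (auto simp: dist_norm)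
        then show "norm (f y - L) \<le> e * r / 2"
          using R[of y] x(1) by (auto simp: dist_norm)
      qed
      moreover have "deriv (\<lambda>y. f y - L) x = deriv f x"
      proof -
        have "f field_differentiable at x"
        proof (rule holomorphic_on_imp_differentiable_at[OF hol])
          have "x \<in> cball x (r * norm x)" using r by simp
          then show "x \<in> - \<real>\<^sub>\<le>\<^sub>0" using sub by blast
        qed (simp add: open_Compl)
        then show ?thesis by simp
      qed
      ultimately have "norm x * norm (deriv f x) \<le> norm x * ((e * r / 2) / (r * norm x))"
        by (intro mult_left_mono) auto
      also have "\<dots> = e / 2" using r x0 by simp
      also have "\<dots> < e" using \<open>e > 0\<close> by simp
      finally show "dist (x * deriv f x) 0 < e" by (simp add: norm_mult)
    qed
  qed
qed

text \<open>
  A limiting form of the division of polynomials. Think of \<open>F j\<close>, \<open>G i\<close>, \<open>R P\<close> as the coefficients of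
  polynomials with product \<open>R\<close>; in the limit \<open>G\<close> and \<open>R\<close> become monomials, so the quotient should be
  the monomial \<open>\<rho> / c\<close> of degree \<open>p\<close>. That the \<open>F j\<close> stay bounded is part of what the equations
  yield: with \<open>s\<close> the sum of all \<open>norm (F j)\<close> and \<open>\<epsilon>\<close> the sum of those \<open>norm (G i)\<close> that vanish
  in the limit, each \<open>F j * G q\<close> differs from \<open>R (j + q)\<close> by at most \<open>s * \<epsilon>\<close>, and summing over \<open>j\<close>
  bounds \<open>s\<close>.
\<close>

lemma convolution_limit:
  fixes F G R :: "nat \<Rightarrow> 'a \<Rightarrow> complex"
  assumes supp: "\<And>j x. j > M \<Longrightarrow> F j x = 0"
    and eq: "\<And>P. eventually (\<lambda>x. (\<Sum>j\<le>P. F j x * G (P - j) x) = R P x) flt"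
    and G: "(G q \<longlongrightarrow> c) flt" "c \<noteq> 0" "\<And>i. i \<noteq> q \<Longrightarrow> (G i \<longlongrightarrow> 0) flt"
    and R: "(R (p + q) \<longlongrightarrow> \<rho>) flt" "\<And>P. P \<noteq> p + q \<Longrightarrow> (R P \<longlongrightarrow> 0) flt"
  shows "(F p \<longlongrightarrow> \<rho> / c) flt"
proof -
  define s where "s = (\<lambda>x. \<Sum>j\<le>M. norm (F j x))"
  define \<epsilon> where "\<epsilon> = (\<lambda>x. \<Sum>i\<in>{..M + p + q} - {q}. norm (G i x))"
  have s0: "s x \<ge> 0" for x by (auto simp: s_def intro!: sum_nonneg)
  have "(\<epsilon> \<longlongrightarrow> (\<Sum>i\<in>{..M + p + q} - {q}. norm (0::complex))) flt"
    unfolding \<epsilon>_def by (intro tendsto_intros G(3)) auto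
  then have \<epsilon>: "(\<epsilon> \<longlongrightarrow> 0) flt" by simp
  have key: "norm (F j x * G q x - R (j + q) x) \<le> s x * \<epsilon> x"
    if j: "j \<le> M + p" and e: "(\<Sum>i\<le>j+q. F i x * G (j + q - i) x) = R (j + q) x" for j x
  proof -
    have "(\<Sum>i\<le>j+q. F i x * G (j + q - i) x) = F j x * G q x + (\<Sum>i\<in>{..j+q}-{j}. F i x * G (j + q - i) x)"
      by (subst sum.remove[of _ j]) auto
    then have "F j x * G q x - R (j + q) x = - (\<Sum>i\<in>{..j+q}-{j}. F i x * G (j + q - i) x)"
      using e by (simp add: algebra_simps)
    then have "norm (F j x * G q x - R (j + q) x) \<le> (\<Sum>i\<in>{..j+q}-{j}. norm (F i x) * norm (G (j + q - i) x))"
      by (simp add: sum_norm_le norm_mult)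
    also have "\<dots> \<le> (\<Sum>i\<in>{..j+q}-{j}. norm (F i x) * \<epsilon> x)"
    proof (intro sum_mono mult_left_mono norm_ge_zero)
      fix i assume "i \<in> {..j+q}-{j}"
      then show "norm (G (j + q - i) x) \<le> \<epsilon> x"
        unfolding \<epsilon>_def using j by (intro member_le_sum) auto
    qed
    also have "\<dots> = (\<Sum>i\<in>{..j+q}-{j}. norm (F i x)) * \<epsilon> x" by (simp add: sum_distrib_right)
    also have "(\<Sum>i\<in>{..j+q}-{j}. norm (F i x)) \<le> s x"
    proof -
      have "(\<Sum>i\<in>{..j+q}-{j}. norm (F i x)) \<le> (\<Sum>i\<in>{..M + j + q}. norm (F i x))"
        by (intro sum_mono2) auto
      also have "\<dots> = s x" unfolding s_def
        by (rule sum.mono_neutral_right) (use supp in auto)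
      finally show ?thesis .
    qed
    finally show ?thesis using s0 by (simp add: \<epsilon>_def mult_right_mono sum_nonneg)
  qed
  \<comment> \<open>Only the finitely many equations with index up to \<open>M + p\<close> are used.\<close>
  have evs: "eventually (\<lambda>x. \<forall>j\<in>{..M + p}. (\<Sum>i\<le>j+q. F i x * G (j + q - i) x) = R (j + q) x) flt"
    by (intro eventually_ball_finite ballI eq) auto
  define S where "S = (\<lambda>x. \<Sum>j\<le>M. norm (R (j + q) x))"
  have "\<exists>r. (R (j + q) \<longlongrightarrow> r) flt" for j using R(1) R(2)[of "j + q"] by (cases "j = p") auto
  then obtain r where "\<And>j. (R (j + q) \<longlongrightarrow> r j) flt" by metis
  then have "(S \<longlongrightarrow> (\<Sum>j\<le>M. norm (r j))) flt" unfolding S_def by (intro tendsto_intros)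
  then have S: "eventually (\<lambda>x. S x < (\<Sum>j\<le>M. norm (r j)) + 1) flt"
    by (rule order_tendstoD) simp
  define K where "K = ((\<Sum>j\<le>M. norm (r j)) + 1) / (norm c / 4)"
  have "eventually (\<lambda>x. norm (G q x) > norm c / 2) flt"
    using tendsto_norm[OF G(1)] G(2) by (intro order_tendstoD) auto
  moreover have "eventually (\<lambda>x. \<epsilon> x < norm c / 4 / (real M + 1)) flt"
    using \<epsilon> G(2) by (intro order_tendstoD) auto
  ultimately have bound: "eventually (\<lambda>x. s x \<le> K) flt"
    using evs S
  proof eventually_elim
    case (elim x)
    have "s x * norm (G q x) = (\<Sum>j\<le>M. norm (F j x * G q x))"
      by (simp add: s_def sum_distrib_right norm_mult)
    also have "\<dots> \<le> (\<Sum>j\<le>M. norm (R (j + q) x) + s x * \<epsilon> x)"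
    proof (intro sum_mono)
      fix j assume "j \<in> {..M}"
      then have "norm (F j x * G q x - R (j + q) x) \<le> s x * \<epsilon> x" using elim by (intro key) auto
      then show "norm (F j x * G q x) \<le> norm (R (j + q) x) + s x * \<epsilon> x"
        by (smt (verit) norm_triangle_ineq2)
    qed
    also have "\<dots> = S x + s x * ((real M + 1) * \<epsilon> x)"
      by (simp add: sum.distrib S_def algebra_simps)
    also have "\<dots> \<le> S x + s x * (norm c / 4)"
      using elim s0[of x] by (intro add_left_mono mult_left_mono) (auto simp: field_simps)
    finally have "s x * norm (G q x) \<le> S x + s x * (norm c / 4)" .
    moreover have "s x * (norm c / 2) \<le> s x * norm (G q x)"
      using elim s0[of x] by (intro mult_left_mono) auto
    ultimately have "s x * (norm c / 4) \<le> (\<Sum>j\<le>M. norm (r j)) + 1"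
      using elim by (simp add: algebra_simps)
    then show "s x \<le> K" using G(2) by (simp add: K_def field_simps)
  qed
  have "((\<lambda>x. F p x * G q x - R (p + q) x) \<longlongrightarrow> 0) flt"
  proof (rule Lim_null_comparison)
    show "eventually (\<lambda>x. norm (F p x * G q x - R (p + q) x) \<le> K * \<epsilon> x) flt"
      using bound evs
    proof eventually_elim
      case (elim x)
      have "norm (F p x * G q x - R (p + q) x) \<le> s x * \<epsilon> x" using elim by (intro key) auto
      also have "\<dots> \<le> K * \<epsilon> x" using elim by (intro mult_right_mono) (auto simp: \<epsilon>_def intro!: sum_nonneg)
      finally show ?case .
    qed
    show "((\<lambda>x. K * \<epsilon> x) \<longlongrightarrow> 0) flt" using tendsto_mult_right_zero[OF \<epsilon>] by simp
  qed
  from tendsto_add[OF this R(1)] have "((\<lambda>x. F p x * G q x) \<longlongrightarrow> \<rho>) flt" by simp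
  then have "((\<lambda>x. F p x * G q x / G q x) \<longlongrightarrow> \<rho> / c) flt"
    using G by (intro tendsto_divide)
  then show ?thesis
  proof (rule Lim_transform_eventually)
    have "eventually (\<lambda>x. G q x \<noteq> 0) flt" using G tendsto_imp_eventually_ne by blast
    then show "\<forall>\<^sub>F x in flt. F p x * G q x / G q x = F p x" by eventually_elim simp
  qed
qed

section \<open>Toeplitz determinants in a pair of solutions\<close>

definition coeffs_holomorphic :: "complex set \<Rightarrow> (complex \<Rightarrow> complex poly) \<Rightarrow> bool" where
  "coeffs_holomorphic A f \<longleftrightarrow> (\<forall>p. (\<lambda>x. coeff (f x) p) holomorphic_on A)"

lemma coeffs_holomorphic_const [intro]: "coeffs_holomorphic A (\<lambda>_. c)"
  by (simp add: coeffs_holomorphic_def)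

lemma coeffs_holomorphic_mult:
  "coeffs_holomorphic A f \<Longrightarrow> coeffs_holomorphic A g \<Longrightarrow> coeffs_holomorphic A (\<lambda>x. f x * g x)"
  by (auto simp: coeffs_holomorphic_def coeff_mult intro!: holomorphic_intros)

lemma coeffs_holomorphic_sum:
  "(\<And>i. i \<in> I \<Longrightarrow> coeffs_holomorphic A (f i)) \<Longrightarrow> coeffs_holomorphic A (\<lambda>x. \<Sum>i\<in>I. f i x)"
  by (auto simp: coeffs_holomorphic_def coeff_sum intro!: holomorphic_intros)

lemma coeffs_holomorphic_prod:
  "(\<And>i. i \<in> I \<Longrightarrow> coeffs_holomorphic A (f i)) \<Longrightarrow> coeffs_holomorphic A (\<lambda>x. \<Prod>i\<in>I. f i x)"
  by (induction I rule: infinite_finite_induct) (auto intro!: coeffs_holomorphic_mult)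

lemma coeffs_holomorphic_linear:
  "f holomorphic_on A \<Longrightarrow> g holomorphic_on A \<Longrightarrow> coeffs_holomorphic A (\<lambda>x. [:f x, g x:])"
  unfolding coeffs_holomorphic_def
proof
  fix p assume "f holomorphic_on A" "g holomorphic_on A"
  then show "(\<lambda>x. coeff [:f x, g x:] p) holomorphic_on A"
    by (cases p; cases "p - 1") (auto simp: coeff_pCons split: nat.splits)
qed

lemma coeffs_holomorphic_dt:
  "(\<And>i j. coeffs_holomorphic A (\<lambda>x. a x i j)) \<Longrightarrow> coeffs_holomorphic A (\<lambda>x. dt n (a x))"
  unfolding dt_permutes by (intro coeffs_holomorphic_sum coeffs_holomorphic_mult coeffs_holomorphic_prod) auto

text \<open>
  The functions \<open>h1 s\<close> and \<open>h2 s\<close> are modelled on \<open>\<surd>x\<close> times the two Hankel functions of order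
  \<open>c + 1/2 + s\<close>. Two pairs of ladder relations and the leading asymptotics for \<open>s = 0\<close> determine
  the asymptotics of all Toeplitz determinants formed from them.
\<close>

locale hankel_pair =
  fixes c :: complex and h1 h2 :: "int \<Rightarrow> complex \<Rightarrow> complex" and k1 k2 :: complex
  assumes down1: "x \<in> - \<real>\<^sub>\<le>\<^sub>0 \<Longrightarrow> (h1 s has_field_derivative - ((c + of_int s) / x) * h1 s x + h1 (s - 1) x) (at x)"
    and up1: "x \<in> - \<real>\<^sub>\<le>\<^sub>0 \<Longrightarrow> (h1 s has_field_derivative ((c + 1 + of_int s) / x) * h1 s x - h1 (s + 1) x) (at x)"
    and down2: "x \<in> - \<real>\<^sub>\<le>\<^sub>0 \<Longrightarrow> (h2 s has_field_derivative - ((c + of_int s) / x) * h2 s x + h2 (s - 1) x) (at x)"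
    and up2: "x \<in> - \<real>\<^sub>\<le>\<^sub>0 \<Longrightarrow> (h2 s has_field_derivative ((c + 1 + of_int s) / x) * h2 s x - h2 (s + 1) x) (at x)"
    and lim1: "sector_tendsto (\<lambda>x. h1 0 x * exp (- (\<i> * x))) k1"
    and lim2: "sector_tendsto (\<lambda>x. h2 0 x * exp (\<i> * x)) k2"
    and nz: "k1 \<noteq> 0" "k2 \<noteq> 0"
begin

text \<open>
  The indeterminate marks the first function of the pair: the coefficient of degree \<open>p\<close> collects the
  contributions with \<open>p\<close> factors \<open>h1\<close> and \<open>n - p\<close> factors \<open>h2\<close>.
\<close>

definition mixed :: "nat \<Rightarrow> complex \<Rightarrow> complex poly" where
  "mixed n x = dt n (\<lambda>i j. [:h2 (int j - int i) x, h1 (int j - int i) x:])"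

definition mixed_coeff :: "nat \<Rightarrow> nat \<Rightarrow> complex \<Rightarrow> complex" where
  "mixed_coeff n p x = coeff (mixed n x) p"

lemma poly_mixed: "poly (mixed n x) \<mu> = dt n (\<lambda>i j. h2 (int j - int i) x + \<mu> * h1 (int j - int i) x)"
  unfolding mixed_def by (subst dt_hom[where h = "\<lambda>p. poly p \<mu>"]) (auto, unfold_locales, auto)

lemma degree_mixed: "degree (mixed n x) \<le> n"
  unfolding mixed_def dt_def
  by (rule order.trans[OF degree_det_le[of n _ 1]]) auto

lemma mixed_coeff_eq_0: "n < p \<Longrightarrow> mixed_coeff n p x = 0"
  using degree_mixed[of n x] by (simp add: mixed_coeff_def coeff_eq_0)

lemma U_0_0: "mixed_coeff 0 0 x = 1" and U_1_0: "mixed_coeff (Suc 0) 0 x = h2 0 x" and U_1_1: "mixed_coeff (Suc 0) (Suc 0) x = h1 0 x"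
  by (simp_all add: mixed_coeff_def mixed_def dt_1)

lemma open_slit: "open (- \<real>\<^sub>\<le>\<^sub>0 :: complex set)" by (simp add: open_Compl)

lemma mixed_coeff_holomorphic: "mixed_coeff n p holomorphic_on - \<real>\<^sub>\<le>\<^sub>0"
proof -
  have "h1 s holomorphic_on - \<real>\<^sub>\<le>\<^sub>0" "h2 s holomorphic_on - \<real>\<^sub>\<le>\<^sub>0" for s
    using up1[of _ s] up2[of _ s] open_slit by (auto simp only: holomorphic_on_open intro!: exI)
  then have "coeffs_holomorphic (- \<real>\<^sub>\<le>\<^sub>0) (mixed n)"
    unfolding mixed_def[abs_def] by (intro coeffs_holomorphic_dt coeffs_holomorphic_linear)
  then show ?thesis by (simp add: coeffs_holomorphic_def mixed_coeff_def[abs_def])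
qed

lemma poly_mixed_altdef: "poly (mixed n x) \<mu> = (\<Sum>p\<le>n. mixed_coeff n p x * \<mu> ^ p)"
proof -
  have "poly (mixed n x) \<mu> = (\<Sum>p\<le>degree (mixed n x). mixed_coeff n p x * \<mu> ^ p)"
    by (simp add: poly_altdef mixed_coeff_def)
  also have "\<dots> = (\<Sum>p\<le>n. mixed_coeff n p x * \<mu> ^ p)"
    by (rule sum.mono_neutral_left) (use degree_mixed[of n x] in \<open>auto simp: mixed_coeff_def coeff_eq_0\<close>)
  finally show ?thesis .
qed

text \<open>
  The combinations \<open>h2 + \<mu> h1\<close> satisfy the same ladder relations for every \<open>\<mu>\<close>, so the Toda
  equation is an identity between polynomials in \<open>\<mu>\<close>.
\<close>

lemma toda_coeff:
  assumes x: "x \<in> - \<real>\<^sub>\<le>\<^sub>0"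
  shows "(\<Sum>j\<le>P. mixed_coeff (n + 2) j x * mixed_coeff n (P - j) x) =
    (\<Sum>a\<le>P. deriv (mixed_coeff (n + 1) a) x * deriv (mixed_coeff (n + 1) (P - a)) x
      - mixed_coeff (n + 1) a x * deriv (deriv (mixed_coeff (n + 1) (P - a))) x - mixed_coeff (n + 1) a x * deriv (mixed_coeff (n + 1) (P - a)) x / x)"
proof -
  define D0 D1 D2 where "D0 = mixed (n + 1) x"
    and "D1 = (\<Sum>p\<le>n+1. monom (deriv (mixed_coeff (n + 1) p) x) p)"
    and "D2 = (\<Sum>p\<le>n+1. monom (deriv (deriv (mixed_coeff (n + 1) p)) x) p)"
  have dz: "deriv (mixed_coeff (n + 1) p) y = 0" "deriv (deriv (mixed_coeff (n + 1) p)) y = 0" if "p > n + 1" for p y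
  proof -
    have "mixed_coeff (n + 1) p = (\<lambda>_. 0)" using mixed_coeff_eq_0[OF that] by auto
    then show "deriv (mixed_coeff (n + 1) p) y = 0" "deriv (deriv (mixed_coeff (n + 1) p)) y = 0" by simp_all
  qed
  have cD: "coeff D0 p = mixed_coeff (n + 1) p x" "coeff D1 p = deriv (mixed_coeff (n + 1) p) x" "coeff D2 p = deriv (deriv (mixed_coeff (n + 1) p)) x" for p
    using dz by (auto simp: D0_def D1_def D2_def mixed_coeff_def coeff_sum)
  have "mixed (n + 2) x * mixed n x = D1 ^ 2 - D0 * D2 - Polynomial.smult (1 / x) (D0 * D1)"
  proof (rule poly_ext)
    fix \<mu>
    define \<tau> where "\<tau> = (\<lambda>n x. dt n (\<lambda>i j. h2 (int j - int i) x + \<mu> * h1 (int j - int i) x))"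
    have \<tau>: "\<tau> n = (\<lambda>x. poly (mixed n x) \<mu>)" for n by (simp add: poly_mixed \<tau>_def)
    have hd: "(mixed_coeff (n + 1) p has_field_derivative deriv (mixed_coeff (n + 1) p) y) (at y)"
      "(deriv (mixed_coeff (n + 1) p) has_field_derivative deriv (deriv (mixed_coeff (n + 1) p)) y) (at y)"
      if "y \<in> - \<real>\<^sub>\<le>\<^sub>0" for p y
      using that holomorphic_derivI[OF mixed_coeff_holomorphic open_slit]
        holomorphic_derivI[OF holomorphic_deriv[OF mixed_coeff_holomorphic open_slit] open_slit] by auto
    have d1: "deriv (\<tau> (n + 1)) y = (\<Sum>p\<le>n+1. deriv (mixed_coeff (n + 1) p) y * \<mu> ^ p)" if "y \<in> - \<real>\<^sub>\<le>\<^sub>0" for y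
      unfolding \<tau> poly_mixed_altdef
      by (intro DERIV_imp_deriv DERIV_sum DERIV_cmult_right hd that)
    have "((\<lambda>y. \<Sum>p\<le>n+1. deriv (mixed_coeff (n + 1) p) y * \<mu> ^ p) has_field_derivative
        (\<Sum>p\<le>n+1. deriv (deriv (mixed_coeff (n + 1) p)) x * \<mu> ^ p)) (at x)"
      by (intro DERIV_sum DERIV_cmult_right hd x)
    then have "(deriv (\<tau> (n + 1)) has_field_derivative (\<Sum>p\<le>n+1. deriv (deriv (mixed_coeff (n + 1) p)) x * \<mu> ^ p)) (at x)"
      by (rule has_field_derivative_transform_within_open[OF _ open_slit x]) (rule d1[symmetric])
    then have d2: "(deriv ^^ 2) (\<tau> (n + 1)) x = (\<Sum>p\<le>n+1. deriv (deriv (mixed_coeff (n + 1) p)) x * \<mu> ^ p)"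
      by (simp add: numeral_2_eq_2 DERIV_imp_deriv)
    have "\<tau> (n + 2) x * \<tau> n x = (deriv (\<tau> (n + 1)) x)\<^sup>2 - \<tau> (n + 1) x * (deriv ^^ 2) (\<tau> (n + 1)) x
     - \<tau> (n + 1) x * deriv (\<tau> (n + 1)) x / x"
      unfolding \<tau>_def
    proof (rule toda_equation[OF open_slit _ x, of "\<lambda>s x. h2 s x + \<mu> * h1 s x" c])
      fix s :: int and y :: complex assume y: "y \<in> - \<real>\<^sub>\<le>\<^sub>0"
      show "((\<lambda>x. h2 s x + \<mu> * h1 s x) has_field_derivative - ((c + of_int s) / y) * (h2 s y + \<mu> * h1 s y) + (h2 (s - 1) y + \<mu> * h1 (s - 1) y)) (at y)"
        using DERIV_add[OF down2[OF y, of s] DERIV_cmult[OF down1[OF y, of s], of \<mu>]] by (rule DERIV_cong) (simp add: algebra_simps)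
      show "((\<lambda>x. h2 s x + \<mu> * h1 s x) has_field_derivative ((c + 1 + of_int s) / y) * (h2 s y + \<mu> * h1 s y) - (h2 (s + 1) y + \<mu> * h1 (s + 1) y)) (at y)"
        using DERIV_add[OF up2[OF y, of s] DERIV_cmult[OF up1[OF y, of s], of \<mu>]] by (rule DERIV_cong) (simp add: algebra_simps)
    qed auto
    then show "poly (mixed (n + 2) x * mixed n x) \<mu> = poly (D1 ^ 2 - D0 * D2 - Polynomial.smult (1 / x) (D0 * D1)) \<mu>"
      unfolding d1[OF x] d2
      by (simp add: \<tau> D0_def D1_def D2_def poly_sum poly_monom)
  qed
  then have "coeff (mixed (n + 2) x * mixed n x) P = coeff (D1 * D1 - D0 * D2 - Polynomial.smult (1 / x) (D0 * D1)) P"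
    by (simp add: power2_eq_square)
  then show ?thesis
    by (simp add: coeff_mult mixed_coeff_def[symmetric] cD sum_subtractf sum_divide_distrib)
qed

end

section \<open>The Barnes function at positive integers\<close>

text \<open>
  The logarithms of consecutive terms differ by \<open>O(1/n\<^sup>2)\<close>, so a positive limit exists. Wallis'
  product determines it through the ratio of the squared \<open>n\<close>-th term and the \<open>2n\<close>-th term.
\<close>

lemma stirling_limit:
  "(\<lambda>n. fact n * exp (real n) / real n powr (real n + 1 / 2)) \<longlonglongrightarrow> sqrt (2 * pi)"
proof -
  define s where "s = (\<lambda>n. fact n * exp (real n) / real n powr (real n + 1 / 2) :: real)"
  have pos: "s n > 0" if "n > 0" for n using that by (simp add: s_def)
  have step: "ln (s (Suc (Suc n))) - ln (s (Suc n)) =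
      1 - (real (Suc n) + 1 / 2) * (ln (real (Suc (Suc n))) - ln (real (Suc n)))" for n
  proof -
    have ln_s: "ln (s n) = ln (fact n) + real n - (real n + 1 / 2) * ln (real n)" if "n > 0" for n
      using that by (simp add: s_def ln_mult ln_div)
    have "ln (fact (Suc (Suc n)) :: real) = ln (real (Suc (Suc n))) + ln (fact (Suc n))"
      by (subst fact_Suc) (simp add: ln_mult del: fact_Suc of_nat_Suc)
    then show ?thesis
      unfolding ln_s[OF zero_less_Suc] by (simp add: algebra_simps del: fact_Suc)
  qed
  have "summable (\<lambda>n. 1 - (real (Suc n) + 1 / 2) * (ln (real (Suc (Suc n))) - ln (real (Suc n))))"
  proof (rule summable_comparison_test_bigo)
    show "summable (\<lambda>n. norm (1 / real n ^ 2))"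
      using inverse_power_summable[of 2, where ?'a = real] by (simp add: field_simps)
    show "(\<lambda>n. 1 - (real (Suc n) + 1 / 2) * (ln (real (Suc (Suc n))) - ln (real (Suc n)))) \<in> O(\<lambda>n. 1 / real n ^ 2)"
      by real_asymp
  qed
  then have "convergent (\<lambda>n. \<Sum>k<n. ln (s (Suc (Suc k))) - ln (s (Suc k)))"
    by (simp add: step summable_iff_convergent)
  then have "convergent (\<lambda>n. ln (s (Suc n)) - ln (s (Suc 0)))"
    by (subst (asm) sum_lessThan_telescope)
  then obtain l where l: "(\<lambda>n. ln (s (Suc n)) - ln (s (Suc 0))) \<longlonglongrightarrow> l"
    by (auto simp: convergent_def)
  have "(\<lambda>n. exp (ln (s (Suc n)) - ln (s (Suc 0)) + ln (s (Suc 0)))) \<longlonglongrightarrow> exp (l + ln (s (Suc 0)))"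
    by (intro tendsto_intros l)
  then have "(\<lambda>n. s (Suc n)) \<longlonglongrightarrow> exp (l + ln (s (Suc 0)))"
    using pos by simp
  then obtain c where c: "s \<longlonglongrightarrow> c" "c > 0"
    using LIMSEQ_imp_Suc exp_gt_zero by blast
  have c2: "(\<lambda>n. s (2 * n)) \<longlonglongrightarrow> c"
    by (rule filterlim_compose[OF c(1)]) (simp add: filterlim_at_top_mult_tendsto_pos mult_nat_left_at_top)
  have "(\<lambda>n. (s n ^ 2 / s (2 * n)) ^ 2) \<longlonglongrightarrow> (c ^ 2 / c) ^ 2"
    by (intro tendsto_intros c c2) (use c in auto)
  moreover
  \<comment> \<open>The partial products of the Wallis product.\<close>
  have W: "(\<Prod>k=1..n. (4*real k^2) / (4*real k^2 - 1)) = (2 ^ n * fact n) ^ 4 / ((fact (2 * n)) ^ 2 * (2 * real n + 1))" for n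
  proof (induction n)
    case (Suc n)
    have f4: "4 * (real n + 1)\<^sup>2 - 1 = (2 * real n + 1) * (2 * real n + 3)"
      by (simp add: power2_eq_square algebra_simps)
    have ff: "fact (2 * Suc n) = 2 * (real n + 1) * (2 * real n + 1) * fact (2 * n)"
      by (simp add: algebra_simps)
    have "p ^ 4 / (f ^ 2 * v) * (4 * u ^ 2 / (v * w)) = (2 * u * p) ^ 4 / ((2 * u * v * f) ^ 2 * w)"
      if "u > 0" "v > 0" "w > 0" "f > 0" for u v w f p :: real
      using that by (simp add: field_simps power2_eq_square power4_eq_xxxx)
    from this[of "real n + 1" "2 * real n + 1" "2 * real n + 3" "fact (2 * n)" "2 ^ n * fact n"]
    have K: "(2 ^ n * fact n) ^ 4 / (fact (2 * n) ^ 2 * (2 * real n + 1)) *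
        (4 * (real n + 1) ^ 2 / ((2 * real n + 1) * (2 * real n + 3))) =
        (2 * (real n + 1) * (2 ^ n * fact n)) ^ 4 / ((2 * (real n + 1) * (2 * real n + 1) * fact (2 * n)) ^ 2 * (2 * real n + 3))"
      by simp
    have e1: "2 ^ Suc n * fact (Suc n) = 2 * (real n + 1) * (2 ^ n * fact n)"
      and e2: "2 * (real n + 1) + 1 = 2 * real n + 3" and e3: "real (Suc n) = real n + 1"
      by auto
    have P: "(\<Prod>k=1..Suc n. (4*real k^2) / (4*real k^2 - 1)) =
        (\<Prod>k=1..n. (4*real k^2) / (4*real k^2 - 1)) * (4 * real (Suc n) ^ 2 / (4 * real (Suc n) ^ 2 - 1))"
      by (subst prod.cl_ivl_Suc) (simp del: of_nat_Suc)
    show ?case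
      unfolding P Suc.IH e1 ff unfolding e3 f4 e2 by (rule K)
  qed simp
  have eq: "(s n ^ 2 / s (2 * n)) ^ 2 =
      (\<Prod>k=1..n. (4*real k^2) / (4*real k^2 - 1)) * ((2 * real n + 1) * 2 / real n)" if "n > 0" for n
  proof -
    have p1: "(real n powr (real n + 1 / 2))^4 = real n ^ (4 * n + 2)"
    proof -
      have "(real n powr (real n + 1 / 2))^4 = real n powr (real (4 * n + 2))"
        using that by (simp add: powr_power algebra_simps)
      also have "\<dots> = real n ^ (4 * n + 2)"
        by (rule powr_realpow) (use that in simp)
      finally show ?thesis .
    qed
    have p2: "(real (2 * n) powr (real (2 * n) + 1 / 2))^2 = real (2 * n) ^ (4 * n + 1)"
    proof -
      have "(real (2 * n) powr (real (2 * n) + 1 / 2))^2 = real (2 * n) powr (real (4 * n + 1))"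
        using that by (simp add: powr_power algebra_simps)
      also have "\<dots> = real (2 * n) ^ (4 * n + 1)"
        by (rule powr_realpow) (use that in simp)
      finally show ?thesis .
    qed
    have "(s n ^ 2 / s (2 * n)) ^ 2 = s n ^ 4 / s (2 * n) ^ 2"
      by (simp add: power_divide flip: power_mult)
    also have "\<dots> = (fact n ^ 4 * exp (real n) ^ 4 / real n ^ (4 * n + 2)) /
         (fact (2 * n) ^ 2 * exp (real (2 * n)) ^ 2 / real (2 * n) ^ (4 * n + 1))"
      by (simp only: s_def power_divide power_mult_distrib p1 p2)
    also have "exp (real n) ^ 4 = exp (real (2 * n)) ^ 2"
      by (simp flip: exp_of_nat_mult)
    also have "(fact n ^ 4 * exp (real (2 * n)) ^ 2 / real n ^ (4 * n + 2)) /
         (fact (2 * n) ^ 2 * exp (real (2 * n)) ^ 2 / real (2 * n) ^ (4 * n + 1))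
       = (fact n ^ 4  / real n ^ (4 * n + 2)) / (fact (2 * n) ^ 2 / real (2 * n) ^ (4 * n + 1))"
      by simp
    also have "\<dots> = (2 ^ n * fact n) ^ 4 / ((fact (2 * n)) ^ 2) * (2 / real n)"
      using that by (simp add: power_mult_distrib field_simps power_add flip: power_mult)
    finally have fin: "(s n ^ 2 / s (2 * n)) ^ 2 = (2 ^ n * fact n) ^ 4 / ((fact (2 * n)) ^ 2) * (2 / real n)" .
    have cancel: "u / (v * w) * (w * 2 / z) = u / v * (2 / z)" if "w \<noteq> 0" for u v w z :: real
      using that by simp
    have w: "2 * real n + 1 \<noteq> 0" by linarith
    show ?thesis
      unfolding W fin by (rule cancel[OF w, symmetric])
  qed
  have "(\<lambda>n. (s n ^ 2 / s (2 * n)) ^ 2) \<longlonglongrightarrow> pi / 2 * 4"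
  proof (rule Lim_transform_eventually)
    show "(\<lambda>n. (\<Prod>k=1..n. (4*real k^2) / (4*real k^2 - 1)) * ((2 * real n + 1) * 2 / real n)) \<longlonglongrightarrow> pi / 2 * 4"
      by (intro tendsto_mult wallis) real_asymp
    show "\<forall>\<^sub>F n in sequentially. (\<Prod>k=1..n. (4*real k^2) / (4*real k^2 - 1)) * ((2 * real n + 1) * 2 / real n) = (s n ^ 2 / s (2 * n)) ^ 2"
      using eventually_gt_at_top[of 0] by eventually_elim (use eq in auto)
  qed
  ultimately have "(c ^ 2 / c) ^ 2 = 2 * pi"
    using LIMSEQ_unique by fastforce
  then have "c = sqrt (2 * pi)"
    using c(2) by (metis div_by_0 less_le nonzero_mult_div_cancel_left power2_eq_square real_sqrt_unique)
  then show ?thesis using c(1) by (simp add: s_def)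
qed

definition superfactorial :: "nat \<Rightarrow> nat" where
  "superfactorial n = (\<Prod>k<n. fact k)"

text \<open>
  The \<open>k\<close>-th factor, counted from \<open>0\<close>, of the Weierstrass product at \<open>m + 1\<close>.
\<close>

abbreviation barnes_factor :: "nat \<Rightarrow> nat \<Rightarrow> real" where
  "barnes_factor m k \<equiv> (1 + real m / real (Suc k)) ^ Suc k * exp (real m ^ 2 / (2 * real (Suc k)) - real m)"

lemma barnes_ratio_telescope:
  "(\<Prod>k<N. ((real (Suc k) + real m + 1) / (real (Suc k) + real m)) ^ Suc k) =
     (real N + real m + 1) ^ N * fact m / fact (N + m)"
proof (induction N)
  case (Suc N)
  define A where "A = real N + real m + 1"
  have nz: "A \<noteq> 0" unfolding A_def by linarith
  have "(real N + real m + 1) ^ N * fact m / fact (N + m) *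
      ((real (Suc N) + real m + 1) / (real (Suc N) + real m)) ^ Suc N
      = (real (Suc N) + real m + 1) ^ Suc N * fact m / ((real N + real m + 1) * fact (N + m))"
  proof -
    have "A ^ N * fact m / fact (N + m) * ((A + 1) / A) ^ Suc N = (A + 1) ^ Suc N * fact m / (A * fact (N + m))"
      using nz by (simp add: power_divide mult_ac)
    then show ?thesis by (simp add: A_def add_ac)
  qed
  then show ?case using Suc.IH by (simp add: add_ac)
qed simp

text \<open>
  This carries the functional equation of the Barnes function at the integer \<open>m + 1\<close>. The
  ratio of the products telescopes to \<open>(N + m + 1)\<^sup>N m! / (N + m)!\<close>, up to an exponential of the harmonic
  number, and Stirling's formula gives the limit.
\<close>

lemma barnes_product_ratio:
  "(\<lambda>N. \<Prod>k<N. barnes_factor (Suc m) k / barnes_factor m k) \<longlonglongrightarrow>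
     fact m * exp (real m + 1 + (real m + 1 / 2) * euler_mascheroni) / sqrt (2 * pi)"
proof -
  have factor: "barnes_factor (Suc m) k / barnes_factor m k =
      ((real (Suc k) + real m + 1) / (real (Suc k) + real m)) ^ Suc k *
      exp ((real m + 1 / 2) * inverse (real (Suc k)) - 1)" for k
  proof -
    have "exp ((real m + 1 / 2) * inverse (real (Suc k)) - 1) =
        exp (real (Suc m) ^ 2 / (2 * real (Suc k)) - real (Suc m)) / exp (real m ^ 2 / (2 * real (Suc k)) - real m)"
    proof -
      have "(real m + 1 / 2) * inverse x - 1 = ((real m + 1) ^ 2 / (2 * x) - (real m + 1)) - (real m ^ 2 / (2 * x) - real m)"
        if "x > 0" for x
        using that by (simp add: field_simps power2_eq_square)
      from this[of "real (Suc k)"] show ?thesis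
        by (simp only: of_nat_Suc of_nat_0_less_iff zero_less_Suc flip: exp_diff) (simp add: add_ac)
    qed
    moreover have "(real (Suc k) + real m + 1) / (real (Suc k) + real m) =
        (1 + real (Suc m) / real (Suc k)) / (1 + real m / real (Suc k))"
    proof -
      have "(x + real m + 1) / (x + real m) = (1 + (real m + 1) / x) / (1 + real m / x)" if "x > 0" for x
        using that by (simp add: divide_simps add_ac)
      from this[of "real (Suc k)"] show ?thesis
        by (simp only: of_nat_0_less_iff zero_less_Suc) (simp add: add_ac)
    qed
    ultimately show ?thesis by (simp add: power_divide)
  qed
  have prod: "(\<Prod>k<N. barnes_factor (Suc m) k / barnes_factor m k) =
      (real N + real m + 1) ^ N * fact m / fact (N + m) * exp ((real m + 1 / 2) * harm N - real N)" for N
  proof -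
    have "(\<Prod>k<N. exp ((real m + 1 / 2) * inverse (real (Suc k)) - 1)) = exp ((real m + 1 / 2) * harm N - real N)"
      by (simp add: harm_def sum_subtractf sum_distrib_left sum.atLeast1_atMost_eq flip: exp_sum)
    then show ?thesis
      unfolding factor prod.distrib barnes_ratio_telescope by simp
  qed
  define s where "s = (\<lambda>n. fact n * exp (real n) / real n powr (real n + 1 / 2) :: real)"
  have s: "(\<lambda>N. s (N + m)) \<longlonglongrightarrow> sqrt (2 * pi)"
    using LIMSEQ_ignore_initial_segment[OF stirling_limit, of m] by (simp add: s_def)
  have eq: "(\<Prod>k<N. barnes_factor (Suc m) k / barnes_factor m k) =
      fact m / s (N + m) * exp ((real m + 1 / 2) * (harm N - ln (real N))) *
      ((real N + real m + 1) powr real N * exp (real m) * real N powr (real m + 1 / 2) / (real N + real m) powr (real N + real m + 1 / 2))"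
    if "N > 0" for N
  proof -
    have e: "exp (real N + real m) = exp (real N) * exp (real m)" by (simp add: exp_add)
    have "exp ((real m + 1 / 2) * harm N - real N) =
        exp ((real m + 1 / 2) * (harm N - ln (real N))) * real N powr (real m + 1 / 2) / exp (real N)"
      using that by (simp add: powr_def right_diff_distrib flip: exp_diff exp_add)
    moreover have "(real N + real m + 1) ^ N = (real N + real m + 1) powr real N"
      by (simp add: powr_realpow)
    ultimately show ?thesis
      using that unfolding prod s_def of_nat_add e by (simp add: field_simps)
  qed
  have "(\<lambda>N. fact m / s (N + m) * exp ((real m + 1 / 2) * (harm N - ln (real N))) *
      ((real N + real m + 1) powr real N * exp (real m) * real N powr (real m + 1 / 2) / (real N + real m) powr (real N + real m + 1 / 2)))
      \<longlonglongrightarrow> fact m / sqrt (2 * pi) * exp ((real m + 1 / 2) * euler_mascheroni) * (exp (real m) * inverse (exp (- 1)))"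
  proof (intro tendsto_mult tendsto_divide tendsto_const s tendsto_exp euler_mascheroni_LIMSEQ)
    show "(\<lambda>N. (real N + real m + 1) powr real N * exp (real m) * real N powr (real m + 1 / 2) / (real N + real m) powr (real N + real m + 1 / 2)) \<longlonglongrightarrow> exp (real m) * inverse (exp (- 1))"
      by real_asymp
  qed auto
  then have "(\<lambda>N. \<Prod>k<N. barnes_factor (Suc m) k / barnes_factor m k)
      \<longlonglongrightarrow> fact m / sqrt (2 * pi) * exp ((real m + 1 / 2) * euler_mascheroni) * (exp (real m) * inverse (exp (- 1)))"
    by (rule Lim_transform_eventually) (rule eventually_mono[OF eventually_gt_at_top[of 0] eq[symmetric]])
  then show ?thesis by (simp add: exp_add exp_minus mult_ac)
qed

lemma barnes_product_limit:
  "(\<lambda>N. \<Prod>k<N. barnes_factor m k) \<longlonglongrightarrow>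
     superfactorial m * exp ((real m + real m ^ 2 * (1 + euler_mascheroni)) / 2) / (2 * pi) powr (real m / 2)"
proof (induction m)
  case 0
  show ?case by (simp add: superfactorial_def)
next
  case (Suc m)
  have pos: "barnes_factor m k \<noteq> 0" for k
    by (smt (verit) divide_nonneg_nonneg exp_gt_zero mult_pos_pos of_nat_0_le_iff zero_less_power)
  have "(\<lambda>N. (\<Prod>k<N. barnes_factor m k) * (\<Prod>k<N. barnes_factor (Suc m) k / barnes_factor m k)) \<longlonglongrightarrow>
     (superfactorial m * exp ((real m + real m ^ 2 * (1 + euler_mascheroni)) / 2) / (2 * pi) powr (real m / 2)) *
     (fact m * exp (real m + 1 + (real m + 1 / 2) * euler_mascheroni) / sqrt (2 * pi))"
    by (intro tendsto_mult Suc.IH barnes_product_ratio)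
  also have "(\<lambda>N. (\<Prod>k<N. barnes_factor m k) * (\<Prod>k<N. barnes_factor (Suc m) k / barnes_factor m k)) =
      (\<lambda>N. \<Prod>k<N. barnes_factor (Suc m) k)"
    using pos by (simp flip: prod.distrib)
  also have "(superfactorial m * exp ((real m + real m ^ 2 * (1 + euler_mascheroni)) / 2) / (2 * pi) powr (real m / 2)) *
     (fact m * exp (real m + 1 + (real m + 1 / 2) * euler_mascheroni) / sqrt (2 * pi)) =
     superfactorial (Suc m) * exp ((real (Suc m) + real (Suc m) ^ 2 * (1 + euler_mascheroni)) / 2) / (2 * pi) powr (real (Suc m) / 2)"
  proof -
    have "exp ((real (Suc m) + real (Suc m) ^ 2 * (1 + euler_mascheroni)) / 2) =
       exp ((real m + real m ^ 2 * (1 + euler_mascheroni)) / 2) * exp (real m + 1 + (real m + 1 / 2) * euler_mascheroni)"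
      unfolding exp_add[symmetric] by (rule arg_cong[of _ _ exp]) (simp add: field_simps power2_eq_square)
    moreover have "(2 * pi) powr (real (Suc m) / 2) = (2 * pi) powr (real m / 2) * sqrt (2 * pi)"
      by (simp add: powr_add add_divide_distrib powr_half_sqrt flip: powr_half_sqrt)
    ultimately show ?thesis
      by (simp add: superfactorial_def)
  qed
  finally show ?case .
qed

lemma Barnes_G_nat: "Barnes_G (of_nat m + 1) = of_nat (superfactorial m)"
proof -
  define c where "c = superfactorial m * exp ((real m + real m ^ 2 * (1 + euler_mascheroni)) / 2) / (2 * pi) powr (real m / 2)"
  have "c > 0" by (auto simp: c_def superfactorial_def intro!: divide_pos_pos mult_pos_pos prod_pos)
  have "(\<lambda>N. \<Prod>k\<le>N. barnes_factor m k) \<longlonglongrightarrow> c"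
    using barnes_product_limit[of m, folded c_def] by (simp add: LIMSEQ_lessThan_iff_atMost)
  have nz: "complex_of_real (barnes_factor m k) \<noteq> 0" for k
    by (smt (verit) divide_nonneg_nonneg exp_gt_zero mult_pos_pos of_nat_0_le_iff of_real_eq_0_iff zero_less_power)
  have "(\<lambda>N. complex_of_real (\<Prod>k\<le>N. barnes_factor m k)) \<longlonglongrightarrow> of_real c"
    by (intro tendsto_of_real) fact
  then have lim: "(\<lambda>N. \<Prod>k\<le>N. complex_of_real (barnes_factor m k)) \<longlonglongrightarrow> of_real c"
    unfolding of_real_prod .
  have "convergent_prod (\<lambda>k. complex_of_real (barnes_factor m k))"
    using lim nz \<open>c > 0\<close> by (subst convergent_prod_iff_nz_lim) auto
  then have "(\<lambda>N. \<Prod>k\<le>N. complex_of_real (barnes_factor m k)) \<longlonglongrightarrow> (\<Prod>k. complex_of_real (barnes_factor m k))"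
    by (rule convergent_prod_LIMSEQ)
  then have "(\<Prod>k. complex_of_real (barnes_factor m k)) = of_real c"
    using lim LIMSEQ_unique by blast
  also have "(\<lambda>k. complex_of_real (barnes_factor m k)) =
     (\<lambda>k. (1 + of_nat m / of_nat (Suc k)) ^ Suc k * exp ((of_nat m)\<^sup>2 / (2 * of_nat (Suc k)) - of_nat m))"
    by (simp flip: exp_of_real del: of_nat_Suc power_Suc)
  finally have P: "(\<Prod>k. (1 + of_nat m / of_nat (Suc k)) ^ Suc k * exp ((of_nat m)\<^sup>2 / (2 * of_nat (Suc k)) - of_nat m)) = complex_of_real c" .
  have pw: "complex_of_real (2 * pi) powr (of_nat m / 2) = of_real ((2 * pi) powr (real m / 2))"
    by (subst powr_of_real[symmetric]) auto
  have ex: "exp (- (complex_of_nat m + (of_nat m)\<^sup>2 * (1 + of_real euler_mascheroni)) / 2) =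
     of_real (exp (- ((real m + real m ^ 2 * (1 + euler_mascheroni)) / 2)))"
    by (simp flip: exp_of_real add: minus_divide_left)
  have "Barnes_G (of_nat m + 1) = of_real ((2 * pi) powr (real m / 2)) * of_real (exp (- ((real m + real m ^ 2 * (1 + euler_mascheroni)) / 2))) * of_real c"
    by (simp only: Barnes_G_def Let_def add_diff_cancel_right' P pw ex)
  also have "\<dots> = of_real ((2 * pi) powr (real m / 2) * exp (- ((real m + real m ^ 2 * (1 + euler_mascheroni)) / 2)) * c)"
    by simp
  also have "(2 * pi) powr (real m / 2) * exp (- ((real m + real m ^ 2 * (1 + euler_mascheroni)) / 2)) * c = real (superfactorial m)"
    by (simp add: c_def exp_minus)
  finally show ?thesis by simp
qed

section \<open>Asymptotics of the coefficients of the mixed determinant\<close>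

lemma superfactorial_Suc: "superfactorial (Suc n) = fact n * superfactorial n"
  by (simp add: superfactorial_def)

lemma superfactorial_pos: "superfactorial n > 0"
  by (simp add: superfactorial_def prod_pos)

context hankel_pair begin

text \<open>
  A determinant of size \<open>p\<close> with entries from \<open>h1\<close> alone decays like \<open>x\<^bsup>-p(p-1)/2\<^esup>\<close>, apart from the
  exponential; the mixed coefficient decays like the product of the two pure determinants.
\<close>

definition decay :: "nat \<Rightarrow> nat \<Rightarrow> int" where
  "decay n p = (int p * (int p - 1) + (int n - int p) * (int n - int p - 1)) div 2"

lemma decay_eq: "2 * decay n p = int p * (int p - 1) + (int n - int p) * (int n - int p - 1)"
  unfolding decay_def by (rule dvd_mult_div_cancel) (intro dvd_add, auto)

definition freq :: "nat \<Rightarrow> nat \<Rightarrow> complex" where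
  "freq n p = \<i> * of_int (2 * int p - int n)"

text \<open>
  The predicted behaviour of \<open>mixed_coeff n p\<close>.
\<close>

definition growth :: "nat \<Rightarrow> nat \<Rightarrow> complex \<Rightarrow> complex" where
  "growth n p x = exp (freq n p * x) * x powi (- decay n p)"

definition normalized :: "nat \<Rightarrow> nat \<Rightarrow> complex \<Rightarrow> complex" where
  "normalized n p x = mixed_coeff n p x * (exp (- (freq n p * x)) * x powi decay n p)"

text \<open>
  With \<open>normalized2\<close>, the first and second derivative of \<open>mixed_coeff n p\<close>, divided by the same
  factor \<open>growth n p\<close>.
\<close>

definition normalized1 :: "nat \<Rightarrow> nat \<Rightarrow> complex \<Rightarrow> complex" where
  "normalized1 n p x = deriv (normalized n p) x + (freq n p - of_int (decay n p) / x) * normalized n p x"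

definition normalized2 :: "nat \<Rightarrow> nat \<Rightarrow> complex \<Rightarrow> complex" where
  "normalized2 n p x = deriv (normalized1 n p) x + (freq n p - of_int (decay n p) / x) * normalized1 n p x"

lemma mixed_coeff_eq: "x \<noteq> 0 \<Longrightarrow> mixed_coeff n p x = normalized n p x * growth n p x"
  by (simp add: normalized_def growth_def exp_minus power_int_minus field_simps)

lemma normalized_holomorphic: "normalized n p holomorphic_on - \<real>\<^sub>\<le>\<^sub>0"
  unfolding normalized_def[abs_def] by (intro holomorphic_intros mixed_coeff_holomorphic) auto

lemma normalized1_holomorphic: "normalized1 n p holomorphic_on - \<real>\<^sub>\<le>\<^sub>0"
  unfolding normalized1_def[abs_def]
  by (intro holomorphic_intros normalized_holomorphic open_slit) auto

lemma normalized_eq_0: "n < p \<Longrightarrow> normalized n p x = 0"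
  by (simp add: normalized_def mixed_coeff_eq_0)

lemma growth_deriv:
  assumes "x \<noteq> 0"
  shows "(growth n p has_field_derivative (freq n p - of_int (decay n p) / x) * growth n p x) (at x)"
proof -
  have "x powi (- decay n p - 1) = x powi (- decay n p) / x" using assms by (simp add: power_int_diff)
  then show ?thesis
    unfolding growth_def[abs_def] using assms
    by (auto intro!: derivative_eq_intros simp: algebra_simps)
qed

lemma mixed_coeff_deriv:
  assumes x: "x \<in> - \<real>\<^sub>\<le>\<^sub>0"
  shows "deriv (mixed_coeff n p) x = normalized1 n p x * growth n p x" "deriv (deriv (mixed_coeff n p)) x = normalized2 n p x * growth n p x"
proof -
  have d1: "(mixed_coeff n p has_field_derivative normalized1 n p x * growth n p x) (at x)" if x: "x \<in> - \<real>\<^sub>\<le>\<^sub>0" for x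
  proof (rule has_field_derivative_transform_within_open[OF _ open_slit x])
    have "x \<noteq> 0" using x by auto
    show "((\<lambda>x. normalized n p x * growth n p x) has_field_derivative normalized1 n p x * growth n p x) (at x)"
      using DERIV_mult[OF holomorphic_derivI[OF normalized_holomorphic open_slit x] growth_deriv[OF \<open>x \<noteq> 0\<close>], of n p n p]
      by (rule DERIV_cong) (simp add: normalized1_def algebra_simps)
  next
    fix y :: complex assume "y \<in> - \<real>\<^sub>\<le>\<^sub>0"
    then have "y \<noteq> 0" by auto
    then show "normalized n p y * growth n p y = mixed_coeff n p y" by (rule mixed_coeff_eq[symmetric])
  qed
  then show "deriv (mixed_coeff n p) x = normalized1 n p x * growth n p x" using x by (simp add: DERIV_imp_deriv)
  have "(deriv (mixed_coeff n p) has_field_derivative normalized2 n p x * growth n p x) (at x)"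
  proof (rule has_field_derivative_transform_within_open[OF _ open_slit x])
    have "x \<noteq> 0" using x by auto
    show "((\<lambda>x. normalized1 n p x * growth n p x) has_field_derivative normalized2 n p x * growth n p x) (at x)"
      using DERIV_mult[OF holomorphic_derivI[OF normalized1_holomorphic open_slit x] growth_deriv[OF \<open>x \<noteq> 0\<close>], of n p n p]
      by (rule DERIV_cong) (simp add: normalized2_def algebra_simps)
  next
    fix y :: complex assume "y \<in> - \<real>\<^sub>\<le>\<^sub>0"
    then show "normalized1 n p y * growth n p y = deriv (mixed_coeff n p) y" by (rule DERIV_imp_deriv[OF d1, symmetric])
  qed
  then show "deriv (deriv (mixed_coeff n p)) x = normalized2 n p x * growth n p x" by (rule DERIV_imp_deriv)
qed

text \<open>
  A summand on the right-hand side of \<open>toda_coeff\<close>, divided by the two factors \<open>growth\<close>.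
\<close>

definition toda_term :: "nat \<Rightarrow> nat \<Rightarrow> nat \<Rightarrow> complex \<Rightarrow> complex" where
  "toda_term n a b x = normalized1 n a x * normalized1 n b x - normalized n a x * normalized2 n b x - normalized n a x * normalized1 n b x / x"

text \<open>
  The powers of \<open>x\<close> in the products of two factors \<open>growth\<close> are quadratic in the index of summation.
  Removing an expression that depends on \<open>P\<close> only, the same on both sides, leaves a sum of two squares
  on the left, which is \<open>0\<close> only for \<open>j = p\<close> and \<open>P - j = p - 1\<close>. On the right it leaves a sum of two
  products of consecutive integers, which is \<open>0\<close> only for \<open>a\<close> and \<open>P - a\<close> in \<open>{p - 1, p}\<close>. So each side
  has few terms that are not damped by a power of \<open>x\<close>.
\<close>

lemma normalized_toda:
  assumes x: "x \<in> - \<real>\<^sub>\<le>\<^sub>0"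
  shows "(\<Sum>j\<le>P. normalized (n + 2) j x * normalized n (P - j) x *
       x powi (- ((int j - int p)\<^sup>2 + (int (P - j) - int p + 1)\<^sup>2))) =
    (\<Sum>a\<le>P. toda_term (n + 1) a (P - a) x *
       x powi (- ((int a - int p) * (int a - int p + 1) + (int (P - a) - int p) * (int (P - a) - int p + 1))))"
    (is "?L = ?R")
proof -
  have "x \<noteq> 0" using x by auto
  define k where "k = (2 * int p - int n - 2) * int P + (int n * (int n + 1) - 2 * int p * (int p - 1))"
  define Z where "Z = exp (\<i> * of_int (2 * int P - 2 * int n - 2) * x) * x powi (- k)"
  have "Z \<noteq> 0" using \<open>x \<noteq> 0\<close> by (simp add: Z_def)
  have EE: "growth (n + 2) j x * growth n i x = Z * x powi (- ((int j - int p)\<^sup>2 + (int i - int p + 1)\<^sup>2))"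
    if "j + i = P" for i j
  proof -
    have "decay (n + 2) j + decay n i = k + ((int j - int p)\<^sup>2 + (int i - int p + 1)\<^sup>2)"
      using decay_eq[of "n + 2" j] decay_eq[of n i] unfolding k_def that[symmetric]
      by (simp add: algebra_simps power2_eq_square)
    then have e: "- decay (n + 2) j + - decay n i = - k + - ((int j - int p)\<^sup>2 + (int i - int p + 1)\<^sup>2)" by simp
    have "growth (n + 2) j x * growth n i x = exp (freq (n + 2) j * x + freq n i * x) * x powi (- decay (n + 2) j + - decay n i)"
      using \<open>x \<noteq> 0\<close> by (subst power_int_add) (auto simp: growth_def exp_add mult_ac)
    also have "freq (n + 2) j * x + freq n i * x = \<i> * of_int (2 * int P - 2 * int n - 2) * x"
      unfolding that[symmetric] freq_def by (simp add: algebra_simps)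
    finally show ?thesis
      unfolding e using \<open>x \<noteq> 0\<close> by (subst (asm) power_int_add) (auto simp: Z_def mult_ac)
  qed
  have EE': "growth (n + 1) a x * growth (n + 1) b x = Z * x powi (- ((int a - int p) * (int a - int p + 1) + (int b - int p) * (int b - int p + 1)))"
    if "a + b = P" for a b
  proof -
    have "decay (n + 1) a + decay (n + 1) b = k + ((int a - int p) * (int a - int p + 1) + (int b - int p) * (int b - int p + 1))"
      using decay_eq[of "n + 1" a] decay_eq[of "n + 1" b] unfolding k_def that[symmetric]
      by (simp add: algebra_simps power2_eq_square)
    then have e: "- decay (n + 1) a + - decay (n + 1) b = - k + - ((int a - int p) * (int a - int p + 1) + (int b - int p) * (int b - int p + 1))" by simp
    have "growth (n + 1) a x * growth (n + 1) b x = exp (freq (n + 1) a * x + freq (n + 1) b * x) * x powi (- decay (n + 1) a + - decay (n + 1) b)"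
      using \<open>x \<noteq> 0\<close> by (subst power_int_add) (auto simp: growth_def exp_add mult_ac)
    also have "freq (n + 1) a * x + freq (n + 1) b * x = \<i> * of_int (2 * int P - 2 * int n - 2) * x"
      unfolding that[symmetric] freq_def by (simp add: algebra_simps)
    finally show ?thesis
      unfolding e using \<open>x \<noteq> 0\<close> by (subst (asm) power_int_add) (auto simp: Z_def mult_ac)
  qed
  have "Z * ?L = (\<Sum>j\<le>P. mixed_coeff (n + 2) j x * mixed_coeff n (P - j) x)"
    unfolding sum_distrib_left
  proof (intro sum.cong refl)
    fix j assume "j \<in> {..P}"
    then have "j + (P - j) = P" by simp
    from EE[OF this] show "Z * (normalized (n + 2) j x * normalized n (P - j) x * x powi (- ((int j - int p)\<^sup>2 + (int (P - j) - int p + 1)\<^sup>2))) = mixed_coeff (n + 2) j x * mixed_coeff n (P - j) x"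
      unfolding mixed_coeff_eq[OF \<open>x \<noteq> 0\<close>] by (simp add: mult_ac)
  qed
  also have "\<dots> = (\<Sum>a\<le>P. toda_term (n + 1) a (P - a) x * (growth (n + 1) a x * growth (n + 1) (P - a) x))"
    unfolding toda_coeff[OF x] unfolding mixed_coeff_deriv[OF x] unfolding mixed_coeff_eq[OF \<open>x \<noteq> 0\<close>] toda_term_def
    by (intro sum.cong refl) (simp add: algebra_simps)
  also have "\<dots> = Z * ?R"
    unfolding sum_distrib_left
  proof (intro sum.cong refl)
    fix a assume "a \<in> {..P}"
    then have "a + (P - a) = P" by simp
    from EE'[OF this] show "toda_term (n + 1) a (P - a) x * (growth (n + 1) a x * growth (n + 1) (P - a) x) =
        Z * (toda_term (n + 1) a (P - a) x * x powi (- ((int a - int p) * (int a - int p + 1) + (int (P - a) - int p) * (int (P - a) - int p + 1))))"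
      by (simp only: mult_ac)
  qed
  finally show ?thesis using \<open>Z \<noteq> 0\<close> by simp
qed

lemma sector_tendsto_over_x: "sector_tendsto f L \<Longrightarrow> sector_tendsto (\<lambda>x. f x / x) 0"
  using sector_tendsto_mult[OF _ sector_tendsto_inverse, of f L] by (simp add: divide_inverse)

lemma normalized1_lim:
  assumes "sector_tendsto (normalized n p) C"
  shows "sector_tendsto (normalized1 n p) (freq n p * C)"
proof -
  have "sector_tendsto (\<lambda>x. (x * deriv (normalized n p) x) / x + (freq n p - of_int (decay n p) / x) * normalized n p x) (0 + (freq n p - 0) * C)"
    by (intro sector_tendsto_add sector_tendsto_mult sector_tendsto_diff sector_tendsto_const assms
        sector_tendsto_over_x[OF sector_tendsto_deriv[OF normalized_holomorphic assms]] sector_tendsto_over_x[OF sector_tendsto_const])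
  moreover have "sector_tendsto (\<lambda>x. (x * deriv (normalized n p) x) / x + (freq n p - of_int (decay n p) / x) * normalized n p x) C' \<longleftrightarrow> sector_tendsto (normalized1 n p) C'" for C'
    by (rule sector_tendsto_cong) (auto simp: normalized1_def)
  ultimately show ?thesis by simp
qed

lemma normalized2_lim:
  assumes "sector_tendsto (normalized n p) C"
  shows "sector_tendsto (normalized2 n p) ((freq n p)\<^sup>2 * C)"
proof -
  note V = normalized1_lim[OF assms]
  have "sector_tendsto (\<lambda>x. (x * deriv (normalized1 n p) x) / x + (freq n p - of_int (decay n p) / x) * normalized1 n p x) (0 + (freq n p - 0) * (freq n p * C))"
    by (intro sector_tendsto_add sector_tendsto_mult sector_tendsto_diff sector_tendsto_const V
        sector_tendsto_over_x[OF sector_tendsto_deriv[OF normalized1_holomorphic V]] sector_tendsto_over_x[OF sector_tendsto_const])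
  moreover have "sector_tendsto (\<lambda>x. (x * deriv (normalized1 n p) x) / x + (freq n p - of_int (decay n p) / x) * normalized1 n p x) C' \<longleftrightarrow> sector_tendsto (normalized2 n p) C'" for C'
    by (rule sector_tendsto_cong) (auto simp: normalized2_def)
  ultimately show ?thesis by (simp add: power2_eq_square mult.assoc)
qed

lemma toda_term_lim:
  assumes a: "sector_tendsto (normalized n a) C" and b: "sector_tendsto (normalized n b) C'"
  shows "sector_tendsto (toda_term n a b) (freq n a * freq n b * C * C' - (freq n b)\<^sup>2 * C * C')"
proof -
  have "sector_tendsto (toda_term n a b) (freq n a * C * (freq n b * C') - C * ((freq n b)\<^sup>2 * C') - 0)"
    unfolding toda_term_def[abs_def]
    by (intro sector_tendsto_diff sector_tendsto_mult normalized1_lim[OF a] normalized1_lim[OF b] normalized2_lim[OF b] a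
         sector_tendsto_over_x[OF sector_tendsto_mult[OF a normalized1_lim[OF b]]])
  then show ?thesis by (simp add: mult_ac)
qed

text \<open>
  On the diagonal the leading terms of \<open>toda_term\<close> cancel. At the next order, the derivatives of the
  normalized functions are negligible, so that only the last term of \<open>toda_term\<close>, with the explicit
  factor \<open>1/x\<close>, contributes.
\<close>

lemma toda_term_diag_lim:
  assumes a: "sector_tendsto (normalized n a) C"
  shows "sector_tendsto (\<lambda>x. x * toda_term n a a x) (- freq n a * C\<^sup>2)"
proof -
  note V = normalized1_lim[OF a]
  have "sector_tendsto (\<lambda>x. normalized1 n a x * (x * deriv (normalized n a) x) - normalized n a x * (x * deriv (normalized1 n a) x) - normalized n a x * normalized1 n a x)
     (freq n a * C * 0 - C * 0 - C * (freq n a * C))"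
    by (intro sector_tendsto_diff sector_tendsto_mult[OF V] sector_tendsto_mult[OF a] V
        sector_tendsto_deriv[OF normalized1_holomorphic V] sector_tendsto_deriv[OF normalized_holomorphic a])
  moreover have "sector_tendsto (\<lambda>x. normalized1 n a x * (x * deriv (normalized n a) x) - normalized n a x * (x * deriv (normalized1 n a) x) - normalized n a x * normalized1 n a x) L
     \<longleftrightarrow> sector_tendsto (\<lambda>x. x * toda_term n a a x) L" for L
  proof (rule sector_tendsto_cong)
    fix x :: complex assume "x \<in> - \<real>\<^sub>\<le>\<^sub>0"
    then have "x \<noteq> 0" by auto
    define g where "g = freq n a - of_int (decay n a) / x"
    define v where "v = normalized1 n a x"
    have d: "deriv (normalized n a) x = v - g * normalized n a x" by (simp add: normalized1_def g_def v_def)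
    have Beq: "toda_term n a a x = v * v - normalized n a x * (deriv (normalized1 n a) x + g * v) - normalized n a x * v / x"
      by (simp add: toda_term_def normalized2_def g_def v_def)
    show "normalized1 n a x * (x * deriv (normalized n a) x) - normalized n a x * (x * deriv (normalized1 n a) x) - normalized n a x * normalized1 n a x = x * toda_term n a a x"
      unfolding d Beq v_def[symmetric] using \<open>x \<noteq> 0\<close> by (simp add: algebra_simps)
  qed
  ultimately show ?thesis by (simp add: power2_eq_square mult_ac)
qed

text \<open>
  The recursions \<open>amp_inner\<close>, \<open>amp_bottom\<close> and \<open>amp_top\<close> below are forced by the Toda equation; this
  is their solution for given values at \<open>n = 0\<close> and \<open>n = 1\<close>.
\<close>

definition amp :: "nat \<Rightarrow> nat \<Rightarrow> complex" where
  "amp n p = (if p \<le> n then k1 ^ p * k2 ^ (n - p) * of_nat (superfactorial p) * of_nat (superfactorial (n - p)) *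
      4 ^ (p * (n - p)) * (- \<i>) ^ (p choose 2) * \<i> ^ ((n - p) choose 2) else 0)"

lemma amp_nz: "p \<le> n \<Longrightarrow> amp n p \<noteq> 0"
  using nz superfactorial_pos[of p] superfactorial_pos[of "n - p"] by (simp add: amp_def)

lemma Suc_choose_two: "Suc n choose 2 = n + (n choose 2)"
  by (simp add: numeral_2_eq_2)

lemma amp_inner: "q \<le> n \<Longrightarrow> amp (n + 2) (Suc q) * amp n q = 4 * amp (n + 1) (Suc q) * amp (n + 1) q"
proof -
  assume "q \<le> n"
  then obtain r where n: "n = q + r" by (auto simp: le_iff_add)
  have "n + 2 - Suc q = Suc r" "n - q = r" "n + 1 - Suc q = r" "n + 1 - q = Suc r" using n by auto
  then show ?thesis
    using n by (simp add: amp_def power_add mult_ac)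
qed

lemma amp_bottom: "amp (n + 2) 0 * amp n 0 = \<i> * of_nat (n + 1) * (amp (n + 1) 0)\<^sup>2"
  by (simp add: amp_def superfactorial_Suc Suc_choose_two power_add power2_eq_square superfactorial_def[of 0] mult_ac)
    (simp add: algebra_simps)

lemma amp_top: "amp (n + 2) (n + 2) * amp n n = - \<i> * of_nat (n + 1) * (amp (n + 1) (n + 1))\<^sup>2"
  by (simp add: amp_def superfactorial_Suc Suc_choose_two power_add power2_eq_square superfactorial_def[of 0] mult_ac)
    (simp add: algebra_simps)

text \<open>
  Where the convolution consists of a single product, it can be solved for \<open>normalized (n + 2) p\<close>
  directly, and the limit is given by \<open>toda_term_diag_lim\<close>.
\<close>

lemma normalized_limit_end:
  assumes N: "sector_tendsto (normalized (n + 1) a) (amp (n + 1) a)" and n: "sector_tendsto (normalized n b) (amp n b)" and b: "b \<le> n"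
    and eq: "\<And>x. x \<in> - \<real>\<^sub>\<le>\<^sub>0 \<Longrightarrow> normalized (n + 2) p x * normalized n b x * x powi (- 1) = toda_term (n + 1) a a x"
    and lead: "amp (n + 2) p * amp n b = - freq (n + 1) a * (amp (n + 1) a)\<^sup>2"
  shows "sector_tendsto (normalized (n + 2) p) (amp (n + 2) p)"
  unfolding sector_tendsto_def
proof (intro allI impI)
  fix a' b' :: real assume ab: "- pi < a' \<and> a' \<le> b' \<and> b' < pi"
  let ?F = "at_infinity_sector a' b'"
  have "- freq (n + 1) a * (amp (n + 1) a)\<^sup>2 / amp n b = amp (n + 2) p"
    unfolding lead[symmetric] using amp_nz[OF b] by simp
  then have L: "((\<lambda>x. (x * toda_term (n + 1) a a x) / normalized n b x) \<longlongrightarrow> amp (n + 2) p) ?F"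
    using sector_tendsto_divide[OF toda_term_diag_lim[OF N] n amp_nz[OF b]] ab unfolding sector_tendsto_def by simp
  have "(normalized n b \<longlongrightarrow> amp n b) ?F" using n ab by (simp add: sector_tendsto_def)
  then have "eventually (\<lambda>x. normalized n b x \<noteq> 0) ?F" using amp_nz[OF b] tendsto_imp_eventually_ne by blast
  moreover have "eventually (\<lambda>x. x \<in> - \<real>\<^sub>\<le>\<^sub>0) ?F" using ab by (intro eventually_slit) auto
  ultimately have "eventually (\<lambda>x. (x * toda_term (n + 1) a a x) / normalized n b x = normalized (n + 2) p x) ?F"
  proof eventually_elim
    case (elim x)
    then have "x \<noteq> 0" by auto
    then show ?case unfolding eq[OF elim(2), symmetric] using elim(1) by (simp add: power_int_minus)
  qed
  with L show "(normalized (n + 2) p \<longlongrightarrow> amp (n + 2) p) ?F" by (rule Lim_transform_eventually)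
qed

lemma normalized_toda_bottom:
  "x \<in> - \<real>\<^sub>\<le>\<^sub>0 \<Longrightarrow> normalized (n + 2) 0 x * normalized n 0 x * x powi (- 1) = toda_term (n + 1) 0 0 x"
  using normalized_toda[of x n 0 0] by simp

lemma normalized_toda_top:
  assumes x: "x \<in> - \<real>\<^sub>\<le>\<^sub>0"
  shows "normalized (n + 2) (n + 2) x * normalized n n x * x powi (- 1) = toda_term (n + 1) (n + 1) (n + 1) x"
proof -
  have B0: "toda_term (n + 1) a b = (\<lambda>_. 0)" if "a > n + 1 \<or> b > n + 1" for a b
  proof -
    have t0: "normalized (n + 1) c = (\<lambda>_. 0)" if "c > n + 1" for c using normalized_eq_0[OF that] by auto
    have V0: "normalized1 (n + 1) c = (\<lambda>_. 0)" if "c > n + 1" for c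
      unfolding normalized1_def[abs_def] t0[OF that] by simp
    have "normalized2 (n + 1) c = (\<lambda>_. 0)" if "c > n + 1" for c
      unfolding normalized2_def[abs_def] V0[OF that] by simp
    note t0 V0 this
    then show ?thesis using that by (auto simp: toda_term_def[abs_def])
  qed
  \<comment> \<open>For the largest possible total index, both sums have a single nonzero term.\<close>
  let ?P = "2 * n + 2"
  have kP: "n + 1 \<le> ?P" "n + 2 \<le> ?P" by auto
  have l: "\<forall>j. j \<noteq> n + 2 \<longrightarrow> normalized (n + 2) j x * normalized n (?P - j) x = 0"
  proof (intro allI impI)
    fix j assume that: "j \<noteq> n + 2"
    have "j > n + 2 \<or> ?P - j > n" using that by auto
    then show "normalized (n + 2) j x * normalized n (?P - j) x = 0" using normalized_eq_0 by auto
  qed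
  have r: "\<forall>a. a \<noteq> n + 1 \<longrightarrow> toda_term (n + 1) a (?P - a) x = 0"
  proof (intro allI impI)
    fix a assume that: "a \<noteq> n + 1"
    have "a > n + 1 \<or> ?P - a > n + 1" using that by auto
    then show "toda_term (n + 1) a (?P - a) x = 0" using B0 by simp
  qed
  have one: "(\<Sum>j\<le>?P. f j * g j) = f k * g k" if "\<forall>j. j \<noteq> k \<longrightarrow> f j = 0" "k \<le> ?P" for f g :: "nat \<Rightarrow> complex" and k
    using that by (subst sum.remove[of _ k]) (auto intro!: sum.neutral)
  show ?thesis
    using normalized_toda[OF x, of n ?P "n + 2"]
    unfolding one[of "n + 2" "\<lambda>j. normalized (n + 2) j x * normalized n (?P - j) x", OF l kP(2)]
      one[of "n + 1" "\<lambda>a. toda_term (n + 1) a (?P - a) x", OF r kP(1)] by simp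
qed

text \<open>
  With \<open>p\<close> as centre, the rescaled equation has the form required by \<open>convolution_limit\<close>: the
  coefficients of the known factor \<open>normalized n\<close> are damped except for the one with index \<open>p - 1\<close>, and
  on the right-hand side only the total index \<open>2 p - 1\<close> escapes the damping, with two summands.
\<close>

lemma normalized_limit_inner:
  assumes N: "\<And>a. sector_tendsto (normalized (n + 1) a) (amp (n + 1) a)" and n: "\<And>a. sector_tendsto (normalized n a) (amp n a)"
    and p: "p = Suc q" "q \<le> n"
  shows "sector_tendsto (normalized (n + 2) p) (amp (n + 2) p)"
proof -
  define F where "F = (\<lambda>j x. normalized (n + 2) j x * x powi (- ((int j - int p)\<^sup>2)))"
  define G where "G = (\<lambda>i x. normalized n i x * x powi (- ((int i - int p + 1)\<^sup>2)))"
  define e where "e = (\<lambda>P a. (int a - int p) * (int a - int p + 1) + (int (P - a) - int p) * (int (P - a) - int p + 1))"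
  define R where "R = (\<lambda>P x. \<Sum>a\<le>P. toda_term (n + 1) a (P - a) x * x powi (- e P a))"
  \<comment> \<open>The limits of the summands on the right: only those with both indices in \<open>{p, q}\<close> escape the
    damping, and for equal indices the limit of \<open>toda_term\<close> is \<open>0\<close>.\<close>
  define L where "L = (\<lambda>P a. if a = p \<and> P - a = q \<or> a = q \<and> P - a = p
     then freq (n + 1) (P - a) * (freq (n + 1) a - freq (n + 1) (P - a)) * amp (n + 1) a * amp (n + 1) (P - a) else 0)"
  have kpos: "(k::int) * (k + 1) \<ge> 0" for k
    by (cases "k \<ge> 0") (auto simp: mult_nonpos_nonpos)
  have k0: "(k::int) * (k + 1) = 0 \<longleftrightarrow> k = 0 \<or> k = -1" for k by auto
  have summand_lim: "sector_tendsto (\<lambda>x. toda_term (n + 1) a (P - a) x * x powi (- e P a)) (L P a)" for P a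
  proof -
    let ?b = "P - a"
    note BL = toda_term_lim[OF N N, of a ?b]
    have freq: "freq (n + 1) p = freq (n + 1) q + 2 * \<i>" using p by (simp add: freq_def algebra_simps)
    consider "e P a > 0" | "a \<in> {p, q}" "?b \<in> {p, q}" "e P a = 0"
    proof (cases "e P a > 0")
      case False
      then have "(int a - int p) * (int a - int p + 1) = 0" "(int ?b - int p) * (int ?b - int p + 1) = 0"
        using kpos[of "int a - int p"] kpos[of "int ?b - int p"] unfolding e_def by linarith+
      then have "a \<in> {p, q}" "?b \<in> {p, q}" "e P a = 0"
        unfolding e_def k0 using p by auto
      then show ?thesis by (rule that(2))
    qed (rule that(1))
    then show ?thesis
    proof cases
      case 1
      have "\<not> (a = p \<and> ?b = q \<or> a = q \<and> ?b = p)" using 1 p by (auto simp: e_def)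
      then have "L P a = 0" unfolding L_def by (rule if_not_P)
      then show ?thesis using sector_tendsto_mult[OF BL sector_tendsto_powi_neg[OF 1]] by simp
    next
      case 2
      have "L P a = freq (n + 1) a * freq (n + 1) ?b * amp (n + 1) a * amp (n + 1) ?b - (freq (n + 1) ?b)\<^sup>2 * amp (n + 1) a * amp (n + 1) ?b"
        using 2 by (auto simp: L_def algebra_simps power2_eq_square)
      then show ?thesis using BL 2 by simp
    qed
  qed
  have sumL: "(\<Sum>a\<le>P. L P a) = (if P = p + q then 4 * amp (n + 1) p * amp (n + 1) q else 0)" for P
  proof (cases "P = p + q")
    case True
    have "(\<Sum>a\<le>P. L P a) = (\<Sum>a\<in>{p, q}. L P a)"
      by (rule sum.mono_neutral_right) (use True in \<open>auto simp: L_def\<close>)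
    also have "\<dots> = - (freq (n + 1) p - freq (n + 1) q)\<^sup>2 * amp (n + 1) p * amp (n + 1) q"
      using p True by (simp add: L_def algebra_simps power2_eq_square)
    also have "freq (n + 1) p - freq (n + 1) q = 2 * \<i>"
      using p by (simp add: freq_def algebra_simps)
    finally show ?thesis using True by (simp add: power_mult_distrib)
  next
    case False
    then show ?thesis by (auto simp: L_def intro!: sum.neutral)
  qed
  have Rlim: "sector_tendsto (R P) (if P = p + q then 4 * amp (n + 1) p * amp (n + 1) q else 0)" for P
    unfolding R_def sumL[symmetric] by (intro sector_tendsto_sum summand_lim)
  have Gq: "G q = normalized n q" using p by (auto simp: G_def)
  have Glim: "sector_tendsto (G i) 0" if "i \<noteq> q" for i
    using sector_tendsto_mult[OF n[of i] sector_tendsto_powi_neg[of "(int i - int p + 1)\<^sup>2"]] that p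
    by (simp add: G_def)
  show ?thesis unfolding sector_tendsto_def
  proof (intro allI impI)
    fix a b :: real assume ab: "- pi < a \<and> a \<le> b \<and> b < pi"
    have "(F p \<longlongrightarrow> 4 * amp (n + 1) p * amp (n + 1) q / amp n q) (at_infinity_sector a b)"
    proof (rule convolution_limit[where M = "n + 2" and G = G and R = R and q = q])
      show "F j x = 0" if "j > n + 2" for j x using normalized_eq_0[OF that] by (simp add: F_def)
      show "\<forall>\<^sub>F x in at_infinity_sector a b. (\<Sum>j\<le>P. F j x * G (P - j) x) = R P x" for P
      proof (rule eventually_mono)
        show "\<forall>\<^sub>F x in at_infinity_sector a b. x \<in> - \<real>\<^sub>\<le>\<^sub>0" using ab by (intro eventually_slit) auto
        fix x :: complex assume x: "x \<in> - \<real>\<^sub>\<le>\<^sub>0"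
        then have "x \<noteq> 0" by auto
        have "F j x * G (P - j) x = normalized (n + 2) j x * normalized n (P - j) x *
             x powi (- ((int j - int p)\<^sup>2 + (int (P - j) - int p + 1)\<^sup>2))" for j
        proof -
          have expo: "- ((int j - int p)\<^sup>2 + (int (P - j) - int p + 1)\<^sup>2) = - ((int j - int p)\<^sup>2) + - ((int (P - j) - int p + 1)\<^sup>2)" by simp
          show ?thesis unfolding F_def G_def expo
            by (subst power_int_add, simp add: \<open>x \<noteq> 0\<close>, simp only: mult_ac)
        qed
        then show "(\<Sum>j\<le>P. F j x * G (P - j) x) = R P x"
          using normalized_toda[OF x, of n P p] by (simp add: R_def e_def)
      qed
      show "(G q \<longlongrightarrow> amp n q) (at_infinity_sector a b)" using n ab by (simp add: Gq sector_tendsto_def)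
      show "amp n q \<noteq> 0" by (rule amp_nz) fact
      show "(G i \<longlongrightarrow> 0) (at_infinity_sector a b)" if "i \<noteq> q" for i
        using Glim[OF that] ab by (simp add: sector_tendsto_def)
      show "(R (p + q) \<longlongrightarrow> 4 * amp (n + 1) p * amp (n + 1) q) (at_infinity_sector a b)"
        using Rlim[of "p + q"] ab by (simp add: sector_tendsto_def)
      show "(R P \<longlongrightarrow> 0) (at_infinity_sector a b)" if "P \<noteq> p + q" for P
        using Rlim[of P] ab that by (simp add: sector_tendsto_def)
    qed
    moreover have "4 * amp (n + 1) p * amp (n + 1) q / amp n q = amp (n + 2) p"
      using amp_inner[OF \<open>q \<le> n\<close>] amp_nz[OF \<open>q \<le> n\<close>] p by (simp add: field_simps)
    moreover have "F p = normalized (n + 2) p" by (simp add: F_def)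
    ultimately show "(normalized (n + 2) p \<longlongrightarrow> amp (n + 2) p) (at_infinity_sector a b)" by simp
  qed
qed

lemma normalized_limit_step:
  assumes N: "\<And>a. sector_tendsto (normalized (n + 1) a) (amp (n + 1) a)" and n: "\<And>a. sector_tendsto (normalized n a) (amp n a)"
  shows "sector_tendsto (normalized (n + 2) p) (amp (n + 2) p)"
proof -
  have "p > n + 2 \<or> p = 0 \<or> p = n + 2 \<or> (p = Suc (p - 1) \<and> p - 1 \<le> n)" by auto
  then consider "p > n + 2" | "p = 0" | "p = n + 2" | q where "p = Suc q" "q \<le> n" by blast
  then show ?thesis
  proof cases
    case 1
    then have "normalized (n + 2) p = (\<lambda>_. 0)" using normalized_eq_0 by auto
    then show ?thesis using 1 by (simp add: amp_def)
  next
    case 2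
    show ?thesis unfolding 2
    proof (rule normalized_limit_end[OF N n le0 normalized_toda_bottom])
      show "amp (n + 2) 0 * amp n 0 = - freq (n + 1) 0 * (amp (n + 1) 0)\<^sup>2"
        unfolding amp_bottom by (simp add: freq_def algebra_simps)
    qed
  next
    case 3
    show ?thesis unfolding 3
    proof (rule normalized_limit_end[OF N n order.refl normalized_toda_top])
      show "amp (n + 2) (n + 2) * amp n n = - freq (n + 1) (n + 1) * (amp (n + 1) (n + 1))\<^sup>2"
        unfolding amp_top by (simp add: freq_def algebra_simps)
    qed
  next
    case (4 q)
    then show ?thesis using normalized_limit_inner[OF N n] by blast
  qed
qed

theorem normalized_limit: "sector_tendsto (normalized n p) (amp n p)"
proof (induction n arbitrary: p rule: less_induct)
  case (less n)
  have "n = 0 \<or> n = 1 \<or> n = (n - 2) + 2" by auto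
  then consider "n = 0" | "n = 1" | m where "n = m + 2" by blast
  then show ?case
  proof cases
    case 1
    show ?thesis
    proof (cases "p = 0")
      case True
      have "normalized 0 0 = (\<lambda>_. 1)" by (auto simp: normalized_def U_0_0 freq_def decay_def)
      then show ?thesis using 1 True by (simp add: amp_def superfactorial_def numeral_2_eq_2)
    next
      case False
      then have "normalized 0 p = (\<lambda>_. 0)" using normalized_eq_0 by auto
      then show ?thesis using 1 False by (simp add: amp_def)
    qed
  next
    case 2
    consider "p = 0" | "p = 1" | "p > 1" by linarith
    then show ?thesis
    proof cases
      case 1
      have "normalized 1 0 = (\<lambda>x. h2 0 x * exp (\<i> * x))" by (auto simp: normalized_def U_1_0 freq_def decay_def)
      then show ?thesis using 2 1 lim2 by (simp add: amp_def superfactorial_def numeral_2_eq_2)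
    next
      case 2
      have "normalized 1 1 = (\<lambda>x. h1 0 x * exp (- (\<i> * x)))" by (auto simp: normalized_def U_1_1 freq_def decay_def)
      then show ?thesis using \<open>n = 1\<close> 2 lim1 by (simp add: amp_def superfactorial_def numeral_2_eq_2)
    next
      case 3
      then have "normalized 1 p = (\<lambda>_. 0)" using normalized_eq_0 by auto
      then show ?thesis using 2 3 by (simp add: amp_def)
    qed
  next
    case 3
    then show ?thesis using normalized_limit_step[of m p] less.IH[of "m + 1"] less.IH[of m] by simp
  qed
qed

end

section \<open>Bessel functions as functions of argument and order\<close>

text \<open>
  In this section a prime stands for the derivative with respect to the order \<open>\<nu>\<close>. It is needed since
  the Neumann functions of integer order are combinations of such derivatives.
\<close>

definition bessel_coeff :: "complex \<Rightarrow> nat \<Rightarrow> complex" where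
  "bessel_coeff \<nu> k = (-1) ^ k * rGamma (\<nu> + of_nat k + 1) / fact k"

definition bessel_coeff' :: "complex \<Rightarrow> nat \<Rightarrow> complex" where
  "bessel_coeff' \<nu> k = (-1) ^ k * deriv rGamma (\<nu> + of_nat k + 1) / fact k"

text \<open>
  The entire factor of the Bessel function, as a function of \<open>u = (x/2)\<^sup>2\<close>; see \<open>Bessel_J_eq\<close>.
\<close>

definition J_series :: "complex \<Rightarrow> complex \<Rightarrow> complex" where
  "J_series \<nu> u = (\<Sum>k. bessel_coeff \<nu> k * u ^ k)"

definition J_series' :: "complex \<Rightarrow> complex \<Rightarrow> complex" where
  "J_series' \<nu> u = (\<Sum>k. bessel_coeff' \<nu> k * u ^ k)"

lemma rGamma_field_deriv: "(rGamma has_field_derivative deriv rGamma z) (at (z::complex))"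
  using holomorphic_derivI[OF holomorphic_rGamma open_UNIV UNIV_I] .

text \<open>
  By the functional equation, the absolute value of \<open>rGamma (z + k)\<close> does not increase with \<open>k\<close> once
  \<open>norm (z + k) \<ge> 1\<close>. So only finitely many shifts matter, and they are bounded by compactness.
\<close>

lemma rGamma_shift_bound:
  "\<exists>M. \<forall>z k. norm z \<le> R \<longrightarrow> norm (rGamma (z + of_nat k :: complex)) \<le> M"
proof -
  define k0 where "k0 = nat \<lceil>R + 1\<rceil>"
  have k0: "real k0 \<ge> R + 1" unfolding k0_def by (rule real_nat_ceiling_ge)
  have "compact (rGamma ` cball (0::complex) (R + real k0))"
    by (intro compact_continuous_image continuous_intros holomorphic_on_imp_continuous_on[OF holomorphic_rGamma]) auto
  then obtain M where "\<forall>z\<in>cball 0 (R + real k0). norm (rGamma (z::complex)) \<le> M"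
    using compact_imp_bounded[OF \<open>compact _\<close>] by (auto simp: bounded_iff)
  then have M: "norm (z::complex) \<le> R + real k0 \<Longrightarrow> norm (rGamma z) \<le> M" for z by simp
  have "norm (rGamma (z + of_nat k)) \<le> M" if z: "norm z \<le> R" for z :: complex and k
  proof (induction k)
    case 0
    show ?case using M[of z] z by simp
  next
    case (Suc k)
    show ?case
    proof (cases "k < k0")
      case True
      have "norm (z + of_nat (Suc k)) \<le> norm z + norm (of_nat (Suc k) :: complex)" by (rule norm_triangle_ineq)
      also have "\<dots> \<le> R + real k0" using z True by (simp only: norm_of_nat)
      finally show ?thesis by (rule M)
    next
      case False
      have "real k - norm z \<le> norm (z + of_nat k)"
        using norm_triangle_ineq2[of "of_nat k" "- z"] by (simp add: add.commute)
      then have ge1: "norm (z + of_nat k) \<ge> 1" using z False k0 by linarith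
      have "rGamma (z + of_nat k) = (z + of_nat k) * rGamma (z + of_nat (Suc k))"
        using rGamma_plus1[of "z + of_nat k"] by (simp add: add_ac)
      then have "norm (rGamma (z + of_nat k)) = norm (z + of_nat k) * norm (rGamma (z + of_nat (Suc k)))"
        by (simp add: norm_mult)
      then have "norm (rGamma (z + of_nat (Suc k))) \<le> norm (rGamma (z + of_nat k))"
        using ge1 mult_right_mono[OF ge1, of "norm (rGamma (z + of_nat (Suc k)))"] by simp
      then show ?thesis using Suc.IH by linarith
    qed
  qed
  then show ?thesis by blast
qed

lemma deriv_rGamma_shift_bound:
  "\<exists>M. \<forall>z k. norm z \<le> R \<longrightarrow> norm (deriv rGamma (z + of_nat k :: complex)) \<le> M"
proof -
  obtain M where M: "\<And>z k. norm z \<le> R + 1 \<Longrightarrow> norm (rGamma (z + of_nat k :: complex)) \<le> M"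
    using rGamma_shift_bound[of "R + 1"] by blast
  have "norm (deriv rGamma (z + of_nat k)) \<le> M" if z: "norm z \<le> R" for z :: complex and k
  proof -
    have "norm ((deriv ^^ 1) rGamma (z + of_nat k)) \<le> fact 1 * M / 1 ^ 1"
    proof (rule Cauchy_inequality)
      fix x :: complex assume x: "norm (z + of_nat k - x) = 1"
      have "norm (x - of_nat k) \<le> norm z + norm (z + of_nat k - x)"
        using norm_triangle_ineq4[of z "z + of_nat k - x"] by (simp add: algebra_simps)
      then show "norm (rGamma x) \<le> M" using M[of "x - of_nat k" k] z x by simp
    qed (auto intro!: holomorphic_on_imp_continuous_on holomorphic_rGamma)
    then show ?thesis by simp
  qed
  then show ?thesis by blast
qed

lemma bessel_coeff_bound:
  "\<exists>M. \<forall>\<nu> k. norm \<nu> \<le> R \<longrightarrow> norm (bessel_coeff \<nu> k) \<le> M / fact k \<and> norm (bessel_coeff' \<nu> k) \<le> M / fact k"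
proof -
  obtain M1 where M1: "\<And>z k. norm z \<le> R + 1 \<Longrightarrow> norm (rGamma (z + of_nat k :: complex)) \<le> M1"
    using rGamma_shift_bound[of "R + 1"] by blast
  obtain M2 where M2: "\<And>z k. norm z \<le> R + 1 \<Longrightarrow> norm (deriv rGamma (z + of_nat k :: complex)) \<le> M2"
    using deriv_rGamma_shift_bound[of "R + 1"] by blast
  show ?thesis
  proof (rule exI[of _ "max M1 M2"], intro allI impI)
    fix \<nu> :: complex and k assume "norm \<nu> \<le> R"
    then have n: "norm (\<nu> + 1) \<le> R + 1" using norm_triangle_ineq[of \<nu> 1] by simp
    have "norm (rGamma (\<nu> + of_nat k + 1)) \<le> max M1 M2" "norm (deriv rGamma (\<nu> + of_nat k + 1)) \<le> max M1 M2"
      using M1[OF n, of k] M2[OF n, of k] by (auto simp: add_ac)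
    then show "norm (bessel_coeff \<nu> k) \<le> max M1 M2 / fact k \<and> norm (bessel_coeff' \<nu> k) \<le> max M1 M2 / fact k"
      by (simp add: bessel_coeff_def bessel_coeff'_def norm_mult norm_divide norm_power divide_right_mono)
  qed
qed

lemma summable_exp_bound: "summable (\<lambda>k. M / fact k * r ^ k :: real)"
  using summable_mult[OF summable_exp[of r], of M] by (simp add: field_simps)

lemma summable_bessel: "summable (\<lambda>k. bessel_coeff \<nu> k * u ^ k)" "summable (\<lambda>k. bessel_coeff' \<nu> k * u ^ k)"
proof -
  obtain M where M: "\<And>k. norm (bessel_coeff \<nu> k) \<le> M / fact k" "\<And>k. norm (bessel_coeff' \<nu> k) \<le> M / fact k"
    using bessel_coeff_bound[of "norm \<nu>"] by blast
  have b: "norm (bessel_coeff \<nu> k * u ^ k) \<le> M / fact k * norm u ^ k" "norm (bessel_coeff' \<nu> k * u ^ k) \<le> M / fact k * norm u ^ k" for k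
    unfolding norm_mult norm_power by (intro mult_right_mono M; simp)+
  show "summable (\<lambda>k. bessel_coeff \<nu> k * u ^ k)"
    by (rule summable_comparison_test'[OF summable_exp_bound[of M "norm u"]]) (rule b)
  show "summable (\<lambda>k. bessel_coeff' \<nu> k * u ^ k)"
    by (rule summable_comparison_test'[OF summable_exp_bound[of M "norm u"]]) (rule b)
qed

lemma diffs_bessel: "diffs (bessel_coeff \<nu>) = (\<lambda>k. - bessel_coeff (\<nu> + 1) k)"
  "diffs (bessel_coeff' \<nu>) = (\<lambda>k. - bessel_coeff' (\<nu> + 1) k)"
proof -
  have f: "of_nat (Suc k) / fact (Suc k) = (1 / fact k :: complex)" for k
    by (simp add: divide_simps del: of_nat_Suc)
  have a: "\<nu> + of_nat (Suc k) + 1 = \<nu> + 1 + of_nat k + 1" for k by simp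
  show "diffs (bessel_coeff \<nu>) = (\<lambda>k. - bessel_coeff (\<nu> + 1) k)"
  proof
    fix k
    have "diffs (bessel_coeff \<nu>) k = (-1) ^ Suc k * rGamma (\<nu> + of_nat (Suc k) + 1) * (of_nat (Suc k) / fact (Suc k))"
      by (simp add: diffs_def bessel_coeff_def del: of_nat_Suc fact_Suc)
    then show "diffs (bessel_coeff \<nu>) k = - bessel_coeff (\<nu> + 1) k"
      unfolding f a by (simp add: bessel_coeff_def)
  qed
  show "diffs (bessel_coeff' \<nu>) = (\<lambda>k. - bessel_coeff' (\<nu> + 1) k)"
  proof
    fix k
    have "diffs (bessel_coeff' \<nu>) k = (-1) ^ Suc k * deriv rGamma (\<nu> + of_nat (Suc k) + 1) * (of_nat (Suc k) / fact (Suc k))"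
      by (simp add: diffs_def bessel_coeff'_def del: of_nat_Suc fact_Suc)
    then show "diffs (bessel_coeff' \<nu>) k = - bessel_coeff' (\<nu> + 1) k"
      unfolding f a by (simp add: bessel_coeff'_def)
  qed
qed

lemma J_series_deriv: "(J_series \<nu> has_field_derivative - J_series (\<nu> + 1) u) (at u)"
  using termdiffs_strong_converges_everywhere[OF summable_bessel(1)[of \<nu>], of u]
  unfolding diffs_bessel J_series_def[abs_def] by (simp add: suminf_minus summable_bessel)

lemma J_series'_deriv: "(J_series' \<nu> has_field_derivative - J_series' (\<nu> + 1) u) (at u)"
  using termdiffs_strong_converges_everywhere[OF summable_bessel(2)[of \<nu>], of u]
  unfolding diffs_bessel J_series'_def[abs_def] by (simp add: suminf_minus summable_bessel)

lemma J_series_order_deriv: "((\<lambda>\<nu>. J_series \<nu> u) has_field_derivative J_series' \<nu> u) (at \<nu>)"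
proof -
  obtain M where M: "\<And>z k. norm z \<le> norm \<nu> + 1 \<Longrightarrow> norm (bessel_coeff' z k) \<le> M / fact k"
    using bessel_coeff_bound[of "norm \<nu> + 1"] by blast
  have "((\<lambda>x. \<Sum>n. bessel_coeff x n * u ^ n) has_field_derivative (\<Sum>n. bessel_coeff' \<nu> n * u ^ n)) (at \<nu>)"
  proof (rule has_field_derivative_series'(2)[where S = "cball \<nu> 1" and ?x0.0 = \<nu>])
    fix n x
    have "((\<lambda>x. rGamma (x + of_nat n + 1)) has_field_derivative deriv rGamma (x + of_nat n + 1) * 1) (at x within cball \<nu> 1)"
      by (rule DERIV_chain2[OF rGamma_field_deriv]) (auto intro!: derivative_eq_intros)
    from DERIV_cmult_right[OF this, of "(-1) ^ n / fact n * u ^ n"]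
    show "((\<lambda>x. bessel_coeff x n * u ^ n) has_field_derivative bessel_coeff' x n * u ^ n) (at x within cball \<nu> 1)"
      by (simp add: bessel_coeff_def bessel_coeff'_def mult_ac)
  next
    have "uniform_limit (cball \<nu> 1) (\<lambda>n x. \<Sum>i<n. bessel_coeff' x i * u ^ i) (\<lambda>x. \<Sum>i. bessel_coeff' x i * u ^ i) sequentially"
    proof (rule Weierstrass_m_test[OF _ summable_exp_bound[of M "norm u"]])
      fix n x assume "x \<in> cball \<nu> 1"
      then have "norm x \<le> norm \<nu> + 1"
        using norm_triangle_ineq3[of x \<nu>] by (auto simp: dist_norm norm_minus_commute)
      from M[OF this] show "norm (bessel_coeff' x n * u ^ n) \<le> M / fact n * norm u ^ n"
        unfolding norm_mult norm_power by (rule mult_right_mono) simp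
    qed
    then show "uniformly_convergent_on (cball \<nu> 1) (\<lambda>n x. \<Sum>i<n. bessel_coeff' x i * u ^ i)"
      by (auto simp: uniformly_convergent_on_def)
  qed (auto intro: summable_bessel)
  then show ?thesis by (simp add: J_series_def J_series'_def)
qed

lemma J_series_rec: "J_series (\<nu> - 1) u = \<nu> * J_series \<nu> u - u * J_series (\<nu> + 1) u"
proof -
  have "(\<lambda>k. bessel_coeff (\<nu> - 1) k * u ^ k - \<nu> * (bessel_coeff \<nu> k * u ^ k)) sums (J_series (\<nu> - 1) u - \<nu> * J_series \<nu> u)"
    unfolding J_series_def by (intro sums_diff sums_mult summable_sums summable_bessel)
  moreover have "(\<lambda>k. bessel_coeff (\<nu> - 1) (Suc k) * u ^ Suc k - \<nu> * (bessel_coeff \<nu> (Suc k) * u ^ Suc k)) = (\<lambda>k. - u * (bessel_coeff (\<nu> + 1) k * u ^ k))"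
  proof
    fix k
    have "rGamma (\<nu> + of_nat k + 1) = (\<nu> + of_nat k + 1) * rGamma (\<nu> + of_nat k + 1 + 1)"
      by (simp only: rGamma_plus1)
    then have "bessel_coeff (\<nu> - 1) (Suc k) = (-1) ^ Suc k * (\<nu> + of_nat (Suc k)) * rGamma (\<nu> + of_nat (Suc k) + 1) / fact (Suc k)"
      by (simp add: bessel_coeff_def add_ac del: fact_Suc)
    then have "bessel_coeff (\<nu> - 1) (Suc k) - \<nu> * bessel_coeff \<nu> (Suc k) = diffs (bessel_coeff \<nu>) k"
      by (simp add: bessel_coeff_def diffs_def algebra_simps add_divide_distrib diff_divide_distrib del: fact_Suc)
    also have "\<dots> = - bessel_coeff (\<nu> + 1) k" by (simp add: diffs_bessel)
    finally have e: "bessel_coeff (\<nu> - 1) (Suc k) = \<nu> * bessel_coeff \<nu> (Suc k) - bessel_coeff (\<nu> + 1) k" by (simp add: algebra_simps)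
    show "bessel_coeff (\<nu> - 1) (Suc k) * u ^ Suc k - \<nu> * (bessel_coeff \<nu> (Suc k) * u ^ Suc k) = - u * (bessel_coeff (\<nu> + 1) k * u ^ k)"
      unfolding e by (simp add: algebra_simps)
  qed
  moreover have "bessel_coeff (\<nu> - 1) 0 * u ^ 0 - \<nu> * (bessel_coeff \<nu> 0 * u ^ 0) = 0"
    using rGamma_plus1[of \<nu>] by (simp add: bessel_coeff_def)
  ultimately have "(\<lambda>k. - u * (bessel_coeff (\<nu> + 1) k * u ^ k)) sums (J_series (\<nu> - 1) u - \<nu> * J_series \<nu> u)"
    using sums_Suc_iff[of "\<lambda>k. bessel_coeff (\<nu> - 1) k * u ^ k - \<nu> * (bessel_coeff \<nu> k * u ^ k)" "J_series (\<nu> - 1) u - \<nu> * J_series \<nu> u"]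
    by (simp only: add_0_right)
  moreover have "(\<lambda>k. - u * (bessel_coeff (\<nu> + 1) k * u ^ k)) sums (- u * J_series (\<nu> + 1) u)"
    unfolding J_series_def by (intro sums_mult summable_sums summable_bessel)
  ultimately have "J_series (\<nu> - 1) u - \<nu> * J_series \<nu> u = - u * J_series (\<nu> + 1) u" by (rule sums_unique2)
  then show ?thesis by (simp add: algebra_simps)
qed

text \<open>
  The derivative of \<open>J_series_rec\<close> with respect to the order.
\<close>

lemma J_series'_rec: "J_series' (\<nu> - 1) u = J_series \<nu> u + \<nu> * J_series' \<nu> u - u * J_series' (\<nu> + 1) u"
proof -
  have "((\<lambda>\<nu>. J_series (\<nu> - 1) u) has_field_derivative J_series' (\<nu> - 1) u * 1) (at \<nu>)"
    by (rule DERIV_chain2[OF J_series_order_deriv]) (auto intro!: derivative_eq_intros)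
  moreover have "((\<lambda>\<nu>. J_series (\<nu> + 1) u) has_field_derivative J_series' (\<nu> + 1) u * 1) (at \<nu>)"
    by (rule DERIV_chain2[OF J_series_order_deriv]) (auto intro!: derivative_eq_intros)
  then have "((\<lambda>\<nu>. \<nu> * J_series \<nu> u - u * J_series (\<nu> + 1) u) has_field_derivative J_series \<nu> u + \<nu> * J_series' \<nu> u - u * J_series' (\<nu> + 1) u) (at \<nu>)"
    by (auto intro!: derivative_eq_intros J_series_order_deriv)
  ultimately show ?thesis
    unfolding J_series_rec using DERIV_unique by fastforce
qed

lemma Bessel_J_eq: "Bessel_J \<nu> x = (x / 2) powr \<nu> * J_series \<nu> ((x / 2)\<^sup>2)"
  unfolding Bessel_J_def J_series_def bessel_coeff_def by (simp add: power_mult)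

definition Bessel_J' :: "complex \<Rightarrow> complex \<Rightarrow> complex" where
  "Bessel_J' \<nu> x = (x / 2) powr \<nu> * (ln (x / 2) * J_series \<nu> ((x / 2)\<^sup>2) + J_series' \<nu> ((x / 2)\<^sup>2))"

lemma Bessel_J'_eq: "x \<noteq> 0 \<Longrightarrow> ((\<lambda>\<nu>. Bessel_J \<nu> x) has_field_derivative Bessel_J' \<nu> x) (at \<nu>)"
  unfolding Bessel_J_eq Bessel_J'_def
  by (auto intro!: derivative_eq_intros J_series_order_deriv simp: algebra_simps)

lemma half_slit: "x \<notin> \<real>\<^sub>\<le>\<^sub>0 \<Longrightarrow> x / 2 \<notin> (\<real>\<^sub>\<le>\<^sub>0 :: complex set)"
  by (auto simp: complex_nonpos_Reals_iff)

lemma powr_half_deriv: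
  fixes x \<nu> :: complex
  assumes "x \<notin> \<real>\<^sub>\<le>\<^sub>0"
  shows "((\<lambda>x. (x / 2) powr \<nu>) has_field_derivative \<nu> / x * (x / 2) powr \<nu>) (at x)"
proof -
  have "x \<noteq> 0" using assms by auto
  have "((\<lambda>x. (x / 2) powr \<nu>) has_field_derivative \<nu> * (x / 2) powr (\<nu> - 1) * (1 / 2)) (at x)"
    by (rule DERIV_chain2[OF has_field_derivative_powr]) (use half_slit[OF assms] in \<open>auto intro!: derivative_eq_intros\<close>)
  also have "\<nu> * (x / 2) powr (\<nu> - 1) * (1 / 2) = \<nu> / x * (x / 2) powr \<nu>"
    using \<open>x \<noteq> 0\<close> by (simp add: powr_diff)
  finally show ?thesis .
qed

lemma powr_plus_one: "x \<noteq> 0 \<Longrightarrow> (x / 2) powr (\<nu> + 1) = (x / 2) powr \<nu> * (x / 2 :: complex)"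
  "x \<noteq> 0 \<Longrightarrow> (x / 2) powr (1 + \<nu>) = (x / 2) powr \<nu> * (x / 2 :: complex)"
  "x \<noteq> 0 \<Longrightarrow> (x / 2) powr (\<nu> - 1) = (x / 2) powr \<nu> / (x / 2 :: complex)"
  by (simp_all add: powr_add powr_diff)

lemma Bessel_J_deriv_up:
  assumes "x \<notin> \<real>\<^sub>\<le>\<^sub>0"
  shows "(Bessel_J \<nu> has_field_derivative \<nu> / x * Bessel_J \<nu> x - Bessel_J (\<nu> + 1) x) (at x)"
proof -
  have "x \<noteq> 0" using assms by auto
  have "((\<lambda>x. J_series \<nu> ((x / 2)\<^sup>2)) has_field_derivative - J_series (\<nu> + 1) ((x / 2)\<^sup>2) * (x / 2)) (at x)"
    by (rule DERIV_chain2[OF J_series_deriv]) (auto intro!: derivative_eq_intros)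
  from DERIV_mult[OF powr_half_deriv[OF assms] this, of \<nu>]
  show ?thesis unfolding Bessel_J_eq[abs_def]
    by (rule DERIV_cong) (use \<open>x \<noteq> 0\<close> in \<open>simp add: powr_plus_one algebra_simps\<close>)
qed

lemma Bessel_J_rec:
  assumes "x \<noteq> 0"
  shows "Bessel_J (\<nu> - 1) x = 2 * \<nu> / x * Bessel_J \<nu> x - Bessel_J (\<nu> + 1) x"
  using assms unfolding Bessel_J_eq J_series_rec by (simp add: powr_plus_one field_simps power2_eq_square)

lemma Bessel_J'_deriv_up:
  assumes "x \<notin> \<real>\<^sub>\<le>\<^sub>0"
  shows "(Bessel_J' \<nu> has_field_derivative \<nu> / x * Bessel_J' \<nu> x - Bessel_J' (\<nu> + 1) x + Bessel_J \<nu> x / x) (at x)"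
proof -
  have "x \<noteq> 0" using assms by auto
  have 1: "((\<lambda>x. J_series \<nu> ((x / 2)\<^sup>2)) has_field_derivative - J_series (\<nu> + 1) ((x / 2)\<^sup>2) * (x / 2)) (at x)"
    by (rule DERIV_chain2[OF J_series_deriv]) (auto intro!: derivative_eq_intros)
  have 2: "((\<lambda>x. J_series' \<nu> ((x / 2)\<^sup>2)) has_field_derivative - J_series' (\<nu> + 1) ((x / 2)\<^sup>2) * (x / 2)) (at x)"
    by (rule DERIV_chain2[OF J_series'_deriv]) (auto intro!: derivative_eq_intros)
  have 3: "((\<lambda>x. ln (x / 2)) has_field_derivative 1 / x) (at x)"
    by (rule derivative_eq_intros refl | use half_slit[OF assms] \<open>x \<noteq> 0\<close> in force)+
  from DERIV_mult[OF powr_half_deriv[OF assms] DERIV_add[OF DERIV_mult[OF 3 1] 2], of \<nu>]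
  show ?thesis unfolding Bessel_J'_def[abs_def] Bessel_J_eq
    by (rule DERIV_cong) (use \<open>x \<noteq> 0\<close> in \<open>simp add: powr_plus_one algebra_simps\<close>)
qed

lemma Bessel_J'_rec:
  assumes "x \<noteq> 0"
  shows "Bessel_J' (\<nu> - 1) x = 2 * \<nu> / x * Bessel_J' \<nu> x - Bessel_J' (\<nu> + 1) x + 2 / x * Bessel_J \<nu> x"
  using assms unfolding Bessel_J'_def Bessel_J_eq J_series_rec J_series'_rec
  by (simp add: powr_plus_one field_simps power2_eq_square)

text \<open>
  At negative integer order the first \<open>n\<close> coefficients vanish, because \<open>rGamma\<close> does at the poles of
  the Gamma function. The remaining ones are those of the positive order.
\<close>

lemma J_series_nat_reflect: "J_series (- of_nat n) u = (-1) ^ n * u ^ n * J_series (of_nat n) u"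
proof -
  have z: "bessel_coeff (- of_nat n) k = 0" if "k < n" for k
  proof -
    have "- of_nat n + of_nat k + 1 = (- of_nat (n - k - 1) :: complex)" using that by (simp add: of_nat_diff)
    then have "rGamma (- of_nat n + of_nat k + 1 :: complex) = 0" by (simp only: rGamma_eq_zero_iff) simp
    then show ?thesis by (simp add: bessel_coeff_def)
  qed
  have sh: "bessel_coeff (- of_nat n) (k + n) = (-1) ^ n * bessel_coeff (of_nat n) k" for k
  proof -
    have "rGamma (of_nat n + of_nat k + 1 :: complex) = 1 / fact (n + k)"
      using rGamma_inverse_Gamma[of "1 + of_nat (n + k) :: complex"] unfolding Gamma_fact by (simp add: inverse_eq_divide add_ac)
    moreover have "rGamma (- of_nat n + of_nat (k + n) + 1 :: complex) = 1 / fact k"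
      using rGamma_inverse_Gamma[of "1 + of_nat k :: complex"] unfolding Gamma_fact by (simp add: inverse_eq_divide add_ac)
    ultimately show ?thesis
      by (simp add: bessel_coeff_def power_add add_ac del: of_nat_add) (simp add: ac_simps)
  qed
  have "J_series (- of_nat n) u = (\<Sum>k. bessel_coeff (- of_nat n) (k + n) * u ^ (k + n)) + (\<Sum>k<n. bessel_coeff (- of_nat n) k * u ^ k)"
    unfolding J_series_def by (rule suminf_split_initial_segment[OF summable_bessel(1)])
  also have "(\<Sum>k<n. bessel_coeff (- of_nat n) k * u ^ k) = 0" by (simp add: z)
  also have "(\<Sum>k. bessel_coeff (- of_nat n) (k + n) * u ^ (k + n)) = (\<Sum>k. (-1) ^ n * u ^ n * (bessel_coeff (of_nat n) k * u ^ k))"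
    unfolding sh by (simp add: power_add mult_ac)
  also have "\<dots> = (-1) ^ n * u ^ n * J_series (of_nat n) u"
    unfolding J_series_def by (rule suminf_mult[OF summable_bessel(1)])
  finally show ?thesis by simp
qed

lemma Bessel_J_neg_nat: "x \<noteq> 0 \<Longrightarrow> Bessel_J (- of_nat n) x = (-1) ^ n * Bessel_J (of_nat n) x"
proof -
  assume "x \<noteq> 0"
  then have "(x / 2) powr (- of_nat n) * (x / 2) ^ (2 * n) = (x / 2) ^ n"
    by (simp add: powr_minus powr_nat power_mult power2_eq_square power_mult_distrib field_simps)
  then show ?thesis
    using \<open>x \<noteq> 0\<close> unfolding Bessel_J_eq J_series_nat_reflect by (simp add: powr_nat flip: power_mult)
qed

lemma Bessel_J_neg_int:
  assumes "x \<noteq> 0"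
  shows "Bessel_J (- of_int m) x = (-1) powi m * Bessel_J (of_int m) x"
proof (cases "m \<ge> 0")
  case True
  then obtain n where "m = int n" using nonneg_int_cases by blast
  then show ?thesis using Bessel_J_neg_nat[OF assms, of n] by simp
next
  case False
  then obtain n where m: "m = - int n" by (metis le_cases neg_int_cases minus_minus nonneg_int_cases neg_0_le_iff_le)
  have "(-1) powi m * Bessel_J (of_int m) x = (-1) ^ n * ((-1) ^ n * Bessel_J (of_nat n) x)"
    using Bessel_J_neg_nat[OF assms, of n] by (simp add: m power_int_minus flip: power_inverse)
  also have "\<dots> = Bessel_J (of_nat n) x" by (simp flip: mult.assoc power_mult_distrib)
  finally show ?thesis by (simp add: m)
qed

lemma minus_one_powi: "(-1 :: complex) powi m = (if even m then 1 else -1)"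
  by (simp add: power_int_minus_left)

lemma cos_int_pi: "cos (of_int m * of_real pi :: complex) = (-1) powi m"
proof -
  have "of_int m * of_real pi = complex_of_real (pi * of_int m)" by simp
  then show ?thesis by (simp only: cos_of_real cos_npi_int minus_one_powi) simp
qed

lemma sin_int_pi: "sin (of_int m * of_real pi :: complex) = 0"
proof -
  have "of_int m * of_real pi = complex_of_real (pi * of_int m)" by simp
  then show ?thesis by (simp only: sin_of_real sin_npi_int) simp
qed

lemma Bessel_J_neg_deriv:
  assumes "x \<notin> \<real>\<^sub>\<le>\<^sub>0"
  shows "(Bessel_J (- \<mu>) has_field_derivative \<mu> / x * Bessel_J (- \<mu>) x + Bessel_J (- (\<mu> + 1)) x) (at x)"
proof -
  have "x \<noteq> 0" using assms by auto
  have e: "- (\<mu> + 1) = - \<mu> - 1" by simp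
  show ?thesis unfolding e Bessel_J_rec[OF \<open>x \<noteq> 0\<close>, of "- \<mu>"]
    by (rule DERIV_cong[OF Bessel_J_deriv_up[OF assms]]) (simp add: algebra_simps)
qed

lemma sin_cos_shift:
  "sin ((\<mu> + 1) * of_real pi) = - sin (\<mu> * of_real pi :: complex)"
  "cos ((\<mu> + 1) * of_real pi) = - cos (\<mu> * of_real pi :: complex)"
  "sin ((\<mu> - 1) * of_real pi) = - sin (\<mu> * of_real pi :: complex)"
  "cos ((\<mu> - 1) * of_real pi) = - cos (\<mu> * of_real pi :: complex)"
  by (simp_all add: sin_add cos_add sin_diff cos_diff distrib_right left_diff_distrib flip: sin_of_real cos_of_real)

lemma sin_pi_nz: "\<mu> \<notin> \<int> \<Longrightarrow> sin (\<mu> * of_real pi) \<noteq> (0 :: complex)"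
  by (auto simp: sin_eq_0 Ints_def)

lemma int_shift: "\<mu> + 1 \<in> \<int> \<longleftrightarrow> \<mu> \<in> (\<int> :: complex set)" "\<mu> - 1 \<in> \<int> \<longleftrightarrow> \<mu> \<in> (\<int> :: complex set)"
  by (metis Ints_1 Ints_add Ints_diff add_diff_cancel_right' diff_add_cancel)+

text \<open>
  Numerator and denominator both vanish at the order \<open>m\<close>, and the limit is the quotient of
  their derivatives with respect to the order. In particular the limit by which \<open>Bessel_Y\<close> is defined
  at integers exists.
\<close>

lemma Bessel_Y_nonint_tendsto:
  fixes x :: complex and m :: int
  assumes x: "x \<noteq> 0"
  defines "y \<equiv> (Bessel_J' (of_int m) x + (-1) powi m * Bessel_J' (- of_int m) x) / of_real pi"
  shows "((\<lambda>\<mu>. Bessel_Y_nonint \<mu> x) \<longlongrightarrow> y) (at (of_int m))" "Bessel_Y (of_int m) x = y"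
proof -
  define e :: complex where "e = (-1) powi m"
  have e: "e * e = 1" by (auto simp: e_def minus_one_powi)
  define N where "N = (\<lambda>\<mu>. Bessel_J \<mu> x * cos (\<mu> * of_real pi) - Bessel_J (- \<mu>) x)"
  have "((\<lambda>\<mu>. Bessel_J (- \<mu>) x) has_field_derivative Bessel_J' (- of_int m) x * (-1)) (at (of_int m))"
    by (rule DERIV_chain2[OF Bessel_J'_eq[OF x]]) (auto intro!: derivative_eq_intros)
  then have "(N has_field_derivative Bessel_J' (of_int m) x * e + Bessel_J' (- of_int m) x) (at (of_int m))"
    unfolding N_def by (auto intro!: derivative_eq_intros Bessel_J'_eq[OF x] simp: sin_int_pi cos_int_pi e_def)
  moreover have "N (of_int m) = 0"
    using Bessel_J_neg_int[OF x, of m] by (simp add: N_def cos_int_pi)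
  ultimately have n: "((\<lambda>\<mu>. N \<mu> / (\<mu> - of_int m)) \<longlongrightarrow> Bessel_J' (of_int m) x * e + Bessel_J' (- of_int m) x) (at (of_int m))"
    by (simp add: has_field_derivative_iff)
  have "((\<lambda>\<mu>::complex. sin (\<mu> * of_real pi)) has_field_derivative e * of_real pi) (at (of_int m))"
    by (auto intro!: derivative_eq_intros simp: cos_int_pi e_def)
  then have s: "((\<lambda>\<mu>::complex. sin (\<mu> * of_real pi) / (\<mu> - of_int m)) \<longlongrightarrow> e * of_real pi) (at (of_int m))"
    by (simp add: has_field_derivative_iff sin_int_pi)
  have nz: "e * of_real pi \<noteq> 0" using e by auto
  have "((\<lambda>\<mu>. (N \<mu> / (\<mu> - of_int m)) / (sin (\<mu> * of_real pi) / (\<mu> - of_int m))) \<longlongrightarrow>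
     (Bessel_J' (of_int m) x * e + Bessel_J' (- of_int m) x) / (e * of_real pi)) (at (of_int m))"
    by (intro tendsto_divide n s nz)
  also have "(Bessel_J' (of_int m) x * e + Bessel_J' (- of_int m) x) / (e * of_real pi) = y"
  proof -
    have "1 / e = e" using e by (metis nonzero_divide_eq_eq mult_zero_left zero_neq_one)
    then have "(Bessel_J' (of_int m) x * e + Bessel_J' (- of_int m) x) / (e * of_real pi) = e * (Bessel_J' (of_int m) x * e + Bessel_J' (- of_int m) x) / of_real pi"
      by (metis divide_divide_eq_left mult.commute mult_1 times_divide_eq_left)
    also have "\<dots> = y" using e by (simp add: y_def e_def[symmetric] distrib_left)
    finally show ?thesis .
  qed
  finally show lim: "((\<lambda>\<mu>. Bessel_Y_nonint \<mu> x) \<longlongrightarrow> y) (at (of_int m))"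
    by (rule Lim_transform_eventually) (auto simp: Bessel_Y_nonint_def N_def eventually_at intro!: exI[of _ 1])
  have "Lim (at (of_int m)) (\<lambda>\<mu>. Bessel_Y_nonint \<mu> x) = y"
    by (rule tendsto_Lim[OF _ lim]) simp
  then show "Bessel_Y (of_int m) x = y" by (simp add: Bessel_Y_def)
qed

lemma Bessel_Y_shift:
  assumes "\<mu> \<notin> \<int>"
  shows "Bessel_Y \<mu> x = (Bessel_J \<mu> x * cos (\<mu> * of_real pi) - Bessel_J (- \<mu>) x) / sin (\<mu> * of_real pi)"
    "Bessel_Y (\<mu> + 1) x = (Bessel_J (\<mu> + 1) x * cos (\<mu> * of_real pi) + Bessel_J (- (\<mu> + 1)) x) / sin (\<mu> * of_real pi)"
    "Bessel_Y (\<mu> - 1) x = (Bessel_J (\<mu> - 1) x * cos (\<mu> * of_real pi) + Bessel_J (- (\<mu> - 1)) x) / sin (\<mu> * of_real pi)"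
proof -
  have neg: "(a * - c - b) / - s = (a * c + b) / s" for a b c s :: complex
  proof -
    have "a * - c - b = - (a * c + b)" by simp
    then show ?thesis by (simp only: minus_divide_divide)
  qed
  show "Bessel_Y \<mu> x = (Bessel_J \<mu> x * cos (\<mu> * of_real pi) - Bessel_J (- \<mu>) x) / sin (\<mu> * of_real pi)"
    "Bessel_Y (\<mu> + 1) x = (Bessel_J (\<mu> + 1) x * cos (\<mu> * of_real pi) + Bessel_J (- (\<mu> + 1)) x) / sin (\<mu> * of_real pi)"
    "Bessel_Y (\<mu> - 1) x = (Bessel_J (\<mu> - 1) x * cos (\<mu> * of_real pi) + Bessel_J (- (\<mu> - 1)) x) / sin (\<mu> * of_real pi)"
    using assms by (simp_all only: Bessel_Y_def Bessel_Y_nonint_def int_shift sin_cos_shift neg if_False)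
qed

text \<open>
  At integer order the inhomogeneous terms in \<open>Bessel_J'_deriv_up\<close> for the orders \<open>m\<close> and \<open>-m\<close> and in
  \<open>Bessel_J'_rec\<close> cancel, by the reflection formula for \<open>Bessel_J\<close>.
\<close>

lemma Bessel_Y_deriv_up:
  assumes "x \<notin> \<real>\<^sub>\<le>\<^sub>0"
  shows "(Bessel_Y \<mu> has_field_derivative \<mu> / x * Bessel_Y \<mu> x - Bessel_Y (\<mu> + 1) x) (at x)"
proof (cases "\<mu> \<in> \<int>")
  case False
  note Y1 = Bessel_Y_shift(2)[OF False, of x]
  have Y: "Bessel_Y \<mu> = (\<lambda>x. (Bessel_J \<mu> x * cos (\<mu> * of_real pi) - Bessel_J (- \<mu>) x) / sin (\<mu> * of_real pi))"
    using Bessel_Y_shift(1)[OF False] by blast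
  show ?thesis unfolding Y1 unfolding Y
    using DERIV_cdivide[OF DERIV_diff[OF DERIV_cmult_right[OF Bessel_J_deriv_up[OF assms, of \<mu>], of "cos (\<mu> * of_real pi)"] Bessel_J_neg_deriv[OF assms, of \<mu>]], of "sin (\<mu> * of_real pi)"]
    by (rule DERIV_cong) (simp add: diff_divide_distrib add_divide_distrib algebra_simps)
next
  case True
  then obtain m where \<mu>: "\<mu> = of_int m" by (auto elim: Ints_cases)
  have x: "x \<noteq> 0" using assms by auto
  define e :: complex where "e = (-1) powi m"
  have e1: "(-1) powi (m + 1) = - e" by (simp add: e_def power_int_add)
  have Ym: "Bessel_Y (of_int m) y = (Bessel_J' (of_int m) y + e * Bessel_J' (- of_int m) y) / of_real pi" if "y \<noteq> 0" for y
    using Bessel_Y_nonint_tendsto(2)[OF that, of m] by (simp add: e_def)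
  have Ym1: "Bessel_Y (\<mu> + 1) x = (Bessel_J' (of_int m + 1) x - e * Bessel_J' (- (of_int m + 1)) x) / of_real pi"
    using Bessel_Y_nonint_tendsto(2)[OF x, of "m + 1"] unfolding e1 \<mu> by simp
  have JJ: "e * Bessel_J (- of_int m) x = Bessel_J (of_int m) x"
    using Bessel_J_neg_int[OF x, of m] by (auto simp: e_def minus_one_powi)
  have nm: "- (of_int m + 1) = - of_int m - (1::complex)" by simp
  have rec: "Bessel_J' (- of_int m + 1) x = - Bessel_J' (- (of_int m + 1)) x - 2 * of_int m / x * Bessel_J' (- of_int m) x + 2 / x * Bessel_J (- of_int m) x"
    unfolding nm using Bessel_J'_rec[OF x, of "- of_int m"] by (simp add: algebra_simps)
  have "((\<lambda>y. (Bessel_J' (of_int m) y + e * Bessel_J' (- of_int m) y) / of_real pi) has_field_derivative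
     ((of_int m / x * Bessel_J' (of_int m) x - Bessel_J' (of_int m + 1) x + Bessel_J (of_int m) x / x) +
     e * (- of_int m / x * Bessel_J' (- of_int m) x - Bessel_J' (- of_int m + 1) x + Bessel_J (- of_int m) x / x)) / of_real pi) (at x)"
    by (intro DERIV_cdivide DERIV_add DERIV_cmult Bessel_J'_deriv_up assms)
  also have "((of_int m / x * Bessel_J' (of_int m) x - Bessel_J' (of_int m + 1) x + Bessel_J (of_int m) x / x) +
     e * (- of_int m / x * Bessel_J' (- of_int m) x - Bessel_J' (- of_int m + 1) x + Bessel_J (- of_int m) x / x)) / of_real pi
     = \<mu> / x * Bessel_Y \<mu> x - Bessel_Y (\<mu> + 1) x"
    unfolding Ym1 unfolding \<mu> Ym[OF x] rec JJ[symmetric] by (simp add: divide_inverse algebra_simps)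
  finally have D: "((\<lambda>y. (Bessel_J' (of_int m) y + e * Bessel_J' (- of_int m) y) / of_real pi) has_field_derivative
    \<mu> / x * Bessel_Y \<mu> x - Bessel_Y (\<mu> + 1) x) (at x)" .
  show ?thesis
  proof (rule has_field_derivative_transform_within_open[OF D])
    show "open (- \<real>\<^sub>\<le>\<^sub>0 :: complex set)" by (simp add: open_Compl)
    show "x \<in> - \<real>\<^sub>\<le>\<^sub>0" using assms by simp
    fix y :: complex assume "y \<in> - \<real>\<^sub>\<le>\<^sub>0"
    then have "y \<noteq> 0" by auto
    then show "(Bessel_J' (of_int m) y + e * Bessel_J' (- of_int m) y) / of_real pi = Bessel_Y \<mu> y" by (simp add: \<mu> Ym)
  qed
qed

lemma Bessel_Y_rec:
  assumes x: "x \<noteq> 0"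
  shows "Bessel_Y (\<mu> - 1) x = 2 * \<mu> / x * Bessel_Y \<mu> x - Bessel_Y (\<mu> + 1) x"
proof (cases "\<mu> \<in> \<int>")
  case False
  note Y = Bessel_Y_shift[OF False, of x]
  have "- (\<mu> - 1) = - \<mu> + 1" "- (\<mu> + 1) = - \<mu> - 1" by simp_all
  then have r: "Bessel_J (- (\<mu> - 1)) x = - 2 * \<mu> / x * Bessel_J (- \<mu>) x - Bessel_J (- (\<mu> + 1)) x"
    using Bessel_J_rec[OF x, of "- \<mu>"] by simp
  show ?thesis unfolding Y r Bessel_J_rec[OF x, of \<mu>]
    by (simp add: divide_inverse algebra_simps)
next
  case True
  then obtain m where \<mu>: "\<mu> = of_int m" by (auto elim: Ints_cases)
  define e :: complex where "e = (-1) powi m"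
  have e1: "(-1) powi (m + 1) = - e" "(-1) powi (m - 1) = - e" by (simp_all add: e_def power_int_add power_int_diff)
  have Ys: "Bessel_Y \<mu> x = (Bessel_J' \<mu> x + e * Bessel_J' (- \<mu>) x) / of_real pi"
    "Bessel_Y (\<mu> + 1) x = (Bessel_J' (\<mu> + 1) x - e * Bessel_J' (- (\<mu> + 1)) x) / of_real pi"
    "Bessel_Y (\<mu> - 1) x = (Bessel_J' (\<mu> - 1) x - e * Bessel_J' (- (\<mu> - 1)) x) / of_real pi"
    using Bessel_Y_nonint_tendsto(2)[OF x, of m] Bessel_Y_nonint_tendsto(2)[OF x, of "m + 1"] Bessel_Y_nonint_tendsto(2)[OF x, of "m - 1"]
    unfolding e1 \<mu> by (simp_all add: e_def)
  have JJ: "e * Bessel_J (- \<mu>) x = Bessel_J \<mu> x"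
    using Bessel_J_neg_int[OF x, of m] by (auto simp: e_def minus_one_powi \<mu>)
  have "- (\<mu> - 1) = - \<mu> + 1" "- (\<mu> + 1) = - \<mu> - 1" by simp_all
  then have r: "Bessel_J' (- (\<mu> - 1)) x = - 2 * \<mu> / x * Bessel_J' (- \<mu>) x - Bessel_J' (- (\<mu> + 1)) x + 2 / x * Bessel_J (- \<mu>) x"
    using Bessel_J'_rec[OF x, of "- \<mu>"] by simp
  show ?thesis unfolding Ys r Bessel_J'_rec[OF x, of \<mu>] JJ[symmetric]
    by (simp add: divide_inverse algebra_simps)
qed

section \<open>Asymptotic integration of the Bessel equation\<close>

text \<open>
  On any interval, \<open>f\<close> varies by at most the maximum of \<open>norm f\<close> times \<open>K / \<rho> \<le> 1/2\<close>. Hence the maximum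
  is at most twice any other value. This bounds \<open>norm f\<close> by its limit and turns absolute errors into
  errors relative to the limit, which is essential for recessive solutions.
\<close>

lemma asymptotic_integration:
  fixes f :: "real \<Rightarrow> 'a::banach"
  assumes K: "0 \<le> K" "0 < \<rho>" "2 * K \<le> \<rho>"
    and deriv: "\<And>s. 0 \<le> s \<Longrightarrow> (f has_vector_derivative f' s) (at s)"
    and bound: "\<And>s. 0 \<le> s \<Longrightarrow> norm (f' s) \<le> K / (\<rho> + s)\<^sup>2 * norm (f s)"
  obtains L where "(f \<longlongrightarrow> L) at_top" "\<And>s. 0 \<le> s \<Longrightarrow> norm (f s - L) \<le> 2 * K / (\<rho> + s) * norm L"
    "\<And>s. 0 \<le> s \<Longrightarrow> norm (f s) \<le> 2 * norm (f 0)"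
proof -
  have cont: "continuous_on {0..} f"
    by (intro continuous_at_imp_continuous_on) (auto intro: has_vector_derivative_continuous deriv)
  have step: "norm (f b - f a) \<le> B * (K / (\<rho> + a) - K / (\<rho> + b))"
    if ab: "0 \<le> a" "a \<le> b" and B: "\<And>s. a \<le> s \<Longrightarrow> s \<le> b \<Longrightarrow> norm (f s) \<le> B" for a b B
  proof (cases "a = b")
    case False
    then have "a < b" using ab by simp
    have "norm (f b - f a) \<le> - (B * K / (\<rho> + b)) - (- (B * K / (\<rho> + a)))"
    proof (rule differentiable_bound_general[OF \<open>a < b\<close>, where f = f and \<phi> = "\<lambda>s. - (B * K / (\<rho> + s))"
          and f' = f' and \<phi>' = "\<lambda>s. B * K / (\<rho> + s)\<^sup>2"])
      show "continuous_on {a..b} f" by (rule continuous_on_subset[OF cont]) (use ab in auto)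
      show "continuous_on {a..b} (\<lambda>s. - (B * K / (\<rho> + s)))"
        using ab K by (intro continuous_intros) auto
      fix s assume s: "a < s" "s < b"
      show "(f has_vector_derivative f' s) (at s)" using s ab by (intro deriv) auto
      have "\<rho> + s \<noteq> 0" using s ab K by linarith
      then show "((\<lambda>s. - (B * K / (\<rho> + s))) has_vector_derivative B * K / (\<rho> + s)\<^sup>2) (at s)"
        unfolding has_real_derivative_iff_has_vector_derivative[symmetric]
        by (auto intro!: derivative_eq_intros simp: power2_eq_square)
      have "norm (f' s) \<le> K / (\<rho> + s)\<^sup>2 * norm (f s)" using s ab by (intro bound) auto
      also have "\<dots> \<le> K / (\<rho> + s)\<^sup>2 * B" using s K by (intro mult_left_mono B) auto
      finally show "norm (f' s) \<le> B * K / (\<rho> + s)\<^sup>2" by (simp add: mult_ac)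
    qed
    then show ?thesis by (simp add: algebra_simps)
  qed (simp)
  have frac: "K / (\<rho> + a) - K / (\<rho> + b) \<le> 1 / 2" "K / (\<rho> + a) - K / (\<rho> + b) \<le> K / (\<rho> + a)"
    if "0 \<le> a" "0 \<le> b" for a b
  proof -
    have "K / (\<rho> + a) \<le> 1 / 2" "0 \<le> K / (\<rho> + b)" using K that by (auto simp: field_simps)
    then show "K / (\<rho> + a) - K / (\<rho> + b) \<le> 1 / 2" "K / (\<rho> + a) - K / (\<rho> + b) \<le> K / (\<rho> + a)" by linarith+
  qed
  \<comment> \<open>The maximum over an interval that contains both points differs from \<open>f c\<close> by at most half of itself.\<close>
  have comparable: "norm (f s) \<le> 2 * norm (f c)" if sc: "0 \<le> s" "0 \<le> c" for s c
  proof -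
    define T where "T = max s c"
    have "\<exists>m\<in>{0..T}. \<forall>y\<in>{0..T}. norm (f y) \<le> norm (f m)"
    proof -
      have "continuous_on {0..T} (\<lambda>s. norm (f s))" by (intro continuous_on_norm continuous_on_subset[OF cont]) auto
      moreover have "{0..T} \<noteq> {}" using sc by (auto simp: T_def)
      ultimately show ?thesis by (intro continuous_attains_sup compact_Icc)
    qed
    then obtain m where m: "m \<in> {0..T}" "\<And>y. y \<in> {0..T} \<Longrightarrow> norm (f y) \<le> norm (f m)" by blast
    have "norm (f m - f c) \<le> norm (f m) / 2"
    proof (cases "c \<le> m")
      case True
      have "norm (f m - f c) \<le> norm (f m) * (K / (\<rho> + c) - K / (\<rho> + m))"
        using sc True m(1) by (intro step m(2)) auto
      also have "\<dots> \<le> norm (f m) * (1 / 2)"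
        using frac[of c m] sc m(1) by (intro mult_left_mono) auto
      finally show ?thesis by simp
    next
      case False
      have "norm (f c - f m) \<le> norm (f m) * (K / (\<rho> + m) - K / (\<rho> + c))"
        using sc False m(1) by (intro step m(2)) (auto simp: T_def)
      also have "\<dots> \<le> norm (f m) * (1 / 2)"
        using frac[of m c] sc m(1) by (intro mult_left_mono) auto
      finally show ?thesis by (simp add: norm_minus_commute)
    qed
    then have "norm (f m) \<le> 2 * norm (f c)" using norm_triangle_ineq2[of "f m" "f c"] by linarith
    moreover have "norm (f s) \<le> norm (f m)" using sc by (intro m(2)) (auto simp: T_def)
    ultimately show ?thesis by linarith
  qed
  have tail: "norm (f b - f a) \<le> 2 * norm (f c) * (K / (\<rho> + a))" if "0 \<le> a" "a \<le> b" "0 \<le> c" for a b c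
  proof -
    have "norm (f b - f a) \<le> 2 * norm (f c) * (K / (\<rho> + a) - K / (\<rho> + b))"
      using that by (intro step comparable) auto
    also have "\<dots> \<le> 2 * norm (f c) * (K / (\<rho> + a))"
      using frac[of a b] that by (intro mult_left_mono) auto
    finally show ?thesis .
  qed
  have "Cauchy (\<lambda>n. f (real n))"
  proof (rule metric_CauchyI)
    fix e :: real assume "e > 0"
    have "((\<lambda>n. 2 * norm (f 0) * (K / (\<rho> + real n))) \<longlongrightarrow> 0) sequentially"
      by (intro tendsto_mult_right_zero tendsto_divide_0[OF tendsto_const] filterlim_at_top_imp_at_infinity
          filterlim_tendsto_add_at_top[OF tendsto_const] filterlim_real_sequentially)
    then have "eventually (\<lambda>n. 2 * norm (f 0) * (K / (\<rho> + real n)) < e) sequentially"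
      using \<open>e > 0\<close> by (rule order_tendstoD)
    then obtain N where N: "\<And>n. n \<ge> N \<Longrightarrow> 2 * norm (f 0) * (K / (\<rho> + real n)) < e"
      by (auto simp: eventually_sequentially)
    have "dist (f (real m)) (f (real n)) < e" if "m \<ge> N" "n \<ge> m" for m n
      using tail[of "real m" "real n" 0] N[OF that(1)] that by (simp add: dist_norm norm_minus_commute)
    then show "\<exists>M. \<forall>m\<ge>M. \<forall>n\<ge>M. dist (f (real m)) (f (real n)) < e"
      by (metis dist_commute nle_le)
  qed
  then obtain L where L: "(\<lambda>n. f (real n)) \<longlonglongrightarrow> L"
    using Cauchy_convergent_iff convergent_def by blast
  have near: "norm (f s - L) \<le> 2 * norm (f c) * (K / (\<rho> + s))" if "0 \<le> s" "0 \<le> c" for s c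
  proof (rule tendsto_upperbound)
    show "(\<lambda>n. norm (f s - f (real n))) \<longlonglongrightarrow> norm (f s - L)" by (intro tendsto_intros L)
    have "eventually (\<lambda>n. s \<le> real n) sequentially"
      using filterlim_real_sequentially eventually_compose_filterlim eventually_ge_at_top by blast
    then show "eventually (\<lambda>n. norm (f s - f (real n)) \<le> 2 * norm (f c) * (K / (\<rho> + s))) sequentially"
      by eventually_elim (use tail that in \<open>simp add: norm_minus_commute\<close>)
  qed simp
  have L2: "norm (f s - L) \<le> 2 * norm L * (K / (\<rho> + s))" if "0 \<le> s" for s
  proof (rule tendsto_lowerbound)
    show "(\<lambda>n. 2 * norm (f (real n)) * (K / (\<rho> + s))) \<longlonglongrightarrow> 2 * norm L * (K / (\<rho> + s))" by (intro tendsto_intros L)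
    show "eventually (\<lambda>n. norm (f s - L) \<le> 2 * norm (f (real n)) * (K / (\<rho> + s))) sequentially"
      by (intro always_eventually allI near that) auto
  qed simp
  have "(f \<longlongrightarrow> L) at_top"
  proof (rule LIM_zero_cancel, rule Lim_null_comparison)
    show "eventually (\<lambda>s. norm (f s - L) \<le> 2 * norm L * (K / (\<rho> + s))) at_top"
      using eventually_ge_at_top[of 0] by eventually_elim (rule L2)
    show "((\<lambda>s. 2 * norm L * (K / (\<rho> + s))) \<longlongrightarrow> 0) at_top"
      by (intro tendsto_mult_right_zero tendsto_divide_0[OF tendsto_const] filterlim_at_top_imp_at_infinity
          filterlim_tendsto_add_at_top[OF tendsto_const] filterlim_ident)
  qed
  moreover have "norm (f s - L) \<le> 2 * K / (\<rho> + s) * norm L" if "0 \<le> s" for s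
    using L2[OF that] by (simp add: mult_ac)
  ultimately show ?thesis using comparable by (intro that[of L]) auto
qed

text \<open>
  Satisfied with \<open>\<kappa> = \<nu>\<^sup>2 - 1/4\<close> by \<open>\<surd>x\<close> times any cylinder function of order \<open>\<nu>\<close>; \<open>u'\<close> is the derivative
  of \<open>u\<close>.
\<close>

definition bessel_ode :: "complex \<Rightarrow> (complex \<Rightarrow> complex) \<Rightarrow> (complex \<Rightarrow> complex) \<Rightarrow> bool" where
  "bessel_ode \<kappa> u u' \<longleftrightarrow> (\<forall>x. x \<notin> \<real>\<^sub>\<le>\<^sub>0 \<longrightarrow>
     (u has_field_derivative u' x) (at x) \<and> (u' has_field_derivative (\<kappa> / x\<^sup>2 - 1) * u x) (at x))"

text \<open>
  For \<open>\<kappa> = 0\<close>, \<open>osc1\<close> and \<open>osc2\<close> are constant: they are the coefficients of \<open>exp (\<i> x)\<close> and \<open>exp (- \<i> x)\<close>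
  in \<open>u\<close>, up to the factors \<open>\<plusminus>2 \<i>\<close>. In general they vary slowly (variation of constants).
\<close>

definition osc1 :: "(complex \<Rightarrow> complex) \<Rightarrow> (complex \<Rightarrow> complex) \<Rightarrow> complex \<Rightarrow> complex" where
  "osc1 u u' x = (u' x + \<i> * u x) * exp (- (\<i> * x))"

definition osc2 :: "(complex \<Rightarrow> complex) \<Rightarrow> (complex \<Rightarrow> complex) \<Rightarrow> complex \<Rightarrow> complex" where
  "osc2 u u' x = (u' x - \<i> * u x) * exp (\<i> * x)"

lemma osc_deriv:
  assumes "bessel_ode \<kappa> u u'" "x \<notin> \<real>\<^sub>\<le>\<^sub>0"
  shows "(osc1 u u' has_field_derivative \<kappa> / x\<^sup>2 * u x * exp (- (\<i> * x))) (at x)"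
    and "(osc2 u u' has_field_derivative \<kappa> / x\<^sup>2 * u x * exp (\<i> * x)) (at x)"
proof -
  have u: "(u has_field_derivative u' x) (at x)" "(u' has_field_derivative (\<kappa> / x\<^sup>2 - 1) * u x) (at x)"
    using assms by (auto simp: bessel_ode_def)
  have e: "((\<lambda>x. exp (- (\<i> * x))) has_field_derivative exp (- (\<i> * x)) * (- \<i>)) (at x)"
    "((\<lambda>x. exp (\<i> * x)) has_field_derivative exp (\<i> * x) * \<i>) (at x)"
    by (auto intro!: derivative_eq_intros)
  show "(osc1 u u' has_field_derivative \<kappa> / x\<^sup>2 * u x * exp (- (\<i> * x))) (at x)"
    unfolding osc1_def[abs_def] using DERIV_mult[OF DERIV_add[OF u(2) DERIV_cmult[OF u(1), of \<i>]] e(1)]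
    by (rule DERIV_cong) (simp add: algebra_simps)
  show "(osc2 u u' has_field_derivative \<kappa> / x\<^sup>2 * u x * exp (\<i> * x)) (at x)"
    unfolding osc2_def[abs_def] using DERIV_mult[OF DERIV_diff[OF u(2) DERIV_cmult[OF u(1), of \<i>]] e(2)]
    by (rule DERIV_cong) (simp add: algebra_simps)
qed

lemma osc_recover:
  "u x * exp (- (\<i> * x)) = (osc1 u u' x - osc2 u u' x * exp (- (2 * \<i> * x))) / (2 * \<i>)"
  "u x * exp (\<i> * x) = (osc1 u u' x * exp (2 * \<i> * x) - osc2 u u' x) / (2 * \<i>)"
proof -
  have "exp (\<i> * x) * exp (- (2 * \<i> * x)) = exp (- (\<i> * x))" "exp (- (\<i> * x)) * exp (2 * \<i> * x) = exp (\<i> * x)"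
    by (simp_all flip: exp_add)
  then have A: "osc2 u u' x * exp (- (2 * \<i> * x)) = (u' x - \<i> * u x) * exp (- (\<i> * x))"
    and B: "osc1 u u' x * exp (2 * \<i> * x) = (u' x + \<i> * u x) * exp (\<i> * x)"
    by (simp_all add: osc1_def osc2_def mult.assoc)
  show "u x * exp (- (\<i> * x)) = (osc1 u u' x - osc2 u u' x * exp (- (2 * \<i> * x))) / (2 * \<i>)"
    unfolding A osc1_def by (simp add: field_simps)
  show "u x * exp (\<i> * x) = (osc1 u u' x * exp (2 * \<i> * x) - osc2 u u' x) / (2 * \<i>)"
    unfolding B osc2_def by (simp add: field_simps)
qed

text \<open>
  The weight is constant along a horizontal line. It makes the derivatives of both components
  equally large, so that their growth can be controlled jointly.
\<close>

definition osc_pair :: "(complex \<Rightarrow> complex) \<Rightarrow> (complex \<Rightarrow> complex) \<Rightarrow> complex \<Rightarrow> complex \<times> complex" where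
  "osc_pair u u' x = (osc1 u u' x, of_real (exp (2 * Im x)) * osc2 u u' x)"

lemma osc_deriv_bound:
  "norm (\<kappa> / x\<^sup>2 * u x * exp (- (\<i> * x))) \<le> norm \<kappa> / (norm x)\<^sup>2 * norm (osc_pair u u' x)"
  "exp (2 * Im x) * norm (\<kappa> / x\<^sup>2 * u x * exp (\<i> * x)) \<le> norm \<kappa> / (norm x)\<^sup>2 * norm (osc_pair u u' x)"
proof -
  have "norm (u x * exp (- (\<i> * x))) \<le> (norm (osc1 u u' x) + norm (osc2 u u' x * exp (- (2 * \<i> * x)))) / 2"
    using norm_triangle_ineq4[of "osc1 u u' x" "osc2 u u' x * exp (- (2 * \<i> * x))"]
    unfolding osc_recover(1)[of u x u'] norm_divide by (simp only: norm_mult) simp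
  also have "norm (osc2 u u' x * exp (- (2 * \<i> * x))) = norm (snd (osc_pair u u' x))"
    by (simp add: osc_pair_def norm_mult)
  also have "(norm (osc1 u u' x) + norm (snd (osc_pair u u' x))) / 2 \<le> norm (osc_pair u u' x)"
    using norm_fst_le[of "osc1 u u' x" "snd (osc_pair u u' x)"] norm_snd_le[of "snd (osc_pair u u' x)" "osc1 u u' x"]
    by (simp add: osc_pair_def)
  finally have *: "norm (u x * exp (- (\<i> * x))) \<le> norm (osc_pair u u' x)" .
  have "norm (\<kappa> / x\<^sup>2 * u x * exp (- (\<i> * x))) = norm \<kappa> / (norm x)\<^sup>2 * norm (u x * exp (- (\<i> * x)))"
    by (simp add: norm_mult norm_divide norm_power)
  also have "\<dots> \<le> norm \<kappa> / (norm x)\<^sup>2 * norm (osc_pair u u' x)" by (intro mult_left_mono *) auto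
  finally show "norm (\<kappa> / x\<^sup>2 * u x * exp (- (\<i> * x))) \<le> norm \<kappa> / (norm x)\<^sup>2 * norm (osc_pair u u' x)" .
  have "norm (exp (\<i> * x)) * exp (2 * Im x) = norm (exp (- (\<i> * x)))"
    by (simp flip: exp_add)
  then have "norm (A * exp (\<i> * x)) * exp (2 * Im x) = norm (A * exp (- (\<i> * x)))" for A
    by (simp only: norm_mult mult.assoc)
  then have "exp (2 * Im x) * norm (\<kappa> / x\<^sup>2 * u x * exp (\<i> * x)) = norm (\<kappa> / x\<^sup>2 * u x * exp (- (\<i> * x)))"
    by (simp only: mult.commute[of "exp (2 * Im x)"])
  with \<open>norm (\<kappa> / x\<^sup>2 * u x * exp (- (\<i> * x))) \<le> _\<close>
  show "exp (2 * Im x) * norm (\<kappa> / x\<^sup>2 * u x * exp (\<i> * x)) \<le> norm \<kappa> / (norm x)\<^sup>2 * norm (osc_pair u u' x)"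
    by simp
qed

lemma line_asymptotics:
  assumes ode: "bessel_ode \<kappa> u u'"
    and c: "0 < c" "\<And>s. 0 \<le> s \<Longrightarrow> x + of_real s \<notin> \<real>\<^sub>\<le>\<^sub>0"
      "\<And>s. 0 \<le> s \<Longrightarrow> c * (norm x + s) \<le> norm (x + of_real s)"
    and K: "K = 2 * norm \<kappa> / c\<^sup>2" "2 * K \<le> norm x"
  obtains p q where
    "((\<lambda>s. osc1 u u' (x + of_real s)) \<longlongrightarrow> p) at_top" "((\<lambda>s. osc2 u u' (x + of_real s)) \<longlongrightarrow> q) at_top"
    "norm (osc_pair u u' x - (p, of_real (exp (2 * Im x)) * q)) \<le> 2 * K / norm x * norm (p, of_real (exp (2 * Im x)) * q)"
    "\<And>s. 0 \<le> s \<Longrightarrow> norm (osc_pair u u' (x + of_real s)) \<le> 2 * norm (osc_pair u u' x)"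
proof -
  define E where "E = complex_of_real (exp (2 * Im x))"
  have E: "norm E = exp (2 * Im x)" "E \<noteq> 0" by (simp_all add: E_def)
  define f where "f = (\<lambda>s. osc_pair u u' (x + of_real s))"
  define f' where "f' = (\<lambda>s. let y = x + of_real s in
     (\<kappa> / y\<^sup>2 * u y * exp (- (\<i> * y)), E * (\<kappa> / y\<^sup>2 * u y * exp (\<i> * y))))"
  have f_eq: "f s = (osc1 u u' (x + of_real s), E * osc2 u u' (x + of_real s))" for s
    by (simp add: f_def osc_pair_def E_def)
  have x0: "x \<notin> \<real>\<^sub>\<le>\<^sub>0" using c(2)[of 0] by simp
  then have nx: "norm x > 0" by auto
  obtain L where L: "(f \<longlongrightarrow> L) at_top" "\<And>s. 0 \<le> s \<Longrightarrow> norm (f s - L) \<le> 2 * K / (norm x + s) * norm L"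
    "\<And>s. 0 \<le> s \<Longrightarrow> norm (f s) \<le> 2 * norm (f 0)"
  proof (rule asymptotic_integration[of K "norm x" f f'])
    show "0 \<le> K" "2 * K \<le> norm x" "0 < norm x" using K nx by auto
    fix s :: real assume s: "0 \<le> s"
    note ns = c(2)[OF s]
    have shift: "((\<lambda>s. x + complex_of_real s) has_vector_derivative 1) (at s)"
      by (auto intro!: derivative_eq_intros)
    have d1: "((\<lambda>s. osc1 u u' (x + of_real s)) has_vector_derivative
        (\<kappa> / (x + of_real s)\<^sup>2 * u (x + of_real s) * exp (- (\<i> * (x + of_real s))))) (at s)"
      using field_vector_diff_chain_at[OF shift osc_deriv(1)[OF ode ns]] by (simp add: o_def)
    have d2: "((\<lambda>s. osc2 u u' (x + of_real s)) has_vector_derivative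
        (\<kappa> / (x + of_real s)\<^sup>2 * u (x + of_real s) * exp (\<i> * (x + of_real s)))) (at s)"
      using field_vector_diff_chain_at[OF shift osc_deriv(2)[OF ode ns]] by (simp add: o_def)
    show "(f has_vector_derivative f' s) (at s)"
      unfolding f_eq[abs_def] f'_def Let_def
      by (intro has_vector_derivative_Pair d1 has_vector_derivative_mult_right d2)
    have Im: "Im (x + of_real s) = Im x" by simp
    have n2: "norm (E * z) = exp (2 * Im x) * norm z" for z by (simp only: norm_mult E(1))
    have "norm (f' s) \<le> norm (\<kappa> / (x + of_real s)\<^sup>2 * u (x + of_real s) * exp (- (\<i> * (x + of_real s)))) +
       exp (2 * Im x) * norm (\<kappa> / (x + of_real s)\<^sup>2 * u (x + of_real s) * exp (\<i> * (x + of_real s)))"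
      unfolding f'_def Let_def n2[symmetric] by (rule norm_Pair_le)
    also have "\<dots> \<le> 2 * norm \<kappa> / (norm (x + of_real s))\<^sup>2 * norm (f s)"
      using osc_deriv_bound[where \<kappa> = \<kappa> and x = "x + of_real s" and u = u and u' = u'] unfolding Im f_def by simp
    also have "\<dots> \<le> 2 * norm \<kappa> / (c * (norm x + s))\<^sup>2 * norm (f s)"
    proof -
      have p: "0 < c * (norm x + s)" using c(1) nx s by (intro mult_pos_pos add_pos_nonneg)
      then have "0 < norm (x + of_real s)" using c(3)[OF s] by linarith
      moreover have "(c * (norm x + s))\<^sup>2 \<le> (norm (x + of_real s))\<^sup>2"
        using p c(3)[OF s] by (intro power_mono) auto
      moreover have "a / B\<^sup>2 * d \<le> a / A\<^sup>2 * d" if "0 < A" "0 < B" "A\<^sup>2 \<le> B\<^sup>2" "0 \<le> a" "0 \<le> d" for a d A B :: real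
        using that by (intro mult_right_mono divide_left_mono mult_pos_pos zero_less_power) auto
      ultimately show ?thesis using p by (metis norm_ge_zero mult_nonneg_nonneg zero_le_numeral)
    qed
    also have "2 * norm \<kappa> / (c * (norm x + s))\<^sup>2 = K / (norm x + s)\<^sup>2"
      by (simp add: K power_mult_distrib)
    finally show "norm (f' s) \<le> K / (norm x + s)\<^sup>2 * norm (f s)" .
  qed (blast intro: that)
  define p q where "p = fst L" and "q = snd L / E"
  have Leq: "L = (p, E * q)" using E by (simp add: p_def q_def)
  have "((\<lambda>s. osc1 u u' (x + of_real s)) \<longlongrightarrow> p) at_top"
    using tendsto_fst[OF L(1)] by (simp add: f_eq p_def)
  moreover have "((\<lambda>s. osc2 u u' (x + of_real s)) \<longlongrightarrow> q) at_top"
    using tendsto_divide[OF tendsto_snd[OF L(1)] tendsto_const[of E]] E by (simp add: f_eq q_def)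
  moreover have "norm (osc_pair u u' x - (p, E * q)) \<le> 2 * K / norm x * norm (p, E * q)"
    using L(2)[of 0] by (simp add: Leq f_def)
  moreover have "\<And>s. 0 \<le> s \<Longrightarrow> norm (osc_pair u u' (x + of_real s)) \<le> 2 * norm (osc_pair u u' x)"
    using L(3) by (simp add: f_def)
  ultimately show ?thesis using that[of p q] by (simp add: E_def)
qed

text \<open>
  The limits exist along every horizontal line and do not depend on the line. For the solution \<open>u\<close>
  this says \<open>u \<approx> (p exp (\<i> x) - q exp (- \<i> x)) / (2 \<i>)\<close> far to the right.
\<close>

definition connection :: "(complex \<Rightarrow> complex) \<Rightarrow> (complex \<Rightarrow> complex) \<Rightarrow> complex \<Rightarrow> complex \<Rightarrow> bool" where
  "connection u u' p q \<longleftrightarrow> (\<forall>Y. ((\<lambda>t. osc1 u u' (Complex t Y)) \<longlongrightarrow> p) at_top \<and>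
      ((\<lambda>t. osc2 u u' (Complex t Y)) \<longlongrightarrow> q) at_top)"

text \<open>
  With \<open>m\<close> a lower bound for \<open>cos (Arg x)\<close> this is the law of cosines.
\<close>

lemma sector_shift_bound:
  assumes "norm x * m \<le> Re x" "m \<le> 1" "0 \<le> s"
  shows "sqrt ((1 + m) / 2) * (norm x + s) \<le> norm (x + of_real s)"
proof -
  have "(norm (x + of_real s))\<^sup>2 = (norm x)\<^sup>2 + 2 * s * Re x + s\<^sup>2"
    unfolding cmod_power2 by (simp add: power2_eq_square algebra_simps)
  moreover have "2 * s * (norm x * m) \<le> 2 * s * Re x"
    using assms by (intro mult_left_mono) auto
  moreover have "(norm x)\<^sup>2 + 2 * s * (norm x * m) + s\<^sup>2 = (1 + m) / 2 * (norm x + s)\<^sup>2 + (1 - m) / 2 * (norm x - s)\<^sup>2"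
    by (simp add: power2_eq_square field_simps)
  moreover have "(1 - m) / 2 * (norm x - s)\<^sup>2 \<ge> 0" using assms by simp
  ultimately have "(1 + m) / 2 * (norm x + s)\<^sup>2 \<le> (norm (x + of_real s))\<^sup>2" by linarith
  then have "sqrt ((1 + m) / 2 * (norm x + s)\<^sup>2) \<le> norm (x + of_real s)"
    by (metis real_sqrt_le_mono real_sqrt_abs abs_norm_cancel)
  moreover have "sqrt ((1 + m) / 2 * (norm x + s)\<^sup>2) = sqrt ((1 + m) / 2) * (norm x + s)"
    using assms(3) by (subst real_sqrt_mult) simp
  ultimately show ?thesis by simp
qed

lemma right_half_bound:
  assumes "0 < Re x" "0 \<le> s"
  shows "x + of_real s \<notin> \<real>\<^sub>\<le>\<^sub>0" "1 / 2 * (norm x + s) \<le> norm (x + of_real s)"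
proof -
  show "x + of_real s \<notin> \<real>\<^sub>\<le>\<^sub>0" using assms by (auto simp: complex_nonpos_Reals_iff)
  have "x \<noteq> 0" using assms by auto
  then have "sqrt ((1 + 0) / 2) * (norm x + s) \<le> norm (x + of_real s)"
    using assms by (intro sector_shift_bound) auto
  moreover have "1 / 2 \<le> sqrt ((1 + 0) / 2 :: real)" by (rule real_le_rsqrt) (simp add: power2_eq_square)
  then have "1 / 2 * (norm x + s) \<le> sqrt ((1 + 0) / 2) * (norm x + s)" using assms by (intro mult_right_mono) auto
  ultimately show "1 / 2 * (norm x + s) \<le> norm (x + of_real s)" by linarith
qed

lemma norm_cos_Arg: "norm x * cos (Arg x) = Re x"
proof (cases "x = 0")
  case False
  then have "Re x = Re (of_real (norm x) * exp (\<i> * of_real (Arg x)))" using Arg_eq by metis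
  then show ?thesis by (simp add: Re_exp)
qed simp

text \<open>
  A horizontal ray to the right that starts in a closed subsector of the slit plane stays
  away from \<open>0\<close> by a fixed multiple of \<open>norm x + s\<close>; so error bounds obtained along the rays are
  uniform in the sector.
\<close>

lemma sector_line_bound:
  assumes "- pi < a" "b < pi"
  obtains c where "0 < c" "\<And>x s. x \<noteq> 0 \<Longrightarrow> a \<le> Arg x \<Longrightarrow> Arg x \<le> b \<Longrightarrow> 0 \<le> s \<Longrightarrow>
     x + of_real s \<notin> \<real>\<^sub>\<le>\<^sub>0 \<and> c * (norm x + s) \<le> norm (x + of_real s)"
proof -
  define \<theta> where "\<theta> = max 0 (max \<bar>a\<bar> \<bar>b\<bar>)"
  define m where "m = min (cos \<theta>) 1"
  show ?thesis
  proof (cases "\<theta> < pi")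
    case True
    have "cos \<theta> > cos pi" by (rule cos_monotone_0_pi) (use True in \<open>auto simp: \<theta>_def\<close>)
    then have m: "m > -1" by (simp add: m_def)
    show ?thesis
    proof (rule that[of "sqrt ((1 + m) / 2)"])
      show "sqrt ((1 + m) / 2) > 0" using m by simp
      fix x :: complex and s :: real
      assume x: "x \<noteq> 0" "a \<le> Arg x" "Arg x \<le> b" and s: "0 \<le> s"
      have "\<bar>Arg x\<bar> \<le> \<theta>" using x by (auto simp: \<theta>_def)
      then have "cos \<theta> \<le> cos \<bar>Arg x\<bar>" using True by (intro cos_monotone_0_pi_le) auto
      then have "norm x * m \<le> norm x * cos (Arg x)" by (intro mult_left_mono) (auto simp: m_def)
      then have bnd: "sqrt ((1 + m) / 2) * (norm x + s) \<le> norm (x + of_real s)"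
        using s by (intro sector_shift_bound) (auto simp: norm_cos_Arg m_def)
      have "x \<notin> \<real>\<^sub>\<le>\<^sub>0" using x assms sector_slit[of x] by auto
      then have "x + of_real s \<notin> \<real>\<^sub>\<le>\<^sub>0" using s by (auto simp: complex_nonpos_Reals_iff)
      with bnd show "x + of_real s \<notin> \<real>\<^sub>\<le>\<^sub>0 \<and> sqrt ((1 + m) / 2) * (norm x + s) \<le> norm (x + of_real s)" by simp
    qed
  next
    case False
    \<comment> \<open>the sector is empty here\<close>
    then have "a \<ge> pi \<or> b \<le> - pi" using assms by (auto simp: \<theta>_def max_def split: if_splits)
    then have "\<not> (a \<le> Arg x \<and> Arg x \<le> b)" for x
      using Arg_bounded[of x] assms by (smt (verit))
    then show ?thesis by (intro that[of 1]) auto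
  qed
qed

lemma osc_continuous:
  assumes "bessel_ode \<kappa> u u'"
  shows "continuous_on (- \<real>\<^sub>\<le>\<^sub>0) (osc_pair u u')"
proof -
  have "continuous_on (- \<real>\<^sub>\<le>\<^sub>0) (osc1 u u')" "continuous_on (- \<real>\<^sub>\<le>\<^sub>0) (osc2 u u')"
    using osc_deriv[OF assms] by (auto intro!: continuous_at_imp_continuous_on DERIV_isCont)
  then show ?thesis unfolding osc_pair_def[abs_def] by (intro continuous_intros)
qed

text \<open>
  Each line has its own limits by \<open>line_asymptotics\<close>. Moving vertically at abscissa \<open>t\<close> from one line to
  another changes \<open>osc1\<close> and \<open>osc2\<close> by \<open>O(1/t\<^sup>2)\<close> only, so the limits agree.
\<close>

lemma connection_exists:
  assumes ode: "bessel_ode \<kappa> u u'"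
  obtains p q where "connection u u' p q"
proof -
  \<comment> \<open>From abscissa \<open>T\<close> on, \<open>line_asymptotics\<close> applies to every horizontal line.\<close>
  define K where "K = 2 * norm \<kappa> / (1 / 2)\<^sup>2"
  define T where "T = 2 * K + 1"
  have "K \<ge> 0" by (simp add: K_def)
  then have T: "T > 0" by (simp add: T_def)
  have line: "\<exists>p q. ((\<lambda>s. osc1 u u' (Complex T Y + of_real s)) \<longlongrightarrow> p) at_top \<and>
      ((\<lambda>s. osc2 u u' (Complex T Y + of_real s)) \<longlongrightarrow> q) at_top \<and>
      (\<forall>s\<ge>0. norm (osc_pair u u' (Complex T Y + of_real s)) \<le> 2 * norm (osc_pair u u' (Complex T Y)))" for Y
  proof -
    have "Re (Complex T Y) > 0" using T by simp
    note b = right_half_bound[OF this]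
    have "T \<le> norm (Complex T Y)" using complex_Re_le_cmod[of "Complex T Y"] by simp
    then have "2 * K \<le> norm (Complex T Y)" by (simp add: T_def)
    from line_asymptotics[OF ode _ b K_def this] show ?thesis by (metis zero_less_divide_1_iff zero_less_numeral)
  qed
  have shift: "Complex T Y + of_real s = Complex (T + s) Y" for Y s by (simp add: complex_eq_iff)
  have lim: "\<exists>p q. ((\<lambda>t. osc1 u u' (Complex t Y)) \<longlongrightarrow> p) at_top \<and> ((\<lambda>t. osc2 u u' (Complex t Y)) \<longlongrightarrow> q) at_top" for Y
  proof -
    have ft: "filterlim (\<lambda>t. t - T) at_top at_top"
      using filterlim_tendsto_add_at_top[OF tendsto_const[of "- T"] filterlim_ident] by simp
    obtain p q where "((\<lambda>s. osc1 u u' (Complex (T + s) Y)) \<longlongrightarrow> p) at_top" "((\<lambda>s. osc2 u u' (Complex (T + s) Y)) \<longlongrightarrow> q) at_top"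
      using line[of Y] unfolding shift by blast
    from filterlim_compose[OF this(1) ft] filterlim_compose[OF this(2) ft] show ?thesis by auto
  qed
  have bnd: "norm (osc_pair u u' (Complex t Y)) \<le> 2 * norm (osc_pair u u' (Complex T Y))" if "t \<ge> T" for t Y
    using line[of Y] that unfolding shift by (metis add_diff_cancel_left' diff_ge_0_iff_ge le_add_diff_inverse)
  have indep: "((\<lambda>t. osc1 u u' (Complex t Y) - osc1 u u' (Complex t 0)) \<longlongrightarrow> 0) at_top \<and>
     ((\<lambda>t. osc2 u u' (Complex t Y) - osc2 u u' (Complex t 0)) \<longlongrightarrow> 0) at_top" for Y
  proof -
    have "compact (osc_pair u u' ` closed_segment (Complex T Y) (Complex T 0))"
    proof (intro compact_continuous_image continuous_on_subset[OF osc_continuous[OF ode]])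
      show "closed_segment (Complex T Y) (Complex T 0) \<subseteq> - \<real>\<^sub>\<le>\<^sub>0"
      proof
        fix z assume "z \<in> closed_segment (Complex T Y) (Complex T 0)"
        then obtain v where "z = (1 - v) *\<^sub>R Complex T Y + v *\<^sub>R Complex T 0" by (auto simp: closed_segment_def)
        then have "Re z = (1 - v) * T + v * T" by (simp only:) simp
        then have "Re z = T" by (simp add: algebra_simps)
        then show "z \<in> - \<real>\<^sub>\<le>\<^sub>0" using T by (auto simp: complex_nonpos_Reals_iff)
      qed
    qed simp
    then have "bounded (osc_pair u u' ` closed_segment (Complex T Y) (Complex T 0))" by (rule compact_imp_bounded)
    then obtain B where B: "\<And>z. z \<in> closed_segment (Complex T Y) (Complex T 0) \<Longrightarrow> norm (osc_pair u u' z) \<le> B"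
      by (auto simp: bounded_iff)
    have B0: "B \<ge> 0" using B[of "Complex T Y"] norm_ge_zero order.trans by (metis ends_in_segment(1))
    define D where "D = norm \<kappa> * (2 * B) * exp (2 * \<bar>Y\<bar>)"
    have D0: "D \<ge> 0" using B0 by (simp add: D_def)
    have est: "norm (osc1 u u' (Complex t Y) - osc1 u u' (Complex t 0)) \<le> D / t\<^sup>2 * \<bar>Y\<bar> \<and>
        norm (osc2 u u' (Complex t Y) - osc2 u u' (Complex t 0)) \<le> D / t\<^sup>2 * \<bar>Y\<bar>" if t: "t \<ge> T" for t
    proof -
      let ?S = "closed_segment (Complex t Y) (Complex t 0)"
      have S: "Re z = t \<and> \<bar>Im z\<bar> \<le> \<bar>Y\<bar> \<and> z \<notin> \<real>\<^sub>\<le>\<^sub>0 \<and> norm (osc_pair u u' z) \<le> 2 * B" if z: "z \<in> ?S" for z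
      proof -
        obtain v where v: "0 \<le> v" "v \<le> 1" "z = (1 - v) *\<^sub>R Complex t Y + v *\<^sub>R Complex t 0"
          using z by (auto simp: closed_segment_def)
        have zz: "z = Complex t ((1 - v) * Y)" using v(3) by (simp add: complex_eq_iff algebra_simps)
        have "Complex T ((1 - v) * Y) = (1 - v) *\<^sub>R Complex T Y + v *\<^sub>R Complex T 0" by (simp add: complex_eq_iff algebra_simps)
        then have "Complex T ((1 - v) * Y) \<in> closed_segment (Complex T Y) (Complex T 0)"
          using v(1,2) by (auto simp: closed_segment_def)
        then have "norm (osc_pair u u' z) \<le> 2 * B" using bnd[OF t, of "(1 - v) * Y"] B unfolding zz by fastforce
        moreover have "\<bar>(1 - v) * Y\<bar> \<le> \<bar>Y\<bar>" using v(1,2) by (simp add: abs_mult mult_left_le_one_le)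
        ultimately show ?thesis using T t by (auto simp: zz complex_nonpos_Reals_iff)
      qed
      have key: "norm (\<kappa> / z\<^sup>2 * u z * exp (- (\<i> * z))) \<le> D / t\<^sup>2" "norm (\<kappa> / z\<^sup>2 * u z * exp (\<i> * z)) \<le> D / t\<^sup>2"
        if z: "z \<in> ?S" for z
      proof -
        have nz: "t \<le> norm z" using S[OF z] complex_Re_le_cmod[of z] by simp
        have "norm \<kappa> / (norm z)\<^sup>2 * norm (osc_pair u u' z) \<le> norm \<kappa> / t\<^sup>2 * (2 * B)"
        proof (intro mult_mono divide_left_mono power_mono mult_pos_pos)
          have "0 < t" using T t by linarith
          then show "0 < (norm z)\<^sup>2" "0 < t\<^sup>2" using nz by auto
        qed (use S[OF z] nz T t in auto)
        then have e: "norm \<kappa> / (norm z)\<^sup>2 * norm (osc_pair u u' z) \<le> D / t\<^sup>2 * exp (- 2 * \<bar>Y\<bar>)"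
        proof -
          have "exp (2 * \<bar>Y\<bar>) * exp (- 2 * \<bar>Y\<bar>) = 1" by (simp flip: exp_add)
          moreover have "D / t\<^sup>2 * exp (- 2 * \<bar>Y\<bar>) = norm \<kappa> / t\<^sup>2 * (2 * B) * (exp (2 * \<bar>Y\<bar>) * exp (- 2 * \<bar>Y\<bar>))"
            by (simp add: D_def)
          ultimately have "D / t\<^sup>2 * exp (- 2 * \<bar>Y\<bar>) = norm \<kappa> / t\<^sup>2 * (2 * B)"
            by (simp only: mult_1_right)
          then show ?thesis using \<open>_ \<le> norm \<kappa> / t\<^sup>2 * (2 * B)\<close> by (simp only:)
        qed
        have "exp (- 2 * \<bar>Y\<bar>) \<le> 1" by simp
        then have "D / t\<^sup>2 * exp (- 2 * \<bar>Y\<bar>) \<le> D / t\<^sup>2 * 1" using D0 by (intro mult_left_mono) auto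
        then show "norm (\<kappa> / z\<^sup>2 * u z * exp (- (\<i> * z))) \<le> D / t\<^sup>2"
          using osc_deriv_bound(1)[of \<kappa> z u u'] e by linarith
        have "exp (- 2 * \<bar>Y\<bar>) * norm (\<kappa> / z\<^sup>2 * u z * exp (\<i> * z)) \<le> exp (2 * Im z) * norm (\<kappa> / z\<^sup>2 * u z * exp (\<i> * z))"
          using S[OF z] by (intro mult_right_mono) auto
        also have "\<dots> \<le> exp (- 2 * \<bar>Y\<bar>) * (D / t\<^sup>2)" using osc_deriv_bound(2)[where \<kappa> = \<kappa> and x = z and u = u and u' = u'] e by (simp add: mult.commute)
        finally show "norm (\<kappa> / z\<^sup>2 * u z * exp (\<i> * z)) \<le> D / t\<^sup>2"
          by (rule mult_left_le_imp_le) simp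
      qed
      have d: "dist (Complex t Y) (Complex t 0) = \<bar>Y\<bar>" by (simp add: dist_norm cmod_def)
      have "norm (osc1 u u' (Complex t Y) - osc1 u u' (Complex t 0)) \<le> D / t\<^sup>2 * norm (Complex t Y - Complex t 0)"
        by (rule field_differentiable_bound[OF convex_closed_segment, where f' = "\<lambda>z. \<kappa> / z\<^sup>2 * u z * exp (- (\<i> * z))"])
          (use S key osc_deriv[OF ode] in \<open>auto intro: has_field_derivative_at_within\<close>)
      moreover have "norm (osc2 u u' (Complex t Y) - osc2 u u' (Complex t 0)) \<le> D / t\<^sup>2 * norm (Complex t Y - Complex t 0)"
        by (rule field_differentiable_bound[OF convex_closed_segment, where f' = "\<lambda>z. \<kappa> / z\<^sup>2 * u z * exp (\<i> * z)"])
          (use S key osc_deriv[OF ode] in \<open>auto intro: has_field_derivative_at_within\<close>)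
      ultimately show ?thesis using d by (simp add: dist_norm)
    qed
    have z: "((\<lambda>t. D / t\<^sup>2 * \<bar>Y\<bar>) \<longlongrightarrow> 0) at_top"
      by (intro tendsto_mult_left_zero tendsto_divide_0[OF tendsto_const] filterlim_at_top_imp_at_infinity
          filterlim_pow_at_top filterlim_ident) simp
    have ev: "eventually (\<lambda>t. t \<ge> T) at_top" by (rule eventually_ge_at_top)
    show ?thesis
      by (intro conjI Lim_null_comparison[OF eventually_mono[OF ev] z]) (use est in auto)
  qed
  obtain p q where pq: "((\<lambda>t. osc1 u u' (Complex t 0)) \<longlongrightarrow> p) at_top" "((\<lambda>t. osc2 u u' (Complex t 0)) \<longlongrightarrow> q) at_top"
    using lim by blast
  have "connection u u' p q"
    unfolding connection_def
    using tendsto_add[OF conjunct1[OF indep] pq(1)] tendsto_add[OF conjunct2[OF indep] pq(2)] by simp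
  then show ?thesis by (rule that)
qed

text \<open>
  Both bounds compare a point \<open>x\<close> with the point at infinity on the horizontal ray through \<open>x\<close>.
\<close>

lemma connection_bound:
  assumes ode: "bessel_ode \<kappa> u u'" and con: "connection u u' p q"
    and c: "0 < c" "\<forall>s\<ge>0. x + of_real s \<notin> \<real>\<^sub>\<le>\<^sub>0 \<and> c * (norm x + s) \<le> norm (x + of_real s)"
    and K: "K = 2 * norm \<kappa> / c\<^sup>2" "2 * K \<le> norm x"
  shows "norm (osc1 u u' x - p) \<le> 2 * K / norm x * (norm p + exp (2 * Im x) * norm q)"
    and "norm (osc2 u u' x - q) \<le> 2 * K / norm x * (exp (- 2 * Im x) * norm p + norm q)"
proof -
  obtain p' q' where
    p': "((\<lambda>s. osc1 u u' (x + of_real s)) \<longlongrightarrow> p') at_top" and q': "((\<lambda>s. osc2 u u' (x + of_real s)) \<longlongrightarrow> q') at_top"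
    and b: "norm (osc_pair u u' x - (p', of_real (exp (2 * Im x)) * q')) \<le> 2 * K / norm x * norm (p', of_real (exp (2 * Im x)) * q')"
    using line_asymptotics[OF ode c(1) _ _ K] c(2) by metis
  have sh: "x + of_real s = Complex (s + Re x) (Im x)" for s by (simp add: complex_eq_iff)
  have ft: "filterlim (\<lambda>s. s + Re x) at_top at_top"
    using filterlim_tendsto_add_at_top[OF tendsto_const[of "Re x"] filterlim_ident] by (simp add: add.commute)
  have "((\<lambda>s. osc1 u u' (x + of_real s)) \<longlongrightarrow> p) at_top" "((\<lambda>s. osc2 u u' (x + of_real s)) \<longlongrightarrow> q) at_top"
    unfolding sh using con filterlim_compose[OF _ ft] unfolding connection_def by blast+
  then have pq: "p' = p" "q' = q" using p' q' tendsto_unique[OF trivial_limit_at_top_linorder] by blast+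
  define E where "E = exp (2 * Im x)"
  have "norm (osc_pair u u' x - (p, of_real E * q)) \<le> 2 * K / norm x * (norm p + E * norm q)"
  proof (rule order.trans[OF b[unfolded pq, folded E_def]], intro mult_left_mono)
    have "norm (p, of_real E * q) \<le> norm p + norm (of_real E * q)" by (rule norm_Pair_le)
    then show "norm (p, complex_of_real E * q) \<le> norm p + E * norm q" by (simp add: norm_mult E_def)
    show "0 \<le> 2 * K / norm x" by (simp add: K)
  qed
  moreover have "osc_pair u u' x - (p, of_real E * q) = (osc1 u u' x - p, of_real E * (osc2 u u' x - q))"
    by (simp add: osc_pair_def E_def algebra_simps)
  ultimately have n: "norm (osc1 u u' x - p, complex_of_real E * (osc2 u u' x - q)) \<le> 2 * K / norm x * (norm p + E * norm q)" by simp
  show "norm (osc1 u u' x - p) \<le> 2 * K / norm x * (norm p + exp (2 * Im x) * norm q)"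
    using order.trans[OF norm_fst_le n] by (simp add: E_def)
  have "E * norm (osc2 u u' x - q) \<le> 2 * K / norm x * (norm p + E * norm q)"
    using order.trans[OF norm_snd_le n] by (simp add: E_def norm_mult)
  then have "exp (- 2 * Im x) * (E * norm (osc2 u u' x - q)) \<le> exp (- 2 * Im x) * (2 * K / norm x * (norm p + E * norm q))"
    by (intro mult_left_mono) auto
  moreover have "exp (- 2 * Im x) * (E * y) = y" for y by (simp add: E_def flip: mult.assoc exp_add)
  moreover have "exp (- 2 * Im x) * (2 * K / norm x * (norm p + E * norm q)) =
     2 * K / norm x * (exp (- 2 * Im x) * norm p + exp (- 2 * Im x) * (E * norm q))"
    by (simp only: distrib_left mult.left_commute)
  ultimately show "norm (osc2 u u' x - q) \<le> 2 * K / norm x * (exp (- 2 * Im x) * norm p + norm q)"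
    by (simp only:)
qed

section \<open>Connection constants of the Bessel function of the first kind\<close>

text \<open>
  \<open>sqrt_J'\<close> is its derivative with respect to the argument.
\<close>

definition sqrt_J :: "complex \<Rightarrow> complex \<Rightarrow> complex" where
  "sqrt_J \<nu> x = x powr (1 / 2) * Bessel_J \<nu> x"

definition sqrt_J' :: "complex \<Rightarrow> complex \<Rightarrow> complex" where
  "sqrt_J' \<nu> x = (\<nu> + 1 / 2) / x * sqrt_J \<nu> x - sqrt_J (\<nu> + 1) x"

lemma sqrt_scaled_deriv:
  fixes x :: complex
  assumes "x \<notin> \<real>\<^sub>\<le>\<^sub>0" "(C has_field_derivative a / x * C x + d) (at x)"
  shows "((\<lambda>x. x powr (1 / 2) * C x) has_field_derivative
    (a + 1 / 2) / x * (x powr (1 / 2) * C x) + x powr (1 / 2) * d) (at x)"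
proof -
  have "x \<noteq> 0" using assms by auto
  have "((\<lambda>x. x powr (1 / 2)) has_field_derivative (1 / 2) * x powr (1 / 2 - 1)) (at x)"
    by (rule has_field_derivative_powr[OF assms(1)])
  also have "x powr (1 / 2 - 1) = x powr (1 / 2) / x"
    using \<open>x \<noteq> 0\<close> by (subst powr_diff) auto
  finally have "((\<lambda>x. x powr (1 / 2)) has_field_derivative (1 / 2) * (x powr (1 / 2) / x)) (at x)" .
  from DERIV_mult[OF this assms(2)] show ?thesis
    by (rule DERIV_cong) (simp add: add_divide_distrib algebra_simps)
qed

lemma sqrt_J_ode: "bessel_ode (\<nu>\<^sup>2 - 1 / 4) (sqrt_J \<nu>) (sqrt_J' \<nu>)"
  unfolding bessel_ode_def
proof (intro allI impI conjI)
  fix x :: complex assume x: "x \<notin> \<real>\<^sub>\<le>\<^sub>0"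
  then have x0: "x \<noteq> 0" by auto
  have d1: "(sqrt_J \<nu> has_field_derivative sqrt_J' \<nu> x) (at x)" for \<nu>
  proof -
    have "(Bessel_J \<nu> has_field_derivative \<nu> / x * Bessel_J \<nu> x + - Bessel_J (\<nu> + 1) x) (at x)"
      using Bessel_J_deriv_up[OF x, of \<nu>] by simp
    from sqrt_scaled_deriv[OF x this] show ?thesis
      by (simp add: sqrt_J_def[abs_def] sqrt_J'_def)
  qed
  then show "(sqrt_J \<nu> has_field_derivative sqrt_J' \<nu> x) (at x)" .
  have r: "sqrt_J (\<nu> + 1 + 1) x = 2 * (\<nu> + 1) / x * sqrt_J (\<nu> + 1) x - sqrt_J \<nu> x"
  proof -
    have "Bessel_J (\<nu> + 1 + 1) x = 2 * (\<nu> + 1) / x * Bessel_J (\<nu> + 1) x - Bessel_J \<nu> x"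
      using Bessel_J_rec[OF x0, of "\<nu> + 1"] by simp
    then show ?thesis unfolding sqrt_J_def by (simp only:) (simp add: algebra_simps)
  qed
  have i: "((\<lambda>x. (\<nu> + 1 / 2) / x) has_field_derivative - (\<nu> + 1 / 2) / x\<^sup>2) (at x)"
    using x0 by (auto intro!: derivative_eq_intros simp: power2_eq_square)
  from DERIV_diff[OF DERIV_mult[OF i d1[of \<nu>]] d1[of "\<nu> + 1"]]
  show "(sqrt_J' \<nu> has_field_derivative ((\<nu>\<^sup>2 - 1 / 4) / x\<^sup>2 - 1) * sqrt_J \<nu> x) (at x)"
    unfolding sqrt_J'_def[abs_def] r
    by (rule DERIV_cong) (use x0 in \<open>simp add: field_simps power2_eq_square\<close>)
qed

text \<open>
  This is \<open>\<surd>y exp (-y) I\<^sub>\<nu>(y)\<close> with the modified Bessel function \<open>I\<^sub>\<nu>\<close>.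
\<close>

definition scaled_I :: "complex \<Rightarrow> real \<Rightarrow> complex" where
  "scaled_I \<nu> y = of_real y powr (1 / 2) * of_real (y / 2) powr \<nu> * exp (- of_real y) * J_series \<nu> (- (of_real (y / 2))\<^sup>2)"

lemma powr_times_pos:
  "0 < r \<Longrightarrow> z \<noteq> 0 \<Longrightarrow> (of_real r * z) powr s = of_real r powr s * z powr (s :: complex)"
  by (simp add: powr_def Ln_times_of_real Ln_of_real distrib_left exp_add)

lemma sqrt_J_imaginary:
  assumes "y > 0"
  shows "sqrt_J \<nu> (of_real y * - \<i>) = exp (- (\<i> * of_real pi / 2 * (\<nu> + 1 / 2))) * (exp (of_real y) * scaled_I \<nu> y)"
    and "sqrt_J \<nu> (of_real y * \<i>) = exp (\<i> * of_real pi / 2 * (\<nu> + 1 / 2)) * (exp (of_real y) * scaled_I \<nu> y)"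
proof -
  have half: "of_real y * z / 2 = of_real (y / 2) * z" for z :: complex by simp
  have e: "exp (of_real y) * (A * B * exp (- of_real y) * C) = A * B * C" for A B C :: complex
    by (simp add: exp_minus)
  have p: "(- \<i>) powr s = exp (- (\<i> * of_real pi / 2 * s))" "\<i> powr s = exp (\<i> * of_real pi / 2 * s)" for s
    by (simp_all add: powr_def mult_ac)
  have sq: "(z * - \<i>)\<^sup>2 = - z\<^sup>2" "(z * \<i>)\<^sup>2 = - z\<^sup>2" for z :: complex
    by (simp_all add: power_mult_distrib)
  have y2: "y / 2 > 0" using assms by simp
  have ne: "- \<i> \<noteq> 0" "\<i> \<noteq> 0" by simp_all
  have pe: "exp (- (\<i> * of_real pi / 2 * (\<nu> + 1 / 2))) = exp (- (\<i> * of_real pi / 2 * \<nu>)) * exp (- (\<i> * of_real pi / 2 * (1 / 2)))"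
    "exp (\<i> * of_real pi / 2 * (\<nu> + 1 / 2)) = exp (\<i> * of_real pi / 2 * \<nu>) * exp (\<i> * of_real pi / 2 * (1 / 2))"
    by (simp_all only: distrib_left minus_add_distrib exp_add)
  show "sqrt_J \<nu> (of_real y * - \<i>) = exp (- (\<i> * of_real pi / 2 * (\<nu> + 1 / 2))) * (exp (of_real y) * scaled_I \<nu> y)"
    unfolding sqrt_J_def Bessel_J_eq scaled_I_def half sq e powr_times_pos[OF assms ne(1)] powr_times_pos[OF y2 ne(1)] p
    unfolding pe by (simp only: mult_ac)
  show "sqrt_J \<nu> (of_real y * \<i>) = exp (\<i> * of_real pi / 2 * (\<nu> + 1 / 2)) * (exp (of_real y) * scaled_I \<nu> y)"
    unfolding sqrt_J_def Bessel_J_eq scaled_I_def half sq e powr_times_pos[OF assms ne(2)] powr_times_pos[OF y2 ne(2)] p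
    unfolding pe by (simp only: mult_ac)
qed

lemma imaginary_line_bound:
  assumes "Re x = 0" "x \<noteq> 0" "0 \<le> s"
  shows "x + of_real s \<notin> \<real>\<^sub>\<le>\<^sub>0 \<and> sqrt (1 / 2) * (norm x + s) \<le> norm (x + of_real s)"
proof
  have "Im x \<noteq> 0" using assms by (auto simp: complex_eq_iff)
  then show "x + of_real s \<notin> \<real>\<^sub>\<le>\<^sub>0" by (simp add: complex_nonpos_Reals_iff)
  show "sqrt (1 / 2) * (norm x + s) \<le> norm (x + of_real s)"
    using sector_shift_bound[of x 0 s] assms by simp
qed

lemma tendsto_decay: "((\<lambda>y::real. C / y) \<longlongrightarrow> (0 :: real)) at_top"
  by (intro tendsto_divide_0[OF tendsto_const] filterlim_at_top_imp_at_infinity filterlim_ident)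

text \<open>
  On the negative imaginary axis \<open>exp (\<i> x)\<close> is large and \<open>exp (- \<i> x)\<close> small, so the values of \<open>sqrt_J\<close>
  there reveal the first connection constant. The positive imaginary axis reveals the
  second. Both axes lead to the same function \<open>scaled_I\<close>, and both constants are given by its limit.
\<close>

lemma sqrt_J_connection:
  obtains A where "(scaled_I \<nu> \<longlongrightarrow> A) at_top"
    "connection (sqrt_J \<nu>) (sqrt_J' \<nu>) (2 * \<i> * A * exp (- (\<i> * of_real pi / 2 * (\<nu> + 1 / 2))))
       (- (2 * \<i> * A * exp (\<i> * of_real pi / 2 * (\<nu> + 1 / 2))))"
proof -
  define \<kappa> where "\<kappa> = \<nu>\<^sup>2 - 1 / 4"
  define c where "c = sqrt (1 / 2 :: real)"
  define K where "K = 2 * norm \<kappa> / c\<^sup>2"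
  define w where "w = exp (\<i> * of_real pi / 2 * (\<nu> + 1 / 2))"
  have w: "w \<noteq> 0" "exp (- (\<i> * of_real pi / 2 * (\<nu> + 1 / 2))) = 1 / w" by (simp_all add: w_def exp_minus inverse_eq_divide)
  have c: "c > 0" by (simp add: c_def)
  have K0: "K \<ge> 0" by (simp add: K_def)
  note ode = sqrt_J_ode[of \<nu>, folded \<kappa>_def]
  obtain p q where con: "connection (sqrt_J \<nu>) (sqrt_J' \<nu>) p q" using connection_exists[OF ode] .
  define D where "D = 2 * K * (norm p + norm q)"
  let ?o1 = "osc1 (sqrt_J \<nu>) (sqrt_J' \<nu>)" and ?o2 = "osc2 (sqrt_J \<nu>) (sqrt_J' \<nu>)"
  have big: "eventually (\<lambda>y. y \<ge> max 1 (2 * K)) at_top" by (rule eventually_ge_at_top)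
  have e0: "((\<lambda>y::real. exp (- 2 * y)) \<longlongrightarrow> 0) at_top"
    by real_asymp
  \<comment> \<open>On each half of the axis, the quantity that belongs to the smaller exponential is multiplied by
    the square of that exponential, which makes it negligible in \<open>osc_recover\<close>.\<close>
  have lower: "norm (?o1 (of_real y * - \<i>) - p) \<le> D / y \<and>
      norm (?o2 (of_real y * - \<i>) * exp (- (2 * \<i> * (of_real y * - \<i>)))) \<le> D / y + exp (- 2 * y) * norm q"
    and upper: "norm (?o2 (of_real y * \<i>) - q) \<le> D / y \<and>
      norm (?o1 (of_real y * \<i>) * exp (2 * \<i> * (of_real y * \<i>))) \<le> D / y + exp (- 2 * y) * norm p"
    if y: "y \<ge> max 1 (2 * K)" for y
  proof -
    have y0: "y > 0" "2 * K \<le> y" using y by auto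
    have bnd: "2 * K / y * (a + exp (- 2 * y) * b) \<le> D / y" if "a + b = norm p + norm q" "0 \<le> b" for a b
    proof -
      have "exp (- 2 * y) * b \<le> 1 * b" using y0 that by (intro mult_right_mono) auto
      then have "2 * K / y * (a + exp (- 2 * y) * b) \<le> 2 * K / y * (norm p + norm q)"
        using that y0 K0 by (intro mult_left_mono) auto
      then show ?thesis by (simp add: D_def)
    qed
    have exp1: "exp (- 2 * y) * exp (2 * y) = 1" by (simp flip: exp_add)
    have cl: "\<forall>s\<ge>0. of_real y * - \<i> + of_real s \<notin> \<real>\<^sub>\<le>\<^sub>0 \<and> c * (norm (of_real y * - \<i>) + s) \<le> norm (of_real y * - \<i> + of_real s)"
      "\<forall>s\<ge>0. of_real y * \<i> + of_real s \<notin> \<real>\<^sub>\<le>\<^sub>0 \<and> c * (norm (of_real y * \<i>) + s) \<le> norm (of_real y * \<i> + of_real s)"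
      unfolding c_def by (intro allI impI imaginary_line_bound; use y0 in simp)+
    have nrm: "norm (of_real y * - \<i>) = y" "norm (of_real y * \<i>) = y" using y0 by (simp_all add: norm_mult)
    note L = connection_bound[OF ode con c cl(1) K_def, unfolded nrm, OF y0(2)]
    note U = connection_bound[OF ode con c cl(2) K_def, unfolded nrm, OF y0(2)]
    have "norm (?o1 (of_real y * - \<i>) - p) \<le> D / y"
      using L(1) bnd[of "norm p" "norm q"] by simp
    moreover have "norm (?o2 (of_real y * - \<i>) * exp (- (2 * \<i> * (of_real y * - \<i>)))) \<le> D / y + exp (- 2 * y) * norm q"
    proof -
      have "norm (?o2 (of_real y * - \<i>)) \<le> 2 * K / y * (exp (2 * y) * norm p + norm q) + norm q"
        using L(2) norm_triangle_ineq2[of "?o2 (of_real y * - \<i>)" q] by simp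
      then have "exp (- 2 * y) * norm (?o2 (of_real y * - \<i>)) \<le> exp (- 2 * y) * (2 * K / y * (exp (2 * y) * norm p + norm q) + norm q)"
        by (intro mult_left_mono) auto
      also have "\<dots> = 2 * K / y * ((exp (- 2 * y) * exp (2 * y)) * norm p + exp (- 2 * y) * norm q) + exp (- 2 * y) * norm q"
        by (simp only: distrib_left mult_ac)
      also have "\<dots> \<le> D / y + exp (- 2 * y) * norm q"
        unfolding exp1 using bnd[of "norm p" "norm q"] by simp
      finally show ?thesis by (simp add: norm_mult mult.commute)
    qed
    ultimately show "norm (?o1 (of_real y * - \<i>) - p) \<le> D / y \<and>
      norm (?o2 (of_real y * - \<i>) * exp (- (2 * \<i> * (of_real y * - \<i>)))) \<le> D / y + exp (- 2 * y) * norm q" ..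
    have "norm (?o2 (of_real y * \<i>) - q) \<le> D / y"
      using U(2) bnd[of "norm q" "norm p"] by (simp add: add.commute)
    moreover have "norm (?o1 (of_real y * \<i>) * exp (2 * \<i> * (of_real y * \<i>))) \<le> D / y + exp (- 2 * y) * norm p"
    proof -
      have "norm (?o1 (of_real y * \<i>)) \<le> 2 * K / y * (norm p + exp (2 * y) * norm q) + norm p"
        using U(1) norm_triangle_ineq2[of "?o1 (of_real y * \<i>)" p] by simp
      then have "exp (- 2 * y) * norm (?o1 (of_real y * \<i>)) \<le> exp (- 2 * y) * (2 * K / y * (norm p + exp (2 * y) * norm q) + norm p)"
        by (intro mult_left_mono) auto
      also have "\<dots> = 2 * K / y * ((exp (- 2 * y) * exp (2 * y)) * norm q + exp (- 2 * y) * norm p) + exp (- 2 * y) * norm p"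
        by (simp only: distrib_left mult_ac add_ac)
      also have "\<dots> \<le> D / y + exp (- 2 * y) * norm p"
        unfolding exp1 using bnd[of "norm q" "norm p"] by (simp add: add.commute)
      finally show ?thesis by (simp add: norm_mult mult.commute)
    qed
    ultimately show "norm (?o2 (of_real y * \<i>) - q) \<le> D / y \<and>
      norm (?o1 (of_real y * \<i>) * exp (2 * \<i> * (of_real y * \<i>))) \<le> D / y + exp (- 2 * y) * norm p" ..
  qed
  have d2: "((\<lambda>y. D / y + exp (- 2 * y) * r) \<longlongrightarrow> 0) at_top" for r
    using tendsto_add[OF tendsto_decay[of D] tendsto_mult_left_zero[OF e0, of r]] by simp
  have l1: "((\<lambda>y. ?o1 (of_real y * - \<i>)) \<longlongrightarrow> p) at_top"
    by (rule LIM_zero_cancel, rule Lim_null_comparison[OF eventually_mono[OF big] tendsto_decay[of D]]) (erule conjunct1[OF lower])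
  have l2: "((\<lambda>y. ?o2 (of_real y * - \<i>) * exp (- (2 * \<i> * (of_real y * - \<i>)))) \<longlongrightarrow> 0) at_top"
    by (rule Lim_null_comparison[OF eventually_mono[OF big] d2[of "norm q"]]) (erule conjunct2[OF lower])
  have u2: "((\<lambda>y. ?o2 (of_real y * \<i>)) \<longlongrightarrow> q) at_top"
    by (rule LIM_zero_cancel, rule Lim_null_comparison[OF eventually_mono[OF big] tendsto_decay[of D]]) (erule conjunct1[OF upper])
  have u1: "((\<lambda>y. ?o1 (of_real y * \<i>) * exp (2 * \<i> * (of_real y * \<i>))) \<longlongrightarrow> 0) at_top"
    by (rule Lim_null_comparison[OF eventually_mono[OF big] d2[of "norm p"]]) (erule conjunct2[OF upper])
  have pos: "eventually (\<lambda>y::real. y > 0) at_top" by (rule eventually_gt_at_top)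
  have cancel: "w * (1 / w * (E * F) * G) = F" "w * (E * F) * G / w = F" if "G * E = 1" for E F G
  proof -
    have "w * (1 / w * (E * F) * G) = (w * (1 / w)) * (G * E) * F" "w * (E * F) * G / w = (w * (1 / w)) * (G * E) * F"
      by (simp_all add: mult_ac)
    then show "w * (1 / w * (E * F) * G) = F" "w * (E * F) * G / w = F" using w(1) that by simp_all
  qed
  have A1: "(scaled_I \<nu> \<longlongrightarrow> w * (p / (2 * \<i>))) at_top"
  proof (rule Lim_transform_eventually)
    show "((\<lambda>y. w * (sqrt_J \<nu> (of_real y * - \<i>) * exp (- (\<i> * (of_real y * - \<i>))))) \<longlongrightarrow> w * (p / (2 * \<i>))) at_top"
      unfolding osc_recover(1)[of "sqrt_J \<nu>" _ "sqrt_J' \<nu>"]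
      using tendsto_mult_left[OF tendsto_divide[OF tendsto_diff[OF l1 l2] tendsto_const[of "2 * \<i>"]], of w] by simp
    show "eventually (\<lambda>y. w * (sqrt_J \<nu> (of_real y * - \<i>) * exp (- (\<i> * (of_real y * - \<i>)))) = scaled_I \<nu> y) at_top"
      using pos
    proof eventually_elim
      case (elim y)
      have "- (\<i> * (of_real y * - \<i>)) = - complex_of_real y" by (simp add: complex_eq_iff)
      then have "exp (- (\<i> * (of_real y * - \<i>))) * exp (of_real y) = (1 :: complex)"
        by (simp only:) (simp flip: exp_add)
      then show ?case
        unfolding sqrt_J_imaginary(1)[OF elim] w(2) by (rule cancel(1))
    qed
  qed
  have A2: "(scaled_I \<nu> \<longlongrightarrow> (- q / (2 * \<i>)) / w) at_top"
  proof (rule Lim_transform_eventually)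
    show "((\<lambda>y. (sqrt_J \<nu> (of_real y * \<i>) * exp (\<i> * (of_real y * \<i>))) / w) \<longlongrightarrow> (- q / (2 * \<i>)) / w) at_top"
      unfolding osc_recover(2)[of "sqrt_J \<nu>" _ "sqrt_J' \<nu>"]
      using tendsto_divide[OF tendsto_divide[OF tendsto_diff[OF u1 u2] tendsto_const[of "2 * \<i>"]] tendsto_const[of w]] w(1) by simp
    show "eventually (\<lambda>y. (sqrt_J \<nu> (of_real y * \<i>) * exp (\<i> * (of_real y * \<i>))) / w = scaled_I \<nu> y) at_top"
      using pos
    proof eventually_elim
      case (elim y)
      have "\<i> * (of_real y * \<i>) = - complex_of_real y" by (simp add: complex_eq_iff)
      then have "exp (\<i> * (of_real y * \<i>)) * exp (of_real y) = (1 :: complex)"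
        by (simp only:) (simp flip: exp_add)
      then show ?case
        unfolding sqrt_J_imaginary(2)[OF elim] w_def[symmetric] by (rule cancel(2))
    qed
  qed
  define A where "A = w * (p / (2 * \<i>))"
  have "A = (- q / (2 * \<i>)) / w" unfolding A_def by (rule tendsto_unique[OF _ A1 A2]) simp
  then have "A * w = - q / (2 * \<i>)" using w(1) by simp
  then have "2 * \<i> * (A * w) = 2 * \<i> * (- q / (2 * \<i>))" by (simp only:)
  also have "\<dots> = - q" by simp
  finally have qA: "- (2 * \<i> * A * exp (\<i> * of_real pi / 2 * (\<nu> + 1 / 2))) = q"
    unfolding w_def[symmetric] by (simp only: mult.assoc minus_minus)
  have pA: "2 * \<i> * A * exp (- (\<i> * of_real pi / 2 * (\<nu> + 1 / 2))) = p"
    unfolding w(2) A_def using w(1) by simp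
  show ?thesis
  proof (rule that)
    show "(scaled_I \<nu> \<longlongrightarrow> A) at_top" unfolding A_def by (rule A1)
    show "connection (sqrt_J \<nu>) (sqrt_J' \<nu>) (2 * \<i> * A * exp (- (\<i> * of_real pi / 2 * (\<nu> + 1 / 2))))
       (- (2 * \<i> * A * exp (\<i> * of_real pi / 2 * (\<nu> + 1 / 2))))"
      unfolding pA qA by (rule con)
  qed
qed

lemma scaled_I_rec:
  assumes "y > 0"
  shows "scaled_I (\<nu> - 1) y = of_real (2 / y) * (\<nu> * scaled_I \<nu> y) + scaled_I (\<nu> + 1) y"
proof -
  have y: "complex_of_real (y / 2) \<noteq> 0" using assms by simp
  define z where "z = complex_of_real (y / 2)"
  have "complex_of_real (2 / y) = 1 / z" by (simp add: z_def)
  then show ?thesis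
    using y assms unfolding scaled_I_def J_series_rec z_def[symmetric]
    by (simp add: powr_add powr_diff field_simps power2_eq_square)
qed

text \<open>
  In the recurrence \<open>scaled_I_rec\<close> the middle term has a factor \<open>1/y\<close>.
\<close>

lemma scaled_I_limit_periodic:
  assumes A: "(scaled_I (\<nu> + 1) \<longlongrightarrow> A) at_top"
  shows "(scaled_I (\<nu> - 1) \<longlongrightarrow> A) at_top"
proof -
  obtain B where B: "(scaled_I \<nu> \<longlongrightarrow> B) at_top" using sqrt_J_connection[of \<nu>] .
  have "((\<lambda>y. complex_of_real (2 / y)) \<longlongrightarrow> of_real 0) at_top"
    by (intro tendsto_of_real tendsto_decay)
  then have "((\<lambda>y. of_real (2 / y) * (\<nu> * scaled_I \<nu> y) + scaled_I (\<nu> + 1) y) \<longlongrightarrow> of_real 0 * (\<nu> * B) + A) at_top"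
    by (intro tendsto_add tendsto_mult tendsto_const A B)
  then have "((\<lambda>y. of_real (2 / y) * (\<nu> * scaled_I \<nu> y) + scaled_I (\<nu> + 1) y) \<longlongrightarrow> A) at_top" by simp
  then show ?thesis
    by (rule Lim_transform_eventually)
      (use eventually_gt_at_top[of 0] in eventually_elim, simp add: scaled_I_rec)
qed

section \<open>The modified Bessel function at infinity\<close>

lemma absolutely_integrable_lborel:
  fixes f :: "real \<Rightarrow> complex"
  assumes "f absolutely_integrable_on {0<..}" and [measurable]: "f \<in> borel_measurable borel"
  shows "set_integrable lborel {0<..} f"
    and "(LINT x:{0<..}|lborel. f x) = integral {0<..} f"
proof -
  have m: "(\<lambda>x. indicator {0<..} x *\<^sub>R f x) \<in> borel_measurable lborel" by measurable
  show 1: "set_integrable lborel {0<..} f"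
    using assms(1) integrable_completion[OF m] unfolding set_integrable_def by simp
  show "(LINT x:{0<..}|lborel. f x) = integral {0<..} f"
    using set_lebesgue_integral_eq_integral(2)[OF assms(1)] integral_completion[OF m]
    unfolding set_lebesgue_integral_def by simp
qed

definition gamma_integrand :: "complex \<Rightarrow> real \<Rightarrow> complex" where
  "gamma_integrand z v = of_real v powr (z - 1) * exp (- of_real v)"

lemma gamma_integrand_measurable [measurable]: "gamma_integrand z \<in> borel_measurable borel"
  unfolding gamma_integrand_def by measurable

lemma norm_gint: "v > 0 \<Longrightarrow> norm (gamma_integrand z v) = v powr (Re z - 1) * exp (- v)"
  by (simp add: gamma_integrand_def norm_mult norm_powr_real_powr)

lemma gamma_integrand_integral:
  assumes "Re z > 0"
  shows "set_integrable lborel {0<..} (gamma_integrand z)" "(LINT v:{0<..}|lborel. gamma_integrand z v) = Gamma z"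
proof -
  have eq: "gamma_integrand z = (\<lambda>t. of_real t powr (z - 1) / of_real (exp t))"
    by (auto simp: gamma_integrand_def exp_minus inverse_eq_divide exp_of_real)
  have ab: "gamma_integrand z absolutely_integrable_on {0<..}"
    unfolding eq by (rule absolutely_integrable_Gamma_integral'[OF assms])
  show "set_integrable lborel {0<..} (gamma_integrand z)" by (rule absolutely_integrable_lborel[OF ab]) measurable
  have "integral {0<..} (gamma_integrand z) = Gamma z"
    unfolding eq using Gamma_integral_complex'[OF assms] by (rule integral_unique)
  then show "(LINT v:{0<..}|lborel. gamma_integrand z v) = Gamma z"
    using absolutely_integrable_lborel(2)[OF ab] by simp
qed

text \<open>
  By dominated convergence, the average of \<open>\<phi>\<close> with a weight that is stretched to infinity only
  sees the limit of \<open>\<phi>\<close>.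
\<close>

lemma abelian_limit:
  assumes s: "Re s > 0" and meas [measurable]: "\<phi> \<in> borel_measurable borel"
    and bound: "\<And>y. y > 0 \<Longrightarrow> norm (\<phi> y) \<le> C" and lim: "(\<phi> \<longlongrightarrow> A) at_top"
    and c: "filterlim c at_top sequentially" "\<And>n. c n > 0"
  shows "(\<lambda>n. LINT v:{0<..}|lborel. gamma_integrand s v * \<phi> (c n * v)) \<longlonglongrightarrow> Gamma s * A"
proof -
  have "(\<lambda>n. LINT v|lborel. indicator {0<..} v *\<^sub>R (gamma_integrand s v * \<phi> (c n * v))) \<longlonglongrightarrow>
      (LINT v|lborel. indicator {0<..} v *\<^sub>R (gamma_integrand s v * A))"
  proof (rule integral_dominated_convergence[where w = "\<lambda>v. norm (indicator {0<..} v *\<^sub>R gamma_integrand s v) * C"])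
    show "integrable lborel (\<lambda>v. norm (indicator {0<..} v *\<^sub>R gamma_integrand s v) * C)"
      using gamma_integrand_integral(1)[OF s] unfolding set_integrable_def by (intro integrable_mult_left integrable_norm)
    show "AE v in lborel. (\<lambda>n. indicator {0<..} v *\<^sub>R (gamma_integrand s v * \<phi> (c n * v))) \<longlonglongrightarrow> indicator {0<..} v *\<^sub>R (gamma_integrand s v * A)"
    proof (rule AE_I2)
      fix v :: real
      show "(\<lambda>n. indicator {0<..} v *\<^sub>R (gamma_integrand s v * \<phi> (c n * v))) \<longlonglongrightarrow> indicator {0<..} v *\<^sub>R (gamma_integrand s v * A)"
      proof (cases "v > 0")
        case True
        then have "filterlim (\<lambda>n. c n * v) at_top sequentially"
          using filterlim_tendsto_pos_mult_at_top[OF tendsto_const[of v] True c(1)] by (simp add: mult.commute)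
        from filterlim_compose[OF lim this] show ?thesis by (intro tendsto_intros)
      qed simp
    qed
    show "AE v in lborel. norm (indicator {0<..} v *\<^sub>R (gamma_integrand s v * \<phi> (c n * v))) \<le> norm (indicator {0<..} v *\<^sub>R gamma_integrand s v) * C" for n
      using bound c(2)[of n] by (intro AE_I2) (auto simp: indicator_def norm_mult intro!: mult_left_mono)
  qed measurable
  also have "(LINT v|lborel. indicator {0<..} v *\<^sub>R (gamma_integrand s v * A)) = (LINT v:{0<..}|lborel. gamma_integrand s v) * A"
    unfolding set_lebesgue_integral_def by (subst integral_mult_left_zero[symmetric]) (simp add: mult.assoc)
  finally show ?thesis
    unfolding gamma_integrand_integral(2)[OF s] by (simp only: set_lebesgue_integral_def)
qed

lemma gamma_integrand_scale:
  assumes [measurable]: "\<psi> \<in> borel_measurable borel" and c: "c > 0"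
  shows "(LINT v:{0<..}|lborel. gamma_integrand s v * \<psi> (c * v)) =
     of_real (1 / c) powr s * (LINT w:{0<..}|lborel. of_real w powr (s - 1) * exp (- of_real (w / c)) * \<psi> w)"
proof -
  have "(LINT w:{0<..}|lborel. of_real w powr (s - 1) * exp (- of_real (w / c)) * \<psi> w) =
     \<bar>c\<bar> *\<^sub>R (LINT v|lborel. indicator {0<..} (0 + c * v) *\<^sub>R (of_real (0 + c * v) powr (s - 1) * exp (- of_real ((0 + c * v) / c)) * \<psi> (0 + c * v)))"
    unfolding set_lebesgue_integral_def using c by (intro lborel_integral_real_affine) auto
  also have "(LINT v|lborel. indicator {0<..} (0 + c * v) *\<^sub>R (of_real (0 + c * v) powr (s - 1) * exp (- of_real ((0 + c * v) / c)) * \<psi> (0 + c * v)))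
    = (LINT v|lborel. of_real c powr (s - 1) * (indicator {0<..} v *\<^sub>R (gamma_integrand s v * \<psi> (c * v))))"
  proof (intro Bochner_Integration.integral_cong refl)
    fix v :: real
    show "indicator {0<..} (0 + c * v) *\<^sub>R (of_real (0 + c * v) powr (s - 1) * exp (- of_real ((0 + c * v) / c)) * \<psi> (0 + c * v)) =
      of_real c powr (s - 1) * (indicator {0<..} v *\<^sub>R (gamma_integrand s v * \<psi> (c * v)))"
    proof (cases "v > 0")
      case True
      have "(of_real c * of_real v) powr (s - 1) = of_real c powr (s - 1) * complex_of_real v powr (s - 1)"
        using True c by (intro powr_times_pos) auto
      then show ?thesis using True c by (simp add: gamma_integrand_def)
    qed (use c in \<open>auto simp: indicator_def zero_less_mult_iff\<close>)
  qed
  also have "\<dots> = of_real c powr (s - 1) * (LINT v:{0<..}|lborel. gamma_integrand s v * \<psi> (c * v))"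
    unfolding set_lebesgue_integral_def by (rule integral_mult_right_zero)
  finally have e: "(LINT w:{0<..}|lborel. of_real w powr (s - 1) * exp (- of_real (w / c)) * \<psi> w) =
     of_real c powr s * (LINT v:{0<..}|lborel. gamma_integrand s v * \<psi> (c * v))"
    using c by (simp add: scaleR_conv_of_real powr_diff)
  have "of_real (1 / c) powr s * complex_of_real c powr s = 1"
    using c powr_times_pos[of "1 / c" "of_real c" s] by simp
  then show ?thesis unfolding e by (simp flip: mult.assoc)
qed

lemma gamma_integrand_norm_integral:
  assumes "Re z > 0"
  shows "(LINT v|lborel. norm (indicator {0<..} v *\<^sub>R gamma_integrand z v)) = Gamma (Re z)"
proof -
  have "complex_of_real (LINT v|lborel. norm (indicator {0<..} v *\<^sub>R gamma_integrand z v)) =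
     (LINT v|lborel. complex_of_real (norm (indicator {0<..} v *\<^sub>R gamma_integrand z v)))"
    by (rule integral_complex_of_real[symmetric])
  also have "\<dots> = (LINT v|lborel. indicator {0<..} v *\<^sub>R gamma_integrand (of_real (Re z)) v)"
  proof (intro Bochner_Integration.integral_cong refl)
    fix v :: real
    show "complex_of_real (norm (indicator {0<..} v *\<^sub>R gamma_integrand z v)) = indicator {0<..} v *\<^sub>R gamma_integrand (of_real (Re z)) v"
    proof (cases "v > 0")
      case True
      have "complex_of_real (v powr (Re z - 1)) = of_real v powr (of_real (Re z) - 1)"
        using True powr_of_real[of v "Re z - 1"] by simp
      then show ?thesis using True by (simp add: norm_gint) (simp add: gamma_integrand_def exp_of_real[symmetric])
    qed simp
  qed
  also have "\<dots> = Gamma (of_real (Re z))"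
    using gamma_integrand_integral(2)[of "of_real (Re z)"] assms by (simp add: set_lebesgue_integral_def)
  finally show ?thesis by (simp only: Gamma_complex_of_real of_real_eq_iff)
qed

lemma gamma_integrand_power:
  assumes "w > 0"
  shows "gamma_integrand z w * of_real w ^ k = gamma_integrand (z + of_nat k) w"
proof -
  have "of_real w powr (z + of_nat k - 1) = of_real w powr ((z - 1) + of_nat k)" by (simp add: algebra_simps)
  also have "\<dots> = of_real w powr (z - 1) * complex_of_real w ^ k"
    using assms by (subst powr_add) (simp add: powr_nat)
  finally show ?thesis by (simp add: gamma_integrand_def)
qed

text \<open>
  The growth of the integrated series from one term to the next. With the factor \<open>\<theta>\<^sup>2 / (4 (k + 1))\<close>
  from the coefficients, the ratio of consecutive terms tends to \<open>\<theta>\<^sup>2 < 1\<close>.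
\<close>

lemma gamma_ratio_step:
  fixes \<nu> :: complex
  assumes "Re \<nu> > - 1 / 2"
  shows "norm (rGamma (\<nu> + of_nat (Suc k) + 1)) * Gamma (2 * Re \<nu> + 2 * real (Suc k) + 1) \<le>
    (2 * (2 * Re \<nu> + 2 * real k + 1)) * (norm (rGamma (\<nu> + of_nat k + 1)) * Gamma (2 * Re \<nu> + 2 * real k + 1))"
proof -
  define \<sigma> where "\<sigma> = Re \<nu>"
  define x where "x = 2 * \<sigma> + 2 * real k + 1"
  have x: "x > 0" using assms by (simp add: x_def \<sigma>_def)
  have "\<sigma> + real k + 1 \<le> norm (\<nu> + of_nat k + 1)"
    using complex_Re_le_cmod[of "\<nu> + of_nat k + 1"] by (simp add: \<sigma>_def)
  moreover have "\<sigma> + real k + 1 > 0" using assms by (simp add: \<sigma>_def)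
  moreover have "(x + 1) / 2 = \<sigma> + real k + 1" by (simp add: x_def)
  ultimately have n: "0 < norm (\<nu> + of_nat k + 1)" "(x + 1) / 2 \<le> norm (\<nu> + of_nat k + 1)" by linarith+
  have "rGamma (\<nu> + of_nat k + 1) = (\<nu> + of_nat k + 1) * rGamma (\<nu> + of_nat (Suc k) + 1)"
    using rGamma_plus1[of "\<nu> + of_nat k + 1"] by (simp add: add_ac)
  then have r: "norm (rGamma (\<nu> + of_nat k + 1)) = norm (\<nu> + of_nat k + 1) * norm (rGamma (\<nu> + of_nat (Suc k) + 1))"
    by (simp only: norm_mult)
  have "2 * \<sigma> + 2 * real (Suc k) + 1 = x + 1 + 1" by (simp add: x_def)
  moreover have "Gamma (x + 1 + 1) = (x + 1) * (x * Gamma x)"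
  proof -
    have np: "x \<notin> \<int>\<^sub>\<le>\<^sub>0" "x + 1 \<notin> \<int>\<^sub>\<le>\<^sub>0" using x by (auto elim!: nonpos_Ints_cases)
    show ?thesis unfolding Gamma_plus1[OF np(2)] Gamma_plus1[OF np(1)] ..
  qed
  ultimately have G: "Gamma (2 * \<sigma> + 2 * real (Suc k) + 1) = (x + 1) * (x * Gamma x)" by (simp only:)
  have "norm (rGamma (\<nu> + of_nat (Suc k) + 1)) * ((x + 1) * (x * Gamma x)) =
      2 * x * (((x + 1) / 2 * norm (rGamma (\<nu> + of_nat (Suc k) + 1))) * Gamma x)" by simp
  also have "\<dots> \<le> 2 * x * (norm (rGamma (\<nu> + of_nat k + 1)) * Gamma x)"
    unfolding r using x n by (intro mult_left_mono mult_right_mono) (auto intro: less_imp_le Gamma_real_pos)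
  finally show ?thesis
    using G by (simp add: x_def \<sigma>_def)
qed

text \<open>
  The Laplace transform of \<open>w\<^sup>\<nu> I\<^sub>\<nu>(\<theta> w)\<close> at \<open>1\<close>, up to elementary factors. Termwise integration gives
  quotients of Gamma values, and Legendre's duplication formula simplifies them to the binomial
  coefficients of \<open>(1 - \<theta>\<^sup>2)\<^bsup>- \<nu> - 1/2\<^esup>\<close>.
\<close>

lemma J_series_integral:
  assumes \<nu>: "Re \<nu> > - 1 / 2" and \<theta>: "0 < \<theta>" "\<theta> < 1"
  shows "(LINT w:{0<..}|lborel. gamma_integrand (2 * \<nu> + 1) w * J_series \<nu> (- (of_real (\<theta> * w / 2))\<^sup>2)) =
     exp (2 * \<nu> * of_real (ln 2)) / of_real (sqrt pi) * Gamma (\<nu> + 1 / 2) * of_real (1 - \<theta>\<^sup>2) powr (- (\<nu> + 1 / 2))"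
proof -
  define \<sigma> where "\<sigma> = Re \<nu>"
  define z where "z = (\<lambda>k::nat. 2 * \<nu> + 1 + of_nat (2 * k))"
  have z: "Re (z k) = 2 * \<sigma> + 2 * real k + 1" "Re (z k) > 0" for k using \<nu> by (simp_all add: z_def \<sigma>_def)
  define a where "a = (\<lambda>k. rGamma (\<nu> + of_nat k + 1) / fact k * of_real ((\<theta> / 2) ^ (2 * k)))"
  define f where "f = (\<lambda>k w. a k * (indicator {0<..} w *\<^sub>R gamma_integrand (z k) w))"
  have term_eq: "gamma_integrand (2 * \<nu> + 1) w * (bessel_coeff \<nu> k * (- (of_real (\<theta> * w / 2))\<^sup>2) ^ k) = a k * gamma_integrand (z k) w"
    if "w > 0" for w k
  proof -
    have sq: "- (complex_of_real (\<theta> * w / 2))\<^sup>2 = (-1) * ((of_real (\<theta> / 2))\<^sup>2 * (of_real w)\<^sup>2)"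
      by (simp add: power2_eq_square)
    have pw: "(- (complex_of_real (\<theta> * w / 2))\<^sup>2) ^ k = (-1) ^ k * (of_real ((\<theta> / 2) ^ (2 * k)) * of_real w ^ (2 * k))"
      unfolding sq by (simp only: power_mult_distrib power_mult of_real_power)
    have e: "(-1) ^ k * (-1) ^ k = (1 :: complex)" by (simp flip: power_mult_distrib)
    have "e * r / g * (e * (p * v)) = (e * e) * (r / g * p * v)" for e r g p v :: complex
      by simp
    then have "bessel_coeff \<nu> k * (- (of_real (\<theta> * w / 2))\<^sup>2) ^ k = ((-1) ^ k * (-1) ^ k) * (a k * of_real w ^ (2 * k))"
      unfolding pw bessel_coeff_def a_def .
    then have "bessel_coeff \<nu> k * (- (of_real (\<theta> * w / 2))\<^sup>2) ^ k = a k * of_real w ^ (2 * k)"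
      unfolding e by (simp only: mult_1)
    then show ?thesis
      unfolding z_def gamma_integrand_power[OF that, symmetric] by (simp only: mult_ac)
  qed
  \<comment> \<open>Termwise integration is justified by the ratio test for the integrals of the absolute values.\<close>
  have f_int: "integrable lborel (f k)" for k
    unfolding f_def using gamma_integrand_integral(1)[OF z(2)] by (intro integrable_mult_right) (simp add: set_integrable_def)
  have f_norm: "(LINT w|lborel. norm (f k w)) = norm (a k) * Gamma (2 * \<sigma> + 2 * real k + 1)" for k
    unfolding f_def norm_mult[of "a k"] using gamma_integrand_norm_integral[OF z(2), of k] z(1)[of k] by simp
  have f_sum: "summable (\<lambda>k. norm (f k w))" for w
  proof (cases "w > 0")
    case True
    define r where "r = (\<theta> * w / 2)\<^sup>2"
    obtain M where M: "\<And>k. norm (bessel_coeff \<nu> k) \<le> M / fact k"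
      using bessel_coeff_bound[of "norm \<nu>"] by blast
    have "norm (norm (f k w)) \<le> norm (gamma_integrand (2 * \<nu> + 1) w) * M / fact k * r ^ k" for k
    proof -
      have "norm (f k w) = norm (gamma_integrand (2 * \<nu> + 1) w) * (norm (bessel_coeff \<nu> k) * r ^ k)"
      proof -
        have "norm (f k w) = norm (gamma_integrand (2 * \<nu> + 1) w * (bessel_coeff \<nu> k * (- (of_real (\<theta> * w / 2))\<^sup>2) ^ k))"
          unfolding term_eq[OF True] using True by (simp add: f_def)
        also have "\<dots> = norm (gamma_integrand (2 * \<nu> + 1) w) * (norm (bessel_coeff \<nu> k) * (\<bar>\<theta> * w / 2\<bar>\<^sup>2) ^ k)"
          by (simp only: norm_mult norm_power norm_minus_cancel norm_of_real)
        finally show ?thesis by (simp only: r_def power2_abs)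
      qed
      also have "\<dots> \<le> norm (gamma_integrand (2 * \<nu> + 1) w) * (M / fact k * r ^ k)"
        by (intro mult_left_mono mult_right_mono M) (auto simp: r_def)
      finally show ?thesis by simp
    qed
    then show ?thesis by (rule summable_comparison_test'[OF summable_exp_bound])
  qed (simp add: f_def)
  have int_sum: "summable (\<lambda>k. LINT w|lborel. norm (f k w))"
  proof -
    define N where "N = (\<lambda>k. norm (a k) * Gamma (2 * \<sigma> + 2 * real k + 1))"
    have "\<theta>\<^sup>2 < 1" using \<theta> by (simp add: power_less_one_iff)
    have lim: "((\<lambda>k. \<theta>\<^sup>2 * ((2 * \<sigma> + 2 * real k + 1) / (2 * (real k + 1)))) \<longlongrightarrow> \<theta>\<^sup>2 * 1) sequentially"
    proof (intro tendsto_mult tendsto_const)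
      show "(\<lambda>k. (2 * \<sigma> + 2 * real k + 1) / (2 * (real k + 1))) \<longlonglongrightarrow> 1" by real_asymp
    qed
    have "eventually (\<lambda>k. \<theta>\<^sup>2 * ((2 * \<sigma> + 2 * real k + 1) / (2 * (real k + 1))) < (1 + \<theta>\<^sup>2) / 2) sequentially"
      by (rule order_tendstoD[OF lim]) (use \<open>\<theta>\<^sup>2 < 1\<close> in simp)
    then obtain k0 where k0: "\<And>k. k \<ge> k0 \<Longrightarrow> \<theta>\<^sup>2 * ((2 * \<sigma> + 2 * real k + 1) / (2 * (real k + 1))) < (1 + \<theta>\<^sup>2) / 2"
      by (auto simp: eventually_sequentially)
    have N0: "N k \<ge> 0" for k
      unfolding N_def using z(2)[of k] unfolding z(1) by (intro mult_nonneg_nonneg less_imp_le[OF Gamma_real_pos]) auto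
    have step: "N (Suc k) \<le> \<theta>\<^sup>2 * ((2 * \<sigma> + 2 * real k + 1) / (2 * (real k + 1))) * N k" for k
    proof -
      define R0 R1 where "R0 = norm (rGamma (\<nu> + of_nat k + 1)) * Gamma (2 * \<sigma> + 2 * real k + 1)"
        and "R1 = norm (rGamma (\<nu> + of_nat (Suc k) + 1)) * Gamma (2 * \<sigma> + 2 * real (Suc k) + 1)"
      have "N (Suc k) = R1 * ((\<theta> / 2) ^ (2 * Suc k) / fact (Suc k))"
        using \<theta> by (simp add: N_def R1_def a_def norm_mult norm_divide norm_power del: of_nat_Suc fact_Suc)
      also have "\<dots> \<le> (2 * (2 * \<sigma> + 2 * real k + 1) * R0) * ((\<theta> / 2) ^ (2 * Suc k) / fact (Suc k))"
        using gamma_ratio_step[OF \<nu>, of k] \<theta> unfolding R0_def R1_def \<sigma>_def by (intro mult_right_mono) auto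
      also have "(\<theta> / 2) ^ (2 * Suc k) / fact (Suc k) = \<theta>\<^sup>2 / (4 * (real k + 1)) * ((\<theta> / 2) ^ (2 * k) / fact k)"
        by (simp add: power2_eq_square field_simps)
      also have "(2 * (2 * \<sigma> + 2 * real k + 1) * R0) * (\<theta>\<^sup>2 / (4 * (real k + 1)) * ((\<theta> / 2) ^ (2 * k) / fact k)) =
         \<theta>\<^sup>2 * ((2 * \<sigma> + 2 * real k + 1) / (2 * (real k + 1))) * (R0 * ((\<theta> / 2) ^ (2 * k) / fact k))"
      proof -
        have "(2 * u * v) * (\<theta>\<^sup>2 / (4 * t) * q) = \<theta>\<^sup>2 * (u / (2 * t)) * (v * q)" for u v t q :: real
          by simp
        then show ?thesis .
      qed
      also have "R0 * ((\<theta> / 2) ^ (2 * k) / fact k) = N k"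
        using \<theta> by (simp add: N_def R0_def a_def norm_mult norm_divide norm_power)
      finally show ?thesis .
    qed
    have "summable N"
    proof (rule summable_ratio_test[of "(1 + \<theta>\<^sup>2) / 2" k0])
      show "(1 + \<theta>\<^sup>2) / 2 < 1" using \<open>\<theta>\<^sup>2 < 1\<close> by simp
      fix k assume "k \<ge> k0"
      then have "\<theta>\<^sup>2 * ((2 * \<sigma> + 2 * real k + 1) / (2 * (real k + 1))) * N k \<le> (1 + \<theta>\<^sup>2) / 2 * N k"
        by (intro mult_right_mono[OF less_imp_le[OF k0] N0])
      with step[of k] have "N (Suc k) \<le> (1 + \<theta>\<^sup>2) / 2 * N k" by (rule order.trans)
      then show "norm (N (Suc k)) \<le> (1 + \<theta>\<^sup>2) / 2 * norm (N k)" using N0 by simp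
    qed
    then show ?thesis unfolding f_norm N_def .
  qed
  have "(LINT w:{0<..}|lborel. gamma_integrand (2 * \<nu> + 1) w * J_series \<nu> (- (of_real (\<theta> * w / 2))\<^sup>2)) = (LINT w|lborel. (\<Sum>k. f k w))"
    unfolding set_lebesgue_integral_def
  proof (intro Bochner_Integration.integral_cong refl)
    fix w :: real
    show "indicator {0<..} w *\<^sub>R (gamma_integrand (2 * \<nu> + 1) w * J_series \<nu> (- (of_real (\<theta> * w / 2))\<^sup>2)) = (\<Sum>k. f k w)"
    proof (cases "w > 0")
      case True
      then show ?thesis
        unfolding f_def J_series_def suminf_mult[OF summable_bessel(1), symmetric] term_eq[OF True] by simp
    qed (simp add: f_def)
  qed
  also have "\<dots> = (\<Sum>k. LINT w|lborel. f k w)"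
    by (rule integral_suminf[OF f_int _ int_sum]) (use f_sum in auto)
  also have "(\<lambda>k. LINT w|lborel. f k w) = (\<lambda>k. exp (2 * \<nu> * of_real (ln 2)) / of_real (sqrt pi) * Gamma (\<nu> + 1 / 2) *
      (((- (\<nu> + 1 / 2)) gchoose k) * (- of_real (\<theta>\<^sup>2)) ^ k))"
  proof
    fix k
    define s where "s = \<nu> + 1 / 2"
    have res: "Re s > 0" using \<nu> by (simp add: s_def)
    have np: "w \<notin> \<int>\<^sub>\<le>\<^sub>0" if "Re w > 0" for w :: complex
      using that by (auto elim!: nonpos_Ints_cases)
    have sk: "s + of_nat k \<notin> \<int>\<^sub>\<le>\<^sub>0" "s + of_nat k + 1 / 2 \<notin> \<int>\<^sub>\<le>\<^sub>0" "s \<notin> \<int>\<^sub>\<le>\<^sub>0"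
      by (rule np; use res in simp)+
    have arg: "s + of_nat k + 1 / 2 = \<nu> + of_nat k + 1" "2 * (s + of_nat k) = z k" "1 - z k = - (2 * \<nu> + of_nat (2 * k))"
      by (simp_all add: s_def z_def algebra_simps)
    have solve: "R * Z = G1 * F / P" if "G1 * G2 = E * P * Z" "G2 * R = 1" "E * F = 1" "P \<noteq> 0" for R Z G1 G2 E F P :: complex
    proof -
      have "R * Z * P = R * Z * P * (E * F)" using that(3) by simp
      also have "\<dots> = (E * P * Z) * R * F" by (simp only: mult_ac)
      also have "\<dots> = G1 * (G2 * R) * F" unfolding that(1)[symmetric] by (simp only: mult_ac)
      finally show ?thesis using that(2,4) by (simp add: nonzero_eq_divide_eq)
    qed
    \<comment> \<open>Legendre duplication at \<open>s + k = \<nu> + k + 1/2\<close>; the factor \<open>4 ^ k\<close> it produces cancels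
      the \<open>2\<close> in \<open>\<theta> / 2\<close>.\<close>
    have "Gamma (s + of_nat k) * Gamma (\<nu> + of_nat k + 1) = exp (- (2 * \<nu> + of_nat (2 * k)) * of_real (ln 2)) * of_real (sqrt pi) * Gamma (z k)"
      using Gamma_legendre_duplication[OF sk(1,2)] unfolding arg .
    moreover have "Gamma (\<nu> + of_nat k + 1) * rGamma (\<nu> + of_nat k + 1) = 1"
    proof -
      have "Gamma (\<nu> + of_nat k + 1) \<noteq> 0" using sk(2) unfolding arg by (simp only: Gamma_eq_zero_iff not_False_eq_True)
      then show ?thesis unfolding rGamma_inverse_Gamma by (rule right_inverse)
    qed
    moreover have "exp (- (2 * \<nu> + of_nat (2 * k)) * of_real (ln 2)) * exp ((2 * \<nu> + of_nat (2 * k)) * of_real (ln 2)) = (1::complex)"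
    proof -
      have "exp (- y * l) * exp (y * l) = 1" for y l :: complex by (simp flip: exp_add)
      then show ?thesis .
    qed
    ultimately have "rGamma (\<nu> + of_nat k + 1) * Gamma (z k) =
       Gamma (s + of_nat k) * exp ((2 * \<nu> + of_nat (2 * k)) * of_real (ln 2)) / of_real (sqrt pi)"
      by (rule solve) simp
    also have "exp ((2 * \<nu> + of_nat (2 * k)) * of_real (ln 2)) = exp (2 * \<nu> * of_real (ln 2)) * 4 ^ k"
    proof -
      have "exp (of_nat (2 * k) * complex_of_real (ln 2)) = exp (of_real (ln 2)) ^ (2 * k)"
        by (rule exp_of_nat_mult)
      also have "exp (complex_of_real (ln 2)) = 2" by (simp add: exp_of_real)
      finally show ?thesis by (simp add: distrib_right exp_add power_mult)
    qed
    also have "Gamma (s + of_nat k) = pochhammer s k * Gamma s"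
      using pochhammer_Gamma[OF sk(3), of k] sk(3) by (simp add: Gamma_eq_zero_iff)
    finally have main: "rGamma (\<nu> + of_nat k + 1) * Gamma (z k) =
       exp (2 * \<nu> * of_real (ln 2)) / of_real (sqrt pi) * Gamma s * (4 ^ k * pochhammer s k)" by (simp add: mult_ac)
    have g: "(- s) gchoose k = (-1) ^ k * pochhammer s k / fact k"
      unfolding gbinomial_pochhammer minus_minus ..
    have e: "(-1) ^ k * (-1) ^ k = (1 :: complex)" by (simp flip: power_mult_distrib)
    have "e * p / g * (e * q) = (e * e) * (p / g * q)" for e p g q :: complex by simp
    then have "((- s) gchoose k) * (- of_real (\<theta>\<^sup>2)) ^ k = ((-1) ^ k * (-1) ^ k) * (pochhammer s k / fact k * complex_of_real (\<theta>\<^sup>2) ^ k)"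
      unfolding g power_minus[of "complex_of_real (\<theta>\<^sup>2)"] .
    then have gb: "((- s) gchoose k) * (- of_real (\<theta>\<^sup>2)) ^ k = pochhammer s k / fact k * complex_of_real (\<theta>\<^sup>2) ^ k"
      unfolding e by (simp only: mult_1)
    have "(LINT w|lborel. f k w) = a k * Gamma (z k)"
      unfolding f_def gamma_integrand_integral(2)[OF z(2), of k, symmetric] set_lebesgue_integral_def
      by (rule integral_mult_right_zero)
    also have "\<dots> = (rGamma (\<nu> + of_nat k + 1) * Gamma (z k)) / fact k * of_real ((\<theta> / 2) ^ (2 * k))"
      by (simp add: a_def)
    also have "\<dots> = exp (2 * \<nu> * of_real (ln 2)) / of_real (sqrt pi) * Gamma s * ((4 ^ k * of_real ((\<theta> / 2) ^ (2 * k))) * (pochhammer s k / fact k))"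
      unfolding main by simp
    also have "4 ^ k * complex_of_real ((\<theta> / 2) ^ (2 * k)) = of_real (\<theta>\<^sup>2) ^ k"
      by (simp add: power_mult power_divide)
    finally show "(LINT w|lborel. f k w) = exp (2 * \<nu> * of_real (ln 2)) / of_real (sqrt pi) * Gamma (\<nu> + 1 / 2) *
      (((- (\<nu> + 1 / 2)) gchoose k) * (- of_real (\<theta>\<^sup>2)) ^ k)"
      unfolding s_def[symmetric] gb by (simp add: mult_ac)
  qed
  also have "(\<Sum>k. exp (2 * \<nu> * of_real (ln 2)) / of_real (sqrt pi) * Gamma (\<nu> + 1 / 2) *
      (((- (\<nu> + 1 / 2)) gchoose k) * (- of_real (\<theta>\<^sup>2)) ^ k)) =
      exp (2 * \<nu> * of_real (ln 2)) / of_real (sqrt pi) * Gamma (\<nu> + 1 / 2) * (1 + - of_real (\<theta>\<^sup>2)) powr (- (\<nu> + 1 / 2))"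
  proof (intro sums_unique[symmetric] sums_mult gen_binomial_complex)
    have "\<theta>\<^sup>2 < 1" using \<theta> by (simp add: power_less_one_iff)
    then show "norm (- complex_of_real (\<theta>\<^sup>2)) < 1" by (simp only: norm_minus_cancel norm_of_real) simp
  qed
  finally show ?thesis by simp
qed

lemma J_series_continuous: "continuous_on A (J_series \<nu>)"
  using J_series_deriv by (auto intro!: continuous_at_imp_continuous_on DERIV_isCont)

lemma scaled_I_measurable [measurable]: "scaled_I \<nu> \<in> borel_measurable borel"
proof -
  have [measurable]: "J_series \<nu> \<in> borel_measurable borel" by (rule borel_measurable_continuous_onI[OF J_series_continuous])
  show ?thesis unfolding scaled_I_def[abs_def] by measurable
qed

lemma scaled_I_bounded:
  assumes \<nu>: "Re \<nu> > - 1 / 2" and lim: "(scaled_I \<nu> \<longlongrightarrow> A) at_top"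
  shows "\<exists>C. \<forall>y>0. norm (scaled_I \<nu> y) \<le> C"
proof -
  have "eventually (\<lambda>y. norm (scaled_I \<nu> y) < norm A + 1) at_top"
    using tendsto_norm[OF lim] by (rule order_tendstoD) simp
  then obtain T where T: "\<And>y. y \<ge> T \<Longrightarrow> norm (scaled_I \<nu> y) < norm A + 1"
    by (auto simp: eventually_at_top_linorder)
  define T' where "T' = max T 1"
  have "compact ((\<lambda>y. J_series \<nu> (- (complex_of_real (y / 2))\<^sup>2)) ` {0..T'})"
    by (intro compact_continuous_image continuous_on_compose2[OF J_series_continuous[of UNIV]] continuous_intros) auto
  then have "bounded ((\<lambda>y. J_series \<nu> (- (complex_of_real (y / 2))\<^sup>2)) ` {0..T'})" by (rule compact_imp_bounded)
  then obtain M where M: "\<forall>y\<in>{0..T'}. norm (J_series \<nu> (- (complex_of_real (y / 2))\<^sup>2)) \<le> M"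
    unfolding bounded_iff ball_simps by blast
  define C where "C = T' powr (1 / 2 + Re \<nu>) * 2 powr (- Re \<nu>) * M"
  have small: "norm (scaled_I \<nu> y) \<le> C" if y: "0 < y" "y \<le> T'" for y
  proof -
    have "y powr (1 / 2) * (y / 2) powr Re \<nu> = y powr (1 / 2 + Re \<nu>) * 2 powr (- Re \<nu>)"
      using y by (simp add: powr_add powr_divide powr_minus_divide)
    moreover have "norm (scaled_I \<nu> y) = y powr (1 / 2) * (y / 2) powr Re \<nu> * exp (- y) * norm (J_series \<nu> (- (complex_of_real (y / 2))\<^sup>2))"
      unfolding scaled_I_def norm_mult using y by (subst norm_powr_real_powr, simp, simp, subst norm_powr_real_powr) auto
    ultimately have "norm (scaled_I \<nu> y) = y powr (1 / 2 + Re \<nu>) * 2 powr (- Re \<nu>) * (exp (- y) * norm (J_series \<nu> (- (complex_of_real (y / 2))\<^sup>2)))"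
      by simp
    also have "\<dots> \<le> T' powr (1 / 2 + Re \<nu>) * 2 powr (- Re \<nu>) * (1 * M)"
      using y \<nu> M by (intro mult_mono powr_mono2 order.refl) auto
    finally show ?thesis by (simp add: C_def)
  qed
  show ?thesis
  proof (intro exI allI impI)
    fix y :: real assume "y > 0"
    show "norm (scaled_I \<nu> y) \<le> max C (norm A + 1)"
    proof (cases "y \<le> T'")
      case True
      then show ?thesis using small[OF \<open>y > 0\<close>] by simp
    next
      case False
      then have "norm (scaled_I \<nu> y) < norm A + 1" by (intro T) (simp add: T'_def)
      then show ?thesis by simp
    qed
  qed
qed

text \<open>
  The limit \<open>A\<close> is known to exist, so it may be computed as an Abelian mean. Stretching by
  \<open>\<theta> / (1 - \<theta>)\<close> with \<open>\<theta> \<rightarrow> 1\<close> turns the mean into the integral \<open>J_series_integral\<close>. For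
  \<open>Re \<nu> > -1/2\<close> the integrals converge at \<open>0\<close>.
\<close>

lemma scaled_I_limit_right:
  assumes \<nu>: "Re \<nu> > - 1 / 2"
  shows "(scaled_I \<nu> \<longlongrightarrow> of_real (1 / sqrt (2 * pi))) at_top"
proof -
  obtain A where A: "(scaled_I \<nu> \<longlongrightarrow> A) at_top" using sqrt_J_connection[of \<nu>] .
  obtain C where "\<forall>y>0. norm (scaled_I \<nu> y) \<le> C" using scaled_I_bounded[OF \<nu> A] by (rule exE)
  then have C: "norm (scaled_I \<nu> y) \<le> C" if "y > 0" for y using that by simp
  define s where "s = \<nu> + 1 / 2"
  have s: "Re s > 0" using \<nu> by (simp add: s_def)
  \<comment> \<open>This sequence tends to \<open>1\<close>, and it is chosen such that \<open>\<theta> n / (1 - \<theta> n) = n + 1\<close>.\<close>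
  define \<theta> where "\<theta> = (\<lambda>n. real (n + 1) / real (n + 2))"
  define G where "G = exp (2 * \<nu> * of_real (ln 2)) / of_real (sqrt pi) * Gamma s"
  have \<theta>: "0 < \<theta> n" "\<theta> n < 1" for n by (auto simp: \<theta>_def)
  have c: "\<theta> n / (1 - \<theta> n) = real n + 1" for n
  proof -
    have "1 - \<theta> n = 1 / real (n + 2)" unfolding \<theta>_def by (simp add: diff_divide_eq_iff)
    then show ?thesis by (simp add: \<theta>_def)
  qed
  have lim1: "(\<lambda>n. LINT v:{0<..}|lborel. gamma_integrand s v * scaled_I \<nu> ((real n + 1) * v)) \<longlonglongrightarrow> Gamma s * A"
  proof (rule abelian_limit[OF s scaled_I_measurable _ A])
    show "filterlim (\<lambda>n. real n + 1) at_top sequentially" by real_asymp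
    show "norm (scaled_I \<nu> y) \<le> C" if "y > 0" for y using that by (rule C)
  qed simp
  have exact: "(LINT v:{0<..}|lborel. gamma_integrand s v * scaled_I \<nu> ((real n + 1) * v)) =
     of_real (\<theta> n) powr (1 / 2) * of_real (\<theta> n / 2) powr \<nu> * G * of_real (1 + \<theta> n) powr (- s)" for n
  proof -
    define t where "t = \<theta> n"
    have t: "0 < t" "t < 1" using \<theta> by (auto simp: t_def)
    have [measurable]: "(\<lambda>w. scaled_I \<nu> (t * w)) \<in> borel_measurable borel" by measurable
    have "(LINT v:{0<..}|lborel. gamma_integrand s v * scaled_I \<nu> ((real n + 1) * v)) =
      (LINT v:{0<..}|lborel. gamma_integrand s v * scaled_I \<nu> (t * (1 / (1 - t) * v)))"
    proof -
      have "t * (1 / (1 - t) * v) = t / (1 - t) * v" for v by simp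
      then show ?thesis unfolding c[of n, folded t_def] by (simp only:)
    qed
    also have "\<dots> = of_real (1 / (1 / (1 - t))) powr s *
       (LINT w:{0<..}|lborel. of_real w powr (s - 1) * exp (- of_real (w / (1 / (1 - t)))) * scaled_I \<nu> (t * w))"
      by (rule gamma_integrand_scale) (use t in auto)
    also have "(LINT w:{0<..}|lborel. of_real w powr (s - 1) * exp (- of_real (w / (1 / (1 - t)))) * scaled_I \<nu> (t * w)) =
      (LINT w|lborel. of_real t powr (1 / 2) * of_real (t / 2) powr \<nu> * (indicator {0<..} w *\<^sub>R (gamma_integrand (2 * \<nu> + 1) w * J_series \<nu> (- (of_real (t * w / 2))\<^sup>2))))"
      unfolding set_lebesgue_integral_def
    proof (intro Bochner_Integration.integral_cong refl)
      fix w :: real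
      show "indicator {0<..} w *\<^sub>R (of_real w powr (s - 1) * exp (- of_real (w / (1 / (1 - t)))) * scaled_I \<nu> (t * w)) =
        of_real t powr (1 / 2) * of_real (t / 2) powr \<nu> * (indicator {0<..} w *\<^sub>R (gamma_integrand (2 * \<nu> + 1) w * J_series \<nu> (- (of_real (t * w / 2))\<^sup>2)))"
      proof (cases "w > 0")
        case True
        have w0: "complex_of_real w \<noteq> 0" using True by simp
        have p: "complex_of_real (t * w) powr (1 / 2) = of_real t powr (1 / 2) * of_real w powr (1 / 2)"
          "complex_of_real (t * w / 2) powr \<nu> = of_real (t / 2) powr \<nu> * of_real w powr \<nu>"
        proof -
          have "complex_of_real (t * w) = of_real t * of_real w" "complex_of_real (t * w / 2) = of_real (t / 2) * of_real w"
            by simp_all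
          moreover have "t / 2 > 0" using t by simp
          ultimately show "complex_of_real (t * w) powr (1 / 2) = of_real t powr (1 / 2) * of_real w powr (1 / 2)"
            "complex_of_real (t * w / 2) powr \<nu> = of_real (t / 2) powr \<nu> * of_real w powr \<nu>"
            using powr_times_pos[OF t(1) w0] powr_times_pos[OF _ w0] by (simp_all only:)
        qed
        have q: "complex_of_real w powr (2 * \<nu> + 1 - 1) = of_real w powr (s - 1) * (of_real w powr (1 / 2) * of_real w powr \<nu>)"
          unfolding powr_add[symmetric] by (rule arg_cong[of _ _ "(powr) _"]) (simp add: s_def)
        have "- of_real (w / (1 / (1 - t))) + - complex_of_real (t * w) = - of_real w"
          using t by (simp add: field_simps)
        then have e: "exp (- of_real w) = exp (- of_real (w / (1 / (1 - t)))) * exp (- complex_of_real (t * w))"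
          by (simp only: exp_add[symmetric])
        show ?thesis
          using True unfolding scaled_I_def gamma_integrand_def p q e by (simp only: mult_ac scaleR_conv_of_real)
      qed simp
    qed
    also have "\<dots> = of_real t powr (1 / 2) * of_real (t / 2) powr \<nu> *
       (LINT w:{0<..}|lborel. gamma_integrand (2 * \<nu> + 1) w * J_series \<nu> (- (of_real (t * w / 2))\<^sup>2))"
      unfolding set_lebesgue_integral_def by (rule integral_mult_right_zero)
    also have "(LINT w:{0<..}|lborel. gamma_integrand (2 * \<nu> + 1) w * J_series \<nu> (- (of_real (t * w / 2))\<^sup>2)) = G * of_real (1 - t\<^sup>2) powr (- s)"
      using J_series_integral[OF \<nu> t] by (simp only: G_def s_def)
    also have "of_real (1 - t\<^sup>2) powr (- s) = of_real (1 - t) powr (- s) * of_real (1 + t) powr (- s)"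
    proof -
      have e: "complex_of_real (1 - t\<^sup>2) = of_real (1 - t) * of_real (1 + t)"
        by (simp add: power2_eq_square algebra_simps)
      show ?thesis unfolding e by (rule powr_times_pos) (use t in \<open>auto simp del: of_real_add\<close>)
    qed
    also have "complex_of_real (1 / (1 / (1 - t))) powr s *
       (of_real t powr (1 / 2) * of_real (t / 2) powr \<nu> * (G * (of_real (1 - t) powr (- s) * of_real (1 + t) powr (- s)))) =
       (of_real (1 - t) powr s * of_real (1 - t) powr (- s)) * (of_real t powr (1 / 2) * of_real (t / 2) powr \<nu> * G * of_real (1 + t) powr (- s))"
      by (simp only: mult_ac divide_divide_eq_right div_by_1 mult_1)
    also have "of_real (1 - t) powr s * complex_of_real (1 - t) powr (- s) = 1"
      using t unfolding powr_add[symmetric] by simp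
    finally show ?thesis by (simp add: t_def)
  qed
  have "\<theta> \<longlonglongrightarrow> 1" unfolding \<theta>_def by real_asymp
  then have \<theta>1: "(\<lambda>n. complex_of_real (\<theta> n)) \<longlonglongrightarrow> of_real 1" "(\<lambda>n. complex_of_real (\<theta> n / 2)) \<longlonglongrightarrow> of_real (1 / 2)"
    "(\<lambda>n. complex_of_real (1 + \<theta> n)) \<longlonglongrightarrow> of_real (1 + 1)"
    by (intro tendsto_of_real tendsto_intros; simp)+
  have "(\<lambda>n. of_real (\<theta> n) powr (1 / 2) * of_real (\<theta> n / 2) powr \<nu> * G * of_real (1 + \<theta> n) powr (- s)) \<longlonglongrightarrow>
    of_real 1 powr (1 / 2) * of_real (1 / 2) powr \<nu> * G * of_real (1 + 1) powr (- s)"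
    by (intro tendsto_mult tendsto_powr_complex \<theta>1 tendsto_const) (simp_all add: complex_nonpos_Reals_iff)
  then have "Gamma s * A = of_real 1 powr (1 / 2) * of_real (1 / 2) powr \<nu> * G * of_real (1 + 1) powr (- s)"
    using LIMSEQ_unique[OF lim1[unfolded exact]] by blast
  also have "\<dots> = Gamma s * (exp (- (\<nu> * of_real (ln 2))) * exp (2 * \<nu> * of_real (ln 2)) * exp (- (s * of_real (ln 2))) / of_real (sqrt pi))"
  proof -
    have "complex_of_real (1 / 2) powr \<nu> = exp (- (\<nu> * of_real (ln 2)))"
    proof -
      have "Ln (complex_of_real (1 / 2)) = - of_real (ln 2)" by (subst Ln_of_real) (simp_all add: ln_div)
      then show ?thesis unfolding powr_def by (simp only:) simp
    qed
    moreover have "complex_of_real (1 + 1) powr (- s) = exp (- (s * of_real (ln 2)))"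
      using Ln_of_real[of 2] by (simp add: powr_def)
    moreover have "complex_of_real 1 powr (1 / 2) = 1" by simp
    ultimately show ?thesis by (simp only: G_def) simp
  qed
  also have "exp (- (\<nu> * of_real (ln 2))) * exp (2 * \<nu> * of_real (ln 2)) * exp (- (s * of_real (ln 2))) = complex_of_real (1 / sqrt 2)"
  proof -
    have "exp (- (\<nu> * of_real (ln 2))) * exp (2 * \<nu> * of_real (ln 2)) * exp (- (s * of_real (ln 2))) =
       exp (complex_of_real (- ln 2 / 2))"
      unfolding exp_add[symmetric] by (rule arg_cong[of _ _ exp]) (simp add: s_def algebra_simps)
    also have "\<dots> = of_real (exp (- ln 2 / 2))" by (rule exp_of_real)
    also have "exp (- ln 2 / 2 :: real) = 1 / sqrt 2"
    proof -
      have "sqrt 2 = exp (ln 2 / 2 :: real)" by (simp add: powr_half_sqrt[symmetric] powr_def)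
      then show ?thesis by (simp add: exp_minus inverse_eq_divide)
    qed
    finally show ?thesis .
  qed
  finally have "Gamma s * A = Gamma s * (of_real (1 / sqrt 2) / of_real (sqrt pi))" .
  moreover have "Gamma s \<noteq> 0"
  proof -
    have "s \<notin> \<int>\<^sub>\<le>\<^sub>0" using s by (auto elim!: nonpos_Ints_cases)
    then show ?thesis by (simp add: Gamma_eq_zero_iff)
  qed
  ultimately have "A = of_real (1 / sqrt 2) / of_real (sqrt pi)" by (metis mult_left_cancel)
  then have "A = of_real (1 / sqrt (2 * pi))" by (simp add: real_sqrt_mult)
  then show ?thesis using A by simp
qed

text \<open>
  The limits for \<open>\<nu> - 1\<close> and \<open>\<nu> + 1\<close> agree, so the half-plane of admissible orders can be extended by
  steps of \<open>2\<close>.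
\<close>

lemma scaled_I_limit: "(scaled_I \<nu> \<longlongrightarrow> of_real (1 / sqrt (2 * pi))) at_top"
proof -
  have "\<forall>\<nu>. Re \<nu> > - 1 / 2 - 2 * real n \<longrightarrow> (scaled_I \<nu> \<longlongrightarrow> of_real (1 / sqrt (2 * pi))) at_top" for n
  proof (induction n)
    case 0
    then show ?case using scaled_I_limit_right by simp
  next
    case (Suc n)
    show ?case
    proof (intro allI impI)
      fix \<nu> :: complex assume "- 1 / 2 - 2 * real (Suc n) < Re \<nu>"
      then have "(scaled_I (\<nu> + 1 + 1) \<longlongrightarrow> of_real (1 / sqrt (2 * pi))) at_top"
        using Suc.IH[rule_format, of "\<nu> + 1 + 1"] by simp
      from scaled_I_limit_periodic[OF this] show "(scaled_I \<nu> \<longlongrightarrow> of_real (1 / sqrt (2 * pi))) at_top" by simp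
    qed
  qed
  moreover have "\<exists>n. Re \<nu> > - 1 / 2 - 2 * real n"
  proof -
    obtain n where "real n > - Re \<nu>" using reals_Archimedean2 by blast
    then have "Re \<nu> > - 1 / 2 - 2 * real n" by linarith
    then show ?thesis ..
  qed
  ultimately show ?thesis by blast
qed

section \<open>Asymptotics of the Hankel functions\<close>

definition Hankel1 :: "complex \<Rightarrow> complex \<Rightarrow> complex" where
  "Hankel1 \<nu> x = Bessel_J \<nu> x + \<i> * Bessel_Y \<nu> x"

definition Hankel2 :: "complex \<Rightarrow> complex \<Rightarrow> complex" where
  "Hankel2 \<nu> x = Bessel_J \<nu> x - \<i> * Bessel_Y \<nu> x"

text \<open>
  The limits of \<open>\<surd>x Hankel1 \<nu> x exp (- \<i> x)\<close> and \<open>\<surd>x Hankel2 \<nu> x exp (\<i> x)\<close>.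
\<close>

definition Hankel1_const :: "complex \<Rightarrow> complex" where
  "Hankel1_const \<nu> = of_real (2 / sqrt (2 * pi)) * exp (- (\<i> * of_real pi / 2 * (\<nu> + 1 / 2)))"

definition Hankel2_const :: "complex \<Rightarrow> complex" where
  "Hankel2_const \<nu> = of_real (2 / sqrt (2 * pi)) * exp (\<i> * of_real pi / 2 * (\<nu> + 1 / 2))"

lemma sqrt_J_connection':
  "connection (sqrt_J \<nu>) (sqrt_J' \<nu>) (\<i> * Hankel1_const \<nu>) (- (\<i> * Hankel2_const \<nu>))"
proof -
  obtain A where A: "(scaled_I \<nu> \<longlongrightarrow> A) at_top"
    "connection (sqrt_J \<nu>) (sqrt_J' \<nu>) (2 * \<i> * A * exp (- (\<i> * of_real pi / 2 * (\<nu> + 1 / 2))))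
       (- (2 * \<i> * A * exp (\<i> * of_real pi / 2 * (\<nu> + 1 / 2))))"
    using sqrt_J_connection[of \<nu>] .
  have "A = of_real (1 / sqrt (2 * pi))" by (rule tendsto_unique[OF _ A(1) scaled_I_limit]) simp
  then have "2 * \<i> * A * e = \<i> * (of_real (2 / sqrt (2 * pi)) * e)" for e by simp
  with A(2) show ?thesis unfolding Hankel1_const_def Hankel2_const_def by (simp only:)
qed

lemma connection_linear:
  assumes "connection u u' p q" "connection v v' r s"
  shows "connection (\<lambda>x. a * u x + b * v x) (\<lambda>x. a * u' x + b * v' x) (a * p + b * r) (a * q + b * s)"
proof -
  have "osc1 (\<lambda>x. a * u x + b * v x) (\<lambda>x. a * u' x + b * v' x) x = a * osc1 u u' x + b * osc1 v v' x"
    "osc2 (\<lambda>x. a * u x + b * v x) (\<lambda>x. a * u' x + b * v' x) x = a * osc2 u u' x + b * osc2 v v' x" for x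
    by (simp_all add: osc1_def osc2_def algebra_simps)
  then show ?thesis
    using assms unfolding connection_def by (auto intro!: tendsto_intros)
qed

lemma bessel_ode_linear:
  assumes "bessel_ode \<kappa> u u'" "bessel_ode \<kappa> v v'"
  shows "bessel_ode \<kappa> (\<lambda>x. a * u x + b * v x) (\<lambda>x. a * u' x + b * v' x)"
  unfolding bessel_ode_def
proof (intro allI impI conjI)
  fix x :: complex assume x: "x \<notin> \<real>\<^sub>\<le>\<^sub>0"
  show "((\<lambda>x. a * u x + b * v x) has_field_derivative a * u' x + b * v' x) (at x)"
    using assms x unfolding bessel_ode_def by (intro DERIV_add DERIV_cmult) auto
  have "((\<lambda>x. a * u' x + b * v' x) has_field_derivative a * ((\<kappa> / x\<^sup>2 - 1) * u x) + b * ((\<kappa> / x\<^sup>2 - 1) * v x)) (at x)"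
    using assms x unfolding bessel_ode_def by (intro DERIV_add DERIV_cmult) auto
  then show "((\<lambda>x. a * u' x + b * v' x) has_field_derivative (\<kappa> / x\<^sup>2 - 1) * (a * u x + b * v x)) (at x)"
    by (rule DERIV_cong) (simp add: algebra_simps)
qed

text \<open>
  If one of the connection constants vanishes, the solution is close to a single exponential, with a
  small relative error even where this exponential is the smaller one of the two.
\<close>

lemma recessive_bound:
  assumes ode: "bessel_ode \<kappa> u u'"
    and c: "0 < c" "\<forall>s\<ge>0. x + of_real s \<notin> \<real>\<^sub>\<le>\<^sub>0 \<and> c * (norm x + s) \<le> norm (x + of_real s)"
    and K: "K = 2 * norm \<kappa> / c\<^sup>2" "2 * K \<le> norm x"
  shows "connection u u' (2 * \<i> * k) 0 \<Longrightarrow> norm (u x * exp (- (\<i> * x)) - k) \<le> 4 * K / norm x * norm k"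
    and "connection u u' 0 (- (2 * \<i> * k)) \<Longrightarrow> norm (u x * exp (\<i> * x) - k) \<le> 4 * K / norm x * norm k"
proof -
  have exp1: "exp (2 * Im x) * exp (- 2 * Im x) = 1" by (simp flip: exp_add)
  {
    assume con: "connection u u' (2 * \<i> * k) 0"
    note b = connection_bound[OF ode con c K]
    have o1: "norm (osc1 u u' x - 2 * \<i> * k) \<le> 4 * K / norm x * norm k"
      using b(1) by (simp add: norm_mult)
    have "norm (osc2 u u' x) \<le> exp (- 2 * Im x) * (4 * K / norm x * norm k)"
      using b(2) by (simp add: norm_mult mult_ac)
    then have "exp (2 * Im x) * norm (osc2 u u' x) \<le> exp (2 * Im x) * (exp (- 2 * Im x) * (4 * K / norm x * norm k))"
      by (intro mult_left_mono) auto
    also have "\<dots> = 4 * K / norm x * norm k" unfolding mult.assoc[symmetric] exp1 by simp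
    finally have o2: "norm (osc2 u u' x * exp (- (2 * \<i> * x))) \<le> 4 * K / norm x * norm k"
      by (simp add: norm_mult mult.commute)
    have "u x * exp (- (\<i> * x)) - k = ((osc1 u u' x - 2 * \<i> * k) - osc2 u u' x * exp (- (2 * \<i> * x))) / (2 * \<i>)"
      unfolding osc_recover(1)[of u x u'] by (simp add: field_simps del: complex_i_mult_minus)
    also have "norm \<dots> = norm ((osc1 u u' x - 2 * \<i> * k) - osc2 u u' x * exp (- (2 * \<i> * x))) / 2"
      unfolding norm_divide by (simp add: norm_mult)
    also have "\<dots> \<le> (4 * K / norm x * norm k + 4 * K / norm x * norm k) / 2"
      by (intro divide_right_mono order.trans[OF norm_triangle_ineq4] add_mono o1 o2) auto
    finally show "norm (u x * exp (- (\<i> * x)) - k) \<le> 4 * K / norm x * norm k" by simp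
  next
    assume con: "connection u u' 0 (- (2 * \<i> * k))"
    note b = connection_bound[OF ode con c K]
    have o2: "norm (osc2 u u' x - (- (2 * \<i> * k))) \<le> 4 * K / norm x * norm k"
      using b(2) by (simp add: norm_mult)
    have "norm (osc1 u u' x) \<le> exp (2 * Im x) * (4 * K / norm x * norm k)"
      using b(1) by (simp add: norm_mult mult_ac)
    then have "exp (- 2 * Im x) * norm (osc1 u u' x) \<le> exp (- 2 * Im x) * (exp (2 * Im x) * (4 * K / norm x * norm k))"
      by (intro mult_left_mono) auto
    also have "\<dots> = 4 * K / norm x * norm k" unfolding mult.assoc[symmetric] mult.commute[of "exp (- 2 * Im x)"] exp1 by simp
    finally have o1: "norm (osc1 u u' x * exp (2 * \<i> * x)) \<le> 4 * K / norm x * norm k"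
      by (simp add: norm_mult mult.commute)
    have "u x * exp (\<i> * x) - k = (osc1 u u' x * exp (2 * \<i> * x) - (osc2 u u' x - (- (2 * \<i> * k)))) / (2 * \<i>)"
      unfolding osc_recover(2)[of u x u'] by (simp add: field_simps del: complex_i_mult_minus)
    also have "norm \<dots> = norm (osc1 u u' x * exp (2 * \<i> * x) - (osc2 u u' x - (- (2 * \<i> * k)))) / 2"
      unfolding norm_divide by (simp add: norm_mult)
    also have "\<dots> \<le> (4 * K / norm x * norm k + 4 * K / norm x * norm k) / 2"
      by (intro divide_right_mono order.trans[OF norm_triangle_ineq4] add_mono o1 o2) auto
    finally show "norm (u x * exp (\<i> * x) - k) \<le> 4 * K / norm x * norm k" by simp
  }
qed

lemma Hankel_nonint:
  assumes "\<nu> \<notin> \<int>"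
  shows "Hankel1 \<nu> x = (\<i> / sin (\<nu> * of_real pi) * exp (- (\<i> * (\<nu> * of_real pi)))) * Bessel_J \<nu> x + (- (\<i> / sin (\<nu> * of_real pi))) * Bessel_J (- \<nu>) x"
    and "Hankel2 \<nu> x = (- (\<i> / sin (\<nu> * of_real pi)) * exp (\<i> * (\<nu> * of_real pi))) * Bessel_J \<nu> x + \<i> / sin (\<nu> * of_real pi) * Bessel_J (- \<nu>) x"
proof -
  define z where "z = \<nu> * complex_of_real pi"
  have s: "sin z \<noteq> 0" using sin_pi_nz[OF assms] by (simp add: z_def)
  have e: "exp (\<i> * z) = cos z + \<i> * sin z" "exp (- (\<i> * z)) = cos z - \<i> * sin z"
    using exp_Euler[of z] exp_Euler[of "- z"] by simp_all
  have Y: "Bessel_Y \<nu> x = (Bessel_J \<nu> x * cos z - Bessel_J (- \<nu>) x) / sin z"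
    using Bessel_Y_shift(1)[OF assms, of x] by (simp add: z_def)
  have ii: "\<i> * (\<i> * w) = - w" for w by (simp flip: mult.assoc)
  show "Hankel1 \<nu> x = (\<i> / sin (\<nu> * of_real pi) * exp (- (\<i> * (\<nu> * of_real pi)))) * Bessel_J \<nu> x + (- (\<i> / sin (\<nu> * of_real pi))) * Bessel_J (- \<nu>) x"
    unfolding z_def[symmetric] Hankel1_def Y e using s by (simp add: field_simps ii)
  show "Hankel2 \<nu> x = (- (\<i> / sin (\<nu> * of_real pi)) * exp (\<i> * (\<nu> * of_real pi))) * Bessel_J \<nu> x + \<i> / sin (\<nu> * of_real pi) * Bessel_J (- \<nu>) x"
    unfolding z_def[symmetric] Hankel2_def Y e using s by (simp add: field_simps ii)
qed

lemma Hankel_const_reflect: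
  fixes \<nu> :: complex
  defines "e \<equiv> exp (\<i> * (\<nu> * of_real pi))"
  shows "Hankel1_const \<nu> * e = Hankel1_const (- \<nu>)" "Hankel2_const \<nu> / e = Hankel2_const (- \<nu>)"
proof -
  have "exp (- (\<i> * of_real pi / 2 * (\<nu> + 1 / 2))) * e = exp (- (\<i> * of_real pi / 2 * (- \<nu> + 1 / 2)))"
    unfolding e_def exp_add[symmetric] by (rule arg_cong[of _ _ exp]) (simp add: field_simps)
  then show "Hankel1_const \<nu> * e = Hankel1_const (- \<nu>)" by (simp only: Hankel1_const_def mult.assoc)
  have "exp (\<i> * of_real pi / 2 * (\<nu> + 1 / 2)) / e = exp (\<i> * of_real pi / 2 * (- \<nu> + 1 / 2))"
    unfolding e_def exp_diff[symmetric] by (rule arg_cong[of _ _ exp]) (simp add: field_simps)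
  then show "Hankel2_const \<nu> / e = Hankel2_const (- \<nu>)" by (simp only: Hankel2_const_def times_divide_eq_right[symmetric])
qed

text \<open>
  The Hankel functions are the combinations of \<open>Bessel_J \<nu>\<close> and \<open>Bessel_J (- \<nu>)\<close> in which one of the
  connection constants cancels, by \<open>Hankel_const_reflect\<close>.
\<close>

lemma Hankel_bound_nonint:
  assumes \<nu>: "\<nu> \<notin> \<int>"
    and c: "0 < c" "\<forall>s\<ge>0. x + of_real s \<notin> \<real>\<^sub>\<le>\<^sub>0 \<and> c * (norm x + s) \<le> norm (x + of_real s)"
    and K: "2 * (2 * norm (\<nu>\<^sup>2 - 1 / 4) / c\<^sup>2) \<le> norm x"
  shows "norm (x powr (1 / 2) * Hankel1 \<nu> x * exp (- (\<i> * x)) - Hankel1_const \<nu>) \<le> 4 * (2 * norm (\<nu>\<^sup>2 - 1 / 4) / c\<^sup>2) / norm x * norm (Hankel1_const \<nu>)"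
    and "norm (x powr (1 / 2) * Hankel2 \<nu> x * exp (\<i> * x) - Hankel2_const \<nu>) \<le> 4 * (2 * norm (\<nu>\<^sup>2 - 1 / 4) / c\<^sup>2) / norm x * norm (Hankel2_const \<nu>)"
proof -
  define S where "S = sin (\<nu> * complex_of_real pi)"
  define e where "e = exp (\<i> * (\<nu> * of_real pi))"
  have S: "S \<noteq> 0" using sin_pi_nz[OF \<nu>] by (simp add: S_def)
  have e: "e \<noteq> 0" "exp (- (\<i> * (\<nu> * of_real pi))) = 1 / e" by (simp_all add: e_def exp_minus inverse_eq_divide)
  have Se: "e - 1 / e = 2 * \<i> * S"
    using exp_Euler[of "\<nu> * complex_of_real pi"] exp_Euler[of "- (\<nu> * complex_of_real pi)"]
    by (simp add: e_def S_def exp_minus inverse_eq_divide)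
  have R: "Hankel1_const (- \<nu>) = Hankel1_const \<nu> * e" "Hankel2_const (- \<nu>) = Hankel2_const \<nu> / e" using Hankel_const_reflect[of \<nu>] by (simp_all add: e_def)
  have ode2: "bessel_ode (\<nu>\<^sup>2 - 1 / 4) (sqrt_J (- \<nu>)) (sqrt_J' (- \<nu>))" using sqrt_J_ode[of "- \<nu>"] by simp
  note con = connection_linear[OF sqrt_J_connection'[of \<nu>] sqrt_J_connection'[of "- \<nu>"]]
  note ode = bessel_ode_linear[OF sqrt_J_ode[of \<nu>] ode2]
  let ?a = "\<i> / S * (1 / e)" and ?b = "- (\<i> / S)"
  have p: "?a * (\<i> * Hankel1_const \<nu>) + ?b * (\<i> * Hankel1_const (- \<nu>)) = 2 * \<i> * Hankel1_const \<nu>"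
  proof -
    have "?a * (\<i> * Hankel1_const \<nu>) + ?b * (\<i> * Hankel1_const (- \<nu>)) = (\<i> * \<i>) * Hankel1_const \<nu> / S * (- (e - 1 / e))"
      unfolding R by (simp add: algebra_simps)
    also have "\<dots> = 2 * \<i> * Hankel1_const \<nu>" unfolding Se using S by simp
    finally show ?thesis .
  qed
  have q: "?a * (- (\<i> * Hankel2_const \<nu>)) + ?b * (- (\<i> * Hankel2_const (- \<nu>))) = 0"
    unfolding R by simp
  from recessive_bound(1)[OF ode c refl K, OF con[of ?a ?b, unfolded p q]]
  show "norm (x powr (1 / 2) * Hankel1 \<nu> x * exp (- (\<i> * x)) - Hankel1_const \<nu>) \<le> 4 * (2 * norm (\<nu>\<^sup>2 - 1 / 4) / c\<^sup>2) / norm x * norm (Hankel1_const \<nu>)"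
    unfolding Hankel_nonint(1)[OF \<nu>] S_def[symmetric] e(2) sqrt_J_def by (simp add: algebra_simps)
  let ?a = "- (\<i> / S) * e" and ?b = "\<i> / S"
  have p: "?a * (\<i> * Hankel1_const \<nu>) + ?b * (\<i> * Hankel1_const (- \<nu>)) = 0"
    unfolding R by (simp add: algebra_simps)
  have q: "?a * (- (\<i> * Hankel2_const \<nu>)) + ?b * (- (\<i> * Hankel2_const (- \<nu>))) = - (2 * \<i> * Hankel2_const \<nu>)"
  proof -
    have "?a * (- (\<i> * Hankel2_const \<nu>)) + ?b * (- (\<i> * Hankel2_const (- \<nu>))) = (\<i> * \<i>) * Hankel2_const \<nu> / S * (e - 1 / e)"
      unfolding R by (simp add: algebra_simps)
    also have "\<dots> = - (2 * \<i> * Hankel2_const \<nu>)" unfolding Se using S by simp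
    finally show ?thesis .
  qed
  from recessive_bound(2)[OF ode c refl K, OF con[of ?a ?b, unfolded p q]]
  show "norm (x powr (1 / 2) * Hankel2 \<nu> x * exp (\<i> * x) - Hankel2_const \<nu>) \<le> 4 * (2 * norm (\<nu>\<^sup>2 - 1 / 4) / c\<^sup>2) / norm x * norm (Hankel2_const \<nu>)"
    unfolding Hankel_nonint(2)[OF \<nu>] S_def[symmetric] e_def[symmetric] sqrt_J_def by (simp add: algebra_simps)
qed

lemma eventually_nonint: "eventually (\<lambda>\<mu>. \<mu> \<notin> \<int>) (at (of_int m :: complex))"
proof -
  have "\<mu> \<notin> \<int>" if "\<mu> \<noteq> of_int m" "dist \<mu> (of_int m) < 1" for \<mu> :: complex
  proof
    assume "\<mu> \<in> \<int>"
    then obtain k where k: "\<mu> = of_int k" by (auto elim: Ints_cases)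
    have "norm (complex_of_int (k - m)) < 1" using that(2) by (simp add: k dist_norm)
    then have "\<bar>real_of_int (k - m)\<bar> < 1" by (simp only: norm_of_int)
    then have "k = m" by linarith
    then show False using that(1) k by simp
  qed
  then show ?thesis unfolding eventually_at by (intro exI[of _ 1]) auto
qed

text \<open>
  Both sides are continuous in the order, so the bound extends to the integers.
\<close>

lemma Hankel_bound:
  assumes c: "0 < c" "\<forall>s\<ge>0. x + of_real s \<notin> \<real>\<^sub>\<le>\<^sub>0 \<and> c * (norm x + s) \<le> norm (x + of_real s)"
    and K: "2 * (2 * norm (\<nu>\<^sup>2 - 1 / 4) / c\<^sup>2) < norm x"
  shows "norm (x powr (1 / 2) * Hankel1 \<nu> x * exp (- (\<i> * x)) - Hankel1_const \<nu>) \<le> 4 * (2 * norm (\<nu>\<^sup>2 - 1 / 4) / c\<^sup>2) / norm x * norm (Hankel1_const \<nu>) \<and>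
    norm (x powr (1 / 2) * Hankel2 \<nu> x * exp (\<i> * x) - Hankel2_const \<nu>) \<le> 4 * (2 * norm (\<nu>\<^sup>2 - 1 / 4) / c\<^sup>2) / norm x * norm (Hankel2_const \<nu>)"
proof (cases "\<nu> \<in> \<int>")
  case False
  then show ?thesis using Hankel_bound_nonint[OF False c less_imp_le[OF K]] by blast
next
  case True
  then obtain m where m: "\<nu> = of_int m" by (auto elim: Ints_cases)
  have "x \<notin> \<real>\<^sub>\<le>\<^sub>0" using c(2)[rule_format, of 0] by simp
  then have x: "x \<noteq> 0" by auto
  let ?F = "at (of_int m :: complex)"
  have J: "((\<lambda>\<mu>. Bessel_J \<mu> x) \<longlongrightarrow> Bessel_J \<nu> x) ?F"
    using DERIV_isCont[OF Bessel_J'_eq[OF x, of \<nu>]] unfolding m isCont_def .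
  have "((\<lambda>\<mu>. Bessel_Y_nonint \<mu> x) \<longlongrightarrow> Bessel_Y \<nu> x) ?F"
    using Bessel_Y_nonint_tendsto[OF x, of m] by (simp add: m)
  then have Y: "((\<lambda>\<mu>. Bessel_Y \<mu> x) \<longlongrightarrow> Bessel_Y \<nu> x) ?F"
    by (rule Lim_transform_eventually) (use eventually_nonint[of m] in eventually_elim, simp add: Bessel_Y_def)
  have H: "((\<lambda>\<mu>. Hankel1 \<mu> x) \<longlongrightarrow> Hankel1 \<nu> x) ?F" "((\<lambda>\<mu>. Hankel2 \<mu> x) \<longlongrightarrow> Hankel2 \<nu> x) ?F"
    unfolding Hankel1_def Hankel2_def by (intro tendsto_intros J Y)+
  have id: "((\<lambda>\<mu>. \<mu>) \<longlongrightarrow> \<nu>) ?F" unfolding m by (rule tendsto_ident_at)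
  have Kt: "(Hankel1_const \<longlongrightarrow> Hankel1_const \<nu>) ?F" "(Hankel2_const \<longlongrightarrow> Hankel2_const \<nu>) ?F"
    unfolding Hankel1_const_def[abs_def] Hankel2_const_def[abs_def] by (intro tendsto_intros id; simp)+
  have kap: "((\<lambda>\<mu>. 2 * norm (\<mu>\<^sup>2 - 1 / 4) / c\<^sup>2) \<longlongrightarrow> 2 * norm (\<nu>\<^sup>2 - 1 / 4) / c\<^sup>2) ?F"
    using c(1) by (intro tendsto_intros id) auto
  have "eventually (\<lambda>\<mu>. 2 * (2 * norm (\<mu>\<^sup>2 - 1 / 4) / c\<^sup>2) < norm x) ?F"
    using tendsto_mult_left[OF kap, of 2] K by (rule order_tendstoD)
  with eventually_nonint[of m]
  have ev: "eventually (\<lambda>\<mu>. \<mu> \<notin> \<int> \<and> 2 * (2 * norm (\<mu>\<^sup>2 - 1 / 4) / c\<^sup>2) \<le> norm x) ?F"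
    by eventually_elim auto
  have r: "((\<lambda>\<mu>. 4 * (2 * norm (\<mu>\<^sup>2 - 1 / 4) / c\<^sup>2) / norm x * norm (Hankel1_const \<mu>)) \<longlongrightarrow> 4 * (2 * norm (\<nu>\<^sup>2 - 1 / 4) / c\<^sup>2) / norm x * norm (Hankel1_const \<nu>)) ?F"
    "((\<lambda>\<mu>. 4 * (2 * norm (\<mu>\<^sup>2 - 1 / 4) / c\<^sup>2) / norm x * norm (Hankel2_const \<mu>)) \<longlongrightarrow> 4 * (2 * norm (\<nu>\<^sup>2 - 1 / 4) / c\<^sup>2) / norm x * norm (Hankel2_const \<nu>)) ?F"
    using x by (intro tendsto_mult tendsto_divide tendsto_norm Kt kap tendsto_const; simp)+
  show ?thesis
  proof
    show "norm (x powr (1 / 2) * Hankel1 \<nu> x * exp (- (\<i> * x)) - Hankel1_const \<nu>) \<le> 4 * (2 * norm (\<nu>\<^sup>2 - 1 / 4) / c\<^sup>2) / norm x * norm (Hankel1_const \<nu>)"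
    proof (rule tendsto_le[OF _ r(1)])
      show "((\<lambda>\<mu>. norm (x powr (1 / 2) * Hankel1 \<mu> x * exp (- (\<i> * x)) - Hankel1_const \<mu>)) \<longlongrightarrow> norm (x powr (1 / 2) * Hankel1 \<nu> x * exp (- (\<i> * x)) - Hankel1_const \<nu>)) ?F"
        by (intro tendsto_norm tendsto_diff tendsto_mult tendsto_const H Kt)
      show "eventually (\<lambda>\<mu>. norm (x powr (1 / 2) * Hankel1 \<mu> x * exp (- (\<i> * x)) - Hankel1_const \<mu>) \<le> 4 * (2 * norm (\<mu>\<^sup>2 - 1 / 4) / c\<^sup>2) / norm x * norm (Hankel1_const \<mu>)) ?F"
        using ev by eventually_elim (erule conjE, rule Hankel_bound_nonint(1)[OF _ c])
    qed simp
    show "norm (x powr (1 / 2) * Hankel2 \<nu> x * exp (\<i> * x) - Hankel2_const \<nu>) \<le> 4 * (2 * norm (\<nu>\<^sup>2 - 1 / 4) / c\<^sup>2) / norm x * norm (Hankel2_const \<nu>)"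
    proof (rule tendsto_le[OF _ r(2)])
      show "((\<lambda>\<mu>. norm (x powr (1 / 2) * Hankel2 \<mu> x * exp (\<i> * x) - Hankel2_const \<mu>)) \<longlongrightarrow> norm (x powr (1 / 2) * Hankel2 \<nu> x * exp (\<i> * x) - Hankel2_const \<nu>)) ?F"
        by (intro tendsto_norm tendsto_diff tendsto_mult tendsto_const H Kt)
      show "eventually (\<lambda>\<mu>. norm (x powr (1 / 2) * Hankel2 \<mu> x * exp (\<i> * x) - Hankel2_const \<mu>) \<le> 4 * (2 * norm (\<mu>\<^sup>2 - 1 / 4) / c\<^sup>2) / norm x * norm (Hankel2_const \<mu>)) ?F"
        using ev by eventually_elim (erule conjE, rule Hankel_bound_nonint(2)[OF _ c])
    qed simp
  qed
qed

text \<open>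
  By \<open>sector_line_bound\<close>, one constant \<open>c\<close> serves a whole closed sector, so a bound of this form
  is uniform there.
\<close>

lemma sector_tendsto_by_bound:
  assumes "\<And>c x. 0 < c \<Longrightarrow> \<forall>s\<ge>0. x + of_real s \<notin> \<real>\<^sub>\<le>\<^sub>0 \<and> c * (norm x + s) \<le> norm (x + of_real s) \<Longrightarrow>
      2 * (D / c\<^sup>2) < norm x \<Longrightarrow> norm (f x - L) \<le> 4 * (D / c\<^sup>2) / norm x * norm L"
  shows "sector_tendsto f L"
  unfolding sector_tendsto_def
proof (intro allI impI)
  fix a b :: real assume ab: "- pi < a \<and> a \<le> b \<and> b < pi"
  obtain c where c: "0 < c" "\<And>x s. x \<noteq> 0 \<Longrightarrow> a \<le> Arg x \<Longrightarrow> Arg x \<le> b \<Longrightarrow> 0 \<le> s \<Longrightarrow>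
     x + of_real s \<notin> \<real>\<^sub>\<le>\<^sub>0 \<and> c * (norm x + s) \<le> norm (x + of_real s)"
    using sector_line_bound[of a b] ab by metis
  have inv: "((\<lambda>x. inverse x) \<longlongrightarrow> (0::complex)) (at_infinity_sector a b)"
    using tendsto_mono[OF at_infinity_sector_le tendsto_inverse_0] by blast
  show "(f \<longlongrightarrow> L) (at_infinity_sector a b)"
  proof (rule LIM_zero_cancel, rule Lim_null_comparison)
    show "eventually (\<lambda>x. norm (f x - L) \<le> 4 * (D / c\<^sup>2) * norm L * norm (inverse x)) (at_infinity_sector a b)"
      unfolding eventually_at_infinity_sector
    proof (intro exI[of _ "max 1 (2 * (D / c\<^sup>2) + 1)"] allI impI, elim conjE)
      fix x assume x: "max 1 (2 * (D / c\<^sup>2) + 1) \<le> norm x" "a \<le> Arg x" "Arg x \<le> b"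
      then have "x \<noteq> 0" by auto
      then have "norm (f x - L) \<le> 4 * (D / c\<^sup>2) / norm x * norm L"
        using x c by (intro assms) auto
      then show "norm (f x - L) \<le> 4 * (D / c\<^sup>2) * norm L * norm (inverse x)"
        by (simp add: norm_inverse divide_inverse mult_ac)
    qed
    show "((\<lambda>x. 4 * (D / c\<^sup>2) * norm L * norm (inverse x)) \<longlongrightarrow> 0) (at_infinity_sector a b)"
      using tendsto_mult_right_zero[OF tendsto_norm_zero[OF inv]] .
  qed
qed

theorem Hankel1_asymptotics: "sector_tendsto (\<lambda>x. x powr (1 / 2) * Hankel1 \<nu> x * exp (- (\<i> * x))) (Hankel1_const \<nu>)"
  by (rule sector_tendsto_by_bound[where D = "2 * norm (\<nu>\<^sup>2 - 1 / 4)"]) (use Hankel_bound in blast)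

theorem Hankel2_asymptotics: "sector_tendsto (\<lambda>x. x powr (1 / 2) * Hankel2 \<nu> x * exp (\<i> * x)) (Hankel2_const \<nu>)"
  by (rule sector_tendsto_by_bound[where D = "2 * norm (\<nu>\<^sup>2 - 1 / 4)"]) (use Hankel_bound in blast)

section \<open>Dominant terms\<close>

lemma dt_scale:
  fixes a :: "nat \<Rightarrow> nat \<Rightarrow> 'a::comm_ring_1"
  shows "dt n (\<lambda>i j. c * a i j) = c ^ n * dt n a"
  unfolding dt_permutes by (simp add: prod.distrib sum_distrib_left mult_ac)

lemma filtermap_of_real_sector: "filtermap complex_of_real at_top \<le> at_infinity_sector 0 0"
  proof (rule filter_leI, unfold eventually_filtermap eventually_at_infinity_sector)
  fix P assume "\<exists>R. \<forall>x. R \<le> norm x \<and> 0 \<le> Arg x \<and> Arg x \<le> 0 \<longrightarrow> P x"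
  then obtain R where R: "\<And>x. R \<le> norm x \<Longrightarrow> Arg x = 0 \<Longrightarrow> P x" by force
  show "eventually (\<lambda>x. P (complex_of_real x)) at_top"
    using eventually_gt_at_top[of "max 0 R"] by eventually_elim (auto intro!: R simp: Arg_of_real)
qed

lemma lower_sector_bound:
  assumes "- pi < a" "a \<le> b" "b < 0"
  obtains \<delta> where "\<delta> > 0" "\<And>x. a \<le> Arg x \<Longrightarrow> Arg x \<le> b \<Longrightarrow> Im x \<le> - \<delta> * norm x"
proof -
  define \<delta> where "\<delta> = min (sin (- a)) (sin (- b))"
  have "\<delta> > 0" using assms by (auto simp: \<delta>_def intro!: sin_gt_zero simp del: sin_minus)
  moreover have "Im x \<le> - \<delta> * norm x" if "a \<le> Arg x" "Arg x \<le> b" for x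
  proof (cases "x = 0")
    case False
    have "\<delta> \<le> sin (- Arg x)"
    proof (cases "- Arg x \<le> pi / 2")
      case True
      have "sin (- b) \<le> sin (- Arg x)" using that assms True by (intro sin_monotone_2pi_le) auto
      then show ?thesis by (simp add: \<delta>_def)
    next
      case F: False
      have "sin (pi - (- a)) \<le> sin (pi - (- Arg x))"
        using that assms F by (intro sin_monotone_2pi_le) auto
      then show ?thesis by (simp add: \<delta>_def)
    qed
    moreover have "Im x = norm x * sin (Arg x)"
      using arg_cong[OF Arg_eq[OF False], of Im] by (simp add: Im_exp)
    moreover have "norm x * sin (Arg x) \<le> norm x * (- \<delta>)" if "\<delta> \<le> sin (- Arg x)"
      using that by (intro mult_left_mono) auto
    ultimately show ?thesis by (simp add: mult.commute)
  qed simp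
  ultimately show ?thesis using that by blast
qed

lemma upper_sector_bound:
  assumes "0 < a" "a \<le> b" "b < pi"
  obtains \<delta> where "\<delta> > 0" "\<And>x. a \<le> Arg x \<Longrightarrow> Arg x \<le> b \<Longrightarrow> \<delta> * norm x \<le> Im x"
proof -
  obtain \<delta> where d: "\<delta> > 0" "\<And>x. - b \<le> Arg x \<Longrightarrow> Arg x \<le> - a \<Longrightarrow> Im x \<le> - \<delta> * norm x"
    using lower_sector_bound[of "- b" "- a"] assms by auto
  have "\<delta> * norm x \<le> Im x" if "a \<le> Arg x" "Arg x \<le> b" for x
  proof -
    have "x \<notin> \<real>" using that assms by (auto simp: Arg_real split: if_splits)
    then have "Arg (cnj x) = - Arg x" by (cases "x = 0") (auto simp: Arg_cnj_eq_inverse Arg_inverse)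
    then show ?thesis using d(2)[of "cnj x"] that by simp
  qed
  then show ?thesis using that d(1) by blast
qed

lemma exp_powi_decay:
  assumes "\<delta> > 0" "eventually (\<lambda>x. Re (c * x) \<le> - \<delta> * norm x) F" "F \<le> at_infinity"
  shows "((\<lambda>x. exp (c * x) * x powi k) \<longlongrightarrow> 0) F"
proof -
  have r: "((\<lambda>r. exp (- \<delta> * r) * r powi k) \<longlongrightarrow> 0) at_top"
  proof -
    have "((\<lambda>r. exp (- \<delta> * r) * r powr real_of_int k) \<longlongrightarrow> 0) at_top" using assms(1) by real_asymp
    then show ?thesis
      by (rule Lim_transform_eventually)
        (use eventually_gt_at_top[of 0] in eventually_elim, simp add: powr_real_of_int')
  qed
  have "filterlim norm at_top F" using filterlim_mono[OF filterlim_norm_at_top order.refl assms(3)] .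
  from filterlim_compose[OF r this]
  have "((\<lambda>x. exp (- \<delta> * norm x) * norm x powi k) \<longlongrightarrow> 0) F" by simp
  then show ?thesis
    by (rule Lim_null_comparison[rotated])
      (use assms(2) in eventually_elim, simp add: norm_mult norm_power_int mult_right_mono)
qed

context hankel_pair begin

definition blend :: "complex \<Rightarrow> complex \<Rightarrow> nat \<Rightarrow> complex \<Rightarrow> complex" where
  "blend w1 w2 n x = dt n (\<lambda>i j. w1 * h1 (int j - int i) x + w2 * h2 (int j - int i) x)"

text \<open>
  For \<open>w2 \<noteq> 0\<close> this is the polynomial \<open>mixed\<close> at \<open>w1 / w2\<close> after scaling; the case \<open>w2 = 0\<close> follows by
  continuity.
\<close>

lemma blend_eq: "blend w1 w2 n x = (\<Sum>p\<le>n. w1 ^ p * w2 ^ (n - p) * mixed_coeff n p x)"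
proof -
  have nz: "blend w1 w2 n x = (\<Sum>p\<le>n. w1 ^ p * w2 ^ (n - p) * mixed_coeff n p x)" if "w2 \<noteq> 0" for w2
  proof -
    have "blend w1 w2 n x = dt n (\<lambda>i j. w2 * (h2 (int j - int i) x + w1 / w2 * h1 (int j - int i) x))"
      using that unfolding blend_def by (intro dt_cong) (simp add: field_simps)
    also have "\<dots> = w2 ^ n * (\<Sum>p\<le>n. mixed_coeff n p x * (w1 / w2) ^ p)"
      by (simp only: dt_scale flip: poly_mixed poly_mixed_altdef)
    also have "\<dots> = (\<Sum>p\<le>n. w1 ^ p * w2 ^ (n - p) * mixed_coeff n p x)"
      unfolding sum_distrib_left using that
      by (intro sum.cong refl) (simp add: power_divide power_diff field_simps)
    finally show ?thesis .
  qed
  have "isCont (\<lambda>w2. blend w1 w2 n x) 0" unfolding blend_def dt_permutes by (intro continuous_intros)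
  then have 1: "(\<lambda>w2. blend w1 w2 n x) \<midarrow>0\<rightarrow> blend w1 0 n x" by (simp add: isCont_def)
  have "isCont (\<lambda>w2. \<Sum>p\<le>n. w1 ^ p * w2 ^ (n - p) * mixed_coeff n p x) 0" by (intro continuous_intros)
  then have "(\<lambda>w2. \<Sum>p\<le>n. w1 ^ p * w2 ^ (n - p) * mixed_coeff n p x) \<midarrow>0\<rightarrow> (\<Sum>p\<le>n. w1 ^ p * 0 ^ (n - p) * mixed_coeff n p x)"
    by (simp add: isCont_def)
  then have "(\<lambda>w2. blend w1 w2 n x) \<midarrow>0\<rightarrow> (\<Sum>p\<le>n. w1 ^ p * 0 ^ (n - p) * mixed_coeff n p x)"
    by (rule Lim_transform_eventually) (auto simp: eventually_at_filter nz)
  from tendsto_unique[OF _ 1 this] nz show ?thesis by (cases "w2 = 0") auto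
qed

lemma growth_ratio:
  assumes "x \<noteq> 0"
  shows "growth n p x * (exp (- (freq n q * x)) * x powi decay n q) =
    exp (2 * \<i> * of_int (int p - int q) * x) * x powi (decay n q - decay n p)"
proof -
  have "exp (freq n p * x) * exp (- (freq n q * x)) = exp (2 * \<i> * of_int (int p - int q) * x)"
    unfolding exp_add[symmetric] by (simp add: freq_def algebra_simps)
  moreover have "x powi (- decay n p) * x powi decay n q = x powi (decay n q - decay n p)"
    using assms by (simp flip: power_int_add)
  ultimately show ?thesis unfolding growth_def by (simp add: mult_ac)
qed

lemma blend_ratio:
  assumes "x \<noteq> 0"
  shows "blend w1 w2 n x * (exp (- (freq n q * x)) * x powi decay n q) =
    (\<Sum>p\<le>n. w1 ^ p * w2 ^ (n - p) * normalized n p x * (exp (2 * \<i> * of_int (int p - int q) * x) * x powi (decay n q - decay n p)))"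
proof -
  have "blend w1 w2 n x * (exp (- (freq n q * x)) * x powi decay n q) =
      (\<Sum>p\<le>n. w1 ^ p * w2 ^ (n - p) * normalized n p x * (growth n p x * (exp (- (freq n q * x)) * x powi decay n q)))"
    unfolding blend_eq sum_distrib_right using assms by (intro sum.cong refl) (simp add: mixed_coeff_eq mult_ac)
  then show ?thesis using growth_ratio[OF assms] by simp
qed

text \<open>
  Multiplication by the weight divides by \<open>growth n q\<close>, and by assumption every term but the one with
  index \<open>q\<close> becomes negligible.
\<close>

lemma blend_one_dominant:
  assumes t: "\<And>p. (normalized n p \<longlongrightarrow> amp n p) F" and F: "F \<le> at_infinity" and q: "q \<le> n"
    and small: "\<And>p. p \<le> n \<Longrightarrow> p \<noteq> q \<Longrightarrow> w1 ^ p * w2 ^ (n - p) = 0 \<or>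
      ((\<lambda>x. exp (2 * \<i> * of_int (int p - int q) * x) * x powi (decay n q - decay n p)) \<longlongrightarrow> 0) F"
  shows "((\<lambda>x. blend w1 w2 n x * (exp (- (freq n q * x)) * x powi decay n q)) \<longlongrightarrow> w1 ^ q * w2 ^ (n - q) * amp n q) F"
proof -
  have "((\<lambda>x. w1 ^ p * w2 ^ (n - p) * normalized n p x * (exp (2 * \<i> * of_int (int p - int q) * x) * x powi (decay n q - decay n p)))
      \<longlongrightarrow> (if p = q then w1 ^ q * w2 ^ (n - q) * amp n q else 0)) F" if "p \<le> n" for p
  proof (cases "p = q")
    case True
    then show ?thesis by (simp, intro tendsto_intros t)
  next
    case False
    from small[OF that False] show ?thesis
    proof
      assume "((\<lambda>x. exp (2 * \<i> * of_int (int p - int q) * x) * x powi (decay n q - decay n p)) \<longlongrightarrow> 0) F"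
      from tendsto_mult[OF tendsto_mult[OF tendsto_const t[of p]] this, of "w1 ^ p * w2 ^ (n - p)"]
      show ?thesis using False by simp
    next
      assume "w1 ^ p * w2 ^ (n - p) = 0"
      then show ?thesis using False by (simp only: mult_zero_left if_False tendsto_const)
    qed
  qed
  then have "((\<lambda>x. \<Sum>p\<le>n. w1 ^ p * w2 ^ (n - p) * normalized n p x * (exp (2 * \<i> * of_int (int p - int q) * x) * x powi (decay n q - decay n p)))
      \<longlongrightarrow> (\<Sum>p\<le>n. if p = q then w1 ^ q * w2 ^ (n - q) * amp n q else 0)) F"
    by (intro tendsto_sum) auto
  also have "(\<Sum>p\<le>n. if p = q then w1 ^ q * w2 ^ (n - q) * amp n q else 0) = w1 ^ q * w2 ^ (n - q) * amp n q"
    using q by simp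
  finally show ?thesis
    by (rule Lim_transform_eventually)
      (use filter_leD[OF F eventually_not_equal_at_infinity[of 0]] in eventually_elim, simp add: blend_ratio)
qed

lemma blend_lower_sector:
  assumes ab: "- pi < a" "a \<le> b" "b < pi" and "b < 0 \<or> w2 = 0"
  shows "((\<lambda>x. blend w1 w2 n x * (exp (- (freq n n * x)) * x powi decay n n)) \<longlongrightarrow> w1 ^ n * amp n n) (at_infinity_sector a b)"
proof -
  have "((\<lambda>x. blend w1 w2 n x * (exp (- (freq n n * x)) * x powi decay n n)) \<longlongrightarrow> w1 ^ n * w2 ^ (n - n) * amp n n) (at_infinity_sector a b)"
  proof (rule blend_one_dominant[OF _ at_infinity_sector_le order.refl])
    show "(normalized n p \<longlongrightarrow> amp n p) (at_infinity_sector a b)" for p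
      using normalized_limit ab unfolding sector_tendsto_def by blast
    fix p assume p: "p \<le> n" "p \<noteq> n"
    show "w1 ^ p * w2 ^ (n - p) = 0 \<or>
      ((\<lambda>x. exp (2 * \<i> * of_int (int p - int n) * x) * x powi (decay n n - decay n p)) \<longlongrightarrow> 0) (at_infinity_sector a b)"
    proof (cases "w2 = 0")
      case True
      then show ?thesis using p by simp
    next
      case False
      then have "b < 0" using assms by simp
      then obtain \<delta> where d: "\<delta> > 0" "\<And>x. a \<le> Arg x \<Longrightarrow> Arg x \<le> b \<Longrightarrow> Im x \<le> - \<delta> * norm x"
        using lower_sector_bound ab by metis
      have "Re (2 * \<i> * of_int (int p - int n) * x) \<le> - (2 * \<delta>) * norm x" if "a \<le> Arg x" "Arg x \<le> b" for x
      proof -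
        have "Im x \<le> 0" using d(1) order.trans[OF d(2)[OF that]] by simp
        then have "real (n - p) * Im x \<le> 1 * Im x" using p by (intro mult_right_mono_neg) auto
        then show ?thesis using d(2)[OF that] p by (simp add: algebra_simps of_nat_diff)
      qed
      then show ?thesis
        using d(1) by (intro disjI2 exp_powi_decay[of "2 * \<delta>"] at_infinity_sector_le)
          (auto simp: eventually_at_infinity_sector)
    qed
  qed
  then show ?thesis by simp
qed

lemma blend_upper_sector:
  assumes ab: "- pi < a" "a \<le> b" "b < pi" and "0 < a \<or> w1 = 0"
  shows "((\<lambda>x. blend w1 w2 n x * (exp (- (freq n 0 * x)) * x powi decay n 0)) \<longlongrightarrow> w2 ^ n * amp n 0) (at_infinity_sector a b)"
proof -
  have "((\<lambda>x. blend w1 w2 n x * (exp (- (freq n 0 * x)) * x powi decay n 0)) \<longlongrightarrow> w1 ^ 0 * w2 ^ (n - 0) * amp n 0) (at_infinity_sector a b)"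
  proof (rule blend_one_dominant[OF _ at_infinity_sector_le le0])
    show "(normalized n p \<longlongrightarrow> amp n p) (at_infinity_sector a b)" for p
      using normalized_limit ab unfolding sector_tendsto_def by blast
    fix p assume p: "p \<le> n" "p \<noteq> 0"
    show "w1 ^ p * w2 ^ (n - p) = 0 \<or>
      ((\<lambda>x. exp (2 * \<i> * of_int (int p - int 0) * x) * x powi (decay n 0 - decay n p)) \<longlongrightarrow> 0) (at_infinity_sector a b)"
    proof (cases "w1 = 0")
      case True
      then show ?thesis using p by simp
    next
      case False
      then have "0 < a" using assms by simp
      then obtain \<delta> where d: "\<delta> > 0" "\<And>x. a \<le> Arg x \<Longrightarrow> Arg x \<le> b \<Longrightarrow> \<delta> * norm x \<le> Im x"
        using upper_sector_bound ab by metis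
      have "Re (2 * \<i> * of_int (int p - int 0) * x) \<le> - (2 * \<delta>) * norm x" if "a \<le> Arg x" "Arg x \<le> b" for x
      proof -
        have "0 \<le> Im x" using d(1) order.trans[OF _ d(2)[OF that]] by simp
        then have "1 * Im x \<le> real p * Im x" using p by (intro mult_right_mono) auto
        then show ?thesis using d(2)[OF that] p by (simp add: algebra_simps)
      qed
      then show ?thesis
        using d(1) by (intro disjI2 exp_powi_decay[of "2 * \<delta>"] at_infinity_sector_le)
          (auto simp: eventually_at_infinity_sector)
    qed
  qed
  then show ?thesis by simp
qed

lemma normalized_limit_real: "((\<lambda>x. normalized n p (complex_of_real x)) \<longlongrightarrow> amp n p) at_top"
proof -
  have "(normalized n p \<longlongrightarrow> amp n p) (at_infinity_sector 0 0)" using normalized_limit[of n p] unfolding sector_tendsto_def by simp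
  from filterlim_compose[OF this, of complex_of_real at_top] filtermap_of_real_sector show ?thesis
    by (simp add: filterlim_def)
qed

lemma oscillating_powi_null:
  assumes "k > 0"
  shows "((\<lambda>x. exp (\<i> * of_real r * of_real x) * of_real x powi (- k)) \<longlongrightarrow> 0) at_top"
proof -
  have "((\<lambda>x. x powi (- k)) \<longlongrightarrow> 0) (at_infinity_sector 0 0)"
    using sector_tendsto_powi_neg[OF assms] unfolding sector_tendsto_def by simp
  from tendsto_mono[OF filtermap_of_real_sector this]
  have "((\<lambda>x. complex_of_real x powi (- k)) \<longlongrightarrow> 0) at_top" by (simp only: filterlim_filtermap)
  then have "((\<lambda>x. norm (complex_of_real x powi (- k))) \<longlongrightarrow> 0) at_top" by (rule tendsto_norm_zero)
  then show ?thesis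
    by (rule Lim_null_comparison[rotated]) (simp add: norm_mult norm_exp_eq_Re)
qed

text \<open>
  Relative to the middle term, the term with index \<open>p\<close> is damped by \<open>x\<^bsup>-(p-m)\<^sup>2\<^esup>\<close>.
\<close>

lemma blend_even:
  "((\<lambda>x. blend w1 w2 (2 * m) (complex_of_real x) * of_real x powi decay (2 * m) m) \<longlongrightarrow> w1 ^ m * w2 ^ m * amp (2 * m) m) at_top"
proof -
  let ?F = "filtermap complex_of_real at_top"
  have "((\<lambda>x. blend w1 w2 (2 * m) x * (exp (- (freq (2 * m) m * x)) * x powi decay (2 * m) m)) \<longlongrightarrow>
      w1 ^ m * w2 ^ (2 * m - m) * amp (2 * m) m) ?F"
  proof (rule blend_one_dominant)
    show "(normalized (2 * m) p \<longlongrightarrow> amp (2 * m) p) ?F" for p using normalized_limit_real by (simp add: filterlim_filtermap)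
    show "?F \<le> at_infinity" using filtermap_of_real_sector at_infinity_sector_le by (rule order.trans)
    fix p assume p: "p \<le> 2 * m" "p \<noteq> m"
    have e: "2 * (decay (2 * m) p - decay (2 * m) m) = 2 * (int p - int m)\<^sup>2"
      unfolding right_diff_distrib decay_eq by (simp add: power2_eq_square algebra_simps)
    have "0 < 2 * (decay (2 * m) p - decay (2 * m) m)" unfolding e using p by simp
    then have "decay (2 * m) p - decay (2 * m) m > 0" by (simp only: zero_less_mult_iff) simp
    from oscillating_powi_null[OF this, of "2 * of_int (int p - int m)"]
    show "w1 ^ p * w2 ^ (2 * m - p) = 0 \<or>
      ((\<lambda>x. exp (2 * \<i> * of_int (int p - int m) * x) * x powi (decay (2 * m) m - decay (2 * m) p)) \<longlongrightarrow> 0) ?F"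
      by (simp add: filterlim_filtermap mult_ac)
  qed simp
  then show ?thesis by (simp add: filterlim_filtermap freq_def)
qed

text \<open>
  The terms with indices \<open>m\<close> and \<open>m + 1\<close> have the same power of \<open>x\<close> and oscillate with opposite
  phases. Any other term is damped by \<open>x\<^bsup>-(p-m)(p-m-1)\<^esup>\<close>, a negative power.
\<close>

lemma blend_odd:
  "((\<lambda>x. blend w1 w2 (2 * m + 1) (complex_of_real x) * of_real x powi (int m)\<^sup>2 -
      (w1 ^ (m + 1) * w2 ^ m * amp (2 * m + 1) (m + 1) * exp (\<i> * of_real x) +
       w1 ^ m * w2 ^ (m + 1) * amp (2 * m + 1) m * exp (- (\<i> * of_real x)))) \<longlongrightarrow> 0) at_top"
proof -
  let ?n = "2 * m + 1"
  have Mm: "decay ?n m = (int m)\<^sup>2" "decay ?n (m + 1) = (int m)\<^sup>2"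
    using decay_eq[of ?n m] decay_eq[of ?n "m + 1"] by (simp_all add: power2_eq_square algebra_simps)
  have "((\<lambda>x. \<Sum>p\<le>?n. w1 ^ p * w2 ^ (?n - p) *
      (normalized ?n p (of_real x) * (exp (\<i> * of_int (2 * int p - int ?n) * of_real x) * of_real x powi ((int m)\<^sup>2 - decay ?n p)) -
       (if p = m \<or> p = m + 1 then amp ?n p * exp (\<i> * of_int (2 * int p - int ?n) * of_real x) else 0))) \<longlongrightarrow>
     (\<Sum>p\<le>?n. w1 ^ p * w2 ^ (?n - p) * 0)) at_top"
  proof (intro tendsto_sum tendsto_mult tendsto_const)
    fix p assume p: "p \<in> {..?n}"
    show "((\<lambda>x. normalized ?n p (of_real x) * (exp (\<i> * of_int (2 * int p - int ?n) * of_real x) * of_real x powi ((int m)\<^sup>2 - decay ?n p)) -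
       (if p = m \<or> p = m + 1 then amp ?n p * exp (\<i> * of_int (2 * int p - int ?n) * of_real x) else 0)) \<longlongrightarrow> 0) at_top"
    proof (cases "p = m \<or> p = m + 1")
      case True
      have "((\<lambda>x. norm (normalized ?n p (of_real x) - amp ?n p)) \<longlongrightarrow> 0) at_top"
        using normalized_limit_real[of ?n p] by (simp add: tendsto_norm_zero_iff LIM_zero)
      then have "((\<lambda>x. (normalized ?n p (of_real x) - amp ?n p) * exp (\<i> * of_int (2 * int p - int ?n) * of_real x)) \<longlongrightarrow> 0) at_top"
        by (rule Lim_null_comparison[rotated]) (simp add: norm_mult norm_exp_eq_Re)
      moreover have "decay ?n p = (int m)\<^sup>2" using True Mm by auto
      ultimately show ?thesis using True by (simp add: algebra_simps)
    next
      case False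
      have "2 * (decay ?n p - (int m)\<^sup>2) = 2 * ((int p - int m) * (int p - int m - 1))"
        unfolding right_diff_distrib decay_eq by (simp add: power2_eq_square algebra_simps)
      moreover have "(int p - int m) * (int p - int m - 1) > 0"
        using False by (auto simp: zero_less_mult_iff)
      ultimately have "decay ?n p - (int m)\<^sup>2 > 0" by simp
      from tendsto_mult[OF normalized_limit_real[of ?n p] oscillating_powi_null[OF this, of "of_int (2 * int p - int ?n)"]]
      show ?thesis using False by simp
    qed
  qed
  moreover have "eventually (\<lambda>x. (\<Sum>p\<le>?n. w1 ^ p * w2 ^ (?n - p) *
      (normalized ?n p (of_real x) * (exp (\<i> * of_int (2 * int p - int ?n) * of_real x) * of_real x powi ((int m)\<^sup>2 - decay ?n p)) -
       (if p = m \<or> p = m + 1 then amp ?n p * exp (\<i> * of_int (2 * int p - int ?n) * of_real x) else 0))) =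
     blend w1 w2 ?n (complex_of_real x) * of_real x powi (int m)\<^sup>2 -
      (w1 ^ (m + 1) * w2 ^ m * amp ?n (m + 1) * exp (\<i> * of_real x) +
       w1 ^ m * w2 ^ (m + 1) * amp ?n m * exp (- (\<i> * of_real x)))) at_top"
    using eventually_gt_at_top[of 0]
  proof eventually_elim
    fix x :: real assume x: "x > 0"
    have "blend w1 w2 ?n (of_real x) * of_real x powi (int m)\<^sup>2 =
        (\<Sum>p\<le>?n. w1 ^ p * w2 ^ (?n - p) * (normalized ?n p (of_real x) * (exp (\<i> * of_int (2 * int p - int ?n) * of_real x) * of_real x powi ((int m)\<^sup>2 - decay ?n p))))"
      unfolding blend_eq sum_distrib_right using x
      by (intro sum.cong refl) (simp add: mixed_coeff_eq growth_def freq_def mult_ac power_int_diff power_int_minus field_simps)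
    moreover have "(\<Sum>p\<le>?n. w1 ^ p * w2 ^ (?n - p) *
       (if p = m \<or> p = m + 1 then amp ?n p * exp (\<i> * of_int (2 * int p - int ?n) * of_real x) else 0)) =
      (\<Sum>p\<in>{m, m + 1}. w1 ^ p * w2 ^ (?n - p) * (amp ?n p * exp (\<i> * of_int (2 * int p - int ?n) * of_real x)))"
      by (intro sum.mono_neutral_cong_right) auto
    moreover have "2 * int (m + 1) - int ?n = 1" "2 * int m - int ?n = - 1" "?n - m = m + 1" "?n - (m + 1) = m" by auto
    ultimately show "(\<Sum>p\<le>?n. w1 ^ p * w2 ^ (?n - p) *
      (normalized ?n p (of_real x) * (exp (\<i> * of_int (2 * int p - int ?n) * of_real x) * of_real x powi ((int m)\<^sup>2 - decay ?n p)) -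
       (if p = m \<or> p = m + 1 then amp ?n p * exp (\<i> * of_int (2 * int p - int ?n) * of_real x) else 0))) =
     blend w1 w2 ?n (complex_of_real x) * of_real x powi (int m)\<^sup>2 -
      (w1 ^ (m + 1) * w2 ^ m * amp ?n (m + 1) * exp (\<i> * of_real x) +
       w1 ^ m * w2 ^ (m + 1) * amp ?n m * exp (- (\<i> * of_real x)))"
      unfolding right_diff_distrib sum_subtractf by (simp add: mult_ac)
  qed
  ultimately show ?thesis using Lim_transform_eventually by fastforce
qed

end

section \<open>The Bessel Toeplitz determinant\<close>

lemma Hankel_deriv_up:
  assumes "x \<notin> \<real>\<^sub>\<le>\<^sub>0"
  shows "(Hankel1 \<nu> has_field_derivative \<nu> / x * Hankel1 \<nu> x - Hankel1 (\<nu> + 1) x) (at x)"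
    "(Hankel2 \<nu> has_field_derivative \<nu> / x * Hankel2 \<nu> x - Hankel2 (\<nu> + 1) x) (at x)"
  unfolding Hankel1_def[abs_def] Hankel2_def[abs_def]
  by (auto intro!: derivative_eq_intros Bessel_J_deriv_up Bessel_Y_deriv_up assms simp: algebra_simps)

lemma Hankel_rec:
  assumes "x \<noteq> 0"
  shows "Hankel1 (\<nu> - 1) x = 2 * \<nu> / x * Hankel1 \<nu> x - Hankel1 (\<nu> + 1) x"
    "Hankel2 (\<nu> - 1) x = 2 * \<nu> / x * Hankel2 \<nu> x - Hankel2 (\<nu> + 1) x"
  unfolding Hankel1_def Hankel2_def Bessel_J_rec[OF assms] Bessel_Y_rec[OF assms]
  by (simp_all add: algebra_simps)

lemma sqrt_scaled_ladder:
  fixes C :: "complex \<Rightarrow> complex \<Rightarrow> complex" and x :: complex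
  assumes x: "x \<notin> \<real>\<^sub>\<le>\<^sub>0"
    and up: "\<And>\<nu>. (C \<nu> has_field_derivative \<nu> / x * C \<nu> x - C (\<nu> + 1) x) (at x)"
    and rec: "\<And>\<nu>. C (\<nu> - 1) x = 2 * \<nu> / x * C \<nu> x - C (\<nu> + 1) x"
  shows "((\<lambda>x. x powr (1 / 2) * C (\<nu> + of_int s) x) has_field_derivative
      ((\<nu> - 1 / 2 + 1 + of_int s) / x) * (x powr (1 / 2) * C (\<nu> + of_int s) x) - x powr (1 / 2) * C (\<nu> + of_int (s + 1)) x) (at x)"
    and "((\<lambda>x. x powr (1 / 2) * C (\<nu> + of_int s) x) has_field_derivative
      - ((\<nu> - 1 / 2 + of_int s) / x) * (x powr (1 / 2) * C (\<nu> + of_int s) x) + x powr (1 / 2) * C (\<nu> + of_int (s - 1)) x) (at x)"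
proof -
  let ?w = "x powr (1 / 2)"
  have "(C (\<nu> + of_int s) has_field_derivative (\<nu> + of_int s) / x * C (\<nu> + of_int s) x + - C (\<nu> + of_int s + 1) x) (at x)"
    using up[of "\<nu> + of_int s"] by simp
  note * = sqrt_scaled_deriv[OF x this]
  show 1: "((\<lambda>x. x powr (1 / 2) * C (\<nu> + of_int s) x) has_field_derivative
      ((\<nu> - 1 / 2 + 1 + of_int s) / x) * (?w * C (\<nu> + of_int s) x) - ?w * C (\<nu> + of_int (s + 1)) x) (at x)"
    by (rule DERIV_cong[OF *]) (simp add: algebra_simps)
  have r: "C (\<nu> + of_int (s - 1)) x = 2 * (\<nu> + of_int s) / x * C (\<nu> + of_int s) x - C (\<nu> + of_int (s + 1)) x"
    using rec[of "\<nu> + of_int s"] by (simp add: algebra_simps)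
  have "x \<noteq> 0" using x by auto
  then have "((\<nu> - 1 / 2 + 1 + of_int s) / x) * (?w * c) - ?w * d =
      - ((\<nu> - 1 / 2 + of_int s) / x) * (?w * c) + ?w * (2 * (\<nu> + of_int s) / x * c - d)" for c d
    by (simp add: field_simps)
  with 1 show "((\<lambda>x. x powr (1 / 2) * C (\<nu> + of_int s) x) has_field_derivative
      - ((\<nu> - 1 / 2 + of_int s) / x) * (?w * C (\<nu> + of_int s) x) + ?w * C (\<nu> + of_int (s - 1)) x) (at x)"
    unfolding r by (simp only:)
qed

text \<open>
  The factor \<open>\<surd>x\<close> moves the order in the ladder relations by \<open>1/2\<close>.
\<close>

lemma hankel_pair_Hankel:
  "hankel_pair (\<nu> - 1 / 2) (\<lambda>s x. x powr (1 / 2) * Hankel1 (\<nu> + of_int s) x)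
     (\<lambda>s x. x powr (1 / 2) * Hankel2 (\<nu> + of_int s) x) (Hankel1_const \<nu>) (Hankel2_const \<nu>)"
proof (unfold_locales, goal_cases)
  case (1 x s)
  then show ?case by (intro sqrt_scaled_ladder Hankel_deriv_up Hankel_rec) auto
next
  case (2 x s)
  then show ?case by (intro sqrt_scaled_ladder Hankel_deriv_up Hankel_rec) auto
next
  case (3 x s)
  then show ?case by (intro sqrt_scaled_ladder Hankel_deriv_up Hankel_rec) auto
next
  case (4 x s)
  then show ?case by (intro sqrt_scaled_ladder Hankel_deriv_up Hankel_rec) auto
qed (use Hankel1_asymptotics[of \<nu>] Hankel2_asymptotics[of \<nu>] in \<open>auto simp: Hankel1_const_def Hankel2_const_def\<close>)

text \<open>
  To be used with a weight \<open>w\<close> that removes the powers and exponentials from both sides.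
\<close>

lemma asymp_equiv_by_weight:
  fixes f g w :: "'a \<Rightarrow> complex"
  assumes "((\<lambda>x. f x * w x) \<longlongrightarrow> c) F" "eventually (\<lambda>x. g x * w x = c) F" "c \<noteq> 0"
  shows "f \<sim>[F] g"
proof (rule asymp_equivI')
  have "((\<lambda>x. f x * w x / c) \<longlongrightarrow> c / c) F" by (intro tendsto_divide assms tendsto_const)
  then show "((\<lambda>x. f x / g x) \<longlongrightarrow> 1) F"
    using \<open>c \<noteq> 0\<close> by (auto elim!: Lim_transform_eventually intro: eventually_mono[OF assms(2)])
qed

lemma asymp_equiv_oscillating_by_weight:
  assumes lim: "((\<lambda>x. f x * w x - c * s x) \<longlongrightarrow> 0) at_top"
    and w: "eventually (\<lambda>x. A x * w x = c) at_top" and c: "c \<noteq> 0"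
  shows "asymp_equiv_oscillating f A s"
  unfolding asymp_equiv_oscillating_def
proof (intro conjI allI impI)
  define r where "r x = f x / A x - s x" for x
  have "((\<lambda>x. (f x * w x - c * s x) / c) \<longlongrightarrow> 0 / c) at_top" by (intro tendsto_divide lim tendsto_const c)
  then have r: "(r \<longlongrightarrow> 0) at_top"
    by (simp, elim Lim_transform_eventually, intro eventually_mono[OF w])
      (use c in \<open>auto simp: r_def diff_divide_distrib\<close>)
  have A: "eventually (\<lambda>x. A x \<noteq> 0) at_top" using w c by (auto elim: eventually_mono)
  show "(\<lambda>x. f x - A x * s x) \<in> o[at_top](A)"
  proof (rule smalloI_tendsto[OF _ A])
    show "((\<lambda>x. (f x - A x * s x) / A x) \<longlongrightarrow> 0) at_top"
      using r by (rule Lim_transform_eventually)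
        (use A in eventually_elim, simp add: r_def diff_divide_distrib)
  qed
  fix \<epsilon> :: real assume e: "\<epsilon> > 0"
  let ?F = "inf at_top (principal {x. \<epsilon> \<le> norm (s x)})"
  have F: "?F \<le> at_top" by simp
  show "f \<sim>[?F] (\<lambda>x. A x * s x)"
  proof (rule asymp_equivI')
    have "((\<lambda>x. norm (r x) / \<epsilon>) \<longlongrightarrow> 0 / \<epsilon>) ?F"
      using e by (intro tendsto_divide tendsto_const tendsto_norm_zero tendsto_mono[OF F r]) auto
    then have "((\<lambda>x. r x / s x) \<longlongrightarrow> 0) ?F"
      by (simp, elim Lim_null_comparison[rotated])
        (use e in \<open>auto simp: eventually_inf_principal norm_divide intro!: always_eventually frac_le\<close>)
    from tendsto_add[OF tendsto_const[of 1] this]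
    have "((\<lambda>x. 1 + r x / s x) \<longlongrightarrow> 1) ?F" by simp
    then show "((\<lambda>x. f x / (A x * s x)) \<longlongrightarrow> 1) ?F"
    proof (rule Lim_transform_eventually)
      have "eventually (\<lambda>x. s x \<noteq> 0) ?F" using e by (auto simp: eventually_inf_principal intro!: always_eventually)
      with filter_leD[OF F A] show "eventually (\<lambda>x. 1 + r x / s x = f x / (A x * s x)) ?F"
        by eventually_elim (simp add: r_def field_simps)
    qed
  qed
qed

text \<open>
  The powers have different exponents, but all are exponentials of multiples of the same
  logarithm of \<open>x\<close>.
\<close>

lemma powr_collect:
  fixes x :: complex
  assumes "x \<noteq> 0" "N = int n + 2 * k"
  shows "x powr (- (of_int N / 2)) * ((x powr (1 / 2)) ^ n * x powi k) = 1"
proof -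
  have 1: "x powr (- (of_int N / 2)) = exp (- (of_int N / 2) * ln x)" using assms(1) by (simp add: powr_def)
  have 2: "(x powr (1 / 2)) ^ n = exp (of_nat n * (1 / 2 * ln x))"
    unfolding exp_of_nat_mult using assms(1) by (simp add: powr_def)
  have 3: "x powi k = exp (of_int k * ln x)" using assms(1) complex_powr_of_int[of x k] by (simp add: powr_def)
  have "x powr (- (of_int N / 2)) * ((x powr (1 / 2)) ^ n * x powi k) =
      exp (- (of_int N / 2) * ln x) * (exp (of_nat n * (1 / 2 * ln x)) * exp (of_int k * ln x))"
    unfolding 1 2 3 ..
  also have "\<dots> = exp 0" unfolding exp_add[symmetric] assms(2) by (simp add: field_simps)
  finally show ?thesis by simp
qed

lemma exp_i_pi_half: "exp (\<i> * of_real pi / 2) = \<i>"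
  using cis_pi_half by (simp add: cis_conv_exp)

context
  fixes d1 d2 \<alpha> :: complex
begin

interpretation hankel_pair "\<alpha> / 2 - 1 / 2" "\<lambda>s x. x powr (1 / 2) * Hankel1 (\<alpha> / 2 + of_int s) x"
   "\<lambda>s x. x powr (1 / 2) * Hankel2 (\<alpha> / 2 + of_int s) x" "Hankel1_const (\<alpha> / 2)" "Hankel2_const (\<alpha> / 2)"
  by (rule hankel_pair_Hankel)

lemma Bessel_Toeplitz_det_blend:
  "blend ((d1 - \<i> * d2) / 2) ((d1 + \<i> * d2) / 2) n x = (x powr (1 / 2)) ^ n * Bessel_Toeplitz_det d1 d2 n x \<alpha>"
proof -
  have "blend ((d1 - \<i> * d2) / 2) ((d1 + \<i> * d2) / 2) n x =
      dt n (\<lambda>j k. x powr (1 / 2) * cylinder d1 d2 (\<alpha> / 2 - of_nat j + of_nat k) x)"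
    unfolding blend_def
  proof (rule dt_cong)
    fix j k :: nat
    have "\<alpha> / 2 + of_int (int k - int j) = \<alpha> / 2 - of_nat j + of_nat k" by simp
    then show "(d1 - \<i> * d2) / 2 * (x powr (1 / 2) * Hankel1 (\<alpha> / 2 + of_int (int k - int j)) x) +
      (d1 + \<i> * d2) / 2 * (x powr (1 / 2) * Hankel2 (\<alpha> / 2 + of_int (int k - int j)) x) =
      x powr (1 / 2) * cylinder d1 d2 (\<alpha> / 2 - of_nat j + of_nat k) x"
      by (simp add: cylinder_def Hankel1_def Hankel2_def field_simps)
  qed
  then show ?thesis by (simp add: dt_scale Bessel_Toeplitz_det_def dt_def)
qed

lemma amp_top_closed:
  "(z / 2) ^ n * amp n n = z ^ n * of_real ((1 / (2 * pi)) powr (real n / 2)) *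
     exp (- (\<i> * of_real pi * (of_nat n)\<^sup>2 / 4)) * Barnes_G (of_nat n + 1) * exp (- (\<i> * of_real pi * of_nat n * \<alpha> / 4))"
  and amp_bottom_closed:
  "(z / 2) ^ n * amp n 0 = z ^ n * of_real ((1 / (2 * pi)) powr (real n / 2)) *
     exp (\<i> * of_real pi * (of_nat n)\<^sup>2 / 4) * Barnes_G (of_nat n + 1) * exp (\<i> * of_real pi * of_nat n * \<alpha> / 4)"
proof -
  have r: "(1 / (2 * pi)) powr (real n / 2) = (1 / sqrt (2 * pi)) ^ n"
    by (simp add: powr_half_sqrt real_sqrt_divide flip: powr_powr powr_realpow)
      (simp add: powr_powr powr_half_sqrt[symmetric] powr_realpow[symmetric] powr_divide)
  have c2: "of_nat (n choose 2) = (of_nat n * (of_nat n - 1) / 2 :: complex)"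
    by (induction n) (simp_all add: Suc_choose_two numeral_2_eq_2[symmetric] field_simps)
  have i: "\<i> ^ (n choose 2) = exp (of_nat (n choose 2) * (\<i> * of_real pi / 2))"
    "(- \<i>) ^ (n choose 2) = exp (of_nat (n choose 2) * (- (\<i> * of_real pi / 2)))"
unfolding exp_of_nat_mult exp_minus exp_i_pi_half by simp_all
  have e: "exp (of_nat n * (- (\<i> * of_real pi / 2 * (\<alpha> / 2 + 1 / 2)))) * exp (of_nat (n choose 2) * (- (\<i> * of_real pi / 2))) =
      exp (- (\<i> * of_real pi * (of_nat n)\<^sup>2 / 4)) * exp (- (\<i> * of_real pi * of_nat n * \<alpha> / 4))"
    "exp (of_nat n * (\<i> * of_real pi / 2 * (\<alpha> / 2 + 1 / 2))) * exp (of_nat (n choose 2) * (\<i> * of_real pi / 2)) =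
      exp (\<i> * of_real pi * (of_nat n)\<^sup>2 / 4) * exp (\<i> * of_real pi * of_nat n * \<alpha> / 4)"
    unfolding exp_add[symmetric] c2
    by (rule arg_cong[of _ _ exp], simp add: field_simps power2_eq_square)+
  have k: "Hankel1_const (\<alpha> / 2) ^ n = 2 ^ n * of_real ((1 / sqrt (2 * pi)) ^ n) * exp (of_nat n * (- (\<i> * of_real pi / 2 * (\<alpha> / 2 + 1 / 2))))"
    "Hankel2_const (\<alpha> / 2) ^ n = 2 ^ n * of_real ((1 / sqrt (2 * pi)) ^ n) * exp (of_nat n * (\<i> * of_real pi / 2 * (\<alpha> / 2 + 1 / 2)))"
    unfolding exp_of_nat_mult by (simp_all add: Hankel1_const_def Hankel2_const_def power_mult_distrib power_divide)
  have "(z / 2) ^ n * amp n n = z ^ n * of_real ((1 / sqrt (2 * pi)) ^ n) * of_nat (superfactorial n) *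
      (exp (of_nat n * (- (\<i> * of_real pi / 2 * (\<alpha> / 2 + 1 / 2)))) * exp (of_nat (n choose 2) * (- (\<i> * of_real pi / 2))))"
    unfolding amp_def diff_zero diff_self_eq_0 k i by (simp add: power_divide superfactorial_def[of 0] binomial_eq_0 mult_ac)
  then show "(z / 2) ^ n * amp n n = z ^ n * of_real ((1 / (2 * pi)) powr (real n / 2)) *
     exp (- (\<i> * of_real pi * (of_nat n)\<^sup>2 / 4)) * Barnes_G (of_nat n + 1) * exp (- (\<i> * of_real pi * of_nat n * \<alpha> / 4))"
    unfolding e r Barnes_G_nat by (simp only: mult_ac)
  have "(z / 2) ^ n * amp n 0 = z ^ n * of_real ((1 / sqrt (2 * pi)) ^ n) * of_nat (superfactorial n) *
      (exp (of_nat n * (\<i> * of_real pi / 2 * (\<alpha> / 2 + 1 / 2))) * exp (of_nat (n choose 2) * (\<i> * of_real pi / 2)))"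
    unfolding amp_def diff_zero diff_self_eq_0 k i by (simp add: power_divide superfactorial_def[of 0] binomial_eq_0 mult_ac)
  then show "(z / 2) ^ n * amp n 0 = z ^ n * of_real ((1 / (2 * pi)) powr (real n / 2)) *
     exp (\<i> * of_real pi * (of_nat n)\<^sup>2 / 4) * Barnes_G (of_nat n + 1) * exp (\<i> * of_real pi * of_nat n * \<alpha> / 4)"
    unfolding e r Barnes_G_nat by (simp only: mult_ac)
qed

lemma decay_ends: "(int n)\<^sup>2 = int n + 2 * decay n n" "(int n)\<^sup>2 = int n + 2 * decay n 0"
  by (simp_all add: decay_eq power2_eq_square algebra_simps)

lemma Bessel_Toeplitz_det_zero:
  assumes "n > 0" "d1 + \<i> * d2 = 0" "d1 - \<i> * d2 = 0"
  shows "Bessel_Toeplitz_det d1 d2 n x \<alpha> = 0"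
proof -
  have "d1 = 0" using assms(2,3) by (simp add: add_eq_0_iff)
  moreover have "d2 = 0" using assms(2) calculation by simp
  ultimately have "Bessel_Toeplitz_det d1 d2 n x \<alpha> = dt n (\<lambda>j k. 0 * (0::complex))"
    unfolding Bessel_Toeplitz_det_def dt_def by (simp add: cylinder_def)
  then show ?thesis using assms(1) unfolding dt_scale by simp
qed

text \<open>
  The first alternative covers the lower half-plane, where \<open>exp (\<i> x)\<close> is the dominant exponential.
  In the second one the second Hankel function is absent. If both combinations of \<open>d1\<close> and \<open>d2\<close>
  vanish, both sides are \<open>0\<close> unless \<open>n = 0\<close>.
\<close>

lemma Bessel_Toeplitz_det_lower:
  assumes "d1 - \<i> * d2 \<noteq> 0 \<and> \<theta> \<le> 0 \<or> d1 + \<i> * d2 = 0 \<and> \<theta> \<le> pi"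
  shows "asymp_equiv_open_sector (\<lambda>x. Bessel_Toeplitz_det d1 d2 n x \<alpha>) (- pi) \<theta>
    (\<lambda>x. (d1 - \<i> * d2) ^ n * of_real ((1 / (2 * pi)) powr (real n / 2)) *
             exp (- (\<i> * of_real pi * (of_nat n)\<^sup>2 / 4)) * Barnes_G (of_nat n + 1) *
             exp (- (\<i> * of_real pi * of_nat n * \<alpha> / 4)) *
             exp (\<i> * of_nat n * x) * x powr (- ((of_nat n)\<^sup>2 / 2)))"
    (is "asymp_equiv_open_sector _ _ _ (\<lambda>x. ?C * exp _ * _)")
  unfolding asymp_equiv_open_sector_def
proof (intro allI impI)
  fix a b assume ab: "- pi < a \<and> a \<le> b \<and> b < \<theta>"
  show "(\<lambda>x. Bessel_Toeplitz_det d1 d2 n x \<alpha>) \<sim>[at_infinity_sector a b]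
    (\<lambda>x. ?C * exp (\<i> * of_nat n * x) * x powr (- ((of_nat n)\<^sup>2 / 2)))"
  proof (cases "n > 0 \<and> d1 - \<i> * d2 = 0")
    case True
    then have "d1 + \<i> * d2 = 0" "d1 - \<i> * d2 = 0" using assms ab by auto
    then have "Bessel_Toeplitz_det d1 d2 n x \<alpha> = 0" for x using True by (intro Bessel_Toeplitz_det_zero) auto
    then show ?thesis using True by (simp add: zero_power)
  next
    case False
    show ?thesis
    proof (rule asymp_equiv_by_weight)
      let ?w = "\<lambda>x. (x powr (1 / 2)) ^ n * (exp (- (freq n n * x)) * x powi decay n n)"
      have "((\<lambda>x. blend ((d1 - \<i> * d2) / 2) ((d1 + \<i> * d2) / 2) n x * (exp (- (freq n n * x)) * x powi decay n n)) \<longlongrightarrow>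
          ((d1 - \<i> * d2) / 2) ^ n * amp n n) (at_infinity_sector a b)"
        using assms ab by (intro blend_lower_sector) auto
      then show "((\<lambda>x. Bessel_Toeplitz_det d1 d2 n x \<alpha> * ?w x) \<longlongrightarrow> ((d1 - \<i> * d2) / 2) ^ n * amp n n) (at_infinity_sector a b)"
        unfolding Bessel_Toeplitz_det_blend by (simp only: mult_ac)
      show "((d1 - \<i> * d2) / 2) ^ n * amp n n \<noteq> 0" using False amp_nz[of n n] by auto
      show "eventually (\<lambda>x. ?C * exp (\<i> * of_nat n * x) * x powr (- ((of_nat n)\<^sup>2 / 2)) * ?w x =
          ((d1 - \<i> * d2) / 2) ^ n * amp n n) (at_infinity_sector a b)"
      proof (rule eventually_mono[OF eventually_slit])
        show "b < pi" using ab assms pi_gt_zero by linarith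
        fix x :: complex assume "x \<in> - \<real>\<^sub>\<le>\<^sub>0"
        then have "x \<noteq> 0" by auto
        from powr_collect[OF this decay_ends(1)[of n]]
        have 1: "x powr (- ((of_nat n)\<^sup>2 / 2)) * ((x powr (1 / 2)) ^ n * x powi decay n n) = 1" by simp
        have 2: "exp (\<i> * of_nat n * x) * exp (- (freq n n * x)) = 1"
          by (simp add: freq_def flip: exp_add)
        have "?C * exp (\<i> * of_nat n * x) * x powr (- ((of_nat n)\<^sup>2 / 2)) * ?w x =
            ?C * (exp (\<i> * of_nat n * x) * exp (- (freq n n * x))) *
            (x powr (- ((of_nat n)\<^sup>2 / 2)) * ((x powr (1 / 2)) ^ n * x powi decay n n))"
          by (simp only: mult_ac)
        then show "?C * exp (\<i> * of_nat n * x) * x powr (- ((of_nat n)\<^sup>2 / 2)) * ?w x = ((d1 - \<i> * d2) / 2) ^ n * amp n n"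
          unfolding 1 2 amp_top_closed by (simp only: mult_1_right)
      qed
    qed
  qed
qed

text \<open>
  The mirror image of \<open>Bessel_Toeplitz_det_lower\<close>, with the two Hankel functions exchanged.
\<close>

lemma Bessel_Toeplitz_det_upper:
  assumes "d1 + \<i> * d2 \<noteq> 0 \<and> 0 \<le> \<theta> \<or> d1 - \<i> * d2 = 0 \<and> - pi \<le> \<theta>"
  shows "asymp_equiv_open_sector (\<lambda>x. Bessel_Toeplitz_det d1 d2 n x \<alpha>) \<theta> pi
    (\<lambda>x. (d1 + \<i> * d2) ^ n * of_real ((1 / (2 * pi)) powr (real n / 2)) *
             exp (\<i> * of_real pi * (of_nat n)\<^sup>2 / 4) * Barnes_G (of_nat n + 1) *
             exp (\<i> * of_real pi * of_nat n * \<alpha> / 4) *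
             exp (- (\<i> * of_nat n * x)) * x powr (- ((of_nat n)\<^sup>2 / 2)))"
    (is "asymp_equiv_open_sector _ _ _ (\<lambda>x. ?C * exp _ * _)")
  unfolding asymp_equiv_open_sector_def
proof (intro allI impI)
  fix a b assume ab: "\<theta> < a \<and> a \<le> b \<and> b < pi"
  show "(\<lambda>x. Bessel_Toeplitz_det d1 d2 n x \<alpha>) \<sim>[at_infinity_sector a b]
    (\<lambda>x. ?C * exp (- (\<i> * of_nat n * x)) * x powr (- ((of_nat n)\<^sup>2 / 2)))"
  proof (cases "n > 0 \<and> d1 + \<i> * d2 = 0")
    case True
    then have "d1 + \<i> * d2 = 0" "d1 - \<i> * d2 = 0" using assms ab by auto
    then have "Bessel_Toeplitz_det d1 d2 n x \<alpha> = 0" for x using True by (intro Bessel_Toeplitz_det_zero) auto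
    then show ?thesis using True by (simp add: zero_power)
  next
    case False
    show ?thesis
    proof (rule asymp_equiv_by_weight)
      let ?w = "\<lambda>x. (x powr (1 / 2)) ^ n * (exp (- (freq n 0 * x)) * x powi decay n 0)"
      have "((\<lambda>x. blend ((d1 - \<i> * d2) / 2) ((d1 + \<i> * d2) / 2) n x * (exp (- (freq n 0 * x)) * x powi decay n 0)) \<longlongrightarrow>
          ((d1 + \<i> * d2) / 2) ^ n * amp n 0) (at_infinity_sector a b)"
        using assms ab by (intro blend_upper_sector) auto
      then show "((\<lambda>x. Bessel_Toeplitz_det d1 d2 n x \<alpha> * ?w x) \<longlongrightarrow> ((d1 + \<i> * d2) / 2) ^ n * amp n 0) (at_infinity_sector a b)"
        unfolding Bessel_Toeplitz_det_blend by (simp only: mult_ac)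
      show "((d1 + \<i> * d2) / 2) ^ n * amp n 0 \<noteq> 0" using False amp_nz[of 0 n] by auto
      show "eventually (\<lambda>x. ?C * exp (- (\<i> * of_nat n * x)) * x powr (- ((of_nat n)\<^sup>2 / 2)) * ?w x =
          ((d1 + \<i> * d2) / 2) ^ n * amp n 0) (at_infinity_sector a b)"
      proof (rule eventually_mono[OF eventually_slit])
        show "b < pi" using ab assms pi_gt_zero by linarith
        fix x :: complex assume "x \<in> - \<real>\<^sub>\<le>\<^sub>0"
        then have "x \<noteq> 0" by auto
        from powr_collect[OF this decay_ends(2)[of n]]
        have 1: "x powr (- ((of_nat n)\<^sup>2 / 2)) * ((x powr (1 / 2)) ^ n * x powi decay n 0) = 1" by simp
        have 2: "exp (- (\<i> * of_nat n * x)) * exp (- (freq n 0 * x)) = 1"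
          by (simp add: freq_def flip: exp_add)
        have "?C * exp (- (\<i> * of_nat n * x)) * x powr (- ((of_nat n)\<^sup>2 / 2)) * ?w x =
            ?C * (exp (- (\<i> * of_nat n * x)) * exp (- (freq n 0 * x))) *
            (x powr (- ((of_nat n)\<^sup>2 / 2)) * ((x powr (1 / 2)) ^ n * x powi decay n 0))"
          by (simp only: mult_ac)
        then show "?C * exp (- (\<i> * of_nat n * x)) * x powr (- ((of_nat n)\<^sup>2 / 2)) * ?w x = ((d1 + \<i> * d2) / 2) ^ n * amp n 0"
          unfolding 1 2 amp_bottom_closed by (simp only: mult_1_right)
      qed
    qed
  qed
qed

lemma Hankel1_const_K2: "Hankel1_const \<nu> * Hankel2_const \<nu> = of_real (4 / (2 * pi))"
proof -
  have "exp (- (\<i> * of_real pi / 2 * (\<nu> + 1 / 2))) * exp (\<i> * of_real pi / 2 * (\<nu> + 1 / 2)) = 1" by (simp flip: exp_add)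
  moreover have "Hankel1_const \<nu> * Hankel2_const \<nu> = of_real ((2 / sqrt (2 * pi)) * (2 / sqrt (2 * pi))) *
      (exp (- (\<i> * of_real pi / 2 * (\<nu> + 1 / 2))) * exp (\<i> * of_real pi / 2 * (\<nu> + 1 / 2)))"
    by (simp only: Hankel1_const_def Hankel2_const_def of_real_mult mult_ac)
  ultimately show ?thesis by (simp add: real_sqrt_mult_self)
qed

lemma quarter_powr:
  assumes "x > 0"
  shows "complex_of_real ((x / 4) powr (- a)) = of_real (4 powr a) * of_real x powr (- of_real a)"
proof -
  have "(x / 4) powr (- a) = 4 powr a * x powr (- a)" using assms by (simp add: powr_divide powr_minus field_simps)
  then show ?thesis using assms by (simp add: powr_of_real flip: of_real_minus)
qed

lemma Bessel_Toeplitz_det_even: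
  assumes lp: "exp lp = d1 + \<i> * d2" and lm: "exp lm = d1 - \<i> * d2" and n: "n = 2 * m"
  shows "(\<lambda>x::real. Bessel_Toeplitz_det d1 d2 n (of_real x) \<alpha>) \<sim>[at_top]
        (\<lambda>x. exp (of_nat n / 2 * lp + of_nat n / 2 * lm) / of_real ((2 * pi) powr (real n / 2)) *
             (Barnes_G (of_nat n / 2 + 1))\<^sup>2 *
             of_real ((x / 4) powr (- ((real n)\<^sup>2 / 4))))"
proof (rule asymp_equiv_by_weight)
  let ?A = "(d1 - \<i> * d2) / 2" and ?B = "(d1 + \<i> * d2) / 2"
  let ?w = "\<lambda>x. (complex_of_real x powr (1 / 2)) ^ n * of_real x powi decay n m"
  from blend_even[of ?A ?B m]
  show "((\<lambda>x. Bessel_Toeplitz_det d1 d2 n (of_real x) \<alpha> * ?w x) \<longlongrightarrow> ?A ^ m * ?B ^ m * amp n m) at_top"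
    unfolding Bessel_Toeplitz_det_blend n by (simp only: mult_ac)
  have "?A \<noteq> 0" "?B \<noteq> 0" unfolding lp[symmetric] lm[symmetric] by simp_all
  then show "?A ^ m * ?B ^ m * amp n m \<noteq> 0" using amp_nz[of m n] n by simp
  have "?A ^ m * ?B ^ m * amp n m = (?A * ?B * (Hankel1_const (\<alpha> / 2) * Hankel2_const (\<alpha> / 2))) ^ m * (of_nat (superfactorial m))\<^sup>2 * 4 ^ (m * m) * (- \<i> * \<i>) ^ (m choose 2)"
    unfolding amp_def n power_mult_distrib by (simp add: power2_eq_square)
  also have "?A * ?B * (Hankel1_const (\<alpha> / 2) * Hankel2_const (\<alpha> / 2)) = exp (lp + lm) / of_real (2 * pi)"
    unfolding Hankel1_const_K2 exp_add lp lm by simp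
  finally have c: "?A ^ m * ?B ^ m * amp n m = (exp (lp + lm) / of_real (2 * pi)) ^ m * (of_nat (superfactorial m))\<^sup>2 * 4 ^ (m * m)"
    by simp
  show "eventually (\<lambda>x. exp (of_nat n / 2 * lp + of_nat n / 2 * lm) / of_real ((2 * pi) powr (real n / 2)) *
             (Barnes_G (of_nat n / 2 + 1))\<^sup>2 * of_real ((x / 4) powr (- ((real n)\<^sup>2 / 4))) * ?w x = ?A ^ m * ?B ^ m * amp n m) at_top"
    using eventually_gt_at_top[of 0]
  proof eventually_elim
    case (elim x)
    have "2 * decay n m = 2 * (int m * (int m - 1))" unfolding decay_eq n by (simp add: algebra_simps)
    then have M: "2 * int (m * m) = int n + 2 * decay n m" unfolding n by (simp add: algebra_simps)
    have 1: "of_real x powr (- of_nat (m * m)) * ?w x = 1"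
      using powr_collect[of "of_real x" _ n, OF _ M] elim by simp
    have 2: "exp (of_nat n / 2 * lp + of_nat n / 2 * lm) = exp (lp + lm) ^ m"
      by (simp add: n algebra_simps flip: exp_of_nat_mult)
    have 3: "(2 * pi) powr (real n / 2) = (2 * pi) ^ m" by (simp add: n powr_realpow)
    have 4: "Barnes_G (of_nat n / 2 + 1) = of_nat (superfactorial m)" using Barnes_G_nat[of m] by (simp add: n)
    have 5: "(real n)\<^sup>2 / 4 = real (m * m)" by (simp add: n power2_eq_square)
    have 6: "(4::real) powr real (m * m) = 4 ^ (m * m)" by (rule powr_realpow) simp
    show ?case
      unfolding c
      unfolding quarter_powr[OF elim] 2 3 4 5 6 power_divide of_real_power of_real_of_nat_eq of_real_numeral mult.assoc 1
      by simp
  qed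
qed

text \<open>
  The right-hand side is the contribution of the two middle terms, up to a common factor;
  \<open>\<kappa>\<close> is the phase shift of the Hankel functions of order \<open>\<alpha> / 2\<close>, and \<open>\<phi>\<close> measures the imbalance between \<open>d1 + \<i> d2\<close> and
  \<open>d1 - \<i> d2\<close>.
\<close>

lemma sine_identity:
  assumes "\<phi> = 1 / (2 * \<i>) * lp - 1 / (2 * \<i>) * lm" "\<kappa> = of_real pi / 2 * (\<alpha> / 2 + 1 / 2)"
  shows "2 * (-1) ^ m * exp ((lp + lm) / 2) * sin (x - \<phi> + of_real pi / 4 * (of_nat (2 * m + 1) - \<alpha>)) =
    (- \<i>) ^ m * exp (lm - \<i> * \<kappa>) * exp (\<i> * x) + \<i> ^ m * exp (lp + \<i> * \<kappa>) * exp (- (\<i> * x))"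
proof -
  define \<theta> where "\<theta> = x - \<phi> + of_real pi / 4 * (of_nat (2 * m + 1) - \<alpha>)"
  have \<theta>: "\<i> * \<theta> = \<i> * x - (lp - lm) / 2 - \<i> * \<kappa> + \<i> * of_real pi / 2 + of_nat m * (\<i> * of_real pi / 2)"
    by (simp add: \<theta>_def assms field_simps)
  have im: "exp (of_nat m * (\<i> * of_real pi / 2)) = \<i> ^ m" "exp (- (of_nat m * (\<i> * of_real pi / 2))) = (- \<i>) ^ m"
    "exp (- (\<i> * of_real pi / 2)) = - \<i>"
    unfolding exp_minus exp_of_nat_mult exp_i_pi_half by (simp_all flip: power_inverse)
  have "exp ((lp + lm) / 2) * exp (\<i> * \<theta>) =
      exp (lm - \<i> * \<kappa>) * exp (\<i> * x) * exp (\<i> * of_real pi / 2) * exp (of_nat m * (\<i> * of_real pi / 2))"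
    unfolding exp_add[symmetric] \<theta> by (intro arg_cong[of _ _ exp]) (simp add: field_simps)
  then have 1: "exp ((lp + lm) / 2) * exp (\<i> * \<theta>) = exp (lm - \<i> * \<kappa>) * exp (\<i> * x) * \<i> * \<i> ^ m"
    unfolding im exp_i_pi_half .
  have "exp ((lp + lm) / 2) * exp (- (\<i> * \<theta>)) =
      exp (lp + \<i> * \<kappa>) * exp (- (\<i> * x)) * exp (- (\<i> * of_real pi / 2)) * exp (- (of_nat m * (\<i> * of_real pi / 2)))"
    unfolding exp_add[symmetric] \<theta> by (intro arg_cong[of _ _ exp]) (simp add: field_simps)
  then have 2: "exp ((lp + lm) / 2) * exp (- (\<i> * \<theta>)) = exp (lp + \<i> * \<kappa>) * exp (- (\<i> * x)) * (- \<i>) * (- \<i>) ^ m"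
    unfolding im .
  have "2 * (-1) ^ m * exp ((lp + lm) / 2) * sin \<theta> =
      (-1) ^ m * (exp ((lp + lm) / 2) * exp (\<i> * \<theta>) - exp ((lp + lm) / 2) * exp (- (\<i> * \<theta>))) / \<i>"
    by (simp add: sin_exp_eq right_diff_distrib)
  also have "\<dots> = ((-1) ^ m * \<i> ^ m) * exp (lm - \<i> * \<kappa>) * exp (\<i> * x) + ((-1) ^ m * (- \<i>) ^ m) * exp (lp + \<i> * \<kappa>) * exp (- (\<i> * x))"
    unfolding 1 2 by (simp add: field_simps)
  also have "(-1) ^ m * \<i> ^ m = (- \<i>) ^ m" by (simp flip: power_mult_distrib)
  also have "(-1) ^ m * (- \<i>) ^ m = \<i> ^ m" by (simp flip: power_mult_distrib)
  finally show ?thesis unfolding \<theta>_def .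
qed

lemma Bessel_Toeplitz_det_odd:
  assumes lp: "exp lp = d1 + \<i> * d2" and lm: "exp lm = d1 - \<i> * d2" and n: "n = 2 * m + 1"
    and \<phi>: "\<phi> = 1 / (2 * \<i>) * lp - 1 / (2 * \<i>) * lm"
  shows "asymp_equiv_oscillating
          (\<lambda>x. Bessel_Toeplitz_det d1 d2 n (of_real x) \<alpha>)
          (\<lambda>x. (-1) ^ ((n - 1) div 2) *
               (exp (of_nat n / 2 * lp + of_nat n / 2 * lm) / of_real ((2 * pi) powr (real n / 2))) *
               Barnes_G ((of_nat n + 1) / 2) * Barnes_G ((of_nat n + 3) / 2) *
               of_real ((x / 4) powr (- (((real n)\<^sup>2 + 1) / 4))))
          (\<lambda>x. sin (of_real x - \<phi> + of_real pi / 4 * (of_nat n - \<alpha>)))"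
proof (rule asymp_equiv_oscillating_by_weight)
  define \<kappa> where "\<kappa> = of_real pi / 2 * (\<alpha> / 2 + 1 / 2)"
  define s where "s = complex_of_real (sqrt (2 * pi))"
  define g where "g = (of_nat (superfactorial m) * of_nat (superfactorial (m + 1)) :: complex)"
  define c where "c = (-1) ^ m * (exp (of_nat m * (lp + lm)) * exp ((lp + lm) / 2) / s ^ n) * g * (2 * 4 ^ (m * (m + 1)))"
  let ?A = "(d1 - \<i> * d2) / 2" and ?B = "(d1 + \<i> * d2) / 2"
  let ?w = "\<lambda>x. (complex_of_real x powr (1 / 2)) ^ n * of_real x powi (int m)\<^sup>2"
  have s: "s \<noteq> 0" by (simp add: s_def)
  have AB: "?A * Hankel1_const (\<alpha> / 2) = exp (lm - \<i> * \<kappa>) / s" "?B * Hankel2_const (\<alpha> / 2) = exp (lp + \<i> * \<kappa>) / s"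
    unfolding Hankel1_const_def Hankel2_const_def exp_add exp_diff lp lm s_def \<kappa>_def by (simp_all add: exp_minus field_simps)
  have nm: "n - (m + 1) = m" "n - m = m + 1" using n by auto
  have ph: "(- \<i>) ^ k * \<i> ^ k = (1::complex)" for k by (simp flip: power_mult_distrib)
  have upper: "?A ^ (m + 1) * ?B ^ m * amp n (m + 1) =
      exp (of_nat m * (lp + lm)) / s ^ n * g * 4 ^ (m * (m + 1)) * ((- \<i>) ^ m * exp (lm - \<i> * \<kappa>))"
  proof -
    have "?A ^ (m + 1) * ?B ^ m * amp n (m + 1) = (?A * Hankel1_const (\<alpha> / 2)) ^ (m + 1) * (?B * Hankel2_const (\<alpha> / 2)) ^ m *
        g * 4 ^ (m * (m + 1)) * ((- \<i>) ^ m * ((- \<i>) ^ (m choose 2) * \<i> ^ (m choose 2)))"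
      unfolding amp_def nm power_mult_distrib g_def using n by (simp add: Suc_choose_two power_add mult_ac)
    also have "(?A * Hankel1_const (\<alpha> / 2)) ^ (m + 1) * (?B * Hankel2_const (\<alpha> / 2)) ^ m =
        (exp (lm - \<i> * \<kappa>) * exp (lp + \<i> * \<kappa>)) ^ m * exp (lm - \<i> * \<kappa>) / s ^ n"
      unfolding AB power_divide n by (simp add: power_mult_distrib power_add power_mult power2_eq_square field_simps)
    also have "exp (lm - \<i> * \<kappa>) * exp (lp + \<i> * \<kappa>) = exp (lp + lm)" by (simp add: add.commute flip: exp_add)
    also have "exp (lp + lm) ^ m = exp (of_nat m * (lp + lm))" by (simp only: exp_of_nat_mult)
    finally show ?thesis unfolding ph by (simp add: mult_ac)
  qed
  have lower: "?A ^ m * ?B ^ (m + 1) * amp n m =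
      exp (of_nat m * (lp + lm)) / s ^ n * g * 4 ^ (m * (m + 1)) * (\<i> ^ m * exp (lp + \<i> * \<kappa>))"
  proof -
    have "?A ^ m * ?B ^ (m + 1) * amp n m = (?A * Hankel1_const (\<alpha> / 2)) ^ m * (?B * Hankel2_const (\<alpha> / 2)) ^ (m + 1) *
        g * 4 ^ (m * (m + 1)) * (\<i> ^ m * ((- \<i>) ^ (m choose 2) * \<i> ^ (m choose 2)))"
      unfolding amp_def nm power_mult_distrib g_def using n by (simp add: Suc_choose_two power_add mult_ac)
    also have "(?A * Hankel1_const (\<alpha> / 2)) ^ m * (?B * Hankel2_const (\<alpha> / 2)) ^ (m + 1) =
        (exp (lm - \<i> * \<kappa>) * exp (lp + \<i> * \<kappa>)) ^ m * exp (lp + \<i> * \<kappa>) / s ^ n"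
      unfolding AB power_divide n by (simp add: power_mult_distrib power_add power_mult power2_eq_square field_simps)
    also have "exp (lm - \<i> * \<kappa>) * exp (lp + \<i> * \<kappa>) = exp (lp + lm)" by (simp add: add.commute flip: exp_add)
    also have "exp (lp + lm) ^ m = exp (of_nat m * (lp + lm))" by (simp only: exp_of_nat_mult)
    finally show ?thesis unfolding ph by (simp add: mult_ac)
  qed
  have sine: "?A ^ (m + 1) * ?B ^ m * amp n (m + 1) * exp (\<i> * x) + ?A ^ m * ?B ^ (m + 1) * amp n m * exp (- (\<i> * x)) =
      c * sin (x - \<phi> + of_real pi / 4 * (of_nat n - \<alpha>))" for x
  proof -
    let ?R = "exp (of_nat m * (lp + lm)) / s ^ n * g * 4 ^ (m * (m + 1))"
    have "c * sin (x - \<phi> + of_real pi / 4 * (of_nat n - \<alpha>)) =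
        ?R * (2 * (-1) ^ m * exp ((lp + lm) / 2) * sin (x - \<phi> + of_real pi / 4 * (of_nat (2 * m + 1) - \<alpha>)))"
      unfolding c_def n by (simp add: mult_ac)
    also have "\<dots> = ?R * ((- \<i>) ^ m * exp (lm - \<i> * \<kappa>) * exp (\<i> * x) + \<i> ^ m * exp (lp + \<i> * \<kappa>) * exp (- (\<i> * x)))"
      unfolding sine_identity[OF \<phi> \<kappa>_def] ..
    finally show ?thesis unfolding upper lower by (simp only: distrib_left mult.assoc)
  qed
  show "((\<lambda>x. Bessel_Toeplitz_det d1 d2 n (of_real x) \<alpha> * ?w x - c * sin (of_real x - \<phi> + of_real pi / 4 * (of_nat n - \<alpha>))) \<longlongrightarrow> 0) at_top"
    using blend_odd[of ?A ?B m, folded n] unfolding sine Bessel_Toeplitz_det_blend by (simp only: mult_ac)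
  show "c \<noteq> 0" using s superfactorial_pos[of m] superfactorial_pos[of "m + 1"] by (simp add: c_def g_def)
  show "eventually (\<lambda>x. (-1) ^ ((n - 1) div 2) *
               (exp (of_nat n / 2 * lp + of_nat n / 2 * lm) / of_real ((2 * pi) powr (real n / 2))) *
               Barnes_G ((of_nat n + 1) / 2) * Barnes_G ((of_nat n + 3) / 2) *
               of_real ((x / 4) powr (- (((real n)\<^sup>2 + 1) / 4))) * ?w x = c) at_top"
    using eventually_gt_at_top[of 0]
  proof eventually_elim
    case (elim x)
    let ?N = "2 * int (m * (m + 1)) + 1"
    have M: "?N = int n + 2 * (int m)\<^sup>2" unfolding n by (simp add: algebra_simps power2_eq_square)
    have r: "((real n)\<^sup>2 + 1) / 4 = of_int ?N / 2" by (simp add: n power2_eq_square field_simps)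
    have 1: "of_real x powr (- of_real (of_int ?N / 2)) * ?w x = 1"
      using powr_collect[of "of_real x" _ n, OF _ M] elim by simp
    have 2: "exp (of_nat n / 2 * lp + of_nat n / 2 * lm) = exp (of_nat m * (lp + lm)) * exp ((lp + lm) / 2)"
      unfolding exp_add[symmetric] n by (intro arg_cong[of _ _ exp]) (simp add: field_simps)
    have 3: "complex_of_real ((2 * pi) powr (real n / 2)) = s ^ n"
    proof -
      have "(2 * pi) powr (real n / 2) = ((2 * pi) powr (1 / 2)) powr real n" by (simp add: powr_powr)
      also have "\<dots> = sqrt (2 * pi) ^ n" by (simp add: powr_half_sqrt powr_realpow)
      finally show ?thesis by (simp add: s_def)
    qed
    have 4: "Barnes_G ((of_nat n + 1) / 2) = of_nat (superfactorial m)"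
      "Barnes_G ((of_nat n + 3) / 2) = of_nat (superfactorial (m + 1))"
    proof -
      have "(of_nat n + 1) / 2 = (of_nat m + 1 :: complex)" "(of_nat n + 3) / 2 = (of_nat (m + 1) + 1 :: complex)"
        by (simp_all add: n field_simps)
      then show "Barnes_G ((of_nat n + 1) / 2) = of_nat (superfactorial m)"
        "Barnes_G ((of_nat n + 3) / 2) = of_nat (superfactorial (m + 1))" by (simp_all only: Barnes_G_nat)
    qed
    have 5: "(4::real) powr (of_int ?N / 2) = 2 * 4 ^ (m * (m + 1))"
    proof -
      have "of_int ?N / 2 = real (m * (m + 1)) + 1 / 2" by (simp add: field_simps)
      then have "(4::real) powr (of_int ?N / 2) = 4 powr real (m * (m + 1)) * 4 powr (1 / 2)" by (simp only: powr_add)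
      also have "(4::real) powr (1 / 2) = 2" by (simp add: powr_half_sqrt)
      also have "(4::real) powr real (m * (m + 1)) = 4 ^ (m * (m + 1))" by (rule powr_realpow) simp
      finally show ?thesis by simp
    qed
    have 6: "(n - 1) div 2 = m" by (simp add: n)
    show ?case
      unfolding r quarter_powr[OF elim] 2 3 4 5 6 c_def g_def using 1
      by (simp only: mult.assoc mult_1_right of_real_mult of_real_numeral of_real_power)
  qed
qed

end

theorem theorem1p3:
  fixes d1 d2 \<alpha> :: complex and n :: nat
  shows
   "(\<comment> \<open>(1)\<close>
     d1 + \<i> * d2 \<noteq> 0 \<and> d1 - \<i> * d2 \<noteq> 0 \<and> even n \<longrightarrow>
      (\<forall>lp lm. exp lp = d1 + \<i> * d2 \<and> exp lm = d1 - \<i> * d2 \<longrightarrow>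
        (\<lambda>x::real. Bessel_Toeplitz_det d1 d2 n (of_real x) \<alpha>) \<sim>[at_top]
        (\<lambda>x. exp (of_nat n / 2 * lp + of_nat n / 2 * lm) / of_real ((2 * pi) powr (real n / 2)) *
             (Barnes_G (of_nat n / 2 + 1))\<^sup>2 *
             of_real ((x / 4) powr (- ((real n)\<^sup>2 / 4)))))) \<and>
    (\<comment> \<open>(2)\<close>
     d1 + \<i> * d2 \<noteq> 0 \<and> d1 - \<i> * d2 \<noteq> 0 \<and> odd n \<longrightarrow>
      (\<forall>lp lm \<phi>. exp lp = d1 + \<i> * d2 \<and> exp lm = d1 - \<i> * d2 \<and>
          \<phi> = 1 / (2 * \<i>) * lp - 1 / (2 * \<i>) * lm \<longrightarrow>
        asymp_equiv_oscillating
          (\<lambda>x. Bessel_Toeplitz_det d1 d2 n (of_real x) \<alpha>)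
          (\<lambda>x. (-1) ^ ((n - 1) div 2) *
               (exp (of_nat n / 2 * lp + of_nat n / 2 * lm) / of_real ((2 * pi) powr (real n / 2))) *
               Barnes_G ((of_nat n + 1) / 2) * Barnes_G ((of_nat n + 3) / 2) *
               of_real ((x / 4) powr (- (((real n)\<^sup>2 + 1) / 4))))
          (\<lambda>x. sin (of_real x - \<phi> + of_real pi / 4 * (of_nat n - \<alpha>))))) \<and>
    (\<comment> \<open>(3)\<close>
     d1 + \<i> * d2 \<noteq> 0 \<and> d1 - \<i> * d2 \<noteq> 0 \<longrightarrow>
      asymp_equiv_open_sector (\<lambda>x. Bessel_Toeplitz_det d1 d2 n x \<alpha>) (- pi) 0
        (\<lambda>x. (d1 - \<i> * d2) ^ n * of_real ((1 / (2 * pi)) powr (real n / 2)) *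
             exp (- (\<i> * of_real pi * (of_nat n)\<^sup>2 / 4)) * Barnes_G (of_nat n + 1) *
             exp (- (\<i> * of_real pi * of_nat n * \<alpha> / 4)) *
             exp (\<i> * of_nat n * x) * x powr (- ((of_nat n)\<^sup>2 / 2)))) \<and>
    (\<comment> \<open>(4)\<close>
     d1 + \<i> * d2 \<noteq> 0 \<and> d1 - \<i> * d2 \<noteq> 0 \<longrightarrow>
      asymp_equiv_open_sector (\<lambda>x. Bessel_Toeplitz_det d1 d2 n x \<alpha>) 0 pi
        (\<lambda>x. (d1 + \<i> * d2) ^ n * of_real ((1 / (2 * pi)) powr (real n / 2)) *
             exp (\<i> * of_real pi * (of_nat n)\<^sup>2 / 4) * Barnes_G (of_nat n + 1) *
             exp (\<i> * of_real pi * of_nat n * \<alpha> / 4) *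
             exp (- (\<i> * of_nat n * x)) * x powr (- ((of_nat n)\<^sup>2 / 2)))) \<and>
    (\<comment> \<open>(5)\<close>
     d1 + \<i> * d2 = 0 \<longrightarrow>
      asymp_equiv_open_sector (\<lambda>x. Bessel_Toeplitz_det d1 d2 n x \<alpha>) (- pi) pi
        (\<lambda>x. (d1 - \<i> * d2) ^ n * of_real ((1 / (2 * pi)) powr (real n / 2)) *
             exp (- (\<i> * of_real pi * (of_nat n)\<^sup>2 / 4)) * Barnes_G (of_nat n + 1) *
             exp (- (\<i> * of_real pi * of_nat n * \<alpha> / 4)) *
             exp (\<i> * of_nat n * x) * x powr (- ((of_nat n)\<^sup>2 / 2)))) \<and>
    (\<comment> \<open>(6)\<close>
     d1 - \<i> * d2 = 0 \<longrightarrow>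
      asymp_equiv_open_sector (\<lambda>x. Bessel_Toeplitz_det d1 d2 n x \<alpha>) (- pi) pi
        (\<lambda>x. (d1 + \<i> * d2) ^ n * of_real ((1 / (2 * pi)) powr (real n / 2)) *
             exp (\<i> * of_real pi * (of_nat n)\<^sup>2 / 4) * Barnes_G (of_nat n + 1) *
             exp (\<i> * of_real pi * of_nat n * \<alpha> / 4) *
             exp (- (\<i> * of_nat n * x)) * x powr (- ((of_nat n)\<^sup>2 / 2))))"
proof (intro conjI impI allI)
  fix lp lm :: complex
  assume "d1 + \<i> * d2 \<noteq> 0 \<and> d1 - \<i> * d2 \<noteq> 0 \<and> even n"
    and "exp lp = d1 + \<i> * d2 \<and> exp lm = d1 - \<i> * d2"
  then show "(\<lambda>x::real. Bessel_Toeplitz_det d1 d2 n (of_real x) \<alpha>) \<sim>[at_top]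
        (\<lambda>x. exp (of_nat n / 2 * lp + of_nat n / 2 * lm) / of_real ((2 * pi) powr (real n / 2)) *
             (Barnes_G (of_nat n / 2 + 1))\<^sup>2 *
             of_real ((x / 4) powr (- ((real n)\<^sup>2 / 4))))"
    by (intro Bessel_Toeplitz_det_even[where m = "n div 2"]) auto
next
  fix lp lm \<phi> :: complex
  assume "d1 + \<i> * d2 \<noteq> 0 \<and> d1 - \<i> * d2 \<noteq> 0 \<and> odd n"
    and "exp lp = d1 + \<i> * d2 \<and> exp lm = d1 - \<i> * d2 \<and> \<phi> = 1 / (2 * \<i>) * lp - 1 / (2 * \<i>) * lm"
  then show "asymp_equiv_oscillating
          (\<lambda>x. Bessel_Toeplitz_det d1 d2 n (of_real x) \<alpha>)
          (\<lambda>x. (-1) ^ ((n - 1) div 2) *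
               (exp (of_nat n / 2 * lp + of_nat n / 2 * lm) / of_real ((2 * pi) powr (real n / 2))) *
               Barnes_G ((of_nat n + 1) / 2) * Barnes_G ((of_nat n + 3) / 2) *
               of_real ((x / 4) powr (- (((real n)\<^sup>2 + 1) / 4))))
          (\<lambda>x. sin (of_real x - \<phi> + of_real pi / 4 * (of_nat n - \<alpha>)))"
    by (intro Bessel_Toeplitz_det_odd[where m = "n div 2"]) auto
qed (rule Bessel_Toeplitz_det_lower Bessel_Toeplitz_det_upper; simp)+

end
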